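(* Let $k\geq 2$, and let $(G/\Gamma,\mu_{G/\Gamma},R_a)$ be an ergodic $k$-step nilsystem. Then the unitary Koopman operator $R_a f=f\circ R_a$ has compact-Lebesgue spectrum on $L^2(G/\Gamma,\mu_{G/\Gamma})$; that is, there is an orthogonal decomposition $L^2(G/\Gamma,\mu_{G/\Gamma})=\mathcal{H}_d\oplus\mathcal{H}_l$ into a closed subspace $\mathcal{H}_d$ on which $R_a$ has discrete spectrum and a closed subspace $\mathcal{H}_l$ on which $R_a$ has infinite Lebesgue spectrum.
   Context: A nilmanifold is a compact manifold of the form $G/\Gamma$ where $G$ is a nilpotent Lie group and $\Gamma$ is a discrete co-compact subgroup; if $G$ is $k$-step nilpotent, $G/\Gamma$ is called a $k$-step nilmanifold. For $a\in G$, $R_a$ denotes the left translation $R_a(g\Gamma)=(ag)\Gamma$ on $G/\Gamma$. The Haar measure $\mu_{G/\Gamma}$ is the unique left-translation invariant Borel probability measure on $G/\Gamma$. The system $(G/\Gamma,\mu_{G/\Gamma},R_a)$ is called a ($k$-step) nilsystem, and it is ergodic if the only $R_a$-invariant functions in $L^2(G/\Gamma,\mu_{G/\Gamma})$ are the constant functions. Let $U$ be a unitary operator on a separable Hilbert space $\mathcal{H}$ and let $S^1$ be the unit circle in $\mathbb{C}$. The spectral measure of $h\in\mathcal{H}$ is the unique finite Borel measure $\sigma_h$ on $S^1$ with $\langle U^n h,h\rangle=\int_{S^1}t^n\,d\sigma_h(t)$ for all $n\in\mathbb{Z}$. The maximal spectral type of $U$ is the finite Borel measure $\sigma$ on $S^1$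 (unique up to equivalence) such that $\sigma_h\ll\sigma$ for every $h\in\mathcal{H}$ and every finite Borel measure absolutely continuous with respect to $\sigma$ is the spectral measure of some $h\in\mathcal{H}$. Two measures are equivalent if each is absolutely continuous with respect to the other. $U$ has discrete spectrum if its maximal spectral type is a discrete measure on $S^1$, or equivalently, if the eigenvectors of $U$ span a dense subspace of $\mathcal{H}$. $U$ has infinite Lebesgue spectrum if $\mathcal{H}$ decomposes into a direct sum of infinitely many pairwise orthogonal closed $U$-invariant subspaces, each with maximal spectral type equivalent to the Lebesgue measure on $S^1$.
   Formalization: One exception is added, where the English is false (e.g. G dihedral of order 8, Γ generated by a reflection, a of order 4): if the identity component of G and a generate an abelian group, H_l may be {0} instead of having infinite Lebesgue spectrum. *)

theory Defs
  imports "HOL-Probability.Probability_Measure" "HOL-Algebra.Left_Coset" "HOL-Algebra.Generated_Groups"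
begin

section \<open>Lie groups\<close>

text \<open>Only used for open \<open>S\<close>. In finite dimension this is the usual class \<open>C\<^sup>k\<close>: all iterated
  directional derivatives up to order \<open>k\<close> exist and are continuous.\<close>

primrec Ck_on :: "nat \<Rightarrow> 'a::euclidean_space set \<Rightarrow> ('a \<Rightarrow> 'b::euclidean_space) \<Rightarrow> bool" where
  "Ck_on 0 S f \<longleftrightarrow> continuous_on S f"
| "Ck_on (Suc k) S f \<longleftrightarrow> (\<forall>x\<in>S. f differentiable (at x)) \<and>
     (\<forall>v. Ck_on k S (\<lambda>x. frechet_derivative f (at x) v))"

definition smooth_on :: "'a::euclidean_space set \<Rightarrow> ('a \<Rightarrow> 'b::euclidean_space) \<Rightarrow> bool" where
  "smooth_on S f \<longleftrightarrow> (\<forall>k. Ck_on k S f)"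

type_synonym ('m, 'e) chart = "'m set \<times> ('m \<Rightarrow> 'e)"

definition is_chart :: "'m topology \<Rightarrow> ('m, 'e::euclidean_space) chart \<Rightarrow> bool" where
  "is_chart T = (\<lambda>(U, \<phi>). openin T U \<and> open (\<phi> ` U) \<and>
     homeomorphic_map (subtopology T U) (top_of_set (\<phi> ` U)) \<phi>)"

definition smooth_atlas :: "'m topology \<Rightarrow> ('m, 'e::euclidean_space) chart set \<Rightarrow> bool" where
  "smooth_atlas T A \<longleftrightarrow>
     (\<forall>c\<in>A. is_chart T c) \<and> (\<Union>(U, \<phi>)\<in>A. U) = topspace T \<and>
     (\<forall>(U, \<phi>)\<in>A. \<forall>(V, \<psi>)\<in>A. smooth_on (\<phi> ` (U \<inter> V)) (\<psi> \<circ> inv_into U \<phi>))"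

definition prod_atlas ::
  "('m, 'e) chart set \<Rightarrow> ('n, 'f) chart set \<Rightarrow> ('m \<times> 'n, 'e \<times> 'f) chart set" where
  "prod_atlas A B = (\<lambda>((U, \<phi>), (V, \<psi>)). (U \<times> V, map_prod \<phi> \<psi>)) ` (A \<times> B)"

definition smooth_map ::
  "'m topology \<Rightarrow> ('m, 'e::euclidean_space) chart set \<Rightarrow>
   'n topology \<Rightarrow> ('n, 'f::euclidean_space) chart set \<Rightarrow> ('m \<Rightarrow> 'n) \<Rightarrow> bool" where
  "smooth_map T A T' B f \<longleftrightarrow> continuous_map T T' f \<and>
     (\<forall>(U, \<phi>)\<in>A. \<forall>(V, \<psi>)\<in>B. smooth_on (\<phi> ` (U \<inter> f -` V)) (\<psi> \<circ> f \<circ> inv_into U \<phi>))"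

text \<open>A type of class \<open>euclidean_space\<close> has positive dimension, so zero-dimensional Lie groups,
  i.e. countable discrete groups, are a separate case (in which the atlas \<open>A\<close> plays no role).\<close>

definition lie_group ::
  "'g monoid \<Rightarrow> 'g topology \<Rightarrow> ('g, 'e::euclidean_space) chart set \<Rightarrow> bool" where
  "lie_group G T A \<longleftrightarrow> group G \<and> topspace T = carrier G \<and>
     Hausdorff_space T \<and> second_countable T \<and>
     (smooth_atlas T A \<and>
      smooth_map (prod_topology T T) (prod_atlas A A) T A (\<lambda>(x, y). x \<otimes>\<^bsub>G\<^esub> y) \<and>
      smooth_map T A T A (m_inv G)
      \<or> T = discrete_topology (carrier G))"

section \<open>Nilpotency\<close>

text \<open>With the indexing of the lower central series that starts at \<open>G\<^sub>1 = G\<close>,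
  \<open>lower_central G k\<close> is \<open>G\<^bsub>k+1\<^esub>\<close>.\<close>

primrec lower_central :: "('g, 'b) monoid_scheme \<Rightarrow> nat \<Rightarrow> 'g set" where
  "lower_central G 0 = carrier G"
| "lower_central G (Suc k) = generate G
     (\<Union>x\<in>lower_central G k. \<Union>y\<in>carrier G. {x \<otimes>\<^bsub>G\<^esub> y \<otimes>\<^bsub>G\<^esub> inv\<^bsub>G\<^esub> x \<otimes>\<^bsub>G\<^esub> inv\<^bsub>G\<^esub> y})"

definition step_nilpotent :: "nat \<Rightarrow> ('g, 'b) monoid_scheme \<Rightarrow> bool" where
  "step_nilpotent k G \<longleftrightarrow> lower_central G k = {\<one>\<^bsub>G\<^esub>}"

section \<open>Nilmanifolds and nilsystems\<close>

text \<open>The quotient topology on the set of left cosets \<open>g\<Gamma>\<close>.\<close>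

definition coset_topology ::
  "('g, 'b) monoid_scheme \<Rightarrow> 'g topology \<Rightarrow> 'g set \<Rightarrow> 'g set topology" where
  "coset_topology G T \<Gamma> = topology (\<lambda>W. W \<subseteq> lcosets\<^bsub>G\<^esub> \<Gamma> \<and>
     openin T {g \<in> topspace T. g <#\<^bsub>G\<^esub> \<Gamma> \<in> W})"

lemma openin_coset_topology:
  "openin (coset_topology G T \<Gamma>) W \<longleftrightarrow>
     W \<subseteq> lcosets\<^bsub>G\<^esub> \<Gamma> \<and> openin T {g \<in> topspace T. g <#\<^bsub>G\<^esub> \<Gamma> \<in> W}"
proof -
  let ?P = "\<lambda>W. {g \<in> topspace T. g <#\<^bsub>G\<^esub> \<Gamma> \<in> W}"
  have "istopology (\<lambda>W. W \<subseteq> lcosets\<^bsub>G\<^esub> \<Gamma> \<and> openin T (?P W))"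
    unfolding istopology_def
  proof (intro conjI allI impI)
    fix V W assume "V \<subseteq> lcosets\<^bsub>G\<^esub> \<Gamma> \<and> openin T (?P V)" "W \<subseteq> lcosets\<^bsub>G\<^esub> \<Gamma> \<and> openin T (?P W)"
    moreover have "?P (V \<inter> W) = ?P V \<inter> ?P W" by blast
    ultimately show "V \<inter> W \<subseteq> lcosets\<^bsub>G\<^esub> \<Gamma>" "openin T (?P (V \<inter> W))"
      by (auto intro: openin_Int)
  next
    fix \<W> assume *: "\<forall>W\<in>\<W>. W \<subseteq> lcosets\<^bsub>G\<^esub> \<Gamma> \<and> openin T (?P W)"
    have "?P (\<Union>\<W>) = \<Union>(?P ` \<W>)" by blast
    moreover have "openin T (\<Union>(?P ` \<W>))" using * by (intro openin_Union) auto
    ultimately show "openin T (?P (\<Union>\<W>))" by simp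
    show "\<Union>\<W> \<subseteq> lcosets\<^bsub>G\<^esub> \<Gamma>" using * by blast
  qed
  thus ?thesis by (simp add: coset_topology_def topology_inverse')
qed

lemma topspace_coset_topology:
  assumes "topspace T = carrier G"
  shows "topspace (coset_topology G T \<Gamma>) = lcosets\<^bsub>G\<^esub> \<Gamma>"
proof
  show "topspace (coset_topology G T \<Gamma>) \<subseteq> lcosets\<^bsub>G\<^esub> \<Gamma>"
    using openin_topspace openin_coset_topology by metis
  have "{g \<in> topspace T. g <#\<^bsub>G\<^esub> \<Gamma> \<in> lcosets\<^bsub>G\<^esub> \<Gamma>} = topspace T"
    using assms by (auto simp: LCOSETS_def)
  hence "openin (coset_topology G T \<Gamma>) (lcosets\<^bsub>G\<^esub> \<Gamma>)"
    by (simp add: openin_coset_topology)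
  thus "lcosets\<^bsub>G\<^esub> \<Gamma> \<subseteq> topspace (coset_topology G T \<Gamma>)" by (rule openin_subset)
qed

lemma quotient_map_coset_topology:
  assumes "topspace T = carrier G"
  shows "quotient_map T (coset_topology G T \<Gamma>) (\<lambda>g. g <#\<^bsub>G\<^esub> \<Gamma>)"
  unfolding quotient_map_def topspace_coset_topology[OF assms] openin_coset_topology
  using assms by (auto simp: LCOSETS_def)

definition discrete_cocompact ::
  "('g, 'b) monoid_scheme \<Rightarrow> 'g topology \<Rightarrow> 'g set \<Rightarrow> bool" where
  "discrete_cocompact G T \<Gamma> \<longleftrightarrow> subgroup \<Gamma> G \<and>
     subtopology T \<Gamma> = discrete_topology \<Gamma> \<and> compact_space (coset_topology G T \<Gamma>)"

definition nilmanifold ::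
  "nat \<Rightarrow> 'g monoid \<Rightarrow> 'g topology \<Rightarrow> ('g, 'e::euclidean_space) chart set \<Rightarrow> 'g set \<Rightarrow> bool" where
  "nilmanifold k G T A \<Gamma> \<longleftrightarrow>
     lie_group G T A \<and> step_nilpotent k G \<and> discrete_cocompact G T \<Gamma>"

definition haar_measure_on_quotient ::
  "('g, 'b) monoid_scheme \<Rightarrow> 'g topology \<Rightarrow> 'g set \<Rightarrow> 'g set measure \<Rightarrow> bool" where
  "haar_measure_on_quotient G T \<Gamma> \<mu> \<longleftrightarrow> prob_space \<mu> \<and>
     space \<mu> = lcosets\<^bsub>G\<^esub> \<Gamma> \<and>
     sets \<mu> = sigma_sets (lcosets\<^bsub>G\<^esub> \<Gamma>) {W. openin (coset_topology G T \<Gamma>) W} \<and>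
     (\<forall>g\<in>carrier G. \<forall>B\<in>sets \<mu>. emeasure \<mu> ((\<lambda>C. g <#\<^bsub>G\<^esub> C) ` B) = emeasure \<mu> B)"

text \<open>The Koopman operator of the translation \<open>C \<mapsto> gC\<close> on left cosets. Its \<open>n\<close>-th power,
  for every integer \<open>n\<close>, is the Koopman operator of \<open>g [^] n\<close>.\<close>

definition koopman :: "('g, 'b) monoid_scheme \<Rightarrow> 'g \<Rightarrow> ('g set \<Rightarrow> complex) \<Rightarrow> 'g set \<Rightarrow> complex" where
  "koopman G g f = (\<lambda>C. f (g <#\<^bsub>G\<^esub> C))"

lemma koopman_mult:
  assumes "group G" "g \<in> carrier G" "h \<in> carrier G" "C \<subseteq> carrier G"
  shows "koopman G g (koopman G h f) C = koopman G (h \<otimes>\<^bsub>G\<^esub> g) f C"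
  using assms by (simp add: koopman_def group.lcos_m_assoc)

definition koopman_powers ::
  "('g, 'b) monoid_scheme \<Rightarrow> 'g \<Rightarrow> int \<Rightarrow> ('g set \<Rightarrow> complex) \<Rightarrow> 'g set \<Rightarrow> complex" where
  "koopman_powers G a n = koopman G (a [^]\<^bsub>G\<^esub> n)"

section \<open>The Hilbert space \<open>L\<^sup>2\<close>\<close>

text \<open>Elements of \<open>L\<^sup>2\<close> are represented by square-integrable functions, not by classes modulo
  almost everywhere equality. A closed subspace, as defined below, is automatically saturated:
  with \<open>f\<close> it contains every element of \<open>L2 M\<close> that is almost everywhere equal to \<open>f\<close>.\<close>

definition L2 :: "'a measure \<Rightarrow> ('a \<Rightarrow> complex) set" where
  "L2 M = {f \<in> borel_measurable M. integrable M (\<lambda>x. (cmod (f x))\<^sup>2)}"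

definition l2_inner :: "'a measure \<Rightarrow> ('a \<Rightarrow> complex) \<Rightarrow> ('a \<Rightarrow> complex) \<Rightarrow> complex" where
  "l2_inner M f g = (\<integral>x. f x * cnj (g x) \<partial>M)"

definition l2_norm :: "'a measure \<Rightarrow> ('a \<Rightarrow> complex) \<Rightarrow> real" where
  "l2_norm M f = sqrt (\<integral>x. (cmod (f x))\<^sup>2 \<partial>M)"

definition l2_orthogonal ::
  "'a measure \<Rightarrow> ('a \<Rightarrow> complex) set \<Rightarrow> ('a \<Rightarrow> complex) set \<Rightarrow> bool" where
  "l2_orthogonal M V W \<longleftrightarrow> (\<forall>f\<in>V. \<forall>g\<in>W. l2_inner M f g = 0)"

definition closed_subspace :: "'a measure \<Rightarrow> ('a \<Rightarrow> complex) set \<Rightarrow> bool" where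
  "closed_subspace M V \<longleftrightarrow> V \<subseteq> L2 M \<and> (\<lambda>_. 0) \<in> V \<and>
     (\<forall>f\<in>V. \<forall>g\<in>V. (\<lambda>x. f x + g x) \<in> V) \<and>
     (\<forall>c. \<forall>f\<in>V. (\<lambda>x. c * f x) \<in> V) \<and>
     (\<forall>F. \<forall>f\<in>L2 M. (\<forall>n::nat. F n \<in> V) \<and> (\<lambda>n. l2_norm M (\<lambda>x. F n x - f x)) \<longlonglongrightarrow> 0
        \<longrightarrow> f \<in> V)"

definition ergodic_translation :: "('g, 'b) monoid_scheme \<Rightarrow> 'g set measure \<Rightarrow> 'g \<Rightarrow> bool" where
  "ergodic_translation G \<mu> a \<longleftrightarrow>
     (\<forall>f\<in>L2 \<mu>. (AE x in \<mu>. koopman G a f x = f x) \<longrightarrow> (\<exists>c. AE x in \<mu>. f x = c))"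

section \<open>Spectral types\<close>

text \<open>Below, \<open>U :: int \<Rightarrow> _\<close> is the family of all integer powers of a unitary operator:
  \<open>U n\<close> stands for the \<open>n\<close>-th power. Invariance of a subspace is invariance under all \<open>U n\<close>,
  including the inverse, so that the operator restricts to a unitary operator on it.\<close>

type_synonym 'a powers = "int \<Rightarrow> ('a \<Rightarrow> complex) \<Rightarrow> 'a \<Rightarrow> complex"

definition invariant_subspace :: "'a measure \<Rightarrow> 'a powers \<Rightarrow> ('a \<Rightarrow> complex) set \<Rightarrow> bool" where
  "invariant_subspace M U V \<longleftrightarrow> closed_subspace M V \<and> (\<forall>n. \<forall>f\<in>V. U n f \<in> V)"

definition circle_borel :: "complex measure" where
  "circle_borel = restrict_space borel (sphere 0 1)"

definition circle_measure :: "complex measure \<Rightarrow> bool" where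
  "circle_measure \<sigma> \<longleftrightarrow> finite_measure \<sigma> \<and> sets \<sigma> = sets circle_borel"

text \<open>Normalised arc length.\<close>

definition circle_lebesgue :: "complex measure" where
  "circle_lebesgue =
     distr (restrict_space lborel {0..<1::real}) circle_borel (\<lambda>t. cis (2 * pi * t))"

definition equivalent_measures :: "'a measure \<Rightarrow> 'a measure \<Rightarrow> bool" where
  "equivalent_measures \<sigma> \<tau> \<longleftrightarrow> absolutely_continuous \<sigma> \<tau> \<and> absolutely_continuous \<tau> \<sigma>"

definition spectral_measure ::
  "'a measure \<Rightarrow> 'a powers \<Rightarrow> ('a \<Rightarrow> complex) \<Rightarrow> complex measure \<Rightarrow> bool" where
  "spectral_measure M U h \<sigma> \<longleftrightarrow> circle_measure \<sigma> \<and>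
     (\<forall>n::int. l2_inner M (U n h) h = (\<integral>t. t powi n \<partial>\<sigma>))"

text \<open>\<open>absolutely_continuous \<sigma> \<tau>\<close> means that \<open>\<tau>\<close> is absolutely continuous with respect to \<open>\<sigma>\<close>.\<close>

definition maximal_spectral_type ::
  "'a measure \<Rightarrow> 'a powers \<Rightarrow> ('a \<Rightarrow> complex) set \<Rightarrow> complex measure \<Rightarrow> bool" where
  "maximal_spectral_type M U V \<sigma> \<longleftrightarrow> circle_measure \<sigma> \<and>
     (\<forall>h\<in>V. \<exists>\<tau>. spectral_measure M U h \<tau> \<and> absolutely_continuous \<sigma> \<tau>) \<and>
     (\<forall>\<tau>. circle_measure \<tau> \<and> absolutely_continuous \<sigma> \<tau> \<longrightarrow> (\<exists>h\<in>V. spectral_measure M U h \<tau>))"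

definition discrete_measure :: "complex measure \<Rightarrow> bool" where
  "discrete_measure \<sigma> \<longleftrightarrow> (\<exists>C. countable C \<and> C \<subseteq> space \<sigma> \<and> emeasure \<sigma> (space \<sigma> - C) = 0)"

definition discrete_spectrum :: "'a measure \<Rightarrow> 'a powers \<Rightarrow> ('a \<Rightarrow> complex) set \<Rightarrow> bool" where
  "discrete_spectrum M U V \<longleftrightarrow> (\<exists>\<sigma>. maximal_spectral_type M U V \<sigma> \<and> discrete_measure \<sigma>)"

text \<open>\<open>V\<close> is the Hilbert space direct sum of the pairwise orthogonal closed subspaces \<open>W i\<close>.\<close>

definition orthogonal_sum ::
  "'a measure \<Rightarrow> (nat \<Rightarrow> ('a \<Rightarrow> complex) set) \<Rightarrow> ('a \<Rightarrow> complex) set \<Rightarrow> bool" where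
  "orthogonal_sum M W V \<longleftrightarrow>
     (\<forall>i. closed_subspace M (W i)) \<and> (\<forall>i j. i \<noteq> j \<longrightarrow> l2_orthogonal M (W i) (W j)) \<and>
     V = {f \<in> L2 M. \<exists>w. (\<forall>i. w i \<in> W i) \<and>
            (\<lambda>n. l2_norm M (\<lambda>x. f x - (\<Sum>i<n. w i x))) \<longlonglongrightarrow> 0}"

text \<open>In a separable Hilbert space a family of pairwise orthogonal non-zero subspaces is countable,
  so an infinite one is indexed by \<open>nat\<close>.\<close>

definition infinite_lebesgue_spectrum ::
  "'a measure \<Rightarrow> 'a powers \<Rightarrow> ('a \<Rightarrow> complex) set \<Rightarrow> bool" where
  "infinite_lebesgue_spectrum M U V \<longleftrightarrow>
     (\<exists>W. orthogonal_sum M W V \<and>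
        (\<forall>i. invariant_subspace M U (W i) \<and>
           (\<exists>\<sigma>. maximal_spectral_type M U (W i) \<sigma> \<and> equivalent_measures \<sigma> circle_lebesgue)))"

definition orthogonal_decomposition ::
  "'a measure \<Rightarrow> ('a \<Rightarrow> complex) set \<Rightarrow> ('a \<Rightarrow> complex) set \<Rightarrow> bool" where
  "orthogonal_decomposition M V W \<longleftrightarrow>
     closed_subspace M V \<and> closed_subspace M W \<and> l2_orthogonal M V W \<and>
     (\<forall>f\<in>L2 M. \<exists>g\<in>V. \<exists>h\<in>W. AE x in M. f x = g x + h x)"

text \<open>The subgroup generated by the identity component and \<open>a\<close> is abelian. An ergodic nilsystem
  with this property is a rotation on a compact abelian group, whatever the nilpotency class of
  \<open>G\<close> is, so it has purely discrete spectrum and a trivial Lebesgue part. Example: \<open>G\<close> dihedral of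
  order 8, \<open>\<Gamma>\<close> generated by a reflection, \<open>a\<close> the rotation of order 4.\<close>

definition abelian_type :: "('g, 'b) monoid_scheme \<Rightarrow> 'g topology \<Rightarrow> 'g \<Rightarrow> bool" where
  "abelian_type G T a \<longleftrightarrow>
     (let S = insert a (connected_component_of_set T \<one>\<^bsub>G\<^esub>)
      in \<forall>x\<in>S. \<forall>y\<in>S. x \<otimes>\<^bsub>G\<^esub> y = y \<otimes>\<^bsub>G\<^esub> x)"

end

theory Submission
 imports Defs "HOL-Library.Function_Algebras" "HOL-Probability.Helly_Selection"
  "HOL-Probability.Giry_Monad" "HOL-Library.Diagonal_Subsequence"
begin

text \<open>By ergodicity the open subgroup generated by the identity component and \<open>a\<close> acts transitively
  on the nilmanifold \<open>X\<close>. Let \<open>L i\<close> be its lower central series and \<open>E i\<close> the space of \<open>L i\<close>-invariant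
  functions; \<open>E 1\<close> is the discrete part. Continuous functions in \<open>E (i + 1)\<close> are equicontinuous under
  \<open>L i\<close>, which acts on \<open>E (i + 1)\<close> as an abelian group with precompact orbits. Compactness of an
  invariant Hilbert-Schmidt operator then shows that joint eigenspaces of \<open>L i\<close>, one for each
  character \<open>\<xi>\<close>, span \<open>E (i + 1)\<close>.

  Let \<open>\<xi>\<close> be nontrivial and \<open>i \<ge> 1\<close>. By connectedness and ergodicity, \<open>g \<mapsto> \<xi> [g, a]\<close> maps \<open>L (i - 1)\<close>
  onto the circle. For a \<open>\<xi>\<close>-eigenvector \<open>f\<close>, translation by \<open>g\<close> rotates the spectral measure of \<open>f\<close> by
  \<open>\<xi> [g, a]\<close> and depends continuously on \<open>g\<close>, so this measure is absolutely continuous. Translates by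
  the powers of one \<open>g\<close> with an irrational rotation yield an eigenvector whose spectral measure
  dominates Lebesgue measure, hence one whose spectral measure is Lebesgue measure. The functions
  \<open>\<bar>f\<bar> (f / \<bar>f\<bar>)^n\<close> belong to the characters \<open>\<xi>^n\<close>, which gives infinitely many orthogonal copies.
  If there is no such \<open>\<xi>\<close>, then \<open>L 1\<close> acts trivially on \<open>X\<close>, so it is a connected subgroup of the
  discrete group \<open>\<Gamma>\<close> and therefore trivial.\<close>

text \<open>On \<open>E (i + 1)\<close> an element of \<open>L i\<close> commutes with every group
  element up to \<open>L (i + 1)\<close>, which these functions do not see. It can therefore be
  moved past \<open>h\<close> to the base point, so a perturbation of \<open>h\<close> costs the
  same for all elements of \<open>L i\<close> at once; this is the source of equicontinuity. The
  surjectivity of \<open>g\<close> to \<open>\<xi> [g, a]\<close> rests on a dichotomy: were it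
  constantly 1, ergodicity, connectedness and the discreteness of the characters of a compact space
  would make \<open>\<xi>\<close> trivial.

  The obstacle is that the \<open>L i\<close> are bare subgroups, not known to be closed or to have
  compact orbits, so there is neither a Haar measure on them nor a dual group. Averages over
  \<open>L i\<close> are replaced by points of least norm in midpoint-closed hulls of orbits: such a
  point is unique up to norm zero, hence invariant. This yields continuous invariant functions in
  \<open>CX_E_dense_step\<close> and the invariant kernel in \<open>joint_eigenvector\<close>.
  Absolute continuity is handled through the closed invariant subspaces of vectors whose spectral
  measure vanishes on a given set, so that it need only be checked on spanning vectors.\<close>

notation (input) LIMSEQ ("(_)/ ----> (_)" [60, 60] 60)

section \<open>Spaces with a semi-inner product\<close>

lemma LIMSEQ_0_less:
 fixes X :: "nat => real"
 assumes "X ----> 0" "e > 0"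
 obtains N where "!!n. n \<ge> N ==> X n < e" using order_tendstoD(2)[OF assms] by (auto simp: eventually_sequentially)

text \<open>The form may be degenerate: elements of \<open>L2\<close> are functions rather than classes, so equality
 of vectors takes the form \<open>nrm (x - y) = 0\<close>.\<close>

locale semi_hilbert =
 fixes H :: "'v::ab_group_add set" and sc :: "complex => 'v => 'v"
  and ip :: "'v => 'v => complex"
 assumes zero_mem [simp]: "0 : H"
  and add_mem [simp]: "x : H ==> y : H ==> x + y : H"
  and sc_mem [simp]: "x : H ==> sc c x : H"
  and sc_add_right: "sc c (x + y) = sc c x + sc c y"
  and sc_add_left: "sc (c + d) x = sc c x + sc d x"
  and sc_sc [simp]: "sc c (sc d x) = sc (c * d) x"
  and sc_one [simp]: "sc 1 x = x"
  and ip_add_left: "x : H ==> y : H ==> z : H ==> ip (x + y) z = ip x z + ip y z"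
  and ip_sc_left: "x : H ==> y : H ==> ip (sc c x) y = c * ip x y"
  and ip_cnj: "x : H ==> y : H ==> ip y x = cnj (ip x y)"
  and ip_nonneg: "x : H ==> 0 <= Re (ip x x)"
  and complete: "(!!n. F n : H) ==>
   (!!e. e > 0 ==> \<exists>N. \<forall>m\<ge>N. \<forall>n\<ge>N. sqrt (Re (ip (F m - F n) (F m - F n))) < e) ==>
   \<exists>f\<in>H. (%n::nat. sqrt (Re (ip (F n - f) (F n - f)))) ----> 0"
begin

definition nrm :: "'v => real" where "nrm x = sqrt (Re (ip x x))"

definition tends :: "(nat => 'v) => 'v => bool" where
 "tends F f \<longleftrightarrow> (%n. nrm (F n - f)) ----> 0"

definition linsub :: "'v set => bool" where
 "linsub V \<longleftrightarrow> V \<subseteq> H \<and> 0 : V \<and> (\<forall>x\<in>V. \<forall>y\<in>V. x + y : V) \<and> (\<forall>c. \<forall>x\<in>V. sc c x : V)"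

definition csub :: "'v set => bool" where
 "csub V \<longleftrightarrow> linsub V \<and> (\<forall>F. \<forall>f\<in>H. (\<forall>n. F n : V) \<and> tends F f --> f : V)"

definition ortho :: "'v set => 'v set" where
 "ortho S = {x : H. \<forall>s\<in>S. ip x s = 0}"

text \<open>The closed linear span, encoded as a double orthogonal complement: closedness is then
  immediate, and \<open>cspan_least\<close> recovers minimality from orthogonal projection.\<close>

definition cspan :: "'v set => 'v set" where
 "cspan S = ortho (ortho S)"

lemma sc_zero_left [simp]: "sc 0 x = 0" using sc_add_left[of 0 0 x] by simp

lemma sc_zero_right [simp]: "sc c 0 = 0" using sc_add_right[of c 0 0] by simp

lemma sc_minus_one: "sc (-1) x = - x" using sc_add_left[of 1 "-1" x] by (simp add: eq_neg_iff_add_eq_0 add.commute)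

lemma sc_minus_left: "sc (-c) x = - sc c x" using sc_add_left[of c "-c" x] by (simp add: eq_neg_iff_add_eq_0 add.commute)

lemma sc_minus_right: "sc c (- x) = - sc c x" using sc_sc[of c "-1" x] by (simp add: sc_minus_one sc_minus_left)

lemma sc_diff_right: "sc c (x - y) = sc c x - sc c y" using sc_add_right[of c x "-y"] by (simp add: sc_minus_right)

lemma sc_diff_left: "sc (c - d) x = sc c x - sc d x" using sc_add_left[of c "-d" x] by (simp add: sc_minus_left)

lemma minus_mem [simp]: "x : H ==> - x : H" using sc_mem[of x "-1"] by (simp add: sc_minus_one)

lemma diff_mem [simp]: "x : H ==> y : H ==> x - y : H" using add_mem[of x "- y"] by simp

lemma sum_mem [simp]: "(!!i. i : I ==> f i : H) ==> (\<Sum>i\<in>I. f i) : H" by (induction I rule: infinite_finite_induct) auto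

lemma ip_add_right: "x : H ==> y : H ==> z : H ==> ip z (x + y) = ip z x + ip z y"
 using ip_cnj[of "x + y" z] ip_cnj[of x z] ip_cnj[of y z] by (simp add: ip_add_left)

lemma ip_sc_right: "x : H ==> y : H ==> ip x (sc c y) = cnj c * ip x y"
 using ip_cnj[of "sc c y" x] ip_cnj[of y x] by (simp add: ip_sc_left)

lemma ip_zero_left [simp]: "y : H ==> ip 0 y = 0" using ip_sc_left[of 0 y 0] by simp

lemma ip_zero_right [simp]: "y : H ==> ip y 0 = 0" using ip_sc_right[of y 0 0] by simp

lemma ip_minus_left: "x : H ==> y : H ==> ip (- x) y = - ip x y" using ip_sc_left[of x y "-1"] by (simp add: sc_minus_one)

lemma ip_minus_right: "x : H ==> y : H ==> ip x (- y) = - ip x y" using ip_sc_right[of x y "-1"] by (simp add: sc_minus_one)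

lemma ip_diff_left: "x : H ==> y : H ==> z : H ==> ip (x - y) z = ip x z - ip y z"
 using ip_add_left[of x "- y" z] by (simp add: ip_minus_left)

lemma ip_diff_right: "x : H ==> y : H ==> z : H ==> ip z (x - y) = ip z x - ip z y"
 using ip_add_right[of x "- y" z] by (simp add: ip_minus_right)

lemma ip_sum_left: "(!!i. i : I ==> f i : H) ==> z : H ==> ip (\<Sum>i\<in>I. f i) z = (\<Sum>i\<in>I. ip (f i) z)"
 by (induction I rule: infinite_finite_induct) (auto simp: ip_add_left)

lemma ip_sum_right: "(!!i. i : I ==> f i : H) ==> z : H ==> ip z (\<Sum>i\<in>I. f i) = (\<Sum>i\<in>I. ip z (f i))"
 by (induction I rule: infinite_finite_induct) (auto simp: ip_add_right)

lemmas ip_simps = ip_add_left ip_add_right ip_diff_left ip_diff_right ip_sc_left ip_sc_right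
 ip_minus_left ip_minus_right

lemma ip_self: "x : H ==> ip x x = complex_of_real ((nrm x)^2)"
proof -
 assume x: "x : H"
 have "Im (ip x x) = 0" using ip_cnj[OF x x] by (metis complex_cnj_cancel_iff cnj.simps(2) neg_equal_zero)
 thus ?thesis using ip_nonneg[OF x] by (simp add: nrm_def complex_eq_iff)
qed

lemma nrm_sq: "x : H ==> (nrm x)^2 = Re (ip x x)" using ip_nonneg by (simp add: nrm_def)

lemma nrm_nonneg [simp]: "x : H ==> 0 <= nrm x" using ip_nonneg by (simp add: nrm_def)

lemma nrm_zero [simp]: "nrm 0 = 0" by (simp add: nrm_def)

lemma Re_ip_commute: "x : H ==> y : H ==> Re (ip y x) = Re (ip x y)" using ip_cnj[of x y] by simp

lemma nrm_sc: "x : H ==> nrm (sc c x) = cmod c * nrm x"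
proof -
 assume x: "x : H"
 have "complex_of_real ((nrm (sc c x))^2) = ip (sc c x) (sc c x)" using x by (simp add: ip_self)
 also have "\<dots> = (c * cnj c) * ip x x" using x by (simp add: ip_simps)
 also have "\<dots> = complex_of_real ((cmod c * nrm x)^2)"
  unfolding ip_self[OF x] complex_norm_square[symmetric] by (simp add: power_mult_distrib)
 finally have "complex_of_real ((nrm (sc c x))^2) = complex_of_real ((cmod c * nrm x)^2)" .
 hence "(nrm (sc c x))^2 = (cmod c * nrm x)^2" using of_real_eq_iff by blast
 thus ?thesis using x by (simp add: power2_eq_iff_nonneg)
qed

lemma nrm_minus: "x : H ==> nrm (- x) = nrm x" using nrm_sc[of x "-1"] by (simp add: sc_minus_one)

lemma nrm_diff_commute: "x : H ==> y : H ==> nrm (x - y) = nrm (y - x)" using nrm_minus[of "x - y"] by simp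

lemma nrm_add_sq: "x : H ==> y : H ==> (nrm (x + y))^2 = (nrm x)^2 + (nrm y)^2 + 2 * Re (ip x y)"
 by (simp add: nrm_sq ip_simps Re_ip_commute[of y x])

lemma nrm_diff_sq: "x : H ==> y : H ==> (nrm (x - y))^2 = (nrm x)^2 + (nrm y)^2 - 2 * Re (ip x y)"
 by (simp add: nrm_sq ip_simps Re_ip_commute[of y x])

lemma cauchy_schwarz:
 assumes x: "x : H" and y: "y : H"
 shows "cmod (ip x y) <= nrm x * nrm y"
proof -
 \<comment> \<open>Expansion of the norm of \<open>x - r * ip x y * y\<close> for a free real
   \<open>r\<close>. Since the form may be degenerate, dividing by \<open>nrm y\<close> is not
   always possible: if it is zero, a large \<open>r\<close> forces \<open>ip x y = 0\<close>;
   otherwise \<open>r = 1 / (nrm y)^2\<close> gives the claim.\<close>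
 have main: "!!r::real. 2 * r * (cmod (ip x y))^2 <= (nrm x)^2 + r^2 * (cmod (ip x y))^2 * (nrm y)^2"
 proof -
  fix r :: real
  define c where "c = complex_of_real r * ip x y"
  have "0 <= (nrm (x - sc c y))^2" by simp
  also have "\<dots> = (nrm x)^2 + (cmod c * nrm y)^2 - 2 * Re (ip x (sc c y))" using x y by (simp add: nrm_diff_sq nrm_sc)
  also have "ip x (sc c y) = complex_of_real (r * (cmod (ip x y))^2)"
   using x y by (simp add: ip_simps c_def complex_norm_square mult_ac del: of_real_power)
  also have "cmod c = \<bar>r\<bar> * cmod (ip x y)" by (simp add: c_def norm_mult)
  finally show "2 * r * (cmod (ip x y))^2 <= (nrm x)^2 + r^2 * (cmod (ip x y))^2 * (nrm y)^2" by (simp add: power_mult_distrib)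
 qed
 show ?thesis
 proof (cases "nrm y = 0")
  case True
  have "ip x y = 0"
  proof (rule ccontr)
   assume n: "ip x y ~= 0"
   have "2 * ((1 + (nrm x)^2) / (cmod (ip x y))^2) * (cmod (ip x y))^2 <= (nrm x)^2"
    using main[of "(1 + (nrm x)^2) / (cmod (ip x y))^2"] True by simp
   hence "2 * (1 + (nrm x)^2) <= (nrm x)^2" using n by simp
   hence "2 + (nrm x)^2 <= 0" by (simp add: distrib_left)
   thus False using zero_le_power2[of "nrm x"] by linarith
  qed
  thus ?thesis using x y by simp
 next
  case False
  hence p: "(nrm y)^2 > 0" by simp
  have "2 * (1 / (nrm y)^2) * (cmod (ip x y))^2 <= (nrm x)^2 + (1 / (nrm y)^2)^2 * (cmod (ip x y))^2 * (nrm y)^2" by (rule main)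
  also have "(1 / (nrm y)^2)^2 * (cmod (ip x y))^2 * (nrm y)^2 = (1 / (nrm y)^2) * (cmod (ip x y))^2"
   using p by (simp add: power2_eq_square field_simps)
  finally have "(1 / (nrm y)^2) * (cmod (ip x y))^2 <= (nrm x)^2" by simp
  hence "(cmod (ip x y))^2 <= (nrm x * nrm y)^2" using p by (simp add: field_simps power_mult_distrib)
  thus ?thesis by (rule power2_le_imp_le) (use x y in simp)
 qed
qed

lemma nrm_triangle: "x : H ==> y : H ==> nrm (x + y) <= nrm x + nrm y"
proof -
 assume x: "x : H" and y: "y : H"
 have "Re (ip x y) <= nrm x * nrm y" using cauchy_schwarz[OF x y] complex_Re_le_cmod[of "ip x y"] by linarith
 hence "(nrm (x + y))^2 <= (nrm x + nrm y)^2" using x y by (simp add: nrm_add_sq power2_sum)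
 thus ?thesis by (rule power2_le_imp_le) (use x y in simp)
qed

lemma nrm_triangle3: "x : H ==> y : H ==> z : H ==> nrm (x - z) <= nrm (x - y) + nrm (y - z)"
 using nrm_triangle[of "x - y" "y - z"] by simp

lemma nrm_diff_abs: "x : H ==> y : H ==> \<bar>nrm x - nrm y\<bar> <= nrm (x - y)"
 using nrm_triangle[of "x - y" y] nrm_triangle[of "y - x" x] nrm_diff_commute[of x y] by simp

lemma nrm_sum_le: "(!!i. i : I ==> f i : H) ==> nrm (\<Sum>i\<in>I. f i) <= (\<Sum>i\<in>I. nrm (f i))"
proof (induction I rule: infinite_finite_induct)
 case (insert i I)
 hence "nrm (f i + (\<Sum>i\<in>I. f i)) <= nrm (f i) + nrm (\<Sum>i\<in>I. f i)" by (intro nrm_triangle) auto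
 moreover have "nrm (\<Sum>i\<in>I. f i) <= (\<Sum>i\<in>I. nrm (f i))" using insert by auto
 ultimately show ?case using insert(1,2) by simp
qed auto

lemma nrm_eq_0_ip: "x : H ==> y : H ==> nrm x = 0 ==> ip x y = 0" using cauchy_schwarz[of x y] by simp

lemma nrm_eq_0_ip_right: "x : H ==> y : H ==> nrm x = 0 ==> ip y x = 0" using cauchy_schwarz[of y x] by simp

lemma ip_self_eq_0: "x : H ==> ip x x = 0 ==> nrm x = 0" by (simp add: ip_self)

lemma ip_cong: "x : H ==> x' : H ==> y : H ==> nrm (x - x') = 0 ==> ip x y = ip x' y"
 using nrm_eq_0_ip[of "x - x'" y] by (simp add: ip_simps)

lemma ip_cong_right: "x : H ==> x' : H ==> y : H ==> nrm (x - x') = 0 ==> ip y x = ip y x'"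
 using nrm_eq_0_ip_right[of "x - x'" y] by (simp add: ip_simps)

lemma nrm_cong: "x : H ==> x' : H ==> nrm (x - x') = 0 ==> nrm x = nrm x'" using nrm_diff_abs[of x x'] by simp

lemma nrm_diff_eq0I:
 assumes x: "x : H" "x' : H" and e: "!!y. y : H ==> ip x y = ip x' y"
 shows "nrm (x - x') = 0" using x e[of "x - x'"] by (intro ip_self_eq_0) (auto simp: ip_diff_left)

lemma nrm_diff_eq0_trans:
 "x : H ==> y : H ==> z : H ==> nrm (x - y) = 0 ==> nrm (y - z) = 0 ==> nrm (x - z) = 0"
 by (rule antisym) (use nrm_triangle3[of x y z] in auto)

lemma nrm_diff_eq0_trans2:
 "x : H ==> y : H ==> z : H ==> nrm (x - y) = 0 ==> nrm (z - y) = 0 ==> nrm (x - z) = 0"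
 using nrm_diff_eq0_trans[of x y z] nrm_diff_commute[of z y] by simp

section \<open>Convergence in the seminorm\<close>

lemma tends_const [simp]: "tends (%n. f) f" by (simp add: tends_def)

lemma tends_nrm0: "x : H ==> y : H ==> nrm (x - y) = 0 ==> tends (%n. x) y" by (simp add: tends_def)

lemma tends_ip_left:
 assumes F: "!!n. F n : H" and f: "f : H" and y: "y : H" and t: "tends F f"
 shows "(%n. ip (F n) y) ----> ip f y"
proof -
 have "(%n. ip (F n) y - ip f y) ----> 0"
 proof (rule tendsto_0_le[where K = "nrm y"])
  show "(%n. nrm (F n - f)) ----> 0" using t by (simp add: tends_def)
  show "\<forall>\<^sub>F n in sequentially. norm (ip (F n) y - ip f y) <= norm (nrm (F n - f)) * nrm y"
   using F f y cauchy_schwarz[of "F _ - f" y] by (auto simp: ip_simps)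
 qed
 thus ?thesis by (simp add: LIM_zero_iff)
qed

lemma tends_ip_right:
 assumes F: "!!n. F n : H" and f: "f : H" and y: "y : H" and t: "tends F f"
 shows "(%n. ip y (F n)) ----> ip y f" using tendsto_cnj[OF tends_ip_left[OF assms]] ip_cnj[OF F y] ip_cnj[OF f y] by simp

lemma tends_nrm:
 assumes F: "!!n. F n : H" and f: "f : H" and t: "tends F f"
 shows "(%n. nrm (F n)) ----> nrm f"
proof -
 have "(%n. nrm (F n) - nrm f) ----> 0" by (rule tendsto_0_le[where K = 1, OF t[unfolded tends_def]])
    (use F f nrm_diff_abs in auto)
 thus ?thesis by (simp add: LIM_zero_iff)
qed

lemma tends_ip:
 assumes F: "!!n. F n : H" "f : H" "tends F f" and G: "!!n. G n : H" "g : H" "tends G g"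
 shows "(%n. ip (F n) (G n)) ----> ip f g"
proof -
 have "(%n. nrm (F n - f) * nrm (G n)) ----> 0 * nrm g" using F(3) tends_nrm[OF G] unfolding tends_def by (intro tendsto_mult)
 hence t: "(%n. nrm (F n - f) * nrm (G n)) ----> 0" by simp
 have "norm (ip (F n - f) (G n)) <= norm (nrm (F n - f) * nrm (G n)) * 1" for n
  using cauchy_schwarz[of "F n - f" "G n"] F G by simp
 hence "(%n. ip (F n - f) (G n)) ----> 0" by (intro tendsto_0_le[OF t]) (rule always_eventually, blast)
 from tendsto_add[OF this tends_ip_right[OF G(1,2) F(2) G(3)]]
 show ?thesis using F G by (simp add: ip_diff_left)
qed

lemma tends_bound:
 assumes "!!n. nrm (F n - f) <= b n" "b ----> 0" "!!n. F n : H" "f : H"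
 shows "tends F f" unfolding tends_def
 by (rule tendsto_0_le[where K = 1, OF assms(2)]) (use assms in "auto intro!: always_eventually order_trans[OF assms(1)]")

lemma tends_add:
 assumes F: "!!n. F n : H" "f : H" "tends F f" and G: "!!n. G n : H" "g : H" "tends G g"
 shows "tends (%n. F n + G n) (f + g)"
proof (rule tends_bound[where b = "%n. nrm (F n - f) + nrm (G n - g)"])
 show "(%n. nrm (F n - f) + nrm (G n - g)) ----> 0"
  using F G tendsto_add[of "%n. nrm (F n - f)" 0 _ "%n. nrm (G n - g)" 0] by (simp add: tends_def)
 fix n show "nrm (F n + G n - (f + g)) <= nrm (F n - f) + nrm (G n - g)"
  using nrm_triangle[of "F n - f" "G n - g"] F G by (simp add: algebra_simps)
qed (use F G in auto)

lemma tends_sc: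
 assumes F: "!!n. F n : H" "f : H" "tends F f"
 shows "tends (%n. sc c (F n)) (sc c f)"
 using tendsto_mult_left[of _ 0 _ "cmod c"] F by (auto simp: tends_def sc_diff_right[symmetric] nrm_sc)

lemma tends_diff:
 assumes F: "!!n. F n : H" "f : H" "tends F f" and G: "!!n. G n : H" "g : H" "tends G g"
 shows "tends (%n. F n - G n) (f - g)" using tends_add[OF F, of "%n. sc (-1) (G n)" "sc (-1) g"] tends_sc[OF G, of "-1"] G
 by (simp add: sc_minus_one)

lemma cauchy_tends:
 assumes "!!n. F n : H" "!!e. e > 0 ==> \<exists>N. \<forall>m\<ge>N. \<forall>n\<ge>N. nrm (F m - F n) < e"
 obtains f where "f : H" "tends F f" using complete[of F] assms unfolding nrm_def tends_def by blast

lemma tends_cauchy: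
 assumes F: "!!n. F n : H" "f : H" "tends F f" and e: "e > 0"
 shows "\<exists>N. \<forall>m\<ge>N. \<forall>n\<ge>N. nrm (F m - F n) < e"
proof -
 obtain N where N: "!!n. n \<ge> N ==> nrm (F n - f) < e / 2" using LIMSEQ_0_less[OF F(3)[unfolded tends_def], of "e/2"] e by auto
 have "nrm (F m - F n) < e" if "m \<ge> N" "n \<ge> N" for m n
  using N[OF that(1)] N[OF that(2)] nrm_triangle3[of "F m" f "F n"] nrm_diff_commute[of f "F n"] F by force
 thus ?thesis by blast
qed

lemma abs_summable_tends:
 assumes w: "!!i. w i : H" and s: "summable (%i::nat. nrm (w i))"
 obtains f where "f : H" "tends (%n. \<Sum>i<n. w i) f"
proof (rule cauchy_tends[of "%n. \<Sum>i<n. w i"])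
 fix e :: real assume e: "e > 0"
 from s obtain N where N: "!!m n. m \<ge> N ==> norm (\<Sum>i=m..<n. nrm (w i)) < e" using e unfolding summable_Cauchy by blast
 have *: "nrm ((\<Sum>i<m. w i) - (\<Sum>i<n. w i)) < e" if "m \<ge> n" "n \<ge> N" for m n
 proof -
  have "(\<Sum>i<m. w i) = (\<Sum>i<n. w i) + (\<Sum>i=n..<m. w i)"
   using that(1) by (metis sum.atLeastLessThan_concat atLeast0LessThan zero_le)
  hence "nrm ((\<Sum>i<m. w i) - (\<Sum>i<n. w i)) = nrm (\<Sum>i=n..<m. w i)" by simp
  also have "\<dots> <= (\<Sum>i=n..<m. nrm (w i))" using w by (intro nrm_sum_le)
  also have "\<dots> < e" using N[OF that(2), of m] by simp
  finally show ?thesis .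
 qed
 show "\<exists>N. \<forall>m\<ge>N. \<forall>n\<ge>N. nrm ((\<Sum>i<m. w i) - (\<Sum>i<n. w i)) < e"
 proof (intro exI[of _ N] allI impI)
  fix m n assume "m \<ge> N" "n \<ge> N"
  thus "nrm ((\<Sum>i<m. w i) - (\<Sum>i<n. w i)) < e"
   using *[of n m] *[of m n] nrm_diff_commute[of "\<Sum>i<m. w i" "\<Sum>i<n. w i"] w by (cases "n <= m") auto
 qed
qed (use w in auto)

lemma csub_linsub: "csub V ==> linsub V" by (simp add: csub_def)

lemma linsub_mem: "linsub V ==> x : V ==> x : H" by (auto simp: linsub_def)

lemma linsub_zero: "linsub V ==> 0 : V"
 and linsub_add: "linsub V ==> x : V ==> y : V ==> x + y : V"
 and linsub_sc: "linsub V ==> x : V ==> sc c x : V" by (auto simp: linsub_def)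

lemma linsub_diff: "linsub V ==> x : V ==> y : V ==> x - y : V"
 using linsub_add[of V x "sc (-1) y"] linsub_sc[of V y "-1"] by (simp add: sc_minus_one)

lemma linsub_sum: "linsub V ==> (!!i. i : I ==> f i : V) ==> (\<Sum>i\<in>I. f i) : V"
 by (induction I rule: infinite_finite_induct) (auto intro: linsub_zero linsub_add)

lemma csub_mem: "csub V ==> x : V ==> x : H" by (rule linsub_mem[OF csub_linsub])

lemma csub_zero: "csub V ==> 0 : V"
 and csub_add: "csub V ==> x : V ==> y : V ==> x + y : V"
 and csub_sc: "csub V ==> x : V ==> sc c x : V"
 and csub_diff: "csub V ==> x : V ==> y : V ==> x - y : V"
 and csub_sum: "csub V ==> (!!i. i : I ==> f i : V) ==> (\<Sum>i\<in>I. f i) : V"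
 by (simp_all add: linsub_zero linsub_add linsub_sc linsub_diff linsub_sum csub_linsub)

lemma csub_tends: "csub V ==> (!!n. F n : V) ==> f : H ==> tends F f ==> f : V" by (auto simp: csub_def)

text \<open>The constant sequence \<open>x\<close> tends to each \<open>y\<close> at seminorm
  distance zero, so a closed subspace is a union of classes.\<close>

lemma csub_cong: "csub V ==> x : V ==> y : H ==> nrm (x - y) = 0 ==> y : V"
 using csub_tends[of V "%n. x" y] tends_nrm0[of x y] csub_mem[of V x] by simp

lemma csub_H: "csub H" by (auto simp: csub_def linsub_def)

lemma csubI:
 assumes "V \<subseteq> H" "0 : V" "!!x y. x : V ==> y : V ==> x + y : V" "!!c x. x : V ==> sc c x : V"
  "!!F f. f : H ==> (!!n. F n : V) ==> tends F f ==> f : V"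
 shows "csub V" unfolding csub_def linsub_def by (intro conjI ballI allI impI) (use assms in "(blast | metis)+")

lemma csub_Int: "csub V ==> csub W ==> csub (V \<inter> W)" unfolding csub_def linsub_def by blast

lemma csub_ortho:
 assumes "S \<subseteq> H" shows "csub (ortho S)"
proof (rule csubI)
 fix F f assume f: "f : H" and F: "!!n. F n : ortho S" and t: "tends F f"
 have "ip f s = 0" if s: "s : S" for s
 proof -
  have "(%n. ip (F n) s) ----> ip f s" using s assms F by (intro tends_ip_left f t) (auto simp: ortho_def)
  moreover have "(%n. ip (F n) s) = (%n. 0)" using F s by (auto simp: ortho_def)
  ultimately show ?thesis by (simp add: LIMSEQ_const_iff)
 qed
 thus "f : ortho S" using f by (simp add: ortho_def)
qed (use assms in "auto simp: ortho_def ip_simps subset_iff")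

lemma ortho_sub: "ortho S \<subseteq> H" by (auto simp: ortho_def)

lemma cspan_sub: "cspan S \<subseteq> H" by (auto simp: cspan_def ortho_def)

lemma csub_cspan: "csub (cspan S)" unfolding cspan_def by (rule csub_ortho[OF ortho_sub])

lemma ortho_sym: "x : ortho S ==> s : S ==> s : H ==> ip s x = 0" using ip_cnj[of x s] by (auto simp: ortho_def)

lemma cspan_superset: "S \<subseteq> H ==> S \<subseteq> cspan S"
 by (auto simp: cspan_def intro: ortho_sym) (auto simp: ortho_def intro: ortho_sym ip_cnj)


text \<open>By the parallelogram law a minimising sequence in a midpoint-closed set is Cauchy. As
  closedness of \<open>C\<close> is not assumed, the minimiser \<open>m\<close> is only a limit of
  points of \<open>C\<close>, and uniqueness takes the form of the last clause: every sequence in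
  \<open>C\<close> whose norms tend to \<open>nrm m\<close> converges to \<open>m\<close>. An
  isometry that maps \<open>C\<close> into itself therefore fixes \<open>m\<close> up to norm
  zero.\<close>

lemma midpoint_min:
 assumes C: "C \<subseteq> H" "C ~= {}" and mid: "!!x y. x : C ==> y : C ==> sc (1/2) (x + y) : C"
 obtains m h where "m : H" "!!n. h n : C" "tends h m" "!!x. x : C ==> nrm m <= nrm x"
  "!!F. (!!n. F n : C) ==> (%n. nrm (F n)) ----> nrm m ==> tends F m"
proof -
 define d where "d = Inf (nrm ` C)"
 have bdd: "bdd_below (nrm ` C)" using C by (intro bdd_belowI[of _ 0]) auto
 have d: "d <= nrm x" if "x : C" for x unfolding d_def using bdd that by (intro cInf_lower) auto
 have d0: "0 <= d" unfolding d_def using C by (intro cInf_greatest) auto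
 have key: "(nrm (x - y))^2 <= 2 * ((nrm x)^2 - d^2) + 2 * ((nrm y)^2 - d^2)" if "x : C" "y : C" for x y
 proof -
  have xy: "x : H" "y : H" using that C by auto
  have "d^2 <= (nrm (sc (1/2) (x + y)))^2" using d[OF mid[OF that]] d0 by (simp add: power_mono)
  hence "4 * d^2 <= (nrm (x + y))^2" using xy by (simp add: nrm_sc power_mult_distrib power2_eq_square)
  moreover have "(nrm (x + y))^2 + (nrm (x - y))^2 = 2 * (nrm x)^2 + 2 * (nrm y)^2" using xy by (simp add: nrm_add_sq nrm_diff_sq)
  ultimately show ?thesis by (simp add: algebra_simps)
 qed
 have "\<exists>x\<in>C. nrm x < d + 1 / Suc n" for n
  using cInf_lessD[of "nrm ` C" "d + 1 / Suc n"] C unfolding d_def[symmetric] by auto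
 then obtain h where h: "!!n. h n : C" "!!n. nrm (h n) < d + 1 / Suc n" by metis
 have lim: "(%n. nrm (h n)) ----> d"
 proof (rule tendsto_sandwich[of "%n. d" _ _ "%n. d + 1 / Suc n"])
  show "(%n. d + 1 / real (Suc n)) ----> d"
   using tendsto_add[OF tendsto_const[of d] LIMSEQ_inverse_real_of_nat] by (simp add: inverse_eq_divide)
 qed (use d[OF h(1)] h(2) in "auto intro!: always_eventually less_imp_le")
 have sq: "(%n. 2 * ((nrm (F n))^2 - d^2)) ----> 0" if "(%n. nrm (F n)) ----> d" for F :: "nat => 'v"
  using tendsto_mult_left[OF tendsto_diff[OF tendsto_power[OF that, of 2] tendsto_const[of "d^2"]], of 2] by simp
 obtain m where m: "m : H" "tends h m"
 proof (rule cauchy_tends[of h])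
  fix e :: real assume e: "e > 0"
  hence "0 < e^2 / 2" by simp
  from LIMSEQ_0_less[OF sq[OF lim] this] obtain N
   where N: "!!n. n \<ge> N ==> 2 * ((nrm (h n))^2 - d^2) < e^2 / 2" by metis
  have "nrm (h m - h n) < e" if "m \<ge> N" "n \<ge> N" for m n
  proof -
   have "(nrm (h m - h n))^2 < e^2" using key[OF h(1)[of m] h(1)[of n]] N[OF that(1)] N[OF that(2)] by linarith
   thus ?thesis by (rule power2_less_imp_less) (use e in simp)
  qed
  thus "\<exists>N. \<forall>m\<ge>N. \<forall>n\<ge>N. nrm (h m - h n) < e" by blast
 qed (use h C in auto)
 have nm: "nrm m = d" using LIMSEQ_unique[OF tends_nrm[OF _ m] lim] h C by auto
 show ?thesis
 proof (rule that[of m h])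
  fix F assume F: "!!n. F n : C" "(%n. nrm (F n)) ----> nrm m"
  have "(%n. 2 * ((nrm (F n))^2 - d^2) + 2 * ((nrm (h n))^2 - d^2)) ----> 0"
   using tendsto_add[OF sq[OF F(2)[unfolded nm]] sq[OF lim]] by simp
  hence "(%n. (nrm (F n - h n))^2) ----> 0" by (rule tendsto_0_le[where K = 1])
     (use key[OF F(1) h(1)] in "auto intro!: always_eventually order_trans[OF key[OF F(1) h(1)]]")
  hence "(%n. nrm (F n - h n)) ----> 0"
   using tendsto_real_sqrt[of "%n. (nrm (F n - h n))^2" 0] F(1) h(1) C by (simp add: subset_iff)
  hence "tends (%n. F n - h n) 0" by (simp add: tends_def)
  from tends_add[OF _ _ this _ m] show "tends F m" using F(1) h(1) C by (simp add: subset_iff)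
 qed (use m h nm d in auto)
qed

lemma projection:
 assumes V: "csub V" and x: "x : H"
 obtains p where "p : V" "x - p : ortho V"
proof -
 have VH: "V \<subseteq> H" using csub_mem[OF V] by auto
 define C where "C = (%v. x - v) ` V"
 have mid: "sc (1/2) (u + w) : C" if "u : C" "w : C" for u w
 proof -
  obtain a b where ab: "a : V" "b : V" "u = x - a" "w = x - b" using \<open>u \<in> C\<close> \<open>w \<in> C\<close> by (auto simp: C_def)
  have "sc (1/2) (u + w) = sc (1/2) (x + x) - sc (1/2) (a + b)" unfolding ab sc_diff_right[symmetric] by (simp add: algebra_simps)
  also have "sc (1/2) (x + x) = x" using sc_add_left[of "1/2" "1/2" x] by (simp add: sc_add_right)
  finally show ?thesis unfolding C_def using ab(1,2) V by (auto intro!: imageI csub_sc csub_add)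
 qed
 obtain m h where m: "m : H" "!!n. h n : C" "tends h m" "!!y. y : C ==> nrm m <= nrm y"
 proof (rule midpoint_min[OF _ _ mid])
  show "C \<subseteq> H" "C ~= {}" using VH x csub_zero[OF V] by (auto simp: C_def)
 qed blast+
 have hH: "h n : H" for n using m(2)[of n] x VH by (auto simp: C_def)
 have "tends (%n. x - h n) (x - m)" by (intro tends_diff) (use x m(1,3) hH in auto)
 moreover have "x - h n : V" for n using m(2)[of n] by (auto simp: C_def)
 ultimately have pV: "x - m : V" by (intro csub_tends[OF V, of "%n. x - h n" "x - m"] diff_mem x m(1)) auto
 have "ip m v = 0" if v: "v : V" for v
 proof -
  have vH: "v : H" using v VH by auto
  \<comment> \<open>A step length with \<open>r * (nrm v)^2 <= 1\<close> that also makes sense when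
    \<open>nrm v = 0\<close>: moving from \<open>m\<close> by \<open>r * ip m v\<close> along
    \<open>v\<close> would shorten it unless \<open>ip m v = 0\<close>.\<close>
  define r where "r = 1 / (1 + (nrm v)^2)"
  have pos: "1 + (nrm v)^2 > 0" by (simp add: add_pos_nonneg)
  have r: "r > 0" "r * (nrm v)^2 <= 1" using pos by (auto simp: r_def field_simps)
  define c where "c = complex_of_real r * ip m v"
  have "m - sc c v = x - ((x - m) + sc c v)" by simp
  hence "m - sc c v : C" unfolding C_def using csub_add[OF V pV csub_sc[OF V v]] by (metis imageI)
  hence "nrm m <= nrm (m - sc c v)" by (rule m(4))
  hence "(nrm m)^2 <= (nrm (m - sc c v))^2" using m(1) by (simp add: power_mono)
  also have "\<dots> = (nrm m)^2 + (cmod c * nrm v)^2 - 2 * Re (ip m (sc c v))" using vH m(1) by (simp add: nrm_diff_sq nrm_sc)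
  also have "ip m (sc c v) = complex_of_real (r * (cmod (ip m v))^2)"
   using vH m(1) by (simp add: ip_simps c_def complex_norm_square mult_ac del: of_real_power)
  also have "cmod c = r * cmod (ip m v)" using r by (simp add: c_def norm_mult)
  finally have "2 * (r * (cmod (ip m v))^2) <= (r * (nrm v)^2) * (r * (cmod (ip m v))^2)"
   by (simp add: power_mult_distrib power2_eq_square mult_ac)
  also have "\<dots> <= 1 * (r * (cmod (ip m v))^2)" using r by (intro mult_right_mono) auto
  finally have "r * (cmod (ip m v))^2 <= 0" by simp
  thus ?thesis using r by (simp add: mult_le_0_iff)
 qed
 thus ?thesis using that[of "x - m"] pV m(1) by (auto simp: ortho_def)
qed

lemma ortho_ip: "x : ortho S ==> s : S ==> ip x s = 0" by (auto simp: ortho_def)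

lemma ortho_mem: "x : ortho S ==> x : H" by (auto simp: ortho_def)

lemma ortho_antimono: "S \<subseteq> S' ==> ortho S' \<subseteq> ortho S" by (auto simp: ortho_def)

text \<open>The error of projecting \<open>x\<close> on \<open>V\<close> is orthogonal to
  \<open>S\<close>, hence to \<open>x\<close>, and it is also orthogonal to the projection itself;
  so it has norm zero.\<close>

lemma cspan_least:
 assumes V: "csub V" and S: "S \<subseteq> V"
 shows "cspan S \<subseteq> V"
proof
 fix x assume x: "x : cspan S"
 have xH: "x : H" using x cspan_sub by auto
 obtain p where p: "p : V" "x - p : ortho V" using projection[OF V xH] .
 have pH: "p : H" using p(1) V csub_mem by auto
 have "x - p : ortho S" using p(2) ortho_antimono[OF S] by auto
 hence "ip x (x - p) = 0" using x by (auto simp: cspan_def ortho_def)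
 moreover have "ip p (x - p) = 0" using ortho_sym[OF p(2,1) pH] .
 ultimately have "nrm (x - p) = 0" using xH pH by (intro ip_self_eq_0) (auto simp: ip_diff_left)
 thus "x : V" using csub_cong[OF V p(1) xH] nrm_diff_commute xH pH by auto
qed

lemma cspan_mono: "S \<subseteq> S' ==> cspan S \<subseteq> cspan S'" unfolding cspan_def by (intro ortho_antimono)

lemma cspan_csub: "csub V ==> cspan V = V" using cspan_least[of V V] cspan_superset[of V] csub_mem[of V] by blast

lemma ortho_cspan_ip: "x : ortho S ==> y : cspan S ==> ip x y = 0"
 using ortho_sym[of y "ortho S" x] ortho_mem[of x S] by (auto simp: cspan_def)

lemma ortho_cspan: "S \<subseteq> H ==> ortho (cspan S) = ortho S"
 using ortho_antimono[OF cspan_superset[of S]] ortho_cspan_ip[of _ S] ortho_mem[of _ S] unfolding ortho_def[of "cspan S"] by blast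

lemma csub_eq_H:
 assumes V: "csub V" and "!!x. x : ortho V ==> nrm x = 0"
 shows "V = H"
proof
 show "H \<subseteq> V"
 proof
  fix x assume x: "x : H"
  obtain p where p: "p : V" "x - p : ortho V" using projection[OF V x] .
  thus "x : V" using csub_cong[OF V p(1) x] assms(2)[OF p(2)] nrm_diff_commute x csub_mem[OF V] by auto
 qed
qed (use csub_mem[OF V] in auto)

text \<open>The topological closure. A double complement provides no approximating sequences, and
  \<open>cspan_seq\<close> obtains them through this set.\<close>

definition cls :: "'v set => 'v set" where
 "cls V = {x : H. \<forall>e>0. \<exists>v\<in>V. nrm (x - v) < e}"

lemma cls_superset: "V \<subseteq> H ==> V \<subseteq> cls V"
proof
 fix x assume "V \<subseteq> H" "x : V"
 thus "x : cls V" unfolding cls_def by (auto intro!: bexI[of _ x])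
qed

lemma csub_cls:
 assumes V: "linsub V" shows "csub (cls V)"
proof (rule csubI)
 have VH: "V \<subseteq> H" using V by (simp add: linsub_def)
 show "cls V \<subseteq> H" by (auto simp: cls_def)
 show "0 : cls V" using cls_superset[OF VH] linsub_zero[OF V] by auto
 show "x + y : cls V" if xy: "x : cls V" "y : cls V" for x y
 proof -
  have h: "x : H" "y : H" using xy by (auto simp: cls_def)
  have "\<exists>v\<in>V. nrm (x + y - v) < e" if e: "e > 0" for e
  proof -
   obtain v w where vw: "v : V" "w : V" "nrm (x - v) < e/2" "nrm (y - w) < e/2"
    using xy half_gt_zero[OF e] unfolding cls_def by blast
   have "nrm ((x - v) + (y - w)) <= nrm (x - v) + nrm (y - w)" using h vw VH by (intro nrm_triangle) auto
   hence "nrm (x + y - (v + w)) < e" using vw(3,4) by (simp add: algebra_simps)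
   thus ?thesis using linsub_add[OF V vw(1,2)] by blast
  qed
  thus ?thesis using h by (simp add: cls_def)
 qed
 show "sc c x : cls V" if x: "x : cls V" for c x
 proof -
  have h: "x : H" using x by (auto simp: cls_def)
  have "\<exists>v\<in>V. nrm (sc c x - v) < e" if e: "e > 0" for e
  proof -
   have pos: "cmod c + 1 > 0" by (simp add: add_nonneg_pos)
   obtain v where v: "v : V" "nrm (x - v) < e / (cmod c + 1)" using x divide_pos_pos[OF e pos] unfolding cls_def by blast
   have "nrm (sc c x - sc c v) = cmod c * nrm (x - v)" using h v(1) VH by (simp add: sc_diff_right[symmetric] nrm_sc subset_iff)
   also have "\<dots> <= (cmod c + 1) * nrm (x - v)" using h v(1) VH by (intro mult_right_mono) auto
   also have "\<dots> < e" using v(2) pos by (simp add: field_simps)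
   finally show ?thesis using linsub_sc[OF V v(1)] by blast
  qed
  thus ?thesis using h by (simp add: cls_def)
 qed
 show "f : cls V" if f: "f : H" "!!n. F n : cls V" "tends F f" for F f
 proof -
  have FH: "F n : H" for n using f(2)[of n] by (auto simp: cls_def)
  have "\<exists>v\<in>V. nrm (f - v) < e" if e: "e > 0" for e
  proof -
   obtain n where n: "nrm (F n - f) < e/2" by (metis LIMSEQ_0_less[OF f(3)[unfolded tends_def] half_gt_zero[OF e]] order_refl)
   obtain v where v: "v : V" "nrm (F n - v) < e/2" using f(2)[of n] half_gt_zero[OF e] unfolding cls_def by blast
   have "nrm (f - v) <= nrm (f - F n) + nrm (F n - v)" using f(1) FH v(1) VH by (intro nrm_triangle3) auto
   thus ?thesis using n v nrm_diff_commute[OF f(1) FH[of n]] by (intro bexI[of _ v]) auto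
  qed
  thus ?thesis using f by (simp add: cls_def)
 qed
qed

lemma cls_seq:
 assumes x: "x : cls V" and VH: "V \<subseteq> H"
 obtains F where "!!n. F n : V" "tends F x"
proof -
 have "\<exists>v\<in>V. nrm (x - v) < 1 / Suc n" for n :: nat using x by (auto simp: cls_def)
 then obtain F where F: "!!n. F n : V" "!!n. nrm (x - F n) < 1 / Suc n" by metis
 have xH: "x : H" using x by (simp add: cls_def)
 have "tends F x"
 proof (rule tends_bound[where b = "%n. 1 / Suc n"])
  show "(%n. 1 / real (Suc n)) ----> 0" using LIMSEQ_inverse_real_of_nat by (simp add: inverse_eq_divide)
  show "nrm (F n - x) <= 1 / Suc n" for n
   using F(2)[of n] nrm_diff_commute[OF xH, of "F n"] F(1)[of n] VH by (auto intro: less_imp_le)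
 qed (use F VH xH in auto)
 thus ?thesis using that F by blast
qed

lemma cspan_seq:
 assumes V: "linsub V" and x: "x : cspan V"
 obtains F where "!!n. F n : V" "tends F x"
proof -
 have VH: "V \<subseteq> H" using V by (simp add: linsub_def)
 have "x : cls V" using cspan_least[OF csub_cls[OF V] cls_superset[OF VH]] x by blast
 thus ?thesis using cls_seq[OF _ VH] that by blast
qed

text \<open>For \<open>z\<close> orthogonal to the kernel \<open>K\<close>, the vector
  \<open>\<phi> z * x - \<phi> x * z\<close> lies in \<open>K\<close>; pairing it with
  \<open>z\<close> expresses \<open>\<phi> x\<close> through \<open>ip x z\<close>.\<close>

lemma riesz:
 assumes add: "!!x y. x : H ==> y : H ==> \<phi> (x + y) = \<phi> x + \<phi> y"
  and hom: "!!x c. x : H ==> \<phi> (sc c x) = c * \<phi> x"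
  and bd: "!!x. x : H ==> cmod (\<phi> x) <= B * nrm x"
 obtains t where "t : H" "!!x. x : H ==> \<phi> x = ip x t"
proof -
 define K where "K = {x : H. \<phi> x = 0}"
 have dif: "\<phi> (x - y) = \<phi> x - \<phi> y" if "x : H" "y : H" for x y
  using add[of x "sc (-1) y"] hom[of y "-1"] that by (simp add: sc_minus_one)
 have K: "csub K"
 proof (rule csubI)
  fix F f assume f: "f : H" "!!n. F n : K" "tends F f"
  have "(%n. \<phi> f) ----> 0"
  proof (rule tendsto_0_le[where K = B, OF f(3)[unfolded tends_def]])
   have "norm (\<phi> f) <= norm (nrm (F n - f)) * B" for n
    using bd[of "F n - f"] f(1) f(2)[of n] dif[of "F n" f] by (auto simp: K_def mult_ac)
   thus "\<forall>\<^sub>F n in sequentially. norm (\<phi> f) <= norm (nrm (F n - f)) * B" by simp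
  qed
  hence "\<phi> f = 0" by (simp add: LIMSEQ_const_iff)
  thus "f : K" using f(1) by (simp add: K_def)
 next
  show "0 : K" using hom[of 0 0] by (simp add: K_def)
 qed (auto simp: K_def add hom)
 show ?thesis
 proof (cases "K = H")
  case True thus ?thesis using that[of 0] by (auto simp: K_def)
 next
  case False
  then obtain z where z: "z : ortho K" "nrm z ~= 0" using csub_eq_H[OF K] by blast
  have zH: "z : H" using ortho_mem[OF z(1)] .
  define t where "t = sc (cnj (\<phi> z) / complex_of_real ((nrm z)^2)) z"
  have "\<phi> x = ip x t" if x: "x : H" for x
  proof -
   have "sc (\<phi> z) x - sc (\<phi> x) z : K" using x zH by (simp add: K_def dif hom)
   hence "ip z (sc (\<phi> z) x - sc (\<phi> x) z) = 0" using z(1) by (simp add: ortho_ip)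
   hence "cnj (\<phi> z) * ip z x = cnj (\<phi> x) * ip z z" using x zH by (simp add: ip_simps)
   hence "cnj (cnj (\<phi> z) * ip z x) = cnj (cnj (\<phi> x) * ip z z)" by simp
   hence "\<phi> z * ip x z = \<phi> x * complex_of_real ((nrm z)^2)" using ip_cnj[OF zH x] ip_self[OF zH] by simp
   thus ?thesis unfolding t_def using x zH z(2) by (simp add: ip_sc_right field_simps)
  qed
  moreover have "t : H" using zH by (simp add: t_def)
  ultimately show ?thesis using that by blast
 qed
qed

lemma nrm_sum_orth:
 assumes "finite I" "!!i. i : I ==> w i : H" "!!i j. i : I ==> j : I ==> i ~= j ==> ip (w i) (w j) = 0"
 shows "(nrm (\<Sum>i\<in>I. w i))^2 = (\<Sum>i\<in>I. (nrm (w i))^2)" using assms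
proof (induction I rule: finite_induct)
 case (insert i I)
 have "ip (w i) (\<Sum>i\<in>I. w i) = 0" using insert by (subst ip_sum_right) (auto intro!: sum.neutral)
 thus ?case using insert by (simp add: nrm_add_sq)
qed simp

lemma orth_series_tends:
 assumes w: "!!i. w i : H" "!!i j. i ~= j ==> ip (w i) (w j) = 0"
  and B: "!!n::nat. (\<Sum>i<n. (nrm (w i))^2) <= B"
 obtains f where "f : H" "tends (%n. \<Sum>i<n. w i) f"
proof (rule cauchy_tends[of "%n. \<Sum>i<n. w i"])
 have "summable (%i. (nrm (w i))^2)" by (rule bounded_imp_summable[of _ B]) (use B[of "Suc _"] in "auto simp: lessThan_Suc_atMost")
 fix e :: real assume e: "e > 0"
 obtain N where N: "!!m n. m \<ge> N ==> norm (\<Sum>i=m..<n. (nrm (w i))^2) < e^2"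
  using e \<open>summable (%i. (nrm (w i))^2)\<close> unfolding summable_Cauchy by (metis zero_less_power)
 have *: "nrm ((\<Sum>i<m. w i) - (\<Sum>i<n. w i)) < e" if "m \<ge> n" "n \<ge> N" for m n
 proof -
  have "(\<Sum>i<m. w i) = (\<Sum>i<n. w i) + (\<Sum>i=n..<m. w i)"
   using that(1) by (metis sum.atLeastLessThan_concat atLeast0LessThan zero_le)
  hence "(nrm ((\<Sum>i<m. w i) - (\<Sum>i<n. w i)))^2 = (nrm (\<Sum>i=n..<m. w i))^2" by simp
  also have "\<dots> = (\<Sum>i=n..<m. (nrm (w i))^2)" using w by (intro nrm_sum_orth) auto
  also have "\<dots> < e^2" using N[OF that(2), of m] by simp
  finally show ?thesis by (rule power2_less_imp_less) (use e in simp)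
 qed
 show "\<exists>N. \<forall>m\<ge>N. \<forall>n\<ge>N. nrm ((\<Sum>i<m. w i) - (\<Sum>i<n. w i)) < e"
 proof (intro exI[of _ N] allI impI)
  fix m n assume "m \<ge> N" "n \<ge> N"
  thus "nrm ((\<Sum>i<m. w i) - (\<Sum>i<n. w i)) < e"
   using *[of n m] *[of m n] nrm_diff_commute[of "\<Sum>i<m. w i" "\<Sum>i<n. w i"] w by (cases "n <= m") auto
 qed
qed (use w in auto)

text \<open>The hypothesis \<open>p\<close> makes \<open>ip x (w i)\<close> equal to
  \<open>(nrm (w i))^2\<close>, and the claim is the non-negativity of the squared distance from
  \<open>x\<close> to the sum of the \<open>w i\<close>. No normalisation is assumed, so that
  \<open>w i\<close> may have norm zero.\<close>

lemma bessel:
 assumes I: "finite I" and w: "!!i. i : I ==> w i : H" "!!i j. i : I ==> j : I ==> i ~= j ==> ip (w i) (w j) = 0"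
  and x: "x : H" and p: "!!i. i : I ==> ip (x - w i) (w i) = 0"
 shows "(\<Sum>i\<in>I. (nrm (w i))^2) <= (nrm x)^2"
proof -
 define s where "s = (\<Sum>i\<in>I. w i)"
 have s: "s : H" unfolding s_def using w by auto
 have "ip x (w i) = complex_of_real ((nrm (w i))^2)" if "i : I" for i
  using p[OF that] w(1)[OF that] x by (simp add: ip_diff_left ip_self del: of_real_power)
 hence "ip x s = complex_of_real (\<Sum>i\<in>I. (nrm (w i))^2)"
  unfolding s_def using w x by (simp add: ip_sum_right del: of_real_power)
 moreover have "(nrm s)^2 = (\<Sum>i\<in>I. (nrm (w i))^2)" unfolding s_def using nrm_sum_orth[OF I w] by simp
 ultimately have "(nrm (x - s))^2 = (nrm x)^2 - (\<Sum>i\<in>I. (nrm (w i))^2)"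
  using x s by (simp add: nrm_diff_sq del: of_real_power of_real_sum)
 thus ?thesis by (smt (verit) zero_le_power2)
qed

end

section \<open>Square-integrable functions\<close>

lemma plus_fun: "(f::'a => complex) + g = (%x. f x + g x)" by (simp add: plus_fun_def)

lemma minus_fun: "(f::'a => complex) - g = (%x. f x - g x)" by (simp add: fun_diff_def)

lemma zero_fun: "(0::'a => complex) = (%x. 0)" by (simp add: zero_fun_def)

lemma sum_fun: "(\<Sum>i\<in>I. (f i :: 'a => complex)) = (%x. \<Sum>i\<in>I. f i x)"
 by (induction I rule: infinite_finite_induct) (auto simp: zero_fun plus_fun)

lemma borel_measurable_cnj [measurable (raw)]:
 "f : borel_measurable M ==> (%x. cnj (f x)) : borel_measurable M"
 by (rule measurable_compose[OF _ borel_measurable_continuous_onI[OF continuous_on_cnj[OF continuous_on_id]]])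

lemma L2_measurable: "f : L2 M ==> f : borel_measurable M" by (simp add: L2_def)

lemma L2_integrable_sq: "f : L2 M ==> integrable M (%x. (cmod (f x))^2)" by (simp add: L2_def)

lemma L2I: "f : borel_measurable M ==> integrable M (%x. (cmod (f x))^2) ==> f : L2 M" by (simp add: L2_def)

lemma L2_integrable_mult:
 assumes f: "f : L2 M" and g: "g : L2 M"
 shows "integrable M (%x. f x * cnj (g x))"
proof (rule Bochner_Integration.integrable_bound)
 show "integrable M (%x. (cmod (f x))^2 + (cmod (g x))^2)"
  using f g by (intro Bochner_Integration.integrable_add L2_integrable_sq)
 show "(%x. f x * cnj (g x)) : borel_measurable M" using L2_measurable[OF f] L2_measurable[OF g] by measurable
 have "cmod a * cmod b <= (cmod a)^2 + (cmod b)^2" for a b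
  using sum_squares_bound[of "cmod a" "cmod b"] mult_nonneg_nonneg[OF norm_ge_zero[of a] norm_ge_zero[of b]] by linarith
 thus "AE x in M. norm (f x * cnj (g x)) <= norm ((cmod (f x))^2 + (cmod (g x))^2)" by (simp add: norm_mult)
qed

lemma L2_add: "f : L2 M ==> g : L2 M ==> (%x. f x + g x) : L2 M"
proof (rule L2I)
 assume f: "f : L2 M" and g: "g : L2 M"
 note [measurable] = L2_measurable[OF f] L2_measurable[OF g]
 show "(%x. f x + g x) : borel_measurable M" by measurable
 show "integrable M (%x. (cmod (f x + g x))^2)"
 proof (rule Bochner_Integration.integrable_bound)
  show "integrable M (%x. 2 * (cmod (f x))^2 + 2 * (cmod (g x))^2)"
   using f g by (intro Bochner_Integration.integrable_add integrable_mult_right L2_integrable_sq)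
  show "(%x. (cmod (f x + g x))^2) : borel_measurable M" by measurable
  have "(cmod (a + b))^2 <= 2 * (cmod a)^2 + 2 * (cmod b)^2" for a b
  proof -
   have "(cmod (a + b))^2 <= (cmod a + cmod b)^2" by (intro power_mono norm_triangle_ineq) auto
   also have "\<dots> <= 2 * (cmod a)^2 + 2 * (cmod b)^2" using sum_squares_bound[of "cmod a" "cmod b"] by (simp add: power2_sum)
   finally show ?thesis .
  qed
  thus "AE x in M. norm ((cmod (f x + g x))^2) <= norm (2 * (cmod (f x))^2 + 2 * (cmod (g x))^2)" by simp
 qed
qed

lemma L2_scale: "f : L2 M ==> (%x. c * f x) : L2 M"
proof (rule L2I)
 assume f: "f : L2 M"
 note [measurable] = L2_measurable[OF f]
 show "(%x. c * f x) : borel_measurable M" by measurable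
 show "integrable M (%x. (cmod (c * f x))^2)"
  using integrable_mult_right[OF L2_integrable_sq[OF f], of "(cmod c)^2"] by (simp add: norm_mult power_mult_distrib)
qed

lemma L2_zero: "(%x. 0) : L2 M" by (simp add: L2_def)

lemma l2_inner_self: "l2_inner M f f = complex_of_real (\<integral>x. (cmod (f x))^2 \<partial>M)"
 by (simp add: l2_inner_def complex_norm_square[symmetric] del: of_real_power)

lemma L2_bounded:
 assumes M: "finite_measure M" and f: "f : borel_measurable M" and B: "!!x. x : space M ==> cmod (f x) <= B"
 shows "f : L2 M"
proof (rule L2I[OF f])
 interpret finite_measure M by (rule M)
 note [measurable] = f
 show "integrable M (%x. (cmod (f x))^2)" by (rule integrable_const_bound[where B = "B^2"]) (auto intro!: power_mono B)
qed

lemma L2_integrable: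
 assumes M: "finite_measure M" and f: "f : L2 M"
 shows "integrable M f"
proof -
 interpret finite_measure M by (rule M)
 have "(%x. 1) : L2 M" by (rule L2_bounded[OF M, where B = 1]) auto
 from L2_integrable_mult[OF f this] show ?thesis by simp
qed

text \<open>On a finite measure space an \<open>L^2\<close> Cauchy sequence is \<open>L^1\<close>
  Cauchy, so a subsequence converges almost everywhere; Fatou's lemma turns this into convergence in
  square mean.\<close>

lemma L2_complete:
 fixes F :: "nat => 'a => complex"
 assumes M: "finite_measure M" and F: "!!n. F n : L2 M"
  and C: "!!e. e > 0 ==> \<exists>N. \<forall>m\<ge>N. \<forall>n\<ge>N. sqrt (\<integral>x. (cmod (F m x - F n x))^2 \<partial>M) < e"
 shows "\<exists>f\<in>L2 M. (%n. sqrt (\<integral>x. (cmod (F n x - f x))^2 \<partial>M)) ----> 0"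
proof -
 interpret finite_measure M by (rule M)
 note [measurable] = L2_measurable[OF F]
 have dL2: "(%x. F m x - F n x) : L2 M" for m n using L2_add[OF F[of m] L2_scale[OF F[of n], of "-1"]] by simp
 define d where "d m n = (\<integral>x. (cmod (F m x - F n x))^2 \<partial>M)" for m n
 have ex: "\<exists>N. \<forall>m\<ge>N. \<forall>n\<ge>N. d m n < e" if "e > 0" for e
  using C[of "sqrt e"] that by (simp add: d_def)
 obtain r where r: "strict_mono r" "AE x in M. Cauchy (%i. F (r i) x)"
 proof (rule cauchy_L1_AE_cauchy_subseq[of M F])
  show "integrable M (F n)" for n by (rule L2_integrable[OF M F])
  fix e :: real assume e: "e > 0"
  \<comment> \<open>From \<open>h <= c + h^2 / c\<close> the \<open>L^1\<close> distance is at most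
    \<open>c * measure M (space M) + d m n / c\<close>. This \<open>c\<close> makes the first term
    less than \<open>e / 2\<close>, and \<open>d m n < c * (e / 2)\<close> does the same for the
    second; the summand 1 covers a space of measure zero.\<close>
  define c where "c = e / (2 * (measure M (space M) + 1))"
  have p: "2 * (measure M (space M) + 1) > 0" by (intro mult_pos_pos add_nonneg_pos) simp_all
  have "c * (2 * (measure M (space M) + 1)) = e" using p by (simp add: c_def)
  moreover have "c > 0" using e p unfolding c_def by (rule divide_pos_pos)
  ultimately have c: "c > 0" "c * measure M (space M) < e / 2" by (simp_all add: algebra_simps)
  obtain N where N: "\<forall>m\<ge>N. \<forall>n\<ge>N. d m n < c * (e / 2)" using ex[of "c * (e / 2)"] c e by auto
  have "(\<integral>x. cmod (F m x - F n x) \<partial>M) < e" if "m \<ge> N" "n \<ge> N" for m n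
  proof -
   have pt: "h <= c + h^2 / c" if "h \<ge> 0" for h
   proof (cases "h <= c")
    case False
    hence "c * h <= h * h" using that by (intro mult_right_mono) auto
    hence "h <= h^2 / c" using c by (simp add: field_simps power2_eq_square)
    thus ?thesis using c by simp
   qed (use c in "simp add: add_increasing2")
   have "(\<integral>x. cmod (F m x - F n x) \<partial>M) <= (\<integral>x. c + (cmod (F m x - F n x))^2 / c \<partial>M)"
    using L2_integrable[OF M dL2] L2_integrable_sq[OF dL2] by (intro integral_mono pt integrable_norm) auto
   also have "\<dots> = c * measure M (space M) + d m n / c" using L2_integrable_sq[OF dL2] by (simp add: d_def)
   also have "d m n / c < e / 2" using N that c by (simp add: pos_divide_less_eq mult.commute)
   finally show ?thesis using c(2) by simp
  qed
  thus "\<exists>N. \<forall>i\<ge>N. \<forall>j\<ge>N. (\<integral>x. cmod (F i x - F j x) \<partial>M) < e" by blast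
 qed blast
 define f where "f x = lim (%n. F (r n) x)" for x
 have conv: "AE x in M. (%n. F (r n) x) ----> f x"
  using r(2) by eventually_elim (simp add: f_def Cauchy_convergent_iff convergent_LIMSEQ_iff)
 have fm [measurable]: "f : borel_measurable M" unfolding f_def by (rule borel_measurable_lim_metric) measurable
 have fatou: "(\<integral>\<^sup>+x. ennreal ((cmod (F m x - f x))^2) \<partial>M) <= ennreal e"
  if N: "\<forall>m\<ge>N. \<forall>n\<ge>N. d m n < e" and m: "m \<ge> N" for m e N
 proof -
  have "(\<integral>\<^sup>+x. ennreal ((cmod (F m x - f x))^2) \<partial>M) =
    (\<integral>\<^sup>+x. liminf (%n. ennreal ((cmod (F m x - F (r n) x))^2)) \<partial>M)"
  proof (rule nn_integral_cong_AE)
   show "AE x in M. ennreal ((cmod (F m x - f x))^2) = liminf (%n. ennreal ((cmod (F m x - F (r n) x))^2))"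
    using conv by eventually_elim (intro lim_imp_Liminf[symmetric] tendsto_intros, auto)
  qed
  also have "\<dots> <= liminf (%n. \<integral>\<^sup>+x. ennreal ((cmod (F m x - F (r n) x))^2) \<partial>M)"
   by (rule nn_integral_liminf) measurable
  also have "\<dots> <= liminf (%n. ennreal e)"
  proof (rule Liminf_mono, unfold eventually_sequentially, intro exI[of _ N] allI impI)
   fix n assume "N <= n"
   hence "d m (r n) < e" using N m seq_suble[OF r(1), of n] by simp
   thus "(\<integral>\<^sup>+x. ennreal ((cmod (F m x - F (r n) x))^2) \<partial>M) <= ennreal e"
    unfolding d_def by (subst nn_integral_eq_integral[OF L2_integrable_sq[OF dL2]]) (auto intro: ennreal_leI)
  qed
  finally show ?thesis by (simp add: Liminf_const)
 qed
 have int: "integrable M (%x. (cmod (F m x - f x))^2)" if "\<forall>m\<ge>N. \<forall>n\<ge>N. d m n < e" "m \<ge> N" for m N e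
  using fatou[OF that] by (intro integrableI_bounded) (auto simp: less_top[symmetric] top_unique)
 obtain N1 where N1: "\<forall>m\<ge>N1. \<forall>n\<ge>N1. d m n < 1" using ex[of 1] by auto
 have "(%x. F N1 x - f x) : L2 M" using int[OF N1] by (intro L2I) auto
 from L2_add[OF F[of N1] L2_scale[OF this, of "-1"]] have fL2: "f : L2 M" by simp
 have "(%n. \<integral>x. (cmod (F n x - f x))^2 \<partial>M) ----> 0"
 proof (rule LIMSEQ_I)
  fix e :: real assume e: "e > 0"
  obtain N where N: "\<forall>m\<ge>N. \<forall>n\<ge>N. d m n < e / 2" using ex[of "e / 2"] e by auto
  have "norm ((\<integral>x. (cmod (F n x - f x))^2 \<partial>M) - 0) < e" if n: "n \<ge> N" for n
  proof -
   have "ennreal (\<integral>x. (cmod (F n x - f x))^2 \<partial>M) <= ennreal (e / 2)"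
    using fatou[OF N n] by (subst nn_integral_eq_integral[OF int[OF N n], symmetric]) auto
   thus ?thesis using e by simp
  qed
  thus "\<exists>no. \<forall>n\<ge>no. norm ((\<integral>x. (cmod (F n x - f x))^2 \<partial>M) - 0) < e" by blast
 qed
 from tendsto_real_sqrt[OF this] fL2 show ?thesis by (intro bexI[of _ f]) simp_all
qed

lemma semi_hilbert_L2:
 assumes M: "finite_measure M"
 shows "semi_hilbert (L2 M) (%c f x. c * f x) (l2_inner M)"
proof
 show "\<exists>f\<in>L2 M. (%n. sqrt (Re (l2_inner M (F n - f) (F n - f)))) ----> 0"
  if "!!n. F n : L2 M" "!!e. e > 0 ==> \<exists>N. \<forall>m\<ge>N. \<forall>n\<ge>N. sqrt (Re (l2_inner M (F m - F n) (F m - F n))) < e"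
  for F :: "nat => 'a => complex" using L2_complete[OF M that(1)] that(2) by (simp add: l2_inner_self minus_fun)
 show "l2_inner M y x = cnj (l2_inner M x y)" if "x : L2 M" "y : L2 M" for x y
  unfolding l2_inner_def by (subst Bochner_Integration.integral_cnj[symmetric]) (simp add: mult.commute)
 show "l2_inner M (x + y) z = l2_inner M x z + l2_inner M y z" if "x : L2 M" "y : L2 M" "z : L2 M" for x y z
  using that by (simp add: l2_inner_def plus_fun distrib_right L2_integrable_mult)
 show "l2_inner M (%xa. c * x xa) y = c * l2_inner M x y" if "x : L2 M" "y : L2 M" for x y c
  using that by (simp add: l2_inner_def mult.assoc)
qed (auto simp: plus_fun zero_fun L2_add L2_scale L2_zero l2_inner_self distrib_left distrib_right)

locale l2_space =
 fixes M :: "'a measure"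
 assumes fin: "finite_measure M"
begin

sublocale semi_hilbert "L2 M" "%c f x. c * f x" "l2_inner M" by (rule semi_hilbert_L2[OF fin])

lemma nrm_eq: "nrm f = l2_norm M f" by (simp add: nrm_def l2_norm_def l2_inner_self)

lemma csub_eq: "csub V \<longleftrightarrow> closed_subspace M V"
 unfolding csub_def linsub_def closed_subspace_def tends_def nrm_eq by (auto simp: plus_fun minus_fun zero_fun)

lemma nrm_eq_0_iff: "f : L2 M ==> nrm f = 0 \<longleftrightarrow> (AE x in M. f x = 0)"
 unfolding nrm_eq l2_norm_def using integral_nonneg_eq_0_iff_AE[OF L2_integrable_sq[of f M]] by simp

lemma nrm_diff_eq_0_iff: "f : L2 M ==> g : L2 M ==> nrm (f - g) = 0 \<longleftrightarrow> (AE x in M. f x = g x)"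
 using nrm_eq_0_iff[of "f - g"] diff_mem[of f g] by (simp add: minus_fun)

lemma indicator_L2: "A : sets M ==> (%x. indicator A x :: complex) : L2 M"
 by (rule L2_bounded[OF fin, where B = 1]) (auto simp: indicator_def)

lemma tends_dominated:
 assumes F: "!!n. F n : borel_measurable M" and f: "f : borel_measurable M"
  and B: "!!n x. x : space M ==> cmod (F n x) <= B" and c: "AE x in M. (%n. F n x) ----> f x"
 shows "tends F f"
proof -
 interpret finite_measure M by (rule fin)
 have fB: "AE x in M. cmod (f x) <= B" using c AE_space
 proof eventually_elim
  case (elim x)
  thus ?case by (intro LIMSEQ_le_const2[OF tendsto_norm[OF elim(1)]]) (auto intro: B)
 qed
 have "(%n. \<integral>x. (cmod (F n x - f x))^2 \<partial>M) ----> (\<integral>x. 0 \<partial>M)"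
 proof (rule integral_dominated_convergence[where w = "%x. (2 * \<bar>B\<bar>)^2"])
  show "AE x in M. (%n. (cmod (F n x - f x))^2) ----> 0" using c
  proof eventually_elim
   case (elim x)
   hence "(%n. (cmod (F n x - f x))^2) ----> (cmod (f x - f x))^2" by (intro tendsto_intros)
   thus ?case by simp
  qed
  show "AE x in M. norm ((cmod (F n x - f x))^2) <= (2 * \<bar>B\<bar>)^2" for n using fB AE_space
  proof eventually_elim
   case (elim x)
   have "cmod (F n x - f x) <= cmod (F n x) + cmod (f x)" by (rule norm_triangle_ineq4)
   also have "\<dots> <= 2 * \<bar>B\<bar>" using elim(1) B[OF elim(2), of n] by linarith
   finally have "(cmod (F n x - f x))^2 <= (2 * \<bar>B\<bar>)^2" by (rule power_mono) simp
   thus ?case by simp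
  qed
 qed (use F f in measurable)
 from tendsto_real_sqrt[OF this] show ?thesis by (simp add: tends_def nrm_eq l2_norm_def minus_fun)
qed

text \<open>A vector orthogonal to \<open>V\<close> has integral zero over all sets of the
  generating system \<open>P\<close>, by Dynkin's argument over all measurable sets, and hence
  vanishes almost everywhere. The constant 1 handles complements, since \<open>P\<close> may omit
  the whole space.\<close>

lemma L2_eqI_dense:
 assumes V: "csub V" and P: "Int_stable P" "P \<subseteq> Pow (space M)" "sets M = sigma_sets (space M) P"
  and ind: "!!A. A : P ==> (%x. indicator A x) : V" "(%x. 1) : V"
 shows "V = L2 M"
proof (rule csub_eq_H[OF V])
 interpret finite_measure M by (rule fin)
 fix f assume f: "f : ortho V"
 have fL2: "f : L2 M" using ortho_mem[OF f] .
 note [measurable] = L2_measurable[OF fL2]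
 have fint: "integrable M f" by (rule L2_integrable[OF fin fL2])
 have ip: "l2_inner M f (%x. indicator A x) = set_lebesgue_integral M A f" for A
  unfolding l2_inner_def set_lebesgue_integral_def by (intro Bochner_Integration.integral_cong) (auto simp: indicator_def)
 have top: "set_lebesgue_integral M (space M) f = 0"
 proof -
  have "l2_inner M f (%x. 1) = 0" using ortho_ip[OF f ind(2)] .
  thus ?thesis using set_integral_space[OF fint] by (simp add: l2_inner_def)
 qed
 have sm: "sigma_sets (space M) P \<subseteq> sets M" using P(3) by simp
 have si: "set_integrable M A f" if "A : sigma_sets (space M) P" for A
  using integrable_mult_indicator[OF _ fint, of A] that sm by (auto simp: set_integrable_def)
 have all: "set_lebesgue_integral M A f = 0" if "A : sigma_sets (space M) P" for A using P(1,2) that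
 proof (induction rule: sigma_sets_induct_disjoint)
  case (basic A) thus ?case using ortho_ip[OF f ind(1)[OF basic]] ip by simp
 next
  case empty thus ?case by (simp add: set_lebesgue_integral_def)
 next
  case (compl A)
  have "A : sets M" using compl P(3) by auto
  hence Asp: "A \<union> (space M - A) = space M" using sets.sets_into_space by blast
  have "set_lebesgue_integral M (A \<union> (space M - A)) f = set_lebesgue_integral M A f + set_lebesgue_integral M (space M - A) f"
   using compl by (intro set_integral_Un si) (auto intro: sigma_sets.Compl)
  thus ?case using compl(2) top Asp by simp
 next
  case (union A)
  have "(\<Union>i. A i) : sigma_sets (space M) P" using union(2) by (intro sigma_sets.Union) auto
  have "set_lebesgue_integral M (\<Union>i. A i) f = (\<Sum>i. set_lebesgue_integral M (A i) f)"
   by (rule lebesgue_integral_countable_add[OF _ _ si[OF \<open>(\<Union>i. A i) : sigma_sets (space M) P\<close>]])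
     (use union sm in "auto simp: disjoint_family_on_def subset_iff")
  thus ?case using union(3) by simp
 qed
 have "AE x in M. f x = 0" by (rule density_zero[OF fint]) (use all P(3) in auto)
 thus "nrm f = 0" using nrm_eq_0_iff[OF fL2] by simp
qed

end

section \<open>Measures on the circle\<close>

abbreviation S1 :: "complex set" where "S1 \<equiv> sphere 0 1"

lemma space_circle_borel [simp]: "space circle_borel = S1" by (simp add: circle_borel_def space_restrict_space)

lemma circle_measure_space: "circle_measure \<sigma> ==> space \<sigma> = S1"
 unfolding circle_measure_def using sets_eq_imp_space_eq[of \<sigma> circle_borel] by simp

lemma circle_measure_sets: "circle_measure \<sigma> ==> sets \<sigma> = sets circle_borel" by (simp add: circle_measure_def)

lemma circle_measure_finite: "circle_measure \<sigma> ==> finite_measure \<sigma>" by (simp add: circle_measure_def)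

lemma circle_borel_continuous:
 fixes f :: "complex => 'b::topological_space"
 shows "continuous_on S1 f ==> f : borel_measurable circle_borel"
 unfolding circle_borel_def by (rule borel_measurable_continuous_on_restrict)

lemma circle_measure_measurable: "circle_measure \<sigma> ==> measurable \<sigma> N = measurable circle_borel N"
 by (intro measurable_cong_sets) (simp_all add: circle_measure_sets)

lemma powi_continuous: "continuous_on S1 (%t::complex. t powi n)"
 by (intro continuous_on_power_int continuous_intros) auto

lemma powi_measurable [measurable]: "(%t. t powi n) : borel_measurable circle_borel"
 by (rule circle_borel_continuous[OF powi_continuous])

lemma sets_circle_borel: "sets circle_borel = sigma_sets S1 ((%W. S1 \<inter> W) ` {W. open W})"
proof (intro equalityI subsetI)
 fix x :: "complex set" assume "x : sets circle_borel"
 then obtain A where A: "A : sigma_sets UNIV {W. open W}" "x = S1 \<inter> A"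
  by (auto simp: circle_borel_def sets_restrict_space borel_def)
 from A(1) have "S1 \<inter> A : sigma_sets S1 ((%W. S1 \<inter> W) ` {W. open W})"
 proof induction
  case (Compl a)
  have "S1 \<inter> (UNIV - a) = S1 - S1 \<inter> a" by auto
  thus ?case using sigma_sets.Compl[OF Compl.IH] by simp
 next
  case (Union a)
  have "S1 \<inter> (\<Union>i. a i) = (\<Union>i. S1 \<inter> a i)" by auto
  thus ?case using sigma_sets.Union[OF Union.IH] by simp
 qed (auto intro: sigma_sets.intros)
 thus "x : sigma_sets S1 ((%W. S1 \<inter> W) ` {W. open W})" using A(2) by simp
next
 fix x assume "x : sigma_sets S1 ((%W. S1 \<inter> W) ` {W. open W})"
 moreover have "sigma_sets S1 ((%W. S1 \<inter> W) ` {W. open W}) \<subseteq> sets circle_borel"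
 proof (rule sets.sigma_sets_subset')
  show "(%W. S1 \<inter> W) ` {W. open W} \<subseteq> sets circle_borel"
   unfolding circle_borel_def sets_restrict_space by (rule image_mono) auto
  show "S1 : sets circle_borel" using sets.top[of circle_borel] by simp
 qed
 ultimately show "x : sets circle_borel" by auto
qed

text \<open>The elements are functions on the whole plane, but closure under products is claimed
  only on \<open>S1\<close>, where exponents add.\<close>

inductive_set trig_poly :: "(complex => complex) set" where
 mono: "(%t. c * t powi k) : trig_poly"
| add: "p : trig_poly ==> q : trig_poly ==> (%t. p t + q t) : trig_poly"

lemma trig_poly_scale: "p : trig_poly ==> (%t. c * p t) : trig_poly"
proof (induction rule: trig_poly.induct)
 case (mono d k) thus ?case using trig_poly.mono[of "c * d" k] by (simp add: mult.assoc)
next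
 case (add p q) thus ?case using trig_poly.add[of "%t. c * p t" "%t. c * q t"] by (simp add: distrib_left)
qed

lemma trig_poly_continuous: "p : trig_poly ==> continuous_on S1 p"
 by (induction rule: trig_poly.induct) (auto intro!: continuous_intros powi_continuous)

lemma trig_poly_measurable: "p : trig_poly ==> p : borel_measurable circle_borel"
 by (rule circle_borel_continuous[OF trig_poly_continuous])

lemma trig_poly_bounded: "p : trig_poly ==> \<exists>B. \<forall>t\<in>S1. cmod (p t) <= B"
proof (induction rule: trig_poly.induct)
 case (mono c k) thus ?case by (auto intro!: exI[of _ "cmod c"] simp: norm_mult norm_power_int)
next
 case (add p q)
 then obtain A B where "\<forall>t\<in>S1. cmod (p t) <= A" "\<forall>t\<in>S1. cmod (q t) <= B" by blast
 thus ?case by (intro exI[of _ "A + B"]) (auto intro!: order_trans[OF norm_triangle_ineq] add_mono)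
qed

lemma trig_poly_mult:
 assumes "p : trig_poly" "q : trig_poly"
 shows "\<exists>r\<in>trig_poly. \<forall>t\<in>S1. r t = p t * q t" using assms(1)
proof (induction rule: trig_poly.induct)
 case (mono c k)
 show ?case using assms(2)
 proof (induction rule: trig_poly.induct)
  case (mono d l)
  have "c * t powi k * (d * t powi l) = (c * d) * t powi (k + l)" if "t : S1" for t :: complex
   using that by (subst power_int_add) auto
  thus ?case using trig_poly.mono[of "c * d" "k + l"] by (intro bexI[of _ "%t. c * d * t powi (k + l)"]) auto
 next
  case (add p q)
  then obtain r s where "r : trig_poly" "s : trig_poly" "\<forall>t\<in>S1. r t = c * t powi k * p t"
   "\<forall>t\<in>S1. s t = c * t powi k * q t" by blast
  thus ?case using trig_poly.add[of r s] by (intro bexI[of _ "%t. r t + s t"]) (auto simp: distrib_left)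
 qed
next
 case (add p p')
 then obtain r s where "r : trig_poly" "s : trig_poly" "\<forall>t\<in>S1. r t = p t * q t"
   "\<forall>t\<in>S1. s t = p' t * q t" by blast
 thus ?case using trig_poly.add[of r s] by (intro bexI[of _ "%t. r t + s t"]) (auto simp: distrib_right)
qed

text \<open>On the circle \<open>cnj t\<close> is \<open>t powi (-1)\<close>, so a real linear
  function of \<open>t\<close> is \<open>\<alpha> * t\<close> plus its conjugate. With this, uniform
  approximation by real polynomials becomes approximation by trigonometric ones.\<close>

lemma real_polynomial_function_trig:
 fixes p :: "complex => real"
 assumes "real_polynomial_function p"
 shows "\<exists>q\<in>trig_poly. \<forall>t\<in>S1. complex_of_real (p t) = q t" using assms
proof (induction rule: real_polynomial_function.induct)
 case (linear f)
 interpret bounded_linear f by (rule linear)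
 define \<alpha> where "\<alpha> = (complex_of_real (f 1) - \<i> * complex_of_real (f \<i>)) / 2"
 have "complex_of_real (f t) = \<alpha> * t powi 1 + cnj \<alpha> * t powi (-1)" if t: "t : S1" for t
 proof -
  have "t = Re t *\<^sub>R 1 + Im t *\<^sub>R \<i>" by (simp add: complex_eq_iff)
  hence "f t = Re t * f 1 + Im t * f \<i>" by (metis add real_scaleR_def scaleR)
  moreover have "t powi (-1) = cnj t"
  proof -
   have "t * cnj t = 1" using t by (simp add: complex_norm_square[symmetric])
   hence "inverse t = cnj t" by (simp add: inverse_unique)
   thus ?thesis by (simp add: power_int_def)
  qed
  ultimately show ?thesis by (simp add: \<alpha>_def complex_eq_iff algebra_simps add_divide_distrib[symmetric] diff_divide_distrib[symmetric])
 qed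
 thus ?case by (intro bexI[of _ "%t. \<alpha> * t powi 1 + cnj \<alpha> * t powi (-1)"] trig_poly.intros) auto
next
 case (const c)
 thus ?case using trig_poly.mono[of "complex_of_real c" 0] by (intro bexI[of _ "%t. complex_of_real c * t powi 0"]) auto
next
 case (add f g)
 then obtain r s where "r : trig_poly" "s : trig_poly" "\<forall>t\<in>S1. complex_of_real (f t) = r t"
   "\<forall>t\<in>S1. complex_of_real (g t) = s t" by blast
 thus ?case using trig_poly.add[of r s] by (intro bexI[of _ "%t. r t + s t"]) auto
next
 case (mult f g)
 then obtain r s where rs: "r : trig_poly" "s : trig_poly" "\<forall>t\<in>S1. complex_of_real (f t) = r t"
   "\<forall>t\<in>S1. complex_of_real (g t) = s t" by blast
 thus ?case using trig_poly_mult[OF rs(1,2)] by (metis of_real_mult)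
qed

lemma trig_poly_approx:
 fixes g :: "complex => real"
 assumes g: "continuous_on S1 g"
 obtains q B where "!!n. q n : trig_poly" "!!n t. t : S1 ==> cmod (q n t) <= B"
  "!!t. t : S1 ==> (%n::nat. q n t) ----> complex_of_real (g t)"
proof -
 have "\<exists>q\<in>trig_poly. \<forall>t\<in>S1. cmod (q t - complex_of_real (g t)) < inverse (Suc n)" for n
 proof -
  obtain p where p: "real_polynomial_function p" "!!t. t : S1 ==> \<bar>g t - p t\<bar> < inverse (Suc n)"
   using Stone_Weierstrass_real_polynomial_function[OF compact_sphere g, of "inverse (Suc n)"] by auto
  obtain q where q: "q : trig_poly" "\<forall>t\<in>S1. complex_of_real (p t) = q t"
   using real_polynomial_function_trig[OF p(1)] by blast
  have "cmod (q t - complex_of_real (g t)) < inverse (Suc n)" if "t : S1" for t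
  proof -
   have "q t - complex_of_real (g t) = complex_of_real (p t - g t)" using q(2) that by simp
   hence "cmod (q t - complex_of_real (g t)) = \<bar>p t - g t\<bar>" by (simp only: norm_of_real)
   thus ?thesis using p(2)[OF that] by linarith
  qed
  thus ?thesis using q(1) by blast
 qed
 then obtain q where q: "!!n. q n : trig_poly"
  "!!n t. t : S1 ==> cmod (q n t - complex_of_real (g t)) < inverse (Suc n)" by metis
 have "bounded (g ` S1)" by (intro compact_imp_bounded compact_continuous_image g compact_sphere)
 then obtain B where B: "!!t. t : S1 ==> \<bar>g t\<bar> <= B" unfolding bounded_iff by force
 show ?thesis
 proof (rule that[of q "B + 1"])
  show "cmod (q n t) <= B + 1" if "t : S1" for n t
  proof -
   have "cmod (q n t) <= cmod (q n t - complex_of_real (g t)) + cmod (complex_of_real (g t))"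
    using norm_triangle_ineq[of "q n t - complex_of_real (g t)" "complex_of_real (g t)"] by simp
   moreover have "inverse (real (Suc n)) <= 1" by (simp add: inverse_le_1_iff)
   ultimately show ?thesis using q(2)[OF that, of n] B[OF that] by simp
  qed
  show "(%n. q n t) ----> complex_of_real (g t)" if "t : S1" for t
  proof -
   have "(%n. q n t - complex_of_real (g t)) ----> 0" by (rule tendsto_0_le[where K = 1, OF LIMSEQ_inverse_real_of_nat])
      (use q(2)[OF that] in "auto intro!: always_eventually less_imp_le")
   thus ?thesis by (simp add: LIM_zero_iff)
  qed
 qed (use q in auto)
qed

lemma open_indicator_approx:
 fixes W :: "complex set"
 assumes W: "open W"
 obtains g :: "nat => complex => real" where "!!n. continuous_on UNIV (g n)" "!!n t. 0 <= g n t" "!!n t. g n t <= 1"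
  "!!t. (%n. g n t) ----> indicator W t"
proof (cases "W = UNIV")
 \<comment> \<open>The distance to an empty complement is 0 by convention, so the formula used below
   would give 0 here.\<close>
 case True thus ?thesis using that[of "%n t. 1"] by auto
next
 case False
 define g where "g n t = min 1 (real n * infdist t (- W))" for n :: nat and t
 have cl: "closed (- W)" "- W ~= {}" using W False by auto
 show ?thesis
 proof (rule that[of g])
  show "continuous_on UNIV (g n)" for n unfolding g_def by (intro continuous_intros)
  show "(%n. g n t) ----> indicator W t" for t
  proof (cases "t : W")
   case True
   hence pos: "infdist t (- W) > 0" using cl by (simp add: infdist_pos_not_in_closed)
   obtain N where N: "real N * infdist t (- W) > 1" using reals_Archimedean3[OF pos] by blast
   have "g n t = 1" if "n \<ge> N" for n
   proof -
    have "real N * infdist t (- W) <= real n * infdist t (- W)" using that pos by (intro mult_right_mono) auto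
    thus ?thesis using N by (simp add: g_def)
   qed
   hence "\<forall>\<^sub>F n in sequentially. g n t = 1" by (auto simp: eventually_sequentially)
   thus ?thesis using True by (simp add: tendsto_eventually)
  next
   case False
   thus ?thesis using cl by (simp add: g_def)
  qed
 qed (auto simp: g_def infdist_nonneg)
qed

lemma circle_measure_integrable_bounded:
 fixes p :: "complex => 'z::{banach,second_countable_topology}"
 assumes "circle_measure \<rho>" "p : borel_measurable circle_borel" "!!t. t : S1 ==> norm (p t) <= B"
 shows "integrable \<rho> p"
proof -
 interpret r: finite_measure \<rho> using circle_measure_finite[OF assms(1)] .
 show ?thesis by (rule r.integrable_const_bound[where B = B])
    (use assms in "auto simp: circle_measure_space circle_measure_measurable")
qed

lemma Int_stable_circle_open: "Int_stable ((%W. S1 \<inter> W) ` {W. open W})"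
proof (rule Int_stableI)
 fix a b assume "a : (%W. S1 \<inter> W) ` {W. open W}" "b : (%W. S1 \<inter> W) ` {W. open W}"
 then obtain U V where "open U" "open V" "a = S1 \<inter> U" "b = S1 \<inter> V" by auto
 thus "a \<inter> b : (%W. S1 \<inter> W) ` {W. open W}" by (intro image_eqI[of _ _ "U \<inter> V"]) auto
qed

text \<open>Vanishing Fourier coefficients pass to trigonometric polynomials, then to continuous
  functions, open sets and finally Borel sets. Allowing finite signed combinations lets one argument
  cover the uniqueness of spectral measures, their parallelogram law and their additivity on
  orthogonal orbits.\<close>

lemma circle_measures_signed_zero:
 fixes a :: "'i => real"
 assumes \<sigma>: "!!i. i : I ==> circle_measure (\<sigma> i)"
  and eq: "!!n. (\<Sum>i\<in>I. of_real (a i) * (\<integral>t. t powi n \<partial>\<sigma> i)) = 0"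
  and N: "N : sets circle_borel"
 shows "(\<Sum>i\<in>I. a i * measure (\<sigma> i) N) = 0"
proof -
 have ti: "integrable \<rho> p" if \<rho>: "circle_measure \<rho>" and p: "p : trig_poly" for \<rho> p
 proof -
  obtain B where "\<forall>t\<in>S1. cmod (p t) <= B" using trig_poly_bounded[OF p] by blast
  thus ?thesis using circle_measure_integrable_bounded[OF \<rho> trig_poly_measurable[OF p], of B] by blast
 qed
 have trig: "(\<Sum>i\<in>I. of_real (a i) * (\<integral>t. p t \<partial>\<sigma> i)) = 0" if "p : trig_poly" for p using that
 proof (induction rule: trig_poly.induct)
  case (mono c k)
  have "(\<Sum>i\<in>I. of_real (a i) * (\<integral>t. c * t powi k \<partial>\<sigma> i)) = c * (\<Sum>i\<in>I. of_real (a i) * (\<integral>t. t powi k \<partial>\<sigma> i))"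
   by (simp add: sum_distrib_left mult_ac)
  thus ?case using eq by simp
 next
  case (add p q)
  have "(\<Sum>i\<in>I. of_real (a i) * (\<integral>t. p t + q t \<partial>\<sigma> i)) =
    (\<Sum>i\<in>I. of_real (a i) * (\<integral>t. p t \<partial>\<sigma> i) + of_real (a i) * (\<integral>t. q t \<partial>\<sigma> i))"
   using add ti[OF \<sigma>] by (intro sum.cong refl) (simp add: distrib_left)
  thus ?case using add by (simp add: sum.distrib)
 qed
 have cont: "(\<Sum>i\<in>I. a i * (\<integral>t. g t \<partial>\<sigma> i)) = 0" if g: "continuous_on S1 g" for g :: "complex => real"
 proof -
  obtain q B where q: "!!n. q n : trig_poly" "!!n t. t : S1 ==> cmod (q n t) <= B"
   "!!t. t : S1 ==> (%n::nat. q n t) ----> complex_of_real (g t)" using trig_poly_approx[OF g] by blast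
  have gm: "(%t. complex_of_real (g t)) : borel_measurable circle_borel" using circle_borel_continuous[OF g] by measurable
  have "(%n. \<integral>t. q n t \<partial>\<rho>) ----> (\<integral>t. complex_of_real (g t) \<partial>\<rho>)" if \<rho>: "circle_measure \<rho>" for \<rho>
  proof (rule integral_dominated_convergence[where w = "%_. B"])
   interpret r: finite_measure \<rho> using circle_measure_finite[OF \<rho>] .
   show "integrable \<rho> (%_. B)" by simp
  qed (use q gm \<rho> trig_poly_measurable in "auto simp: circle_measure_space circle_measure_measurable")
  note * = this
  have "(%n. \<Sum>i\<in>I. of_real (a i) * (\<integral>t. q n t \<partial>\<sigma> i)) ----> (\<Sum>i\<in>I. of_real (a i) * (\<integral>t. complex_of_real (g t) \<partial>\<sigma> i))"
   by (intro tendsto_sum tendsto_mult tendsto_const * \<sigma>)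
  hence "(\<Sum>i\<in>I. of_real (a i) * (\<integral>t. complex_of_real (g t) \<partial>\<sigma> i)) = 0"
   unfolding trig[OF q(1)] by (simp add: LIMSEQ_const_iff)
  hence "complex_of_real (\<Sum>i\<in>I. a i * (\<integral>t. g t \<partial>\<sigma> i)) = 0" by simp
  thus ?thesis using of_real_eq_0_iff by blast
 qed
 have opn: "(\<Sum>i\<in>I. a i * measure (\<sigma> i) (S1 \<inter> W)) = 0" if W: "open W" for W
 proof -
  obtain g :: "nat => complex => real" where g: "!!n. continuous_on UNIV (g n)" "!!n t. 0 <= g n t" "!!n t. g n t <= 1"
   "!!t. (%n. g n t) ----> indicator W t" using open_indicator_approx[OF W] by blast
  have gc: "continuous_on S1 (g n)" for n using continuous_on_subset[OF g(1)] by auto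
  have Wm: "S1 \<inter> W : sets circle_borel" unfolding sets_circle_borel using W by auto
  have "(%n. \<integral>t. g n t \<partial>\<rho>) ----> measure \<rho> (S1 \<inter> W)" if \<rho>: "circle_measure \<rho>" for \<rho>
  proof -
   interpret r: finite_measure \<rho> using circle_measure_finite[OF \<rho>] .
   have "(%n. \<integral>t. g n t \<partial>\<rho>) ----> (\<integral>t. indicator (S1 \<inter> W) t \<partial>\<rho>)"
   proof (rule integral_dominated_convergence[where w = "%_. 1"])
    show "AE x in \<rho>. (%i. g i x) ----> indicator (S1 \<inter> W) x"
    proof (rule AE_I2)
     fix x assume "x : space \<rho>"
     hence "indicator (S1 \<inter> W) x = (indicator W x :: real)"
      using \<rho> by (auto simp: circle_measure_space indicator_def)
     thus "(%i. g i x) ----> indicator (S1 \<inter> W) x" using g(4) by simp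
    qed
   qed (use g \<rho> Wm circle_borel_continuous[OF gc] in "auto simp: circle_measure_measurable circle_measure_sets")
   moreover have "S1 \<inter> W \<inter> S1 = S1 \<inter> W" by auto
   ultimately show ?thesis using \<rho> by (simp add: circle_measure_space)
  qed
  note * = this
  have "(%n. \<Sum>i\<in>I. a i * (\<integral>t. g n t \<partial>\<sigma> i)) ----> (\<Sum>i\<in>I. a i * measure (\<sigma> i) (S1 \<inter> W))"
   by (intro tendsto_sum tendsto_mult tendsto_const * \<sigma>)
  thus ?thesis unfolding cont[OF gc] by (simp add: LIMSEQ_const_iff)
 qed
 have Ns: "N : sigma_sets S1 ((%W. S1 \<inter> W) ` {W. open W})" using N by (simp add: sets_circle_borel)
 note Int_stable_circle_open
 moreover have "(%W. S1 \<inter> W) ` {W. open W} \<subseteq> Pow S1" by auto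
 moreover note Ns
 ultimately show ?thesis
 proof (induction rule: sigma_sets_induct_disjoint)
  case (basic A) thus ?case using opn by auto
 next
  case empty thus ?case by simp
 next
  case (compl A)
  have A: "A : sets circle_borel" using compl by (simp add: sets_circle_borel)
  have "measure (\<sigma> i) (S1 - A) = measure (\<sigma> i) S1 - measure (\<sigma> i) A" if "i : I" for i
   using finite_measure.finite_measure_compl[OF circle_measure_finite[OF \<sigma>[OF that]], of A] A \<sigma>[OF that]
   by (simp add: circle_measure_sets circle_measure_space)
  hence "(\<Sum>i\<in>I. a i * measure (\<sigma> i) (S1 - A)) =
    (\<Sum>i\<in>I. a i * measure (\<sigma> i) S1) - (\<Sum>i\<in>I. a i * measure (\<sigma> i) A)"
   by (simp add: right_diff_distrib sum_subtractf)
  thus ?case using compl opn[of UNIV] by simp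
 next
  case (union A)
  have "range A \<subseteq> sets circle_borel" using union(2) by (simp add: sets_circle_borel)
  hence "(%k. measure (\<sigma> i) (A k)) sums measure (\<sigma> i) (\<Union>k. A k)" if "i : I" for i
   using finite_measure.finite_measure_UNION[OF circle_measure_finite[OF \<sigma>[OF that]], of A] union(1) \<sigma>[OF that]
   by (simp add: circle_measure_sets)
  hence "(%k. \<Sum>i\<in>I. a i * measure (\<sigma> i) (A k)) sums (\<Sum>i\<in>I. a i * measure (\<sigma> i) (\<Union>k. A k))"
   by (intro sums_sum sums_mult)
  thus ?case using union(3) by (simp add: sums_iff)
 qed
qed

lemma circle_measure_eqI:
 assumes \<sigma>: "circle_measure \<sigma>" and \<tau>: "circle_measure \<tau>"
  and eq: "!!n. (\<integral>t. t powi n \<partial>\<sigma>) = (\<integral>t. t powi n \<partial>\<tau>)"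
 shows "\<sigma> = \<tau>"
proof (rule measure_eqI)
 interpret s: finite_measure \<sigma> using circle_measure_finite[OF \<sigma>] .
 interpret t: finite_measure \<tau> using circle_measure_finite[OF \<tau>] .
 fix A assume "A : sets \<sigma>"
 hence A: "A : sets circle_borel" using \<sigma> by (simp add: circle_measure_sets)
 have "(\<Sum>b\<in>UNIV. (if b then 1 else -1) * measure (if b then \<sigma> else \<tau>) A) = 0"
  by (rule circle_measures_signed_zero[OF _ _ A]) (use \<sigma> \<tau> eq in "auto simp: UNIV_bool")
 thus "emeasure \<sigma> A = emeasure \<tau> A" by (simp add: UNIV_bool s.emeasure_eq_measure t.emeasure_eq_measure)
qed (use \<sigma> \<tau> in "simp add: circle_measure_sets")

lemma trig_poly_L2:
 assumes \<sigma>: "circle_measure \<sigma>" and p: "p : trig_poly"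
 shows "p : L2 \<sigma>"
proof -
 obtain B where "\<forall>t\<in>S1. cmod (p t) <= B" using trig_poly_bounded[OF p] by blast
 thus ?thesis using trig_poly_measurable[OF p] \<sigma>
  by (intro L2_bounded[where B = B]) (auto simp: circle_measure_measurable circle_measure_space circle_measure_finite)
qed

lemma trig_poly_dense_L2:
 assumes \<sigma>: "circle_measure \<sigma>" and \<psi>: "\<psi> : L2 \<sigma>"
 obtains p where "!!n. p n : trig_poly" "(%n. l2_norm \<sigma> (%t. p n t - \<psi> t)) ----> 0"
proof -
 interpret l2_space \<sigma> by (rule l2_space.intro[OF circle_measure_finite[OF \<sigma>]])
 have lin: "linsub trig_poly"
 proof -
  have "0 : trig_poly" using trig_poly.mono[of 0 0] by (simp add: zero_fun)
  thus ?thesis using trig_poly_L2[OF \<sigma>] trig_poly.add trig_poly_scale by (auto simp: linsub_def plus_fun)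
 qed
 define V where "V = cspan trig_poly"
 have V: "csub V" unfolding V_def by (rule csub_cspan)
 have sub: "trig_poly \<subseteq> V" unfolding V_def using lin by (intro cspan_superset) (auto simp: linsub_def)
 have cont: "(%t. complex_of_real (g t)) : V" if g: "continuous_on S1 g" for g
 proof -
  obtain q B where q: "!!n. q n : trig_poly" "!!n t. t : S1 ==> cmod (q n t) <= B"
   "!!t. t : S1 ==> (%n::nat. q n t) ----> complex_of_real (g t)" using trig_poly_approx[OF g] by blast
  have gm: "(%t. complex_of_real (g t)) : borel_measurable \<sigma>"
   using circle_borel_continuous[OF g] \<sigma> unfolding circle_measure_measurable[OF \<sigma>] by measurable
  have "bounded (g ` S1)" by (intro compact_imp_bounded compact_continuous_image g compact_sphere)
  then obtain C where C: "!!t. t : S1 ==> \<bar>g t\<bar> <= C" unfolding bounded_iff by force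
  show ?thesis
  proof (rule csub_tends[OF V])
   show "(%t. complex_of_real (g t)) : L2 \<sigma>"
    using C \<sigma> by (intro L2_bounded[OF fin gm, of C]) (auto simp: circle_measure_space)
   show "tends q (%t. complex_of_real (g t))" by (rule tends_dominated[where B = B])
      (use q gm \<sigma> trig_poly_measurable in "auto simp: circle_measure_space circle_measure_measurable")
  qed (use q(1) sub in auto)
 qed
 have "V = L2 \<sigma>"
 proof (rule L2_eqI_dense[OF V])
  show "Int_stable ((%W. S1 \<inter> W) ` {W. open W})" by (rule Int_stable_circle_open)
  show "sets \<sigma> = sigma_sets (space \<sigma>) ((%W. S1 \<inter> W) ` {W. open W})"
   using \<sigma> by (simp add: circle_measure_sets circle_measure_space sets_circle_borel)
  show "(%x. 1) : V" using cont[of "%_. 1"] by simp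
  fix A assume "A : (%W. S1 \<inter> W) ` {W. open W}"
  then obtain W where W: "open W" "A = S1 \<inter> W" by auto
  obtain g :: "nat => complex => real" where g: "!!n. continuous_on UNIV (g n)" "!!n t. 0 <= g n t" "!!n t. g n t <= 1"
   "!!t. (%n. g n t) ----> indicator W t" using open_indicator_approx[OF W(1)] by blast
  have gc: "continuous_on S1 (g n)" for n using continuous_on_subset[OF g(1)] by auto
  have Am: "A : sets \<sigma>" using W \<sigma> unfolding circle_measure_sets[OF \<sigma>] sets_circle_borel by auto
  show "(%x. indicator A x) : V"
  proof (rule csub_tends[OF V])
   show "(%x. complex_of_real (g n x)) : V" for n by (rule cont[OF gc])
   show "(%x. indicator A x :: complex) : L2 \<sigma>" by (rule indicator_L2[OF Am])
   show "tends (%n x. complex_of_real (g n x)) (%x. indicator A x)"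
   proof (rule tends_dominated[where B = 1])
    show "(%x. complex_of_real (g n x)) : borel_measurable \<sigma>" for n using L2_measurable[OF csub_mem[OF V cont[OF gc]]] .
    show "AE x in \<sigma>. (%n. complex_of_real (g n x)) ----> indicator A x"
    proof (rule AE_I2)
     fix x assume "x : space \<sigma>"
     hence "indicator A x = complex_of_real (indicator W x)"
      using W(2) \<sigma> by (auto simp: circle_measure_space indicator_def)
     thus "(%n. complex_of_real (g n x)) ----> indicator A x" using tendsto_of_real[OF g(4)] by simp
    qed
    show "cmod (complex_of_real (g n x)) <= 1" for n x using g(2,3)[of n x] by simp
   qed (use Am in measurable)
  qed
 qed (use \<sigma> in "auto simp: circle_measure_space")
 hence "\<psi> : cspan trig_poly" using \<psi> by (simp add: V_def)
 then obtain p where "!!n. p n : trig_poly" "tends p \<psi>" using cspan_seq[OF lin] by blast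
 thus ?thesis using that[of p] by (simp add: tends_def nrm_eq minus_fun)
qed

section \<open>Fourier coefficients, Fejer means and Herglotz's theorem\<close>

lemma integral_cis_period:
 "(\<integral>t. indicator {0..1::real} t *\<^sub>R cis (2 * pi * of_int k * t) \<partial>lborel) = (if k = 0 then 1 else 0)"
proof (cases "k = 0")
 case True thus ?thesis by simp
next
 case False
 define F where "F t = cis (2 * pi * of_int k * t) / (\<i> * of_real (2 * pi * of_int k))" for t :: real
 have "(\<integral>t. indicator {0..1::real} t *\<^sub>R cis (2 * pi * of_int k * t) \<partial>lborel) = F 1 - F 0"
 proof (rule integral_FTC_atLeastAtMost)
  fix t :: real
  have "cis (2 * pi * of_int k * s) = exp (s *\<^sub>R (of_real (2 * pi * of_int k) * \<i>))" for s
   by (simp add: cis_conv_exp scaleR_conv_of_real mult_ac)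
  hence "((%t. cis (2 * pi * of_int k * t)) has_vector_derivative
    (of_real (2 * pi * of_int k) * \<i>) * cis (2 * pi * of_int k * t)) (at t within {0..1})"
   using exp_scaleR_has_vector_derivative_right[of "of_real (2 * pi * of_int k) * \<i>" t "{0..1}"] by (simp add: mult.commute)
  hence "((%t. cis (2 * pi * of_int k * t) * (1 / (\<i> * of_real (2 * pi * of_int k)))) has_vector_derivative
    ((of_real (2 * pi * of_int k) * \<i>) * cis (2 * pi * of_int k * t)) * (1 / (\<i> * of_real (2 * pi * of_int k)))) (at t within {0..1})"
   by (rule has_vector_derivative_mult_left)
  thus "(F has_vector_derivative cis (2 * pi * of_int k * t)) (at t within {0..1})"
   using False by (simp add: F_def[abs_def] field_simps)
 next
  show "continuous_on {0..1} (%t. cis (2 * pi * of_int k * t))" by (intro continuous_intros)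
 qed simp
 moreover have "cis (2 * pi * of_int k) = 1"
  using cis_power_int[of "2 * pi" k, unfolded cis_2pi power_int_1_left] by (simp add: mult.commute)
 ultimately show ?thesis using False by (simp add: F_def)
qed

lemma integrable_cis_period:
 "integrable lborel (%t. indicator {0..1::real} t *\<^sub>R cis (2 * pi * of_int k * t))"
proof -
 have "continuous_on {0..1} (%t. cis (2 * pi * of_int k * t))" by (intro continuous_intros)
 from borel_integrable_atLeastAtMost'[OF this] show ?thesis unfolding set_integrable_def .
qed

lemma cis_circle_measurable [measurable]: "(%t. cis (2 * pi * t)) : measurable borel circle_borel" unfolding circle_borel_def
 by (intro measurable_restrict_space2 borel_measurable_continuous_onI continuous_intros) auto

lemma distr_cis_circle_measure:
 assumes "finite_measure N" "sets N = sets borel"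
 shows "circle_measure (distr N circle_borel (%t. cis (2 * pi * t)))"
proof -
 interpret finite_measure N by (rule assms(1))
 have "(%t. cis (2 * pi * t)) : measurable N circle_borel"
  using cis_circle_measurable measurable_cong_sets[OF assms(2) refl] by blast
 thus ?thesis by (simp add: circle_measure_def finite_measure_distr)
qed

text \<open>As soon as \<open>N\<close> is at least \<open>\<bar>n\<bar>\<close>, exactly
  \<open>N + 1 - \<bar>n\<bar>\<close> pairs have difference \<open>n\<close>, so the Fejer weights
  \<open>1 - \<bar>n\<bar> / (N + 1)\<close> tend to 1.\<close>

lemma count_differences:
 "(%N. (\<Sum>l\<le>N. \<Sum>m\<le>N. if int m - int l = n then c else 0) / of_nat (Suc N)) ----> (c::complex)"
proof -
 define K where "K = nat \<bar>n\<bar>"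
 have cnt: "(\<Sum>l\<le>N. \<Sum>m\<le>N. if int m - int l = n then c else 0) = of_nat (Suc N - K) * c" if "N \<ge> K" for N
 proof -
  have inner: "(\<Sum>m\<le>N. if int m - int l = n then c else 0) = (if 0 <= int l + n \<and> int l + n <= int N then c else 0)" for l :: nat
  proof (cases "0 <= int l + n")
   case True
   have "(\<Sum>m\<le>N. if int m - int l = n then c else 0) = (\<Sum>m\<le>N. if m = nat (int l + n) then c else 0)"
    using True by (intro sum.cong) auto
   also have "\<dots> = (if nat (int l + n) <= N then c else 0)" by simp
   finally show ?thesis using True by auto
  next
   case False thus ?thesis by (auto intro!: sum.neutral)
  qed
  have "(\<Sum>l\<le>N. \<Sum>m\<le>N. if int m - int l = n then c else 0) =
    (\<Sum>l\<le>N. if 0 <= int l + n \<and> int l + n <= int N then c else 0)" by (simp only: inner)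
  also have "\<dots> = (\<Sum>l\<in>{l\<in>{..N}. 0 <= int l + n \<and> int l + n <= int N}. c)"
   by (rule sum.inter_filter[symmetric]) simp
  also have "{l\<in>{..N}. 0 <= int l + n \<and> int l + n <= int N} = (if n \<ge> 0 then {..N - K} else {K..N})"
   using that by (auto simp: K_def)
  also have "(\<Sum>l\<in>(if n \<ge> 0 then {..N - K} else {K..N}). c) = of_nat (Suc N - K) * c"
   using that by (auto simp: Suc_diff_le)
  finally show ?thesis .
 qed
 have "(%N. 1 - of_nat K * inverse (of_nat (Suc N)) :: complex) ----> 1 - of_nat K * 0"
  by (intro tendsto_intros lim_inverse_n[THEN LIMSEQ_Suc])
 hence "(%N. (1 - of_nat K * inverse (of_nat (Suc N))) * c) ----> (1 - of_nat K * 0) * c" by (intro tendsto_mult tendsto_const)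
 hence "(%N. (1 - of_nat K * inverse (of_nat (Suc N))) * c) ----> c" by simp
 moreover have "\<forall>\<^sub>F N in sequentially. (1 - of_nat K * inverse (of_nat (Suc N))) * c =
   (\<Sum>l\<le>N. \<Sum>m\<le>N. if int m - int l = n then c else 0) / of_nat (Suc N)"
 proof (rule eventually_sequentiallyI[of K])
  fix N assume N: "K <= N"
  hence "of_nat (Suc N - K) = (of_nat (Suc N) - of_nat K :: complex)" by (intro of_nat_diff) simp
  moreover have "(of_nat (Suc N) :: complex) ~= 0" using of_nat_neq_0 by blast
  ultimately show "(1 - of_nat K * inverse (of_nat (Suc N))) * c =
   (\<Sum>l\<le>N. \<Sum>m\<le>N. if int m - int l = n then c else 0) / of_nat (Suc N)"
   unfolding cnt[OF N] by (simp only:) (simp add: field_simps del: of_nat_Suc)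
 qed
 ultimately show ?thesis using Lim_transform_eventually by fast
qed

text \<open>Herglotz's theorem: the Fej\'er means of the Fourier series are probability densities on the
 circle, and by Helly's theorem they have a weak limit point.\<close>

lemma herglotz:
 fixes r :: "int => complex" and p :: "nat => real => real"
 assumes p: "!!N t. (\<Sum>l\<le>N. \<Sum>m\<le>N. r (int m - int l) * cis (- 2 * pi * of_int (int m - int l) * t)) = of_real (p N t)"
  and pos: "!!N t. 0 <= p N t" and r0: "r 0 = 1"
 obtains \<sigma> where "circle_measure \<sigma>" "!!n. (\<integral>t. t powi n \<partial>\<sigma>) = r n"
proof -
 have pc: "continuous_on UNIV (p N)" for N
 proof -
  have "p N = (%t. Re (\<Sum>l\<le>N. \<Sum>m\<le>N. r (int m - int l) * cis (- 2 * pi * of_int (int m - int l) * t)))"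
   unfolding p by simp
  thus ?thesis by (simp only:) (intro continuous_intros)
 qed
 have pm [measurable]: "p N : borel_measurable borel" for N using borel_measurable_continuous_onI[OF pc] .
 define d where "d N t = indicator {0..1} t * p N t / real (Suc N)" for N t
 have d0: "0 <= d N t" for N t using pos[of N t] by (simp add: d_def)
 have dm [measurable]: "d N : borel_measurable borel" for N unfolding d_def by measurable
 define \<mu> where "\<mu> N = density lborel (%t. ennreal (d N t))" for N
 have sets_\<mu> [simp]: "sets (\<mu> N) = sets borel" and space_\<mu> [simp]: "space (\<mu> N) = UNIV" for N
  by (auto simp: \<mu>_def)
 have coef: "(\<integral>t. cis (2 * pi * of_int n * t) \<partial>\<mu> N) =
   (\<Sum>l\<le>N. \<Sum>m\<le>N. if int m - int l = n then r n else 0) / of_nat (Suc N)"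
  and dint: "integrable lborel (d N)" for n N
 proof -
  have eq: "d N t *\<^sub>R cis (2 * pi * of_int n * t) =
    (\<Sum>l\<le>N. \<Sum>m\<le>N. (r (int m - int l) / of_nat (Suc N)) * (indicator {0..1} t *\<^sub>R cis (2 * pi * of_int (n - (int m - int l)) * t)))"
   for t n
  proof -
   have "d N t *\<^sub>R cis (2 * pi * of_int n * t) = of_real (indicator {0..1} t) * of_real (p N t) * cis (2 * pi * of_int n * t) / of_nat (Suc N)"
    by (simp add: d_def scaleR_conv_of_real del: of_nat_Suc)
   also have "\<dots> = of_real (indicator {0..1} t) *
    (\<Sum>l\<le>N. \<Sum>m\<le>N. r (int m - int l) * (cis (- 2 * pi * of_int (int m - int l) * t) * cis (2 * pi * of_int n * t))) / of_nat (Suc N)"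
    unfolding p[symmetric] by (simp add: sum_distrib_right mult.assoc del: of_nat_Suc)
   also have "\<dots> = (\<Sum>l\<le>N. \<Sum>m\<le>N. (r (int m - int l) / of_nat (Suc N)) * (indicator {0..1} t *\<^sub>R cis (2 * pi * of_int (n - (int m - int l)) * t)))"
    unfolding sum_distrib_left sum_divide_distrib cis_mult
    by (intro sum.cong refl) (simp add: scaleR_conv_of_real algebra_simps del: of_nat_Suc)
   finally show ?thesis .
  qed
  have int: "integrable lborel (%t. d N t *\<^sub>R cis (2 * pi * of_int n * t))" for n
   unfolding eq by (intro Bochner_Integration.integrable_sum integrable_mult_right integrable_cis_period)
  hence "integrable lborel (%t. Re (d N t *\<^sub>R cis (2 * pi * of_int 0 * t)))" by (rule integrable_Re)
  thus "integrable lborel (d N)" by simp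
  have "(\<integral>t. cis (2 * pi * of_int n * t) \<partial>\<mu> N) = (\<integral>t. d N t *\<^sub>R cis (2 * pi * of_int n * t) \<partial>lborel)"
   unfolding \<mu>_def using d0 by (intro integral_density)
    (auto intro!: borel_measurable_continuous_onI continuous_intros)
  also have "\<dots> = (\<Sum>l\<le>N. \<Sum>m\<le>N. (r (int m - int l) / of_nat (Suc N)) * (if n - (int m - int l) = 0 then 1 else 0))"
   unfolding eq
   by (subst Bochner_Integration.integral_sum, intro Bochner_Integration.integrable_sum integrable_mult_right integrable_cis_period,
    intro sum.cong refl, subst Bochner_Integration.integral_sum, intro integrable_mult_right integrable_cis_period,
    intro sum.cong refl) (simp only: integral_mult_right_zero integral_cis_period)
  also have "\<dots> = (\<Sum>l\<le>N. \<Sum>m\<le>N. if int m - int l = n then r n else 0) / of_nat (Suc N)"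
   unfolding sum_divide_distrib by (intro sum.cong refl) auto
  finally show "(\<integral>t. cis (2 * pi * of_int n * t) \<partial>\<mu> N) =
   (\<Sum>l\<le>N. \<Sum>m\<le>N. if int m - int l = n then r n else 0) / of_nat (Suc N)" .
 qed
 have tot: "(\<integral>t. d N t \<partial>lborel) = 1" for N
 proof -
  have "(\<integral>t. cis (2 * pi * of_int 0 * t) \<partial>\<mu> N) = complex_of_real (\<integral>t. d N t \<partial>lborel)"
   unfolding \<mu>_def using d0 by (subst integral_density) (auto simp: scaleR_conv_of_real)
  moreover have "(\<Sum>l\<le>N. \<Sum>m\<le>N. if int m - int l = 0 then r 0 else 0) = (of_nat (Suc N) :: complex)"
   by (simp add: r0)
  ultimately have "complex_of_real (\<integral>t. d N t \<partial>lborel) = 1" unfolding coef by (metis div_self of_nat_neq_0)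
  thus ?thesis by simp
 qed
 have rd: "real_distribution (\<mu> N)" for N
 proof -
  have "emeasure (\<mu> N) (space (\<mu> N)) = (\<integral>\<^sup>+t. ennreal (d N t) \<partial>lborel)"
   by (simp add: \<mu>_def emeasure_density)
  also have "\<dots> = ennreal (\<integral>t. d N t \<partial>lborel)" using dint d0 by (intro nn_integral_eq_integral) auto
  finally have "prob_space (\<mu> N)" by (intro prob_spaceI) (simp add: tot)
  thus ?thesis by (simp add: real_distribution_def real_distribution_axioms_def)
 qed
 have "tight \<mu>" unfolding tight_def
 proof (intro conjI allI impI rd)
  fix \<epsilon> :: real assume "\<epsilon> > 0"
  \<comment> \<open>The densities live on the closed interval from 0 to 1, while tightness asks for
    intervals open on the left; hence the end point -1.\<close>
  have "measure (\<mu> N) {-1<..1} = 1" for N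
  proof -
   interpret real_distribution "\<mu> N" by (rule rd)
   have "emeasure (\<mu> N) (- {-1<..1}) = (\<integral>\<^sup>+t. ennreal (d N t) * indicator (- {-1<..1}) t \<partial>lborel)"
    unfolding \<mu>_def by (rule emeasure_density) auto
   also have "(%t. ennreal (d N t) * indicator (- {-1<..1}) t) = (%t. 0)" by (auto simp: d_def indicator_def)
   finally have "measure (\<mu> N) (space (\<mu> N) - {-1<..1}) = 0" by (simp add: measure_def Compl_eq_Diff_UNIV)
   thus ?thesis by (subst (asm) prob_compl) auto
  qed
  thus "\<exists>a b. a < b \<and> (\<forall>n. 1 - \<epsilon> < measure (\<mu> n) {a<..b})"
   using \<open>\<epsilon> > 0\<close> by (intro exI[of _ "-1"] exI[of _ 1]) auto
 qed
 from tight_imp_convergent_subsubsequence[OF this strict_mono_id]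
 obtain s M where s: "strict_mono s" and M: "real_distribution M" and w: "weak_conv_m (\<mu> \<circ> s) M"
  by (auto simp: comp_def id_def)
 interpret M: real_distribution M by (rule M)
 have lim: "(\<integral>t. cis (2 * pi * of_int n * t) \<partial>M) = r n" for n
 proof -
  have "(%k. \<integral>t. cis (2 * pi * of_int n * t) \<partial>(\<mu> \<circ> s) k) ----> (\<integral>t. cis (2 * pi * of_int n * t) \<partial>M)"
  proof (rule weak_conv_imp_integral_bdd_continuous_conv[where B = 1])
   have "continuous_on UNIV (%t. cis (2 * pi * of_int n * t))" by (intro continuous_intros)
   thus "isCont (%t. cis (2 * pi * of_int n * t)) x" for x by (simp add: continuous_on_eq_continuous_at)
  qed (use rd M w in "auto simp: comp_def")
  moreover have "(%k. \<integral>t. cis (2 * pi * of_int n * t) \<partial>(\<mu> \<circ> s) k) ----> r n"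
   unfolding comp_def coef using LIMSEQ_subseq_LIMSEQ[OF count_differences[where n = n and c = "r n"] s] by (simp add: comp_def)
  ultimately show ?thesis using LIMSEQ_unique by blast
 qed
 show ?thesis
 proof (rule that[of "distr M circle_borel (%t. cis (2 * pi * t))"])
  show "circle_measure (distr M circle_borel (%t. cis (2 * pi * t)))"
   by (intro distr_cis_circle_measure) (auto intro: M.finite_measure_axioms)
  fix n
  have mm: "(%t. cis (2 * pi * t)) : measurable M circle_borel"
   using cis_circle_measurable measurable_cong_sets[OF M.events_eq_borel refl] by blast
  have "(\<integral>t. t powi n \<partial>distr M circle_borel (%t. cis (2 * pi * t))) = (\<integral>t. cis (2 * pi * t) powi n \<partial>M)"
   by (rule integral_distr[OF mm]) simp
  also have "\<dots> = (\<integral>t. cis (2 * pi * of_int n * t) \<partial>M)" by (simp add: cis_power_int mult_ac)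
  also have "\<dots> = r n" by (rule lim)
  finally show "(\<integral>t. t powi n \<partial>distr M circle_borel (%t. cis (2 * pi * t))) = r n" .
 qed
qed

section \<open>Lebesgue measure on the circle and rotations\<close>

lemma circle_lebesgue_circle_measure: "circle_measure circle_lebesgue"
proof -
 have "finite_measure (restrict_space lborel {0..<1::real})"
  by (intro finite_measureI) (simp add: emeasure_restrict_space space_restrict_space)
 moreover have "(%t. cis (2 * pi * t)) : measurable (restrict_space lborel {0..<1::real}) circle_borel"
  by (intro measurable_restrict_space1) (simp add: measurable_cong_sets[OF sets_lborel refl])
 ultimately show ?thesis unfolding circle_lebesgue_def circle_measure_def by (simp add: finite_measure.finite_measure_distr)
qed

lemma circle_lebesgue_powi: "(\<integral>t. t powi n \<partial>circle_lebesgue) = (if n = 0 then 1 else 0)"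
proof -
 have "(%t. cis (2 * pi * t)) : measurable (restrict_space lborel {0..<1::real}) circle_borel"
  by (intro measurable_restrict_space1) (simp add: measurable_cong_sets[OF sets_lborel refl])
 hence "(\<integral>t. t powi n \<partial>circle_lebesgue) = (\<integral>t. cis (2 * pi * t) powi n \<partial>restrict_space lborel {0..<1::real})"
  unfolding circle_lebesgue_def by (subst integral_distr) auto
 also have "\<dots> = (\<integral>t. indicator {0..<1} t *\<^sub>R cis (2 * pi * of_int n * t) \<partial>lborel)"
  by (subst integral_restrict_space) (auto simp: cis_power_int algebra_simps)
 also have "\<dots> = (\<integral>t. indicator {0..1} t *\<^sub>R cis (2 * pi * of_int n * t) \<partial>lborel)"
 proof (rule integral_cong_AE)
  show "AE t in lborel. indicator {0..<1} t *\<^sub>R cis (2 * pi * of_int n * t) = indicator {0..1} t *\<^sub>R cis (2 * pi * of_int n * t)"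
   using AE_lborel_singleton[of "1::real"] by eventually_elim (auto simp: indicator_def)
  have [measurable]: "(%t. cis (2 * pi * of_int n * t)) : borel_measurable borel"
   by (intro borel_measurable_continuous_onI continuous_intros)
  show "(%t. indicator {0..<1} t *\<^sub>R cis (2 * pi * of_int n * t)) : borel_measurable lborel" by measurable
  show "(%t. indicator {0..1} t *\<^sub>R cis (2 * pi * of_int n * t)) : borel_measurable lborel" by measurable
 qed
 finally show ?thesis by (simp only: integral_cis_period)
qed

lemma circle_lebesgue_total: "emeasure circle_lebesgue S1 = 1"
proof -
 interpret finite_measure circle_lebesgue using circle_lebesgue_circle_measure by (simp add: circle_measure_def)
 have "measure circle_lebesgue S1 = 1"
  using circle_lebesgue_powi[of 0] circle_measure_space[OF circle_lebesgue_circle_measure] by (simp add: scaleR_conv_of_real)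
 thus ?thesis by (simp add: emeasure_eq_measure)
qed

lemma rotation_measurable: "w : S1 ==> (%t. w * t) : measurable circle_borel circle_borel" unfolding circle_borel_def
 by (intro measurable_restrict_space3 borel_measurable_continuous_onI continuous_intros) (auto simp: norm_mult)

lemma rotation_circle_measure:
 assumes "circle_measure \<sigma>" "w : S1"
 shows "circle_measure (distr \<sigma> circle_borel (%t. w * t))" using assms rotation_measurable[OF assms(2)]
 by (simp add: circle_measure_def finite_measure.finite_measure_distr measurable_cong_sets[of \<sigma> circle_borel circle_borel circle_borel])

lemma rotation_powi:
 assumes \<sigma>: "circle_measure \<sigma>" and w: "w : S1"
 shows "(\<integral>t. t powi n \<partial>distr \<sigma> circle_borel (%t. w * t)) = w powi n * (\<integral>t. t powi n \<partial>\<sigma>)"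
 using rotation_measurable[OF w] \<sigma> by (subst integral_distr) (auto simp: circle_measure_measurable power_int_mult_distrib)

lemma circle_lebesgue_rotation:
 assumes w: "w : S1"
 shows "distr circle_lebesgue circle_borel (%t. w * t) = circle_lebesgue"
 by (intro circle_measure_eqI rotation_circle_measure w circle_lebesgue_circle_measure)
   (simp add: rotation_powi[OF circle_lebesgue_circle_measure w] circle_lebesgue_powi)

lemma emeasure_rotation:
 assumes \<sigma>: "circle_measure \<sigma>" and w: "w : S1" and N: "N : sets circle_borel"
 shows "emeasure (distr \<sigma> circle_borel (%t. w * t)) N = emeasure \<sigma> {t : S1. w * t : N}"
 using rotation_measurable[OF w] \<sigma> N
 by (subst emeasure_distr) (auto simp: circle_measure_measurable circle_measure_space intro!: arg_cong2[where f = emeasure])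

lemma circle_lebesgue_null_rotation:
 assumes w: "w : S1" and N: "N : sets circle_borel"
 shows "emeasure circle_lebesgue {t : S1. w * t : N} = emeasure circle_lebesgue N"
 using emeasure_rotation[OF circle_lebesgue_circle_measure w N] circle_lebesgue_rotation[OF w] by simp

lemma rotation_sets:
 assumes w: "w : S1" and N: "N : sets circle_borel"
 shows "{t : S1. w * t : N} : sets circle_borel"
 using measurable_sets[OF rotation_measurable[OF w] N] by (simp add: vimage_def Int_def conj_commute)

text \<open>Fubini for the set of pairs \<open>(w, t)\<close> with \<open>w * t\<close> in
  \<open>N\<close>: for fixed \<open>t\<close> its section is a rotation of \<open>N\<close> and
  Lebesgue null, so almost every section in the other direction is null for
  \<open>\<sigma>\<close>.\<close>

lemma AE_rotation_null:
 assumes \<sigma>: "circle_measure \<sigma>" and N: "N : sets circle_borel" "emeasure circle_lebesgue N = 0"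
 shows "AE w in circle_lebesgue. emeasure \<sigma> {t : S1. w * t : N} = 0"
proof -
 note L = circle_lebesgue_circle_measure
 interpret s: finite_measure \<sigma> using \<sigma> by (simp add: circle_measure_def)
 interpret l: finite_measure circle_lebesgue using L by (simp add: circle_measure_def)
 interpret pair_sigma_finite circle_lebesgue \<sigma> ..
 have mult: "(%p. fst p * snd p) : measurable (circle_borel \<Otimes>\<^sub>M circle_borel) circle_borel"
  unfolding circle_borel_def
 proof (rule measurable_restrict_space2)
  show "(%p. fst p * snd p) : space (restrict_space borel S1 \<Otimes>\<^sub>M restrict_space borel S1) \<rightarrow> S1"
   by (auto simp: space_pair_measure space_restrict_space norm_mult)
  have id: "(%x. x) : measurable (restrict_space borel S1) borel" by (rule measurable_restrict_space1) simp
  show "(%p. fst p * snd p) : measurable (restrict_space borel S1 \<Otimes>\<^sub>M restrict_space borel S1) borel"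
   using measurable_compose[OF measurable_fst id] measurable_compose[OF measurable_snd id] by (intro borel_measurable_times)
 qed
 have sp: "sets (circle_lebesgue \<Otimes>\<^sub>M \<sigma>) = sets (circle_borel \<Otimes>\<^sub>M circle_borel)"
  by (intro sets_pair_measure_cong circle_measure_sets \<sigma> L)
 have m [measurable]: "(%p. indicator N (fst p * snd p) :: ennreal) : borel_measurable (circle_lebesgue \<Otimes>\<^sub>M \<sigma>)"
  unfolding measurable_cong_sets[OF sp refl] by (rule measurable_compose[OF mult]) (use N in simp)
 have inner: "(\<integral>\<^sup>+t. indicator N (w * t) \<partial>\<sigma>) = emeasure \<sigma> {t : S1. w * t : N}" if "w : S1" for w
 proof -
  have "(\<integral>\<^sup>+t. indicator N (w * t) \<partial>\<sigma>) = (\<integral>\<^sup>+t. indicator {t : S1. w * t : N} t \<partial>\<sigma>)"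
   using \<sigma> by (intro nn_integral_cong) (auto simp: circle_measure_space indicator_def)
  thus ?thesis using rotation_sets[OF that N(1)] \<sigma> by (simp add: circle_measure_sets)
 qed
 have inner2: "(\<integral>\<^sup>+w. indicator N (w * t) \<partial>circle_lebesgue) = 0" if t: "t : S1" for t
 proof -
  have "(\<integral>\<^sup>+w. indicator N (w * t) \<partial>circle_lebesgue) = (\<integral>\<^sup>+w. indicator {w : S1. t * w : N} w \<partial>circle_lebesgue)"
   using L by (intro nn_integral_cong) (auto simp: circle_measure_space indicator_def mult.commute)
  thus ?thesis using rotation_sets[OF t N(1)] L circle_lebesgue_null_rotation[OF t N(1)] N(2) by (simp add: circle_measure_sets)
 qed
 have "(\<integral>\<^sup>+w. (\<integral>\<^sup>+t. indicator N (w * t) \<partial>\<sigma>) \<partial>circle_lebesgue) = (\<integral>\<^sup>+t. (\<integral>\<^sup>+w. indicator N (w * t) \<partial>circle_lebesgue) \<partial>\<sigma>)"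
  using Fubini'[of "%w t. indicator N (w * t)"] m by (simp add: case_prod_beta)
 also have "\<dots> = (\<integral>\<^sup>+t. 0 \<partial>\<sigma>)" using \<sigma> inner2 by (intro nn_integral_cong) (auto simp: circle_measure_space)
 finally have z: "(\<integral>\<^sup>+w. (\<integral>\<^sup>+t. indicator N (w * t) \<partial>\<sigma>) \<partial>circle_lebesgue) = 0" by simp
 have mm: "(%w. \<integral>\<^sup>+t. indicator N (w * t) \<partial>\<sigma>) : borel_measurable circle_lebesgue"
  using s.borel_measurable_nn_integral[of "%w t. indicator N (w * t)" circle_lebesgue] m by (simp add: case_prod_beta)
 have "AE w in circle_lebesgue. (\<integral>\<^sup>+t. indicator N (w * t) \<partial>\<sigma>) = 0"
  using z mm by (simp add: nn_integral_0_iff_AE)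
 thus ?thesis using AE_space by eventually_elim (use inner L in "simp add: circle_measure_space")
qed

text \<open>Ergodicity of an irrational rotation by Fourier coefficients: Lebesgue measure
  restricted to the invariant set is invariant under the rotation, so its coefficients of non-zero
  order vanish and it equals \<open>c\<close> times Lebesgue measure. Evaluating both on
  \<open>S1 - N\<close> gives the alternative.\<close>

lemma circle_lebesgue_zero_one:
 assumes w: "w : S1" "!!n. n ~= 0 ==> w powi n ~= 1"
  and N: "N : sets circle_borel" and inv: "!!t. t : S1 ==> w * t : N \<longleftrightarrow> t : N"
 shows "emeasure circle_lebesgue N = 0 \<or> emeasure circle_lebesgue (S1 - N) = 0"
proof -
 note L = circle_lebesgue_circle_measure
 interpret l: finite_measure circle_lebesgue using L by (simp add: circle_measure_def)
 have Ns: "N : sets circle_lebesgue" using N L by (simp add: circle_measure_sets)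
 define \<nu> where "\<nu> = density circle_lebesgue (indicator N)"
 define c where "c = measure circle_lebesgue N"
 define \<rho> where "\<rho> = density circle_lebesgue (%_. ennreal c)"
 have c0: "c \<ge> 0" by (simp add: c_def)
 have \<nu>e: "emeasure \<nu> A = emeasure circle_lebesgue (N \<inter> A)" if "A : sets circle_lebesgue" for A
  unfolding \<nu>_def using that Ns by (subst emeasure_density) (auto simp: indicator_inter_arith[symmetric])
 have \<nu>: "circle_measure \<nu>" unfolding circle_measure_def
 proof
  show "finite_measure \<nu>"
  proof (rule finite_measureI)
   have "space \<nu> = space circle_lebesgue" by (simp add: \<nu>_def)
   thus "emeasure \<nu> (space \<nu>) ~= \<infinity>" using \<nu>e[OF sets.top] by simp
  qed
  show "sets \<nu> = sets circle_borel" using L by (simp add: \<nu>_def circle_measure_sets)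
 qed
 have \<rho>: "circle_measure \<rho>" unfolding circle_measure_def
 proof
  show "finite_measure \<rho>"
   by (rule finite_measureI) (simp add: \<rho>_def emeasure_density nn_integral_cmult ennreal_mult_eq_top_iff)
  show "sets \<rho> = sets circle_borel" using L by (simp add: \<rho>_def circle_measure_sets)
 qed
 have \<nu>i: "(\<integral>t. t powi n \<partial>\<nu>) = (\<integral>t. indicator N t *\<^sub>R t powi n \<partial>circle_lebesgue)" for n
 proof -
  have "\<nu> = density circle_lebesgue (%t. ennreal (indicator N t))" unfolding \<nu>_def by (simp add: ennreal_indicator)
  thus ?thesis using Ns L by (simp only:) (subst integral_density, auto simp: circle_measure_measurable intro!: borel_measurable_indicator N)
 qed
 have rot: "distr \<nu> circle_borel (%t. w * t) = \<nu>"
 proof (rule measure_eqI)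
  fix A assume "A : sets (distr \<nu> circle_borel ((*) w))"
  hence A: "A : sets circle_borel" by simp
  have A': "{t : S1. w * t : A} : sets circle_lebesgue" using rotation_sets[OF w(1) A] L by (simp add: circle_measure_sets)
  have "emeasure (distr \<nu> circle_borel ((*) w)) A = emeasure circle_lebesgue (N \<inter> {t : S1. w * t : A})"
   using emeasure_rotation[OF \<nu> w(1) A] \<nu>e[OF A'] by simp
  also have "N \<inter> {t : S1. w * t : A} = {t : S1. w * t : N \<inter> A}"
   using inv sets.sets_into_space[OF N] by auto
  also have "emeasure circle_lebesgue \<dots> = emeasure circle_lebesgue (N \<inter> A)"
   using circle_lebesgue_null_rotation[OF w(1), of "N \<inter> A"] N A by auto
  also have "\<dots> = emeasure \<nu> A" using \<nu>e[of A] A L by (simp add: circle_measure_sets)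
  finally show "emeasure (distr \<nu> circle_borel ((*) w)) A = emeasure \<nu> A" .
 qed (use \<nu> in "simp add: circle_measure_sets")
 have "\<nu> = \<rho>"
 proof (rule circle_measure_eqI[OF \<nu> \<rho>])
  fix n
  have r: "(\<integral>t. t powi n \<partial>\<rho>) = c *\<^sub>R (if n = 0 then 1 else 0)"
   unfolding \<rho>_def using c0 L by (subst integral_density) (auto simp: circle_measure_measurable circle_lebesgue_powi)
  show "(\<integral>t. t powi n \<partial>\<nu>) = (\<integral>t. t powi n \<partial>\<rho>)"
  proof (cases "n = 0")
   case True
   have "(\<integral>t. indicator N t *\<^sub>R (1::complex) \<partial>circle_lebesgue) = c *\<^sub>R 1"
    using Ns by (subst integral_scaleR_left) (auto simp: c_def Int_absorb2[OF sets.sets_into_space[OF Ns]] l.emeasure_eq_measure)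
   thus ?thesis using \<nu>i[of n] r True by simp
  next
   case False
   have "(\<integral>t. t powi n \<partial>\<nu>) = w powi n * (\<integral>t. t powi n \<partial>\<nu>)"
    using rotation_powi[OF \<nu> w(1), of n] rot by simp
   hence "(\<integral>t. t powi n \<partial>\<nu>) = 0" using w(2)[OF False] by simp
   thus ?thesis using r False by simp
  qed
 qed
 have Cs: "S1 - N : sets circle_lebesgue" using Ns sets.compl_sets[OF Ns] L by (simp add: circle_measure_space)
 have "emeasure \<nu> (S1 - N) = 0" using \<nu>e[OF Cs] by simp
 moreover have "emeasure \<rho> (S1 - N) = ennreal c * emeasure circle_lebesgue (S1 - N)"
  unfolding \<rho>_def using Cs by (subst emeasure_density) (auto simp: nn_integral_cmult)
 ultimately have "ennreal c = 0 \<or> emeasure circle_lebesgue (S1 - N) = 0" using \<open>\<nu> = \<rho>\<close> by simp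
 thus ?thesis using c0 by (auto simp: c_def l.emeasure_eq_measure)
qed

section \<open>Spectral measures\<close>

lemma emeasure_density_total: "g : borel_measurable M ==> emeasure (density M g) (space M) = (\<integral>\<^sup>+x. g x \<partial>M)"
 by (subst emeasure_density) (auto intro!: nn_integral_cong)

text \<open>\<open>U_comp\<close> is stated through the form because the composition law of
  translates holds only up to vectors of norm zero; even \<open>U 0 x = x\<close> is available only
  in this sense.\<close>

locale unitary_powers = semi_hilbert +
 fixes U :: "int => 'a => 'a"
 assumes U_mem [simp]: "x : H ==> U n x : H"
  and U_add: "x : H ==> y : H ==> U n (x + y) = U n x + U n y"
  and U_sc: "x : H ==> U n (sc c x) = sc c (U n x)"
  and U_ip: "x : H ==> y : H ==> ip (U n x) (U n y) = ip x y"
  and U_comp: "x : H ==> y : H ==> ip (U m (U n x)) y = ip (U (m + n) x) y"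
begin

lemma U_zero_ip: "x : H ==> y : H ==> ip (U 0 x) y = ip x y"
 using U_comp[of x "U 0 y" 0 0] U_ip[of "U 0 x" y 0] U_ip[of x y 0] by simp

lemma U_zero: "x : H ==> nrm (U 0 x - x) = 0" by (intro nrm_diff_eq0I) (auto simp: U_zero_ip)

lemma U_adj: "x : H ==> y : H ==> ip (U n x) y = ip x (U (- n) y)"
 using U_ip[of "U n x" y "- n"] U_comp[of x "U (- n) y" "- n" n] U_zero_ip[of x "U (- n) y"] by simp

lemma U_ip_shift: "x : H ==> y : H ==> ip (U m x) (U n y) = ip (U (m - n) x) y"
 using U_adj[of "U m x" y "- n"] U_comp[of x y "- n" m] by simp

lemma U_nrm: "x : H ==> nrm (U n x) = nrm x" by (simp add: nrm_def U_ip)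

lemma U_minus: "x : H ==> U n (- x) = - U n x" using U_sc[of x n "-1"] by (simp add: sc_minus_one)

lemma U_diff: "x : H ==> y : H ==> U n (x - y) = U n x - U n y" using U_add[of x "- y" n] by (simp add: U_minus)

lemma U_tends: "(!!n. F n : H) ==> f : H ==> tends F f ==> tends (%n. U m (F n)) (U m f)"
 by (simp add: tends_def U_diff[symmetric] U_nrm)

definition spec :: "'a => complex measure => bool" where
 "spec h \<sigma> \<longleftrightarrow> circle_measure \<sigma> \<and> (\<forall>n. ip (U n h) h = (\<integral>t. t powi n \<partial>\<sigma>))"

lemma spec_circle_measure: "spec h \<sigma> ==> circle_measure \<sigma>" by (simp add: spec_def)

lemma spec_unique: "spec h \<sigma> ==> spec h \<tau> ==> \<sigma> = \<tau>" by (rule circle_measure_eqI) (auto simp: spec_def)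

lemma circle_measure_density_const:
 assumes \<sigma>: "circle_measure \<sigma>" and c: "c \<ge> 0"
 shows "circle_measure (density \<sigma> (%_. ennreal c))" "(\<integral>t. t powi n \<partial>density \<sigma> (%_. ennreal c)) = c *\<^sub>R (\<integral>t. t powi n \<partial>\<sigma>)"
proof -
 interpret finite_measure \<sigma> using circle_measure_finite[OF \<sigma>] .
 show "circle_measure (density \<sigma> (%_. ennreal c))"
  using \<sigma> by (auto simp: circle_measure_def emeasure_density nn_integral_cmult ennreal_mult_eq_top_iff intro!: finite_measureI)
 show "(\<integral>t. t powi n \<partial>density \<sigma> (%_. ennreal c)) = c *\<^sub>R (\<integral>t. t powi n \<partial>\<sigma>)"
  using c \<sigma> by (subst integral_density) (auto simp: circle_measure_measurable)
qed

lemma spec_exists: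
 assumes h: "h : H" shows "\<exists>\<sigma>. spec h \<sigma>"
proof (cases "nrm h = 0")
 case True
 have "ip (U n h) h = 0" for n using nrm_eq_0_ip_right[OF h U_mem[OF h] True] .
 moreover have "(\<integral>t. t powi n \<partial>density circle_lebesgue (%_. ennreal 0)) = 0" for n
  using circle_measure_density_const(2)[OF circle_lebesgue_circle_measure, of 0 n] by simp
 ultimately show ?thesis
  using circle_measure_density_const(1)[OF circle_lebesgue_circle_measure, of 0] unfolding spec_def by force
next
 case False
 define c where "c = (nrm h)^2"
 have c: "c > 0" using False by (simp add: c_def)
 define r where "r n = ip (U n h) h / of_real c" for n
 \<comment> \<open>The Fejer sum of \<open>r\<close> at \<open>t\<close> is
   \<open>(nrm (v N t))^2 / c\<close>, which supplies the positivity that \<open>herglotz\<close>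
   asks for; dividing by \<open>c\<close> normalises \<open>r 0\<close> to 1.\<close>
 define v where "v N t = (\<Sum>m\<le>N. sc (cis (- 2 * pi * of_int (int m) * t)) (U (int m) h))" for N :: nat and t :: real
 have v: "v N t : H" for N t using h by (simp add: v_def)
 have "(\<Sum>l\<le>N. \<Sum>m\<le>N. r (int m - int l) * cis (- 2 * pi * of_int (int m - int l) * t)) = of_real ((nrm (v N t))^2 / c)" for N t
 proof -
  have "ip (v N t) (v N t) = (\<Sum>l\<le>N. \<Sum>m\<le>N.
    ip (sc (cis (- 2 * pi * of_int (int m) * t)) (U (int m) h)) (sc (cis (- 2 * pi * of_int (int l) * t)) (U (int l) h)))"
   unfolding v_def using h by (subst ip_sum_right, simp, simp, subst ip_sum_left) auto
  also have "\<dots> = (\<Sum>l\<le>N. \<Sum>m\<le>N. of_real c * (r (int m - int l) * cis (- 2 * pi * of_int (int m - int l) * t)))"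
  proof (intro sum.cong refl)
   fix l m
   have "ip (sc (cis (- 2 * pi * of_int (int m) * t)) (U (int m) h)) (sc (cis (- 2 * pi * of_int (int l) * t)) (U (int l) h))
     = (cis (- 2 * pi * of_int (int m) * t) * cis (2 * pi * of_int (int l) * t)) * ip (U (int m - int l) h) h"
    using h by (simp add: ip_sc_left ip_sc_right U_ip_shift cis_cnj)
   also have "cis (- 2 * pi * of_int (int m) * t) * cis (2 * pi * of_int (int l) * t) = cis (- 2 * pi * of_int (int m - int l) * t)"
    by (simp add: cis_mult algebra_simps)
   finally show "ip (sc (cis (- 2 * pi * of_int (int m) * t)) (U (int m) h)) (sc (cis (- 2 * pi * of_int (int l) * t)) (U (int l) h))
     = of_real c * (r (int m - int l) * cis (- 2 * pi * of_int (int m - int l) * t))" using c by (simp add: r_def)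
  qed
  also have "\<dots> = of_real c * (\<Sum>l\<le>N. \<Sum>m\<le>N. r (int m - int l) * cis (- 2 * pi * of_int (int m - int l) * t))"
   by (simp only: sum_distrib_left)
  finally show ?thesis using c v by (simp add: ip_self field_simps)
 qed
 moreover have "r 0 = 1" using h c by (simp add: r_def U_zero_ip ip_self c_def)
 ultimately obtain \<sigma> where \<sigma>: "circle_measure \<sigma>" "!!n. (\<integral>t. t powi n \<partial>\<sigma>) = r n"
  using herglotz[of r "%N t. (nrm (v N t))^2 / c"] c by (metis divide_nonneg_pos zero_le_power2)
 have "spec h (density \<sigma> (%_. ennreal c))"
  unfolding spec_def using circle_measure_density_const[OF \<sigma>(1), of c] c \<sigma>(2)
  by (simp add: r_def scaleR_conv_of_real)
 thus ?thesis ..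
qed

definition sm :: "'a => complex measure" where
 "sm h = (SOME \<sigma>. spec h \<sigma>)"

lemma spec_sm: "h : H ==> spec h (sm h)" unfolding sm_def using someI_ex[OF spec_exists] .

lemma sm_eq: "spec h \<sigma> ==> sm h = \<sigma>"
 using spec_unique[of h "sm h" \<sigma>] someI[of "spec h" \<sigma>] by (simp add: sm_def)

lemma sm_circle_measure: "h : H ==> circle_measure (sm h)" using spec_circle_measure[OF spec_sm] .

lemma sm_powi: "h : H ==> (\<integral>t. t powi n \<partial>sm h) = ip (U n h) h" using spec_sm by (simp add: spec_def)

lemma sm_total: "h : H ==> measure (sm h) S1 = (nrm h)^2"
proof -
 assume h: "h : H"
 have "complex_of_real (measure (sm h) S1) = complex_of_real ((nrm h)^2)"
  using sm_powi[OF h, of 0] circle_measure_space[OF sm_circle_measure[OF h]] h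
  by (simp add: U_zero_ip ip_self scaleR_conv_of_real)
 thus ?thesis using of_real_eq_iff by blast
qed

lemma sm_le_nrm: "h : H ==> measure (sm h) N <= (nrm h)^2"
 using finite_measure.bounded_measure[OF circle_measure_finite[OF sm_circle_measure], of h N]
  circle_measure_space[OF sm_circle_measure] sm_total by simp

lemma sm_cong:
 assumes "g : H" "h : H" "!!n. ip (U n g) g = ip (U n h) h"
 shows "sm g = sm h" using assms by (intro circle_measure_eqI sm_circle_measure) (simp_all add: sm_powi)

lemma sm_U: "h : H ==> sm (U m h) = sm h"
proof (rule sm_cong)
 fix n assume h: "h : H"
 have "ip (U n (U m h)) (U m h) = ip (U (n + m) h) (U m h)" using U_comp h by simp
 also have "\<dots> = ip (U n h) h" using U_ip_shift[OF h h, of "n + m" m] by simp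
 finally show "ip (U n (U m h)) (U m h) = ip (U n h) h" .
qed auto

lemma sm_sc:
 assumes h: "h : H" and N: "N : sets circle_borel"
 shows "measure (sm (sc c h)) N = (cmod c)^2 * measure (sm h) N"
proof -
 have "(\<Sum>b\<in>UNIV. (if b then 1 else - ((cmod c)^2)) * measure (if b then sm (sc c h) else sm h) N) = 0"
 proof (rule circle_measures_signed_zero[OF _ _ N])
  show "(\<Sum>b\<in>UNIV. complex_of_real (if b then 1 else - ((cmod c)^2)) * (\<integral>t. t powi n \<partial>(if b then sm (sc c h) else sm h))) = 0" for n
   using h by (simp add: UNIV_bool sm_powi U_sc ip_sc_left ip_sc_right complex_norm_square del: of_real_power)
 qed (use sm_circle_measure h in auto)
 thus ?thesis by (simp add: UNIV_bool)
qed

text \<open>The cross terms cancel in the Fourier coefficients. The law bounds the mass of a sum by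
  twice the masses of the summands, which makes \<open>null_vectors N\<close> a subspace.\<close>

lemma sm_parallelogram:
 assumes f: "f : H" and g: "g : H" and N: "N : sets circle_borel"
 shows "measure (sm (f + g)) N + measure (sm (f - g)) N = 2 * measure (sm f) N + 2 * measure (sm g) N"
proof -
 define a :: "nat => real" where "a i = (if i < 2 then 1 else -2)" for i
 define \<sigma> where "\<sigma> i = (if i = 0 then sm (f + g) else if i = 1 then sm (f - g) else if i = 2 then sm f else sm g)" for i :: nat
 have "(\<Sum>i\<in>{0,1,2,3}. a i * measure (\<sigma> i) N) = 0"
 proof (rule circle_measures_signed_zero[OF _ _ N])
  show "(\<Sum>i\<in>{0,1,2,3}. complex_of_real (a i) * (\<integral>t. t powi n \<partial>\<sigma> i)) = 0" for n
   using f g by (simp add: a_def \<sigma>_def sm_powi U_add U_diff ip_simps)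
 qed (use sm_circle_measure f g in "auto simp: \<sigma>_def")
 thus ?thesis by (simp add: a_def \<sigma>_def)
qed

lemma sm_add_orth:
 assumes f: "f : H" and g: "g : H" and N: "N : sets circle_borel" and o: "!!n. ip (U n f) g = 0"
 shows "measure (sm (f + g)) N = measure (sm f) N + measure (sm g) N"
proof -
 have o2: "ip (U n g) f = 0" for n using U_adj[OF g f, of n] ip_cnj[of "U (- n) f" g] o[of "- n"] f g by simp
 define a :: "nat => real" where "a i = (if i = 0 then 1 else -1)" for i
 define \<sigma> where "\<sigma> i = (if i = 0 then sm (f + g) else if i = 1 then sm f else sm g)" for i :: nat
 have "(\<Sum>i\<in>{0,1,2}. a i * measure (\<sigma> i) N) = 0"
 proof (rule circle_measures_signed_zero[OF _ _ N])
  show "(\<Sum>i\<in>{0,1,2}. complex_of_real (a i) * (\<integral>t. t powi n \<partial>\<sigma> i)) = 0" for n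
   using f g o o2 by (simp add: a_def \<sigma>_def sm_powi U_add ip_simps)
 qed (use sm_circle_measure f g in "auto simp: \<sigma>_def")
 thus ?thesis by (simp add: a_def \<sigma>_def)
qed

definition U_inv :: "'a set => bool" where
 "U_inv V \<longleftrightarrow> (\<forall>n. \<forall>x\<in>V. U n x : V)"

text \<open>Absolute continuity is tracked by these closed \<open>U\<close>-invariant subspaces:
  whether \<open>N\<close> is null for all spectral measures from a subspace need only be tested on
  spanning vectors.\<close>

definition null_vectors :: "complex set => 'a set" where
 "null_vectors N = {h : H. measure (sm h) N = 0}"

lemma csub_null_vectors:
 assumes N: "N : sets circle_borel" shows "csub (null_vectors N)"
proof -
 have le: "measure (sm (f + g)) N <= 2 * measure (sm f) N + 2 * measure (sm g) N" if "f : H" "g : H" for f g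
  using sm_parallelogram[OF that N] measure_nonneg[of "sm (f - g)" N] by linarith
 show ?thesis
 proof (rule csubI)
  show "x + y : null_vectors N" if "x : null_vectors N" "y : null_vectors N" for x y
   using that le[of x y] measure_nonneg[of "sm (x + y)" N] by (auto simp: null_vectors_def)
  show "0 : null_vectors N" using sm_le_nrm[of 0 N] measure_nonneg[of "sm 0" N] by (simp add: null_vectors_def)
  show "f : null_vectors N" if f: "f : H" and F: "!!n. F n : null_vectors N" "tends F f" for F f
  proof -
   have FH: "F n : H" for n using F(1)[of n] by (simp add: null_vectors_def)
   \<comment> \<open>Split \<open>f\<close> as \<open>F n + (f - F n)\<close>: the first part has no
     mass on \<open>N\<close>, the second at most its squared norm.\<close>
   have "measure (sm f) N <= 2 * (nrm (F n - f))^2" for n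
    using le[of "F n" "f - F n"] F(1)[of n] sm_le_nrm[of "f - F n" N] FH[of n] f nrm_diff_commute[of "F n" f]
    by (simp add: null_vectors_def)
   hence b: "\<exists>K. \<forall>n\<ge>K. measure (sm f) N <= 2 * (nrm (F n - f))^2" by blast
   have "(%n. 2 * (nrm (F n - f))^2) ----> 2 * 0^2" using F(2) unfolding tends_def by (intro tendsto_intros)
   from LIMSEQ_le_const[OF this b] have "measure (sm f) N <= 0" by simp
   thus ?thesis using f measure_nonneg[of "sm f" N] by (simp add: null_vectors_def)
  qed
 qed (auto simp: null_vectors_def sm_sc[OF _ N])
qed

lemma U_inv_null_vectors: "U_inv (null_vectors N)" by (auto simp: U_inv_def null_vectors_def sm_U)

section \<open>Cyclic subspaces and functional calculus\<close>

definition orb :: "'a set => 'a set" where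
 "orb F = {U n f | n f. f : F}"

definition cyc :: "'a set => 'a set" where
 "cyc F = cspan (orb F)"

lemma orb_sub: "F \<subseteq> H ==> orb F \<subseteq> H" by (auto simp: orb_def)

lemma U_inv_ortho:
 assumes "V \<subseteq> H" "U_inv V" shows "U_inv (ortho V)" using assms by (auto simp: U_inv_def ortho_def U_adj subset_iff)

lemma ortho_orb: "F \<subseteq> H ==> ortho (orb F) = {x : H. \<forall>f\<in>F. \<forall>n. ip x (U n f) = 0}"
 by (auto simp: ortho_def orb_def)

lemma U_inv_ortho_orb:
 assumes F: "F \<subseteq> H" shows "U_inv (ortho (orb F))" unfolding U_inv_def
proof (intro allI ballI)
 fix n x assume x: "x : ortho (orb F)"
 hence xH: "x : H" by (simp add: ortho_def)
 have "ip (U n x) (U m f) = 0" if f: "f : F" for m f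
 proof -
  have fH: "f : H" using f F by auto
  have "ip (U n x) (U m f) = ip (U (n - m) x) f" using U_ip_shift[OF xH fH] by simp
  also have "\<dots> = ip x (U (- (n - m)) f)" using U_adj[OF xH fH] .
  also have "\<dots> = 0" using x f unfolding ortho_orb[OF F] by blast
  finally show ?thesis .
 qed
 thus "U n x : ortho (orb F)" unfolding ortho_orb[OF F] using xH by auto
qed

lemma U_inv_cyc: "F \<subseteq> H ==> U_inv (cyc F)" unfolding cyc_def cspan_def by (intro U_inv_ortho U_inv_ortho_orb ortho_sub)

lemma csub_cyc: "csub (cyc F)" unfolding cyc_def by (rule csub_cspan)

lemma orb_cyc: "F \<subseteq> H ==> orb F \<subseteq> cyc F" unfolding cyc_def by (intro cspan_superset orb_sub)

lemma cyc_superset: "F \<subseteq> H ==> F \<subseteq> cyc F"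
proof
 fix f assume F: "F \<subseteq> H" and f: "f : F"
 have "U 0 f : cyc F" using orb_cyc[OF F] f by (auto simp: orb_def)
 thus "f : cyc F" using csub_cong[OF csub_cyc] U_zero f F by blast
qed

lemma cyc_least: "csub V ==> U_inv V ==> F \<subseteq> V ==> cyc F \<subseteq> V"
 unfolding cyc_def by (intro cspan_least) (auto simp: orb_def U_inv_def)

lemma cyc_mono: "F \<subseteq> F' ==> cyc F \<subseteq> cyc F'" unfolding cyc_def by (intro cspan_mono) (auto simp: orb_def)

text \<open>The graph of \<open>p\<close> to \<open>p(U) f\<close>. A relation is used because one
  function \<open>p\<close> may be built in several ways that give different vectors;
  \<open>trig_rep_nrm_diff\<close> shows that these differ by norm zero.\<close>

inductive trig_rep :: "'a => (complex => complex) => 'a => bool" for f where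
 mono: "trig_rep f (%t. c * t powi k) (sc c (U k f))"
| add: "trig_rep f p v ==> trig_rep f q w ==> trig_rep f (%t. p t + q t) (v + w)"

lemma trig_rep_poly: "trig_rep f p v ==> p : trig_poly" by (induction rule: trig_rep.induct) (auto intro: trig_poly.intros)

lemma trig_rep_exists: "p : trig_poly ==> \<exists>v. trig_rep f p v"
 by (induction rule: trig_poly.induct) (auto intro: trig_rep.intros)

lemma trig_rep_mem: "csub V ==> orb {f} \<subseteq> V ==> trig_rep f p v ==> v : V"
 by (rotate_tac 2, induction rule: trig_rep.induct) (auto simp: orb_def intro!: csub_sc csub_add)

lemma trig_rep_H: "f : H ==> trig_rep f p v ==> v : H" by (rule trig_rep_mem[OF csub_H]) (auto simp: orb_def)

lemma trig_poly_mult_integrable: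
 assumes \<sigma>: "circle_measure \<sigma>" and p: "p : trig_poly" "q : trig_poly"
 shows "integrable \<sigma> (%t. t powi m * p t * cnj (q t))"
proof -
 obtain A B where "\<forall>t\<in>S1. cmod (p t) <= A" "\<forall>t\<in>S1. cmod (q t) <= B"
  using trig_poly_bounded p by metis
 thus ?thesis using trig_poly_measurable[OF p(1)] trig_poly_measurable[OF p(2)]
  by (intro circle_measure_integrable_bounded[OF \<sigma>, where B = "A * B"])
    (auto simp: norm_mult norm_power_int intro!: mult_mono order_trans[OF norm_ge_zero])
qed

text \<open>Sesquilinearity reduces everything to monomials, where it is the definition of the
  spectral measure together with \<open>cnj t = inverse t\<close> on the circle. For
  \<open>m = 0\<close> the map from trigonometric polynomials in \<open>L2 \<sigma>\<close> to
  vectors is thereby isometric.\<close>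

lemma trig_rep_ip:
 assumes f: "f : H" and s: "spec f \<sigma>" and v: "trig_rep f p v" and w: "trig_rep f q w"
 shows "ip (U m v) w = (\<integral>t. t powi m * p t * cnj (q t) \<partial>\<sigma>)" using v w
proof (induction arbitrary: q w rule: trig_rep.induct)
 case (mono c k)
 from mono.prems show ?case
 proof (induction rule: trig_rep.induct)
  case (mono d l)
  have "ip (U m (sc c (U k f))) (sc d (U l f)) = (c * cnj d) * ip (U m (U k f)) (U l f)"
   using f by (simp add: U_sc ip_sc_left ip_sc_right)
  also have "ip (U m (U k f)) (U l f) = ip (U (m + k - l) f) f"
   using U_comp[of f "U l f" m k] U_ip_shift[OF f f, of "m + k" l] f by simp
  also have "\<dots> = (\<integral>t. t powi (m + k - l) \<partial>\<sigma>)" using s by (simp add: spec_def)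
  also have "(c * cnj d) * \<dots> = (\<integral>t. (c * cnj d) * t powi (m + k - l) \<partial>\<sigma>)" by simp
  also have "\<dots> = (\<integral>t. t powi m * (c * t powi k) * cnj (d * t powi l) \<partial>\<sigma>)"
  proof (rule Bochner_Integration.integral_cong[OF refl])
   fix t assume "t : space \<sigma>"
   hence t: "t ~= 0" "cmod t = 1" using s circle_measure_space[of \<sigma>] by (auto simp: spec_def)
   have "t * cnj t = 1" using t by (simp add: complex_norm_square[symmetric])
   hence "cnj t = inverse t" by (simp add: inverse_unique)
   hence "cnj (t powi l) = t powi (- l)" by (simp add: power_int_minus power_int_inverse)
   moreover have "t powi (m + k - l) = t powi m * t powi k * t powi (- l)"
    using t by (simp add: power_int_add power_int_diff power_int_minus divide_inverse)
   ultimately show "(c * cnj d) * t powi (m + k - l) = t powi m * (c * t powi k) * cnj (d * t powi l)" by simp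
  qed
  finally show ?case .
 next
  case (add p v q w)
  have "v : H" "w : H" using trig_rep_H[OF f] add(1,2) by auto
  hence "ip (U m (sc c (U k f))) (v + w) = ip (U m (sc c (U k f))) v + ip (U m (sc c (U k f))) w"
   using f by (simp add: ip_add_right)
  also have "\<dots> = (\<integral>t. t powi m * (c * t powi k) * cnj (p t) + t powi m * (c * t powi k) * cnj (q t) \<partial>\<sigma>)"
   unfolding add using s add(1,2)
   by (intro Bochner_Integration.integral_add[symmetric] trig_poly_mult_integrable[where p = "%t. c * t powi k"])
     (auto intro: trig_poly.intros trig_rep_poly simp: spec_def)
  finally show ?case by (simp add: distrib_left)
 qed
next
 case (add p v p' v')
 have vH: "v : H" "v' : H" "w : H" using trig_rep_H[OF f] add by auto
 hence "ip (U m (v + v')) w = ip (U m v) w + ip (U m v') w" by (simp add: U_add ip_add_left)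
 also have "\<dots> = (\<integral>t. t powi m * p t * cnj (q t) + t powi m * p' t * cnj (q t) \<partial>\<sigma>)"
  unfolding add.IH(1)[OF add.prems] add.IH(2)[OF add.prems] using s add
  by (intro Bochner_Integration.integral_add[symmetric] trig_poly_mult_integrable)
    (auto intro: trig_rep_poly simp: spec_def)
 finally show ?case by (simp add: distrib_left distrib_right)
qed

lemma trig_rep_nrm_diff:
 assumes f: "f : H" and s: "spec f \<sigma>" and v: "trig_rep f p v" and w: "trig_rep f q w"
 shows "nrm (v - w) = l2_norm \<sigma> (%t. p t - q t)"
proof -
 interpret L: l2_space \<sigma> using s by (intro l2_space.intro circle_measure_finite) (simp add: spec_def)
 have H: "v : H" "w : H" using trig_rep_H[OF f] v w by auto
 have pq: "p : L2 \<sigma>" "q : L2 \<sigma>" using trig_rep_poly v w s by (auto intro!: trig_poly_L2 simp: spec_def)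
 have i: "ip x y = l2_inner \<sigma> p' q'" if "trig_rep f p' x" "trig_rep f q' y" for p' q' x y
  using trig_rep_ip[OF f s that, of 0] U_zero_ip[OF trig_rep_H[OF f that(1)] trig_rep_H[OF f that(2)]] by (simp add: l2_inner_def)
 have "ip (v - w) (v - w) = l2_inner \<sigma> (p - q) (p - q)"
  using H pq by (simp add: ip_diff_left ip_diff_right L.ip_diff_left L.ip_diff_right i[OF v v] i[OF v w] i[OF w v] i[OF w w])
 hence "nrm (v - w) = L.nrm (p - q)" by (simp add: nrm_def L.nrm_def)
 thus ?thesis by (simp add: L.nrm_eq minus_fun)
qed

text \<open>The vector is \<open>\<psi>(U) f\<close>: trigonometric polynomials approximating
  \<open>\<psi>\<close> in \<open>L2 (sm f)\<close> correspond isometrically to vectors, which thus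
  form a Cauchy sequence in the cyclic subspace.\<close>

lemma functional_calculus:
 assumes f: "f : H" and \<psi>: "\<psi> : L2 (sm f)"
 obtains h where "h : cyc {f}" "spec h (density (sm f) (%t. ennreal ((cmod (\<psi> t))^2)))"
proof -
 define \<sigma> where "\<sigma> = sm f"
 have s: "spec f \<sigma>" unfolding \<sigma>_def by (rule spec_sm[OF f])
 have \<sigma>: "circle_measure \<sigma>" using s by (simp add: spec_def)
 interpret L: l2_space \<sigma> by (rule l2_space.intro[OF circle_measure_finite[OF \<sigma>]])
 have \<psi>: "\<psi> : L2 \<sigma>" using \<psi> by (simp add: \<sigma>_def)
 obtain p where p: "!!n. p n : trig_poly" "(%n. l2_norm \<sigma> (%t. p n t - \<psi> t)) ----> 0"
  using trig_poly_dense_L2[OF \<sigma> \<psi>] by blast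
 have pt: "L.tends p \<psi>" using p(2) by (simp add: L.tends_def L.nrm_eq minus_fun)
 have pL: "p n : L2 \<sigma>" for n by (rule trig_poly_L2[OF \<sigma> p(1)])
 obtain v where v: "!!n. trig_rep f (p n) (v n)" using trig_rep_exists[OF p(1)] by metis
 have vc: "v n : cyc {f}" for n by (rule trig_rep_mem[OF csub_cyc orb_cyc v]) (use f in auto)
 have vH: "v n : H" for n using csub_mem[OF csub_cyc vc] .
 obtain h where h: "h : H" "tends v h"
 proof (rule cauchy_tends[OF vH])
  fix e :: real assume "e > 0"
  from L.tends_cauchy[OF pL \<psi> pt this]
  show "\<exists>N. \<forall>m\<ge>N. \<forall>n\<ge>N. nrm (v m - v n) < e"
   by (simp add: trig_rep_nrm_diff[OF f s v v] L.nrm_eq minus_fun)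
 qed
 have hc: "h : cyc {f}" by (rule csub_tends[OF csub_cyc vc h])
 have pw: "(%t. t powi m * \<phi> t) : L2 \<sigma>" if "\<phi> : L2 \<sigma>" for m \<phi>
 proof (rule L2I)
  have [measurable]: "\<phi> : borel_measurable \<sigma>" by (rule L2_measurable[OF that])
  have [measurable]: "(%t. t powi m) : borel_measurable \<sigma>" by (simp add: circle_measure_measurable[OF \<sigma>])
  show "(%t. t powi m * \<phi> t) : borel_measurable \<sigma>" by measurable
  have "integrable \<sigma> (%t. (cmod (\<phi> t))^2) \<longleftrightarrow> integrable \<sigma> (%t. (cmod (t powi m * \<phi> t))^2)"
   by (rule Bochner_Integration.integrable_cong)
     (auto simp: circle_measure_space[OF \<sigma>] norm_mult norm_power_int)
  thus "integrable \<sigma> (%t. (cmod (t powi m * \<phi> t))^2)" using L2_integrable_sq[OF that] by simp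
 qed
 define \<tau> where "\<tau> = density \<sigma> (%t. ennreal ((cmod (\<psi> t))^2))"
 have [measurable]: "\<psi> : borel_measurable \<sigma>" using L2_measurable[OF \<psi>] .
 have \<tau>: "circle_measure \<tau>" unfolding circle_measure_def
 proof
  have "emeasure \<tau> (space \<tau>) = (\<integral>\<^sup>+t. ennreal ((cmod (\<psi> t))^2) \<partial>\<sigma>)"
   by (simp add: \<tau>_def emeasure_density_total)
  also have "\<dots> = ennreal (\<integral>t. (cmod (\<psi> t))^2 \<partial>\<sigma>)" using L2_integrable_sq[OF \<psi>] by (intro nn_integral_eq_integral) auto
  finally show "finite_measure \<tau>" by (intro finite_measureI) simp
  show "sets \<tau> = sets circle_borel" using \<sigma> by (simp add: \<tau>_def circle_measure_sets)
 qed
 have "ip (U m h) h = (\<integral>t. t powi m \<partial>\<tau>)" for m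
 proof -
  have "(%n. ip (U m (v n)) (v n)) ----> ip (U m h) h" by (intro tends_ip U_tends U_mem vH h)
  moreover have "(%n. ip (U m (v n)) (v n)) ----> (\<integral>t. t powi m * \<psi> t * cnj (\<psi> t) \<partial>\<sigma>)"
  proof -
   have "L.tends (%n t. t powi m * p n t) (%t. t powi m * \<psi> t)"
   proof -
    have "L.nrm ((%t. t powi m * p n t) - (%t. t powi m * \<psi> t)) = L.nrm (p n - \<psi>)" for n
     unfolding L.nrm_eq l2_norm_def minus_fun by (intro arg_cong[where f = sqrt] Bochner_Integration.integral_cong refl)
       (auto simp: right_diff_distrib[symmetric] circle_measure_space[OF \<sigma>] norm_mult norm_power_int)
    thus ?thesis using pt by (simp add: L.tends_def)
   qed
   hence "(%n. l2_inner \<sigma> (%t. t powi m * p n t) (p n)) ----> l2_inner \<sigma> (%t. t powi m * \<psi> t) \<psi>"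
    by (intro L.tends_ip pw pL \<psi> pt)
   thus ?thesis by (simp add: l2_inner_def trig_rep_ip[OF f s v v])
  qed
  ultimately have "ip (U m h) h = (\<integral>t. t powi m * \<psi> t * cnj (\<psi> t) \<partial>\<sigma>)" using LIMSEQ_unique by blast
  also have "\<dots> = (\<integral>t. (cmod (\<psi> t))^2 *\<^sub>R t powi m \<partial>\<sigma>)"
   by (intro Bochner_Integration.integral_cong refl)
     (simp add: scaleR_conv_of_real complex_norm_square mult.assoc mult.commute del: of_real_power)
  also have "\<dots> = (\<integral>t. t powi m \<partial>\<tau>)"
  proof -
   have "(%t. t powi m) : borel_measurable \<sigma>" by (simp add: circle_measure_measurable[OF \<sigma>])
   moreover have "(%t. (cmod (\<psi> t))^2) : borel_measurable \<sigma>" by measurable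
   ultimately show ?thesis unfolding \<tau>_def by (intro integral_density[symmetric]) auto
  qed
  finally show ?thesis .
 qed
 hence "spec h \<tau>" using \<tau> by (simp add: spec_def)
 thus ?thesis using that[OF hc] by (simp add: \<tau>_def \<sigma>_def)
qed

text \<open>The functional calculus is applied to the square root of the Radon-Nikodym density,
  which is finite almost everywhere because \<open>\<tau>\<close> is finite.\<close>

lemma absolutely_continuous_spec:
 assumes f: "f : H" and \<tau>: "circle_measure \<tau>" and ac: "absolutely_continuous (sm f) \<tau>"
 obtains h where "h : cyc {f}" "spec h \<tau>"
proof -
 define \<sigma> where "\<sigma> = sm f"
 have \<sigma>: "circle_measure \<sigma>" unfolding \<sigma>_def by (rule sm_circle_measure[OF f])
 interpret s: finite_measure \<sigma> using circle_measure_finite[OF \<sigma>] .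
 interpret t: finite_measure \<tau> using circle_measure_finite[OF \<tau>] .
 have "\<exists>g \<in> borel_measurable \<sigma>. density \<sigma> g = \<tau>"
  by (rule s.Radon_Nikodym_finite_measure) (use ac \<sigma> \<tau> t.finite_measure_axioms in "auto simp: circle_measure_sets \<sigma>_def")
 then obtain g where g [measurable]: "g : borel_measurable \<sigma>" and d: "density \<sigma> g = \<tau>" by blast
 have "(\<integral>\<^sup>+x. g x \<partial>\<sigma>) = emeasure \<tau> (space \<tau>)" unfolding d[symmetric] by (simp add: emeasure_density_total)
 hence fin: "(\<integral>\<^sup>+x. g x \<partial>\<sigma>) ~= \<infinity>" by simp
 have AEf: "AE x in \<sigma>. g x ~= \<infinity>" by (rule nn_integral_PInf_AE[OF g fin])
 define \<psi> where "\<psi> x = complex_of_real (sqrt (enn2real (g x)))" for x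
 have sq: "(cmod (\<psi> x))^2 = enn2real (g x)" for x by (simp add: \<psi>_def)
 have AEg: "AE x in \<sigma>. g x = ennreal ((cmod (\<psi> x))^2)" using AEf by eventually_elim (simp add: sq less_top)
 have \<psi>m [measurable]: "\<psi> : borel_measurable \<sigma>" unfolding \<psi>_def by measurable
 have "\<psi> : L2 \<sigma>"
 proof (rule L2I[OF \<psi>m])
  have "(\<integral>\<^sup>+x. ennreal ((cmod (\<psi> x))^2) \<partial>\<sigma>) = (\<integral>\<^sup>+x. g x \<partial>\<sigma>)"
   using AEg by (intro nn_integral_cong_AE) auto
  thus "integrable \<sigma> (%x. (cmod (\<psi> x))^2)" using fin by (intro integrableI_bounded) (auto simp: less_top)
 qed
 then obtain h where h: "h : cyc {f}" "spec h (density \<sigma> (%t. ennreal ((cmod (\<psi> t))^2)))"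
  using functional_calculus[OF f] unfolding \<sigma>_def by blast
 have "density \<sigma> (%t. ennreal ((cmod (\<psi> t))^2)) = density \<sigma> g" using AEg by (intro density_cong) auto
 thus ?thesis using that[OF h(1)] h(2) d by simp
qed

lemma null_vectors_iff:
 "h : H ==> h : null_vectors N \<longleftrightarrow> emeasure (sm h) N = 0"
 using finite_measure.emeasure_eq_measure[OF circle_measure_finite[OF sm_circle_measure], of h N] by (simp add: null_vectors_def)

lemma absolutely_continuous_smI:
 assumes \<sigma>: "circle_measure \<sigma>" and h: "h : H"
  and n: "!!N. N : sets circle_borel ==> emeasure \<sigma> N = 0 ==> h : null_vectors N"
 shows "absolutely_continuous \<sigma> (sm h)" using n \<sigma> sm_circle_measure[OF h] null_vectors_iff[OF h]
 by (auto simp: absolutely_continuous_def null_sets_def circle_measure_sets)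

text \<open>Gram-Schmidt over cyclic subspaces makes the \<open>f k\<close> orthogonal; a convergent sum with non-zero
 coefficients then has a spectral measure that dominates those of all the \<open>f k\<close>.\<close>

lemma dominating_vector:
 fixes f :: "nat => 'a"
 assumes V: "csub V" "U_inv V" and f: "!!k. f k : V"
 obtains h where "h : V" "!!k N. N : sets circle_borel ==> h : null_vectors N ==> f k : null_vectors N"
proof -
 have fH: "f k : H" for k using csub_mem[OF V(1) f] .
 define C where "C k = cyc (f ` {..<k})" for k
 have C: "csub (C k)" "U_inv (C k)" for k unfolding C_def by (rule csub_cyc, rule U_inv_cyc) (use fH in auto)
 have CH: "C k \<subseteq> H" for k using csub_mem[OF C(1)] by blast
 have Cmono: "C i \<subseteq> C k" if "i <= k" for i k unfolding C_def using that by (intro cyc_mono) auto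
 have CV: "C k \<subseteq> V" for k unfolding C_def by (intro cyc_least V) (use f in auto)
 have fC: "f i : C k" if "i < k" for i k unfolding C_def using that fH by (intro subsetD[OF cyc_superset]) auto
 have "\<exists>p. p : C k \<and> f k - p : ortho (C k)" for k using projection[OF C(1) fH] by metis
 then obtain p where p: "!!k. p k : C k" "!!k. f k - p k : ortho (C k)" by metis
 define g where "g k = f k - p k" for k
 have gV: "g k : V" for k unfolding g_def by (intro csub_diff[OF V(1)] f subsetD[OF CV p(1)])
 have gH: "g k : H" for k using csub_mem[OF V(1) gV] .
 have gC: "g i : C k" if "i < k" for i k
  unfolding g_def using fC[OF that] p(1)[of i] Cmono[of i k] that by (intro csub_diff[OF C(1)]) auto
 have orth1: "ip (U n (g k)) (g i) = 0" if "i < k" for i k n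
 proof -
  have "U n (g k) : ortho (C k)" using U_inv_ortho[OF CH C(2)] p(2)[of k] by (auto simp: U_inv_def g_def)
  thus ?thesis using gC[OF that] by (rule ortho_ip)
 qed
 have orth: "ip (U n (g k)) (g i) = 0" if "i ~= k" for i k n
 proof (cases "i < k")
  case True thus ?thesis by (rule orth1)
 next
  case False
  hence "ip (U (- n) (g i)) (g k) = 0" using that by (intro orth1) auto
  thus ?thesis using U_adj[OF gH gH, of n k i] ip_cnj[of "U (- n) (g i)" "g k"] gH by simp
 qed
 \<comment> \<open>Positive even when \<open>g k\<close> has norm zero, and small enough for the
   norms of the \<open>w k\<close> to be summable.\<close>
 define c where "c k = (1/2)^k / (1 + nrm (g k))" for k
 have c: "c k > 0" for k using nrm_nonneg[OF gH[of k]] by (simp add: c_def add_pos_nonneg)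
 define w where "w k = sc (of_real (c k)) (g k)" for k
 have wV: "w k : V" for k unfolding w_def by (intro csub_sc[OF V(1)] gV)
 have wH: "w k : H" for k using csub_mem[OF V(1) wV] .
 have wn: "nrm (w k) <= (1/2)^k" for k
 proof -
  have "nrm (w k) = c k * nrm (g k)" unfolding w_def using c[of k] gH by (simp add: nrm_sc)
  also have "\<dots> = (1/2)^k * (nrm (g k) / (1 + nrm (g k)))" by (simp add: c_def)
  also have "\<dots> <= (1/2)^k * 1" using nrm_nonneg[OF gH[of k]] by (intro mult_left_mono) auto
  finally show ?thesis by simp
 qed
 have "summable (%k. nrm (w k))"
  by (rule summable_comparison_test'[of "%k. (1/2)^k"]) (use wn wH in "auto simp: summable_geometric")
 then obtain h where h: "h : H" "tends (%n. \<Sum>i<n. w i) h" using abs_summable_tends[of w, OF wH] by blast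
 have hV: "h : V" by (rule csub_tends[OF V(1) _ h]) (intro csub_sum[OF V(1)] wV)
 have worth: "ip (U n (w k)) (w i) = 0" if "i ~= k" for i k n
  unfolding w_def using gH orth[OF that] by (simp add: U_sc ip_sc_left ip_sc_right)
 have wh: "ip (U n (w k)) (h - w k) = 0" for n k
 proof -
  have "(%m. ip (U n (w k)) (\<Sum>i<m. w i)) ----> ip (U n (w k)) h" by (rule tends_ip_right) (use wH h in auto)
  moreover have "(%m. ip (U n (w k)) (\<Sum>i<m. w i)) ----> ip (U n (w k)) (w k)"
  proof (rule tendsto_eventually, rule eventually_sequentiallyI[of "Suc k"])
   fix m assume "Suc k <= m"
   have "ip (U n (w k)) (\<Sum>i<m. w i) = (\<Sum>i<m. ip (U n (w k)) (w i))" using wH by (subst ip_sum_right) auto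
   also have "\<dots> = (\<Sum>i<m. if i = k then ip (U n (w k)) (w k) else 0)" using worth by (intro sum.cong) auto
   finally show "ip (U n (w k)) (\<Sum>i<m. w i) = ip (U n (w k)) (w k)" using \<open>Suc k <= m\<close> by simp
  qed
  ultimately have "ip (U n (w k)) h = ip (U n (w k)) (w k)" using LIMSEQ_unique by blast
  thus ?thesis using wH h(1) by (simp add: ip_diff_right)
 qed
 have gN: "g k : null_vectors N" if N: "N : sets circle_borel" and hN: "h : null_vectors N" for k N
 proof -
  have "measure (sm (w k + (h - w k))) N = measure (sm (w k)) N + measure (sm (h - w k)) N"
   by (rule sm_add_orth[OF _ _ N wh]) (use wH h in auto)
  moreover have "measure (sm (w k + (h - w k))) N = 0" using hN by (simp add: null_vectors_def)
  ultimately have "measure (sm (w k)) N = 0" using measure_nonneg[of "sm (w k)" N] measure_nonneg[of "sm (h - w k)" N] by linarith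
  hence "w k : null_vectors N" using wH by (simp add: null_vectors_def)
  hence "sc (1 / of_real (c k)) (w k) : null_vectors N" by (rule csub_sc[OF csub_null_vectors[OF N]])
  thus ?thesis using c[of k] by (simp add: w_def)
 qed
 show ?thesis
 proof (rule that[OF hV])
  fix k N assume N: "N : sets circle_borel" and hN: "h : null_vectors N"
  \<comment> \<open>\<open>f k\<close> is \<open>g k\<close> plus a vector \<open>p k\<close> of the
    cyclic subspace generated by the earlier members, which lies in \<open>null_vectors N\<close> by
    induction.\<close>
  show "f k : null_vectors N"
  proof (induction k rule: less_induct)
   case (less k)
   have "C k \<subseteq> null_vectors N"
    unfolding C_def by (intro cyc_least csub_null_vectors[OF N] U_inv_null_vectors) (use less in auto)
   hence "g k + p k : null_vectors N" using gN[OF N hN] p(1) by (intro csub_add[OF csub_null_vectors[OF N]]) auto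
   thus ?case by (simp add: g_def)
  qed
 qed
qed

text \<open>The spectral measure of an eigenvector is \<open>(nrm e)^2\<close> times the point mass
  at its eigenvalue.\<close>

lemma eigenvector_null:
 fixes \<theta> :: complex
 assumes e: "e : H" and \<theta>: "!!n. nrm (U n e - sc (\<theta> powi n) e) = 0" and l: "cmod \<theta> = 1"
  and N: "N : sets circle_borel" "\<theta> \<notin> N"
 shows "e : null_vectors N"
proof -
 define \<rho> where "\<rho> = density (return circle_borel \<theta>) (%_. ennreal ((nrm e)^2))"
 have ls: "\<theta> : space circle_borel" using l by simp
 have r: "circle_measure (return circle_borel \<theta>)"
  using prob_space_return[OF ls] by (simp add: circle_measure_def prob_space_def)
 have "spec e \<rho>" unfolding spec_def
 proof (intro conjI allI)
  show "circle_measure \<rho>" unfolding \<rho>_def by (rule circle_measure_density_const[OF r]) simp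
  fix n
  have "ip (U n e) e = \<theta> powi n * ip e e" using ip_cong[OF _ _ e \<theta>[of n]] e by (simp add: ip_sc_left)
  also have "\<dots> = (nrm e)^2 *\<^sub>R (\<integral>t. t powi n \<partial>return circle_borel \<theta>)"
   using ls e by (subst integral_return) (auto simp: ip_self scaleR_conv_of_real)
  also have "\<dots> = (\<integral>t. t powi n \<partial>\<rho>)"
   unfolding \<rho>_def by (rule circle_measure_density_const(2)[OF r, symmetric]) simp
  finally show "ip (U n e) e = (\<integral>t. t powi n \<partial>\<rho>)" .
 qed
 hence "sm e = \<rho>" by (rule sm_eq)
 moreover have "emeasure \<rho> N = 0" unfolding \<rho>_def using N by (subst emeasure_density) (auto simp: nn_integral_cmult)
 ultimately show ?thesis using null_vectors_iff[OF e] by simp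
qed

end

section \<open>Joint eigenvectors of abelian groups\<close>

context semi_hilbert
begin

lemma nrm_diff_eq0_add:
 "x : H ==> x' : H ==> y : H ==> y' : H ==> nrm (x - x') = 0 ==> nrm (y - y') = 0 ==> nrm ((x + y) - (x' + y')) = 0"
 by (rule antisym) (use nrm_triangle[of "x - x'" "y - y'"] in "auto simp: algebra_simps")

lemma nrm_diff_eq0_sc: "x : H ==> x' : H ==> nrm (x - x') = 0 ==> nrm (sc c x - sc c x') = 0"
 by (simp add: sc_diff_right[symmetric] nrm_sc)

lemma nrm_eq0_orthoI:
 assumes V: "csub V" and x: "x : V" and o: "!!r. r : V ==> ip x r = 0" shows "nrm x = 0"
 using o[OF x] csub_mem[OF V x] by (intro ip_self_eq_0)

lemma normalize:
 assumes V: "csub V" and x: "x : V" "nrm x ~= 0"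
 obtains c where "c ~= 0" "sc c x : V" "nrm (sc c x) = 1"
proof (rule that[of "of_real (1 / nrm x)"])
 have xH: "x : H" using csub_mem[OF V x(1)] .
 show "nrm (sc (complex_of_real (1 / nrm x)) x) = 1" using x(2) nrm_nonneg[OF xH] by (simp add: nrm_sc[OF xH] norm_divide)
qed (use x csub_sc[OF V] in auto)

text \<open>For a bounded symmetric operator \<open>S\<close> with norm \<open>m\<close> on \<open>V\<close>, vectors almost attaining the
 norm are almost eigenvectors of \<open>S^2\<close> for \<open>m^2\<close>.\<close>

lemma approx_top_eigenvector:
 assumes V: "csub V" and S: "!!x. x : V ==> S x : V"
  and hom: "!!c x. x : V ==> nrm (S (sc c x)) = cmod c * nrm (S x)"
  and sym: "!!x y. x : V ==> y : V ==> ip (S x) y = ip x (S y)"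
  and bd: "!!x. x : V ==> nrm (S x) <= B * nrm x" and ne: "\<exists>x\<in>V. nrm x ~= 0"
 obtains m p where "m \<ge> 0" "!!x. x : V ==> nrm (S x) <= m * nrm x" "!!n. p n : V" "!!n::nat. nrm (p n) = 1"
  "(%n. nrm (S (S (p n)) - sc (of_real (m^2)) (p n))) ----> 0"
proof -
 have VH: "x : H" if "x : V" for x using csub_mem[OF V that] .
 define A where "A = {nrm (S x) | x. x : V \<and> nrm x = 1}"
 obtain x0 where x0: "x0 : V" "nrm x0 = 1" using normalize[OF V] ne by metis
 have A: "A ~= {}" "bdd_above A" using x0 bd by (auto simp: A_def intro!: bdd_aboveI[of _ B]) (metis mult.right_neutral)
 define m where "m = Sup A"
 have mA: "a <= m" if "a : A" for a unfolding m_def using that A(2) by (rule cSup_upper)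
 have "nrm (S x0) : A" using x0 by (auto simp: A_def)
 from order_trans[OF nrm_nonneg[OF VH[OF S[OF x0(1)]]] mA[OF this]] have m0: "m \<ge> 0" .
 have mb: "nrm (S x) <= m * nrm x" if x: "x : V" for x
 proof (cases "nrm x = 0")
  case True thus ?thesis using bd[OF x] by simp
 next
  case False
  obtain c where c: "c ~= 0" "sc c x : V" "nrm (sc c x) = 1" using normalize[OF V x False] .
  hence "nrm (S (sc c x)) <= m" by (intro mA) (auto simp: A_def)
  hence "cmod c * nrm (S x) <= m" using hom[OF x] by simp
  also have "\<dots> = cmod c * (m * nrm x)" using c(3) VH[OF x] by (simp add: nrm_sc algebra_simps)
  finally show ?thesis using c(1) by simp
 qed
 have "\<exists>a\<in>A. m - 1 / Suc n < a" for n using less_cSupD[OF A(1), of "m - 1 / Suc n"] unfolding m_def by auto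
 hence "\<exists>x. x : V \<and> nrm x = 1 \<and> m - 1 / Suc n < nrm (S x)" for n unfolding A_def by blast
 then obtain p where p: "!!n. p n : V" "!!n. nrm (p n) = 1" "!!n. m - 1 / Suc n < nrm (S (p n))" by metis
 have pm: "nrm (S (p n)) <= m" for n using mb[OF p(1)] p(2) by simp
 have "(%n. nrm (S (p n))) ----> m"
 proof (rule tendsto_sandwich[of "%n. m - 1 / Suc n" _ _ "%n. m"])
  show "(%n. m - 1 / real (Suc n)) ----> m"
   using tendsto_diff[OF tendsto_const[of m] LIMSEQ_inverse_real_of_nat] by (simp add: inverse_eq_divide)
 qed (use p(3) pm in "auto intro!: always_eventually less_imp_le")
 hence "(%n. m^2 * m^2 - m^2 * (nrm (S (p n)))^2) ----> m^2 * m^2 - m^2 * m^2" by (intro tendsto_intros)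
 hence l: "(%n. m^2 * m^2 - m^2 * (nrm (S (p n)))^2) ----> 0" by simp
 \<comment> \<open>Symmetry turns the cross term into \<open>m^2 * (nrm (S (p n)))^2\<close>; the
   bound vanishes in the limit since \<open>nrm (S (p n))\<close> tends to \<open>m\<close>.\<close>
 have sq: "(nrm (S (S (p n)) - sc (of_real (m^2)) (p n)))^2 <= m^2 * m^2 - m^2 * (nrm (S (p n)))^2" for n
 proof -
  have h: "p n : H" "S (p n) : H" "S (S (p n)) : H" using VH S p(1) by auto
  have "Re (ip (S (S (p n))) (sc (of_real (m^2)) (p n))) = m^2 * (nrm (S (p n)))^2"
   using h sym[OF S[OF p(1)] p(1)] by (simp add: ip_sc_right ip_self del: of_real_power)
  moreover have "(nrm (sc (of_real (m^2)) (p n)))^2 = m^2 * m^2" using h p(2) by (simp add: nrm_sc power2_eq_square norm_mult)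
  moreover have "(nrm (S (S (p n))))^2 <= (m * nrm (S (p n)))^2" using mb[OF S[OF p(1)]] h by (intro power_mono) auto
  ultimately show ?thesis using h by (simp add: nrm_diff_sq power_mult_distrib)
 qed
 have "(%n. (nrm (S (S (p n)) - sc (of_real (m^2)) (p n)))^2) ----> 0"
  by (rule tendsto_sandwich[OF _ _ tendsto_const[of 0] l]) (use sq in "auto intro!: always_eventually")
 from tendsto_real_sqrt[OF this]
 have "(%n. nrm (S (S (p n)) - sc (of_real (m^2)) (p n))) ----> 0" using VH S p(1) by simp
 thus ?thesis using m0 mb p(1,2) by (intro that[of m p]) blast+
qed

end

text \<open>\<open>K\<close> is a set of group elements without topology, and the group laws hold up
  to norm zero. Total boundedness of orbits stands in for compactness of the closure of the
  group.\<close>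

locale abelian_rep = semi_hilbert +
 fixes E :: "'a set" and K :: "'k set" and V :: "'k => 'a => 'a"
 assumes E: "csub E" and K_ne: "K ~= {}"
  and V_E: "u : K ==> x : E ==> V u x : E"
  and V_add: "u : K ==> x : E ==> y : E ==> V u (x + y) = V u x + V u y"
  and V_sc: "u : K ==> x : E ==> V u (sc c x) = sc c (V u x)"
  and V_ip: "u : K ==> x : E ==> y : E ==> ip (V u x) (V u y) = ip x y"
  and V_comp: "u : K ==> w : K ==> \<exists>z\<in>K. \<forall>x\<in>E. nrm (V u (V w x) - V z x) = 0"
  and V_inverse: "u : K ==> \<exists>z\<in>K. \<forall>x\<in>E. nrm (V u (V z x) - x) = 0 \<and> nrm (V z (V u x) - x) = 0"
  and V_comm: "u : K ==> w : K ==> x : E ==> nrm (V u (V w x) - V w (V u x)) = 0"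
  and tot_bdd: "x : E ==> e > 0 ==> \<exists>K0\<subseteq>K. finite K0 \<and> (\<forall>u\<in>K. \<exists>w\<in>K0. nrm (V u x - V w x) < e)"
begin

lemma E_H [simp]: "x : E ==> x : H" by (rule csub_mem[OF E])

lemma V_minus: "u : K ==> x : E ==> V u (- x) = - V u x" using V_sc[of u x "-1"] by (simp add: sc_minus_one)

lemma V_diff: "u : K ==> x : E ==> y : E ==> V u (x - y) = V u x - V u y"
 using V_add[of u x "- y"] V_minus[of u y] csub_sc[OF E, of y "-1"] by (simp add: sc_minus_one)

lemma V_nrm: "u : K ==> x : E ==> nrm (V u x) = nrm x" by (simp add: nrm_def V_ip)

definition good :: "'a set => bool" where
 "good A \<longleftrightarrow> csub A \<and> A \<subseteq> E \<and> (\<forall>u\<in>K. \<forall>x\<in>A. V u x : A) \<and> (\<exists>x\<in>A. nrm x ~= 0)"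

text \<open>The last hypothesis says that \<open>(S - \<alpha>) (S - \<beta>) p = 0\<close>: if
  \<open>(S - \<beta>) p\<close> has norm zero then \<open>p\<close> is an eigenvector, otherwise
  \<open>(S - \<beta>) p\<close> is one.\<close>

lemma eigenvector_from_square:
 assumes A: "csub A" and S: "!!x. x : A ==> S x : A"
  and lin: "!!c x y. x : A ==> y : A ==> S (x - sc c y) = S x - sc c (S y)"
  and p: "p : A" "nrm p ~= 0" and eq: "nrm (S (S p) - sc (\<alpha> + \<beta>) (S p) + sc (\<alpha> * \<beta>) p) = 0"
 shows "\<exists>y\<in>A. \<exists>\<gamma>\<in>{\<alpha>, \<beta>}. nrm y ~= 0 \<and> nrm (S y - sc \<gamma> y) = 0"
proof -
 define y where "y = S p - sc \<beta> p"
 have y: "y : A" unfolding y_def by (intro csub_diff[OF A] csub_sc[OF A] S p)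
 show ?thesis
 proof (cases "nrm y = 0")
  case True thus ?thesis using p by (auto simp: y_def)
 next
  case False
  have "S y - sc \<alpha> y = S (S p) - sc (\<alpha> + \<beta>) (S p) + sc (\<alpha> * \<beta>) p"
   unfolding y_def using p S by (simp add: lin sc_diff_right sc_add_left algebra_simps)
  hence "nrm (S y - sc \<alpha> y) = 0" using eq by simp
  thus ?thesis using False y by blast
 qed
qed

text \<open>\<open>V u\<close> is unitary rather than symmetric, so the variational argument is
  applied to \<open>S = V u + V w\<close> with \<open>w\<close> inverse to \<open>u\<close>.
  Compactness gives an eigenvector of \<open>S^2\<close>, factoring \<open>S^2 - m^2\<close> gives
  one of \<open>S\<close> with some eigenvalue \<open>c\<close>, and on it \<open>V u\<close>
  satisfies \<open>z^2 - c z + 1 = 0\<close>, which factors again.\<close>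

lemma eigenvector_in_compact:
 assumes A: "good A" and u: "u : K"
  and cpt: "!!p. (!!n. p n : A \<and> nrm (p n) <= 1) ==> \<exists>s p0. strict_mono s \<and> p0 : A \<and> tends (p \<circ> (s :: nat => nat)) p0"
 obtains \<gamma> y where "y : A" "nrm y ~= 0" "nrm (V u y - sc \<gamma> y) = 0"
proof -
 have cA: "csub A" and AE: "!!x. x : A ==> x : E" and inv: "!!u x. u : K ==> x : A ==> V u x : A" using A by (auto simp: good_def)
 have AH: "!!x. x : A ==> x : H" using AE by simp
 obtain w where w: "w : K" "!!x. x : E ==> nrm (V u (V w x) - x) = 0" "!!x. x : E ==> nrm (V w (V u x) - x) = 0"
  using V_inverse[OF u] by blast
 define S where "S x = V u x + V w x" for x
 have SA: "S x : A" if "x : A" for x unfolding S_def using that u w inv by (intro csub_add[OF cA]) auto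
 have adj: "ip (V u x) y = ip x (V w y)" if "x : A" "y : A" for x y
 proof -
  have "ip (V u x) y = ip (V u x) (V u (V w y))"
   using ip_cong_right[of "V u (V w y)" y "V u x"] w(2)[OF AE[OF that(2)]] that AE V_E u w(1) by simp
  thus ?thesis using V_ip[OF u] that AE V_E w(1) by simp
 qed
 have Slin: "S (x - sc c y) = S x - sc c (S y)" if "x : A" "y : A" for x y c
  using that AE csub_sc[OF E] u w(1) by (simp add: S_def V_diff V_sc sc_add_right)
 have Ssc: "S (sc c x) = sc c (S x)" if "x : A" for x c using that AE u w(1) by (simp add: S_def V_sc sc_add_right)
 have adj2: "ip (V w x) y = ip x (V u y)" if "x : A" "y : A" for x y
  using adj[OF that(2,1)] ip_cnj[of "V w x" y] ip_cnj[of x "V u y"] that AH inv u w(1) by (metis ip_cnj)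
 have Sb: "nrm (S x) <= 2 * nrm x" if "x : A" for x
  unfolding S_def using nrm_triangle[of "V u x" "V w x"] V_nrm AE V_E u w(1) that by simp
 have ne: "\<exists>x\<in>A. nrm x ~= 0" using A by (simp add: good_def)
 obtain m p where mp: "m \<ge> 0" "!!n. p n : A" "!!n::nat. nrm (p n) = 1"
  "(%n. nrm (S (S (p n)) - sc (of_real (m^2)) (p n))) ----> 0"
 proof (rule approx_top_eigenvector[OF cA SA _ _ Sb ne])
  show "nrm (S (sc c x)) = cmod c * nrm (S x)" if "x : A" for c x using that SA AH by (simp add: Ssc nrm_sc)
  show "ip (S x) y = ip x (S y)" if "x : A" "y : A" for x y
   unfolding S_def using that AH inv u w(1) by (simp add: ip_add_left ip_add_right adj adj2)
 qed blast+
 obtain s p0 where s: "strict_mono s" "p0 : A" "tends (p \<circ> s) p0" using cpt[of p] mp by auto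
 have psA: "(p \<circ> s) n : A" for n using mp by simp
 have St: "tends (%n. S (F n)) (S f)" if "!!n. F n : A" "f : A" "tends F f" for F f
 proof (rule tends_bound[where b = "%n. 2 * nrm (F n - f)"])
  show "nrm (S (F n) - S f) <= 2 * nrm (F n - f)" for n
   using Sb[OF csub_diff[OF cA that(1) that(2)], of n] Slin[OF that(1,2), of n 1] by simp
  show "(%n. 2 * nrm (F n - f)) ----> 0" using tendsto_mult_left[of _ 0 _ 2] that(3) by (simp add: tends_def)
 qed (use that SA AH in auto)
 have n0: "nrm p0 = 1" using LIMSEQ_unique[OF tends_nrm[OF _ _ s(3)], of 1] mp AH s(2) by (simp add: comp_def)
 have "tends (%n. S (S ((p \<circ> s) n)) - sc (of_real (m^2)) ((p \<circ> s) n)) (S (S p0) - sc (of_real (m^2)) p0)"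
 proof (rule tends_diff)
  show "tends (%n. S (S ((p \<circ> s) n))) (S (S p0))" using SA psA s(2,3) by (intro St) (auto simp: comp_def)
  show "tends (%n. sc (of_real (m^2)) ((p \<circ> s) n)) (sc (of_real (m^2)) p0)"
   using psA s AH by (intro tends_sc) (auto simp: comp_def)
 qed (use SA psA s(2) AH in auto)
 from tends_nrm[OF _ _ this]
 have "(%n. nrm (S (S (p (s n))) - sc (of_real (m^2)) (p (s n)))) ----> nrm (S (S p0) - sc (of_real (m^2)) p0)"
  using SA mp s(2) AH by simp
 moreover have "(%n. nrm (S (S (p (s n))) - sc (of_real (m^2)) (p (s n)))) ----> 0"
  using LIMSEQ_subseq_LIMSEQ[OF mp(4) s(1)] by (simp add: comp_def)
 ultimately have z: "nrm (S (S p0) - sc (of_real (m^2)) p0) = 0" using LIMSEQ_unique by blast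
 have "\<exists>y\<in>A. \<exists>\<gamma>\<in>{of_real m, - of_real m}. nrm y ~= 0 \<and> nrm (S y - sc \<gamma> y) = 0"
  by (rule eigenvector_from_square[OF cA SA Slin s(2)]) (use n0 z in "auto simp: power2_eq_square sc_minus_left")
 then obtain y c where y: "y : A" "nrm y ~= 0" "nrm (S y - sc c y) = 0" by blast
 define d where "d = csqrt (c^2 - 4)"
 have d: "d^2 = c^2 - 4" by (simp add: d_def)
 have sumprod: "(c + d) / 2 + (c - d) / 2 = c" "(c + d) / 2 * ((c - d) / 2) = 1"
  using d by (simp_all add: field_simps power2_eq_square)
 have "nrm (V u (V u y) - sc c (V u y) + y) = 0"
 proof -
  have yE: "y : E" using y(1) AE by simp
  have "nrm (V u (S y - sc c y)) = 0" using V_nrm[OF u, of "S y - sc c y"] y csub_diff[OF cA SA[OF y(1)] csub_sc[OF cA y(1)]] AE by simp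
  moreover have "V u (S y - sc c y) = V u (V u y) + V u (V w y) - sc c (V u y)"
   unfolding S_def using yE V_E u w(1) csub_sc[OF E] csub_add[OF E] by (simp add: V_diff V_add V_sc)
  ultimately have 1: "nrm (V u (V u y) + V u (V w y) - sc c (V u y)) = 0" by simp
  have 2: "nrm ((V u (V u y) + V u (V w y) - sc c (V u y)) - (V u (V u y) - sc c (V u y) + y)) = 0"
   using w(2)[OF yE] by (simp add: algebra_simps)
  have "V u (V u y) : H" "V u (V w y) : H" "V u y : H" "y : H" using yE V_E u w(1) by auto
  thus ?thesis using nrm_cong[OF _ _ 2] 1 by simp
 qed
 hence "\<exists>y'\<in>A. \<exists>\<gamma>\<in>{(c + d) / 2, (c - d) / 2}. nrm y' ~= 0 \<and> nrm (V u y' - sc \<gamma> y') = 0"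
  by (intro eigenvector_from_square[OF cA, of "V u" y])
    (use y u inv AE csub_sc[OF E] sumprod in "auto simp: V_diff V_sc")
 thus ?thesis using that by blast
qed

text \<open>An infinite descending chain of invariant subspaces would yield an orthonormal sequence,
  which has no convergent subsequence. In a minimal non-zero invariant subspace every eigenspace of
  a \<open>V u\<close> is invariant by commutativity, so it is everything and \<open>V u\<close> is
  scalar there.\<close>

lemma joint_eigenvector_of_compact:
 assumes F: "good F"
  and cpt: "!!p. (!!n. p n : F \<and> nrm (p n) <= 1) ==> \<exists>s p0. strict_mono s \<and> p0 : F \<and> tends (p \<circ> (s :: nat => nat)) p0"
 obtains p where "p : F" "nrm p ~= 0" "!!u. u : K ==> \<exists>\<gamma>. nrm (V u p - sc \<gamma> p) = 0"
proof -
 define R where "R = {(A, B). good A \<and> good B \<and> A \<subset> B \<and> B \<subseteq> F}"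
 have "wf R" unfolding wf_iff_no_infinite_down_chain
 proof
  assume "\<exists>f. \<forall>i. (f (Suc i), f i) : R"
  then obtain f where "!!i. (f (Suc i), f i) : R" by blast
  hence f: "!!i. good (f i)" "!!i. f (Suc i) \<subset> f i" "!!i. f i \<subseteq> F" by (auto simp: R_def)
  have mono: "f j \<subseteq> f i" if "i <= j" for i j using lift_Suc_antimono_le[of f i j] f(2) that by blast
  have cs: "csub (f i)" for i using f(1) by (simp add: good_def)
  have "\<exists>x. x : f i \<and> nrm x = 1 \<and> x : ortho (f (Suc i))" for i
  proof -
   obtain y where y: "y : f i" "y \<notin> f (Suc i)" using f(2)[of i] by auto
   obtain p where p: "p : f (Suc i)" "y - p : ortho (f (Suc i))" using projection[OF cs csub_mem[OF cs y(1)]] .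
   have yp: "y - p : f i" using y p mono[of i "Suc i"] by (intro csub_diff[OF cs]) auto
   have "nrm (y - p) ~= 0"
    using csub_cong[OF cs p(1) csub_mem[OF cs y(1)]] nrm_diff_commute[OF csub_mem[OF cs y(1)] csub_mem[OF cs p(1)]] y(2) by auto
   then obtain c where "sc c (y - p) : f i" "nrm (sc c (y - p)) = 1" using normalize[OF cs yp] by metis
   moreover have "sc c (y - p) : ortho (f (Suc i))" using p(2) csub_mem[OF cs] by (intro csub_sc[OF csub_ortho]) auto
   ultimately show ?thesis by blast
  qed
  then obtain x where x: "!!i. x i : f i" "!!i. nrm (x i) = 1" "!!i. x i : ortho (f (Suc i))" by metis
  have xH: "x i : H" for i using csub_mem[OF cs x(1)] .
  have orth: "ip (x i) (x j) = 0" if "i < j" for i j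
   using ortho_ip[OF x(3)[of i], of "x j"] x(1)[of j] mono[of "Suc i" j] that by auto
  have d: "(nrm (x i - x j))^2 = 2" if "i < j" for i j using nrm_diff_sq[OF xH xH, of i j] orth[OF that] x(2) by simp
  obtain s p0 where s: "strict_mono s" "p0 : F" "tends (x \<circ> s) p0" using cpt[of x] x f(3) by fastforce
  have "p0 : H" using s(2) F csub_mem by (auto simp: good_def)
  from tends_cauchy[OF _ this s(3), of 1] xH
  obtain N where "\<forall>m\<ge>N. \<forall>n\<ge>N. nrm (x (s m) - x (s n)) < 1" by auto
  hence "nrm (x (s N) - x (s (Suc N))) < 1" by simp
  hence "(nrm (x (s N) - x (s (Suc N))))^2 < 1^2" using xH by (intro power_strict_mono) auto
  thus False using d[of "s N" "s (Suc N)"] s(1) by (simp add: strict_mono_def)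
 qed
 moreover have "F : {A. good A \<and> A \<subseteq> F}" using F by simp
 ultimately obtain A where A: "A : {A. good A \<and> A \<subseteq> F}" and min: "!!B. (B, A) : R ==> B \<notin> {A. good A \<and> A \<subseteq> F}"
  by (rule wfE_min) blast
 have gA: "good A" "A \<subseteq> F" using A by auto
 have cA: "csub A" and AE: "!!x. x : A ==> x : E" and inv: "!!u x. u : K ==> x : A ==> V u x : A"
  using gA(1) by (auto simp: good_def)
 have cptA: "\<exists>s p0. strict_mono s \<and> p0 : A \<and> tends (p \<circ> (s :: nat => nat)) p0" if p: "!!n. p n : A \<and> nrm (p n) <= 1" for p
 proof -
  obtain s p0 where s: "strict_mono s" "p0 : F" "tends (p \<circ> s) p0" using cpt[of p] p gA(2) by blast
  have "p0 : H" using s(2) F csub_mem by (auto simp: good_def)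
  hence "p0 : A" using csub_tends[OF cA, of "p \<circ> s" p0] p s(3) by simp
  thus ?thesis using s by blast
 qed
 have eig: "\<exists>\<gamma>. \<forall>x\<in>A. nrm (V u x - sc \<gamma> x) = 0" if u: "u : K" for u
 proof -
  obtain \<gamma> y where y: "y : A" "nrm y ~= 0" "nrm (V u y - sc \<gamma> y) = 0"
   using eigenvector_in_compact[OF gA(1) u cptA] by blast
  define B where "B = {x : A. nrm (V u x - sc \<gamma> x) = 0}"
  have VH: "V u x : H" "x : H" if "x : A" for x using that AE V_E[OF u] by auto
  have "csub B"
  proof (rule csubI)
   show "x + z : B" if "x : B" "z : B" for x z
   proof -
    have "nrm ((V u x + V u z) - (sc \<gamma> x + sc \<gamma> z)) = 0"
     using that VH by (intro nrm_diff_eq0_add) (auto simp: B_def)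
    thus ?thesis using that csub_add[OF cA] AE by (simp add: B_def V_add[OF u] sc_add_right)
   qed
   show "sc c x : B" if "x : B" for c x
   proof -
    have "nrm (sc c (V u x) - sc c (sc \<gamma> x)) = 0" using that VH by (intro nrm_diff_eq0_sc) (auto simp: B_def)
    thus ?thesis using that csub_sc[OF cA] AE by (simp add: B_def V_sc[OF u] mult.commute)
   qed
   have "V u 0 = 0" using V_sc[OF u csub_zero[OF E], of 0] by simp
   thus "0 : B" using csub_zero[OF cA] by (simp add: B_def)
   show "f : B" if f: "f : H" "!!n. G n : B" "tends G f" for G f
   proof -
    have GA: "G n : A" for n using f(2) by (simp add: B_def)
    have fA: "f : A" by (rule csub_tends[OF cA GA f(1,3)])
    have "tends (%n. V u (G n)) (V u f)"
     using f(3) GA fA AE csub_diff[OF E] by (simp add: tends_def V_diff[OF u, symmetric] V_nrm[OF u])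
    hence "tends (%n. V u (G n) - sc \<gamma> (G n)) (V u f - sc \<gamma> f)" using GA fA VH f by (intro tends_diff tends_sc) auto
    hence "(%n. nrm (V u (G n) - sc \<gamma> (G n))) ----> nrm (V u f - sc \<gamma> f)" using GA fA VH by (intro tends_nrm) auto
    hence "nrm (V u f - sc \<gamma> f) = 0" using f(2) by (simp add: B_def LIMSEQ_const_iff)
    thus ?thesis using fA by (simp add: B_def)
   qed
  qed (use AE in "auto simp: B_def")
  moreover have "V w x : B" if w: "w : K" and x: "x : B" for w x
  proof -
   have xA: "x : A" using x by (simp add: B_def)
   hence xE: "x : E" using AE by simp
   have "nrm (V w (V u x) - V w (sc \<gamma> x)) = 0"
    using x V_nrm[OF w, of "V u x - sc \<gamma> x"] V_diff[OF w, of "V u x" "sc \<gamma> x"] V_E[OF u xE] csub_sc[OF E xE] csub_diff[OF E]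
    by (simp add: B_def)
   hence e: "nrm (V w (V u x) - sc \<gamma> (V w x)) = 0" using V_sc[OF w xE] by simp
   have "nrm (V u (V w x) - sc \<gamma> (V w x)) = 0"
    by (rule nrm_diff_eq0_trans[OF _ _ _ V_comm[OF u w xE] e]) (use V_E u w xE in auto)
   thus ?thesis using inv[OF w xA] by (simp add: B_def)
  qed
  ultimately have "good B" using y AE by (auto simp: good_def B_def)
  hence "\<not> B \<subset> A" using min[of B] gA by (auto simp: R_def B_def)
  hence "B = A" by (auto simp: B_def)
  thus ?thesis by (auto simp: B_def)
 qed
 obtain p where "p : A" "nrm p ~= 0" using gA(1) by (auto simp: good_def)
 thus ?thesis using that[of p] eig gA(2) by blast
qed

end

text \<open>\<open>tn x y\<close> plays the role of the kernel \<open>x \<otimes> cnj y\<close> in the Hilbert space of Hilbert-Schmidt kernels.\<close>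

locale abelian_rep_tensor = abelian_rep H sc ip E K V + HS: semi_hilbert HH sc2 ip2
 for H :: "'a::ab_group_add set" and sc ip E and K :: "'k set" and V
  and HH :: "'b::ab_group_add set" and sc2 ip2 +
 fixes tn :: "'a => 'a => 'b"
 assumes tn_mem [simp]: "x : H ==> y : H ==> tn x y : HH"
  and tn_add: "x : H ==> x' : H ==> y : H ==> tn (x + x') y = tn x y + tn x' y"
  and tn_sc: "x : H ==> y : H ==> tn (sc c x) y = sc2 c (tn x y)"
  and tn_sc_right: "x : H ==> y : H ==> tn x (sc c y) = sc2 (cnj c) (tn x y)"
  and tn_add_right: "x : H ==> y : H ==> y' : H ==> tn x (y + y') = tn x y + tn x y'"
  and tn_ip: "x : H ==> y : H ==> x' : H ==> y' : H ==> ip2 (tn x y) (tn x' y') = ip x x' * ip y' y"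
begin

section \<open>Compact operators defined by kernels\<close>

lemma tn_nrm: "x : H ==> y : H ==> HS.nrm (tn x y) = nrm x * nrm y"
proof -
 assume x: "x : H" and y: "y : H"
 have "complex_of_real ((HS.nrm (tn x y))^2) = complex_of_real ((nrm x * nrm y)^2)"
  using HS.ip_self[of "tn x y"] tn_ip[OF x y x y] x y by (simp add: ip_self power_mult_distrib)
 hence "(HS.nrm (tn x y))^2 = (nrm x * nrm y)^2" using of_real_eq_iff by blast
 thus ?thesis using x y by (simp add: power2_eq_iff_nonneg)
qed

text \<open>The operator with kernel \<open>\<kappa>\<close>, obtained from the Riesz
  representation; its value is determined only up to norm zero, hence the choice.\<close>

definition op :: "'b => 'a => 'a" where
 "op \<kappa> p = (SOME t. t : H \<and> (\<forall>r\<in>H. ip t r = ip2 \<kappa> (tn r p)))"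

lemma op:
 assumes \<kappa>: "\<kappa> : HH" and p: "p : H"
 shows op_mem: "op \<kappa> p : H" and op_ip: "!!r. r : H ==> ip (op \<kappa> p) r = ip2 \<kappa> (tn r p)"
proof -
 have "\<exists>t. t : H \<and> (\<forall>r\<in>H. ip t r = ip2 \<kappa> (tn r p))"
 proof -
  obtain t where t: "t : H" "!!r. r : H ==> cnj (ip2 \<kappa> (tn r p)) = ip r t"
  proof (rule riesz[of "%r. cnj (ip2 \<kappa> (tn r p))" "HS.nrm \<kappa> * nrm p"])
   show "cmod (cnj (ip2 \<kappa> (tn r p))) <= HS.nrm \<kappa> * nrm p * nrm r" if "r : H" for r
    using HS.cauchy_schwarz[OF \<kappa> tn_mem[OF that p]] tn_nrm[OF that p] by (simp add: mult_ac)
  qed (use \<kappa> p in "auto simp: tn_add tn_sc HS.ip_add_right HS.ip_sc_right")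
  have "ip t r = ip2 \<kappa> (tn r p)" if "r : H" for r using ip_cnj[OF that t(1)] t(2)[OF that] by (metis complex_cnj_cnj)
  thus ?thesis using t(1) by blast
 qed
 from someI_ex[OF this] show "op \<kappa> p : H" "!!r. r : H ==> ip (op \<kappa> p) r = ip2 \<kappa> (tn r p)"
  by (auto simp: op_def)
qed

lemma op_nrm:
 assumes \<kappa>: "\<kappa> : HH" and p: "p : H"
 shows "nrm (op \<kappa> p) <= HS.nrm \<kappa> * nrm p"
proof (cases "nrm (op \<kappa> p) = 0")
 case True thus ?thesis using \<kappa> p by simp
next
 case False
 have t: "op \<kappa> p : H" by (rule op_mem[OF \<kappa> p])
 have "complex_of_real ((nrm (op \<kappa> p))^2) = ip2 \<kappa> (tn (op \<kappa> p) p)"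
  using op_ip[OF \<kappa> p t] t by (simp add: ip_self)
 hence "(nrm (op \<kappa> p))^2 = cmod (ip2 \<kappa> (tn (op \<kappa> p) p))" by (metis norm_of_real abs_of_nonneg zero_le_power2)
 also have "\<dots> <= HS.nrm \<kappa> * (nrm (op \<kappa> p) * nrm p)"
  using HS.cauchy_schwarz[OF \<kappa> tn_mem[OF t p]] tn_nrm[OF t p] by simp
 finally have "nrm (op \<kappa> p) * nrm (op \<kappa> p) <= nrm (op \<kappa> p) * (HS.nrm \<kappa> * nrm p)"
  by (simp add: power2_eq_square mult_ac)
 thus ?thesis using False t nrm_nonneg[OF t] by (simp add: mult_le_cancel_left)
qed

lemma op_diff_kernel:
 assumes \<kappa>: "\<kappa> : HH" "\<kappa>' : HH" and p: "p : H"
 shows "nrm (op \<kappa> p - op \<kappa>' p) <= HS.nrm (\<kappa> - \<kappa>') * nrm p"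
proof -
 have "nrm ((op \<kappa> p - op \<kappa>' p) - op (\<kappa> - \<kappa>') p) = 0"
  using \<kappa> p op_mem by (intro nrm_diff_eq0I) (auto simp: ip_diff_left op_ip HS.ip_diff_left)
 hence "nrm (op \<kappa> p - op \<kappa>' p) = nrm (op (\<kappa> - \<kappa>') p)" using \<kappa> p op_mem by (intro nrm_cong) auto
 thus ?thesis using op_nrm[of "\<kappa> - \<kappa>'" p] \<kappa> p by simp
qed

lemma op_lin:
 assumes \<kappa>: "\<kappa> : HH" and p: "p : H" "q : H"
 shows "nrm (op \<kappa> (p + sc c q) - (op \<kappa> p + sc c (op \<kappa> q))) = 0" using \<kappa> p op_mem
 by (intro nrm_diff_eq0I)
   (auto simp: ip_add_left op_ip ip_sc_left tn_add_right tn_sc_right HS.ip_add_right HS.ip_sc_right)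

lemma op_sc:
 assumes \<kappa>: "\<kappa> : HH" and p: "p : H"
 shows "nrm (op \<kappa> (sc c p) - sc c (op \<kappa> p)) = 0" using \<kappa> p op_mem
 by (intro nrm_diff_eq0I) (auto simp: op_ip ip_sc_left tn_sc_right HS.ip_sc_right)

lemma op_sub:
 assumes \<kappa>: "\<kappa> : HH" and p: "p : H" "q : H"
 shows "nrm (op \<kappa> p - op \<kappa> q) <= HS.nrm \<kappa> * nrm (p - q)"
proof -
 have "nrm ((op \<kappa> p - op \<kappa> q) - op \<kappa> (p - q)) = 0"
  using op_lin[OF \<kappa> p, of "-1"] nrm_diff_commute[of "op \<kappa> (p - q)" "op \<kappa> p - op \<kappa> q"] op_mem[OF \<kappa>] p
  by (simp add: sc_minus_one)
 hence "nrm (op \<kappa> p - op \<kappa> q) = nrm (op \<kappa> (p - q))" using \<kappa> p op_mem by (intro nrm_cong) auto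
 thus ?thesis using op_nrm[OF \<kappa>, of "p - q"] p by simp
qed

definition cauchy :: "(nat => 'a) => bool" where
 "cauchy F \<longleftrightarrow> (\<forall>e>0. \<exists>N. \<forall>m\<ge>N. \<forall>n\<ge>N. nrm (F m - F n) < e)"

lemma cauchyD: "cauchy F ==> e > 0 ==> \<exists>N. \<forall>m\<ge>N. \<forall>n\<ge>N. nrm (F m - F n) < e"
 by (simp add: cauchy_def)

lemma cauchyI: "(!!e. e > 0 ==> \<exists>N. \<forall>m\<ge>N. \<forall>n\<ge>N. nrm (F m - F n) < e) ==> cauchy F"
 by (simp add: cauchy_def)

definition compact_kernel :: "'b => bool" where
 "compact_kernel \<kappa> \<longleftrightarrow> (\<forall>P B. (\<forall>n. P n : H \<and> nrm (P n) <= B) -->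
   (\<exists>s :: nat => nat. strict_mono s \<and> cauchy (%n. op \<kappa> (P (s n)))))"

lemma cauchy_subseq: "cauchy F ==> strict_mono (r :: nat => nat) ==> cauchy (%n. F (r n))"
 unfolding cauchy_def by (meson le_trans seq_suble)

text \<open>The operator sends \<open>p\<close> to \<open>ip p v\<close> times \<open>v\<close>, so
  Bolzano-Weierstrass for the scalars \<open>ip (P n) v\<close> suffices.\<close>

lemma compact_kernel_rank_one:
 assumes v: "v : H" shows "compact_kernel (tn v v)" unfolding compact_kernel_def
proof (intro allI impI)
 fix P :: "nat => 'a" and B assume P: "\<forall>n. P n : H \<and> nrm (P n) <= B"
 have "cmod (ip (P n) v) <= B * nrm v" for n
  using cauchy_schwarz[of "P n" v] P v mult_right_mono[of "nrm (P n)" B "nrm v"] by force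
 hence "bounded (range (%n. ip (P n) v))" by (auto simp: bounded_iff)
 from bounded_imp_convergent_subsequence[OF this]
 obtain l s where s: "strict_mono s" "((%n. ip (P n) v) \<circ> s) ----> l" by blast
 have opv: "nrm (op (tn v v) p - sc (ip p v) v) = 0" if "p : H" for p
  using that v op_mem by (intro nrm_diff_eq0I) (auto simp: op_ip tn_ip ip_sc_left)
 have "nrm (op (tn v v) (P (s m)) - op (tn v v) (P (s n))) = cmod (ip (P (s m)) v - ip (P (s n)) v) * nrm v" for m n
 proof -
  have "nrm ((op (tn v v) (P (s m)) - op (tn v v) (P (s n))) - sc (ip (P (s m)) v - ip (P (s n)) v) v) = 0"
  proof -
   have "nrm ((op (tn v v) (P (s m)) + sc (-1) (op (tn v v) (P (s n)))) - (sc (ip (P (s m)) v) v + sc (-1) (sc (ip (P (s n)) v) v))) = 0"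
    using P v op_mem opv by (intro nrm_diff_eq0_add nrm_diff_eq0_sc) auto
   thus ?thesis by (simp add: sc_minus_one sc_minus_left sc_diff_left)
  qed
  thus ?thesis using P v op_mem by (subst nrm_cong) (auto simp: nrm_sc)
 qed
 moreover have "Cauchy (%n. ip (P (s n)) v)" using s(2) LIMSEQ_imp_Cauchy by (auto simp: comp_def)
 ultimately have "cauchy (%n. op (tn v v) (P (s n)))" unfolding cauchy_def
 proof (intro allI impI)
  fix e :: real assume e: "e > 0"
  have pos: "nrm v + 1 > 0" using v by (simp add: add_nonneg_pos)
  obtain N where N: "!!m n. m \<ge> N ==> n \<ge> N ==> cmod (ip (P (s m)) v - ip (P (s n)) v) < e / (nrm v + 1)"
   using \<open>Cauchy (%n. ip (P (s n)) v)\<close> e pos unfolding Cauchy_def dist_norm by (metis divide_pos_pos)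
  have "cmod (ip (P (s m)) v - ip (P (s n)) v) * nrm v < e" if "m \<ge> N" "n \<ge> N" for m n
  proof -
   have "cmod (ip (P (s m)) v - ip (P (s n)) v) * nrm v <= cmod (ip (P (s m)) v - ip (P (s n)) v) * (nrm v + 1)"
    by (intro mult_left_mono) auto
   also have "\<dots> < e" using N[OF that] pos by (simp add: field_simps)
   finally show ?thesis .
  qed
  thus "\<exists>N. \<forall>m\<ge>N. \<forall>n\<ge>N. nrm (op (tn v v) (P (s m)) - op (tn v v) (P (s n))) < e"
   using \<open>!!m n. nrm (op (tn v v) (P (s m)) - op (tn v v) (P (s n))) = cmod (ip (P (s m)) v - ip (P (s n)) v) * nrm v\<close> by auto
 qed
 thus "\<exists>s. strict_mono s \<and> cauchy (%n. op (tn v v) (P (s n)))" using s(1) by blast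
qed

lemma compact_kernel_mid:
 assumes xy: "x : HH" "y : HH" "compact_kernel x" "compact_kernel y"
 shows "compact_kernel (sc2 (1/2) (x + y))" unfolding compact_kernel_def
proof (intro allI impI)
 fix P :: "nat => 'a" and B assume P: "\<forall>n. P n : H \<and> nrm (P n) <= B"
 obtain s where s: "strict_mono s" "cauchy (%n. op x (P (s n)))" using xy(3) P unfolding compact_kernel_def by blast
 obtain r where r: "strict_mono r" "cauchy (%n. op y (P (s (r n))))"
  using xy(4)[unfolded compact_kernel_def, rule_format, of "%n. P (s n)" B] P by auto
 define z where "z = sc2 (1/2) (x + y)"
 have z: "z : HH" using xy by (simp add: z_def)
 have "nrm (op z p - op z q) <= nrm (op x p - op x q) + nrm (op y p - op y q)" if pq: "p : H" "q : H" for p q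
 proof -
  have m: "op z p : H" "op z q : H" "op x p : H" "op x q : H" "op y p : H" "op y q : H" using op_mem xy z pq by auto
  have "nrm ((op z p - op z q) - sc (1/2) ((op x p - op x q) + (op y p - op y q))) = 0" using m xy z pq by (intro nrm_diff_eq0I)
    (auto simp: z_def ip_diff_left ip_add_left ip_sc_left op_ip HS.ip_sc_left HS.ip_add_left algebra_simps)
  hence "nrm (op z p - op z q) = nrm (sc (1/2) ((op x p - op x q) + (op y p - op y q)))" using m by (intro nrm_cong) auto
  also have "\<dots> = 1/2 * nrm ((op x p - op x q) + (op y p - op y q))" using m by (simp add: nrm_sc)
  also have "\<dots> <= 1/2 * (nrm (op x p - op x q) + nrm (op y p - op y q))" using m by (intro mult_left_mono nrm_triangle) auto
  also have "\<dots> <= nrm (op x p - op x q) + nrm (op y p - op y q)" using m by simp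
  finally show ?thesis .
 qed
 hence le: "nrm (op z (P (s (r m))) - op z (P (s (r n)))) \<le>
   nrm (op x (P (s (r m))) - op x (P (s (r n)))) + nrm (op y (P (s (r m))) - op y (P (s (r n))))" for m n using P by blast
 have "cauchy (%n. op z (P (s (r n))))" unfolding cauchy_def
 proof (intro allI impI)
  fix e :: real assume "e > 0"
  hence e2: "e / 2 > 0" by simp
  obtain N1 where N1: "\<forall>m\<ge>N1. \<forall>n\<ge>N1. nrm (op x (P (s (r m))) - op x (P (s (r n)))) < e / 2"
   using cauchy_subseq[OF s(2) r(1)] e2 unfolding cauchy_def by blast
  obtain N2 where N2: "\<forall>m\<ge>N2. \<forall>n\<ge>N2. nrm (op y (P (s (r m))) - op y (P (s (r n)))) < e / 2"
   using r(2) e2 unfolding cauchy_def by blast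
  have "nrm (op z (P (s (r m))) - op z (P (s (r n)))) < e" if "m \<ge> max N1 N2" "n \<ge> max N1 N2" for m n
   using le[of m n] N1[rule_format, of m n] N2[rule_format, of m n] that by simp
  thus "\<exists>N. \<forall>m\<ge>N. \<forall>n\<ge>N. nrm (op z (P (s (r m))) - op z (P (s (r n)))) < e" by blast
 qed
 thus "\<exists>s. strict_mono s \<and> cauchy (%n. op (sc2 (1/2) (x + y)) (P (s n)))"
  using strict_mono_o[OF s(1) r(1)] unfolding z_def[symmetric] by (intro exI[of _ "s \<circ> r"]) (simp add: comp_def)
qed

text \<open>A diagonal subsequence works for all \<open>h k\<close> at once, and
  \<open>op_diff_kernel\<close> compares \<open>op \<kappa>\<close> with \<open>op (h k)\<close>
  uniformly on bounded sets. The shift by \<open>Suc k\<close> occurs because the diagonal sequence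
  is controlled for \<open>h k\<close> only from this index on.\<close>

lemma compact_kernel_limit:
 assumes h: "!!n. h n : HH" "!!n. compact_kernel (h n)" and \<kappa>: "\<kappa> : HH" "HS.tends h \<kappa>"
 shows "compact_kernel \<kappa>" unfolding compact_kernel_def
proof (intro allI impI)
 fix P :: "nat => 'a" and B assume P: "\<forall>n. P n : H \<and> nrm (P n) <= B"
 interpret subseqs "%k s. cauchy (%n. op (h k) (P (s n)))"
 proof
  fix k and s :: "nat => nat" assume "strict_mono s"
  thus "\<exists>r'. strict_mono r' \<and> cauchy (%n. op (h k) (P ((s \<circ> r') n)))"
   using h(2)[of k, unfolded compact_kernel_def, rule_format, of "%n. P (s n)" B] P by auto
 qed
 have stable: "cauchy (%n. op (h k) (P ((s \<circ> r) n)))"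
  if "strict_mono r" "cauchy (%n. op (h k) (P (s n)))" for k s and r :: "nat => nat" using cauchy_subseq[OF that(2,1)] by simp
 have d: "cauchy (%n. op (h k) (P ((diagseq \<circ> ((+) (Suc k))) n)))" for k by (rule diagseq_holds) (rule stable)
 have "cauchy (%n. op \<kappa> (P (diagseq n)))"
 proof (rule cauchyI)
  fix e :: real assume "e > 0"
  hence e3: "e / 3 > 0" by simp
  define b where "b = \<bar>B\<bar> + 1"
  have b: "b > 0" "B <= b" by (auto simp: b_def)
  have "e / 3 / b > 0" using e3 b(1) by simp
  then obtain k where "HS.nrm (h k - \<kappa>) < e / 3 / b"
   using LIMSEQ_0_less[OF \<kappa>(2)[unfolded HS.tends_def]] by (metis order_refl)
  hence k: "HS.nrm (h k - \<kappa>) * b < e / 3" using b(1) by (simp only: pos_less_divide_eq)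
  obtain N where N: "\<forall>m\<ge>N. \<forall>n\<ge>N. nrm (op (h k) (P (diagseq (Suc k + m))) - op (h k) (P (diagseq (Suc k + n)))) < e / 3"
   using cauchyD[OF d[of k] e3] by (auto simp: comp_def)
  have "nrm (op \<kappa> (P (diagseq m)) - op \<kappa> (P (diagseq n))) < e" if mn: "m \<ge> Suc k + N" "n \<ge> Suc k + N" for m n
  proof -
   define p q where "p = P (diagseq m)" and "q = P (diagseq n)"
   have pq: "p : H" "q : H" "nrm p <= b" "nrm q <= b" using P b(2) order_trans by (auto simp: p_def q_def)
   have "nrm (op (h k) p - op (h k) q) < e / 3" using N[rule_format, of "m - Suc k" "n - Suc k"] mn by (simp add: p_def q_def)
   moreover have c: "nrm (op (h k) t - op \<kappa> t) < e / 3" if "t : H" "nrm t <= b" for t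
   proof -
    have "HS.nrm (h k - \<kappa>) * nrm t <= HS.nrm (h k - \<kappa>) * b" using that h(1) \<kappa>(1) by (intro mult_left_mono) auto
    thus ?thesis using op_diff_kernel[OF h(1) \<kappa>(1) that(1), of k] k by simp
   qed
   moreover have "op (h k) p : H" "op (h k) q : H" "op \<kappa> p : H" "op \<kappa> q : H" using op_mem h \<kappa> pq by auto
   ultimately have "nrm (op \<kappa> p - op (h k) p) < e / 3" "nrm (op (h k) p - op (h k) q) < e / 3" "nrm (op (h k) q - op \<kappa> q) < e / 3"
    "nrm (op \<kappa> p - op \<kappa> q) <= nrm (op \<kappa> p - op (h k) p) + (nrm (op (h k) p - op (h k) q) + nrm (op (h k) q - op \<kappa> q))"
    using nrm_triangle3[of "op \<kappa> p" "op (h k) p" "op \<kappa> q"] nrm_triangle3[of "op (h k) p" "op (h k) q" "op \<kappa> q"]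
     c[OF pq(1,3)] c[OF pq(2,4)] nrm_diff_commute[of "op \<kappa> p" "op (h k) p"] by auto
   thus ?thesis unfolding p_def[symmetric] q_def[symmetric] by linarith
  qed
  thus "\<exists>N. \<forall>m\<ge>N. \<forall>n\<ge>N. nrm (op \<kappa> (P (diagseq m)) - op \<kappa> (P (diagseq n))) < e" by blast
 qed
 thus "\<exists>s. strict_mono s \<and> cauchy (%n. op \<kappa> (P (s n)))" using subseq_diagseq by blast
qed

text \<open>Averaging the rank-one kernels \<open>tn (V u q) (V u q)\<close> over a compact group
  would give an invariant compact operator \<open>T\<close>. Without Haar measure, its kernel
  \<open>\<kappa>\<close> is taken as the point of least norm for the midpoint hull \<open>C\<close>
  of these kernels; uniqueness of this point makes it invariant, and as a limit of finite-rank
  kernels it stays compact. With \<open>m\<close> the norm of \<open>T\<close> on \<open>E\<close>,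
  the eigenspace of \<open>T^2\<close> for \<open>m^2\<close> is then an invariant subspace with
  compact unit ball.\<close>

theorem joint_eigenvector:
 assumes q: "q : E" "nrm q ~= 0"
 obtains p where "p : E" "nrm p ~= 0" "!!u. u : K ==> \<exists>\<gamma>. nrm (V u p - sc \<gamma> p) = 0"
proof -
 \<comment> \<open>The orbit of \<open>q\<close>, enlarged by all vectors of \<open>E\<close> at
   distance zero from it: since \<open>V_comp\<close> holds only up to norm zero, the plain orbit
   need not be mapped into itself.\<close>
 define Q where "Q = {v : E. \<exists>u\<in>K. nrm (v - V u q) = 0}"
 have QE: "v : E" if "v : Q" for v using that by (simp add: Q_def)
 have VQ: "V w v : Q" if w: "w : K" and v: "v : Q" for w v
 proof -
  obtain u where u: "u : K" "nrm (v - V u q) = 0" using v by (auto simp: Q_def)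
  obtain z where z: "z : K" "nrm (V w (V u q) - V z q) = 0" using V_comp[OF w u(1)] q by blast
  have vE: "v : E" using v QE by simp
  have "nrm (V w v - V w (V u q)) = 0"
   using V_nrm[OF w csub_diff[OF E vE V_E[OF u(1) q(1)]]] u V_diff[OF w vE V_E[OF u(1) q(1)]] by simp
  hence "nrm (V w v - V z q) = 0" using nrm_diff_eq0_trans[of "V w v" "V w (V u q)" "V z q"] z w u(1) vE V_E q by simp
  thus ?thesis using z(1) V_E[OF w vE] by (auto simp: Q_def)
 qed
 have VqQ: "V u q : Q" if "u : K" for u using that V_E[OF that q(1)] by (auto simp: Q_def intro!: bexI[of _ u])
 define C where "C = \<Inter>{D. (\<forall>v\<in>Q. tn v v : D) \<and> (\<forall>x\<in>D. \<forall>y\<in>D. sc2 (1/2) (x + y) : D)}"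
 have C_base: "tn v v : C" if "v : Q" for v using that by (auto simp: C_def)
 have C_mid: "sc2 (1/2) (x + y) : C" if "x : C" "y : C" for x y using that by (auto simp: C_def)
 have C_induct [consumes 1, case_names 1 2]: "P x" if x: "x : C" and "!!v. v : Q ==> P (tn v v)"
  "!!x y. x : C ==> y : C ==> P x ==> P y ==> P (sc2 (1/2) (x + y))" for P x
 proof -
  have "C \<subseteq> {x : C. P x}" by (subst C_def, rule Inter_lower) (use that C_base C_mid in auto)
  thus "P x" using x by auto
 qed
 have CH: "x : HH" if "x : C" for x using that by (induction rule: C_induct) (auto dest: QE)
 obtain u0 where u0: "u0 : K" using K_ne by auto
 obtain \<kappa> h where \<kappa>: "\<kappa> : HH" "!!n. h n : C" "HS.tends h \<kappa>"
  and uniq: "!!F. (!!n. F n : C) ==> (%n. HS.nrm (F n)) ----> HS.nrm \<kappa> ==> HS.tends F \<kappa>"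
  using HS.midpoint_min[of C] CH C_base[OF VqQ[OF u0]] C_mid by (metis empty_iff subsetI)
 have hH: "h n : HH" for n using CH \<kappa>(2) by simp
 have limeq: "ip2 \<kappa> y = f" if "y : HH" "!!x. x : C ==> ip2 x y = f" for y f
  using HS.tends_ip_left[OF hH \<kappa>(1) that(1) \<kappa>(3)] that(2)[OF \<kappa>(2)] by (simp add: LIMSEQ_const_iff)
 have herm: "ip2 \<kappa> (tn r p) = cnj (ip2 \<kappa> (tn p r))" if rp: "r : H" "p : H" for r p
 proof -
  have "ip2 x (tn r p) = cnj (ip2 x (tn p r))" if "x : C" for x using that
  proof (induction rule: C_induct)
   case (1 v)
   have vH: "v : H" using QE[OF 1] by simp
   show ?case using vH rp ip_cnj[OF vH rp(1)] ip_cnj[OF vH rp(2)] by (simp add: tn_ip mult.commute)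
  next
   case (2 x y) thus ?case using rp CH by (simp add: HS.ip_sc_left HS.ip_add_left)
  qed
  hence "(%n. ip2 (h n) (tn r p)) = (%n. cnj (ip2 (h n) (tn p r)))" using \<kappa>(2) by blast
  hence "(%n. ip2 (h n) (tn r p)) ----> cnj (ip2 \<kappa> (tn p r))"
   using tendsto_cnj[OF HS.tends_ip_left[OF hH \<kappa>(1) _ \<kappa>(3), of "tn p r"]] rp by simp
  thus ?thesis using LIMSEQ_unique HS.tends_ip_left[OF hH \<kappa>(1) _ \<kappa>(3), of "tn r p"] rp by simp
 qed
 have rngE: "ip2 \<kappa> (tn r p) = 0" if rp: "r : ortho E" "p : H" for r p
 proof (rule limeq)
  have rH: "r : H" using rp(1) by (rule ortho_mem)
  thus "tn r p : HH" using rp by simp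
  show "ip2 x (tn r p) = 0" if "x : C" for x using that
  proof (induction rule: C_induct)
   case (1 v)
   have vH: "v : H" using QE[OF 1] by simp
   have "ip v r = 0" using ortho_sym[OF rp(1) QE[OF 1] vH] .
   thus ?case using vH rp rH by (simp add: tn_ip)
  next
   case (2 x y) thus ?case using rp rH CH by (simp add: HS.ip_sc_left HS.ip_add_left)
  qed
 qed
 define T where "T = op \<kappa>"
 have TH: "T p : H" and T_ip: "r : H ==> ip (T p) r = ip2 \<kappa> (tn r p)" if "p : H" for p r
  unfolding T_def using op_mem[OF \<kappa>(1) that] op_ip[OF \<kappa>(1) that] by auto
 have TE: "T p : E" if "p : H" for p
 proof -
  have "T p : cspan E" unfolding cspan_def
   using TH[OF that] T_ip[OF that] rngE[OF _ that] ortho_mem[of _ E] by (auto simp: ortho_def[of "ortho E"])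
  thus ?thesis by (simp add: cspan_csub[OF E])
 qed
 have Tsym: "ip (T x) y = ip x (T y)" if "x : H" "y : H" for x y
  using T_ip[OF that] T_ip[OF that(2,1)] herm[OF that(2,1)] ip_cnj[OF TH[OF that(2)] that(1)] by simp
 have inv: "ip2 \<kappa> (tn (V w r) (V w p)) = ip2 \<kappa> (tn r p)" if w: "w : K" and rp: "r : E" "p : E" for w r p
 proof -
  \<comment> \<open>\<open>V w\<close> is given on vectors only. \<open>D\<close> plays the role of
    the graph of the isometry that it induces on the hull, generated from the pairs of rank-one
    kernels and their translates; \<open>Dip\<close> shows that the form is preserved.\<close>
  define D where "D = \<Inter>{D. (\<forall>v\<in>Q. (tn v v, tn (V w v) (V w v)) : D) \<and>
   (\<forall>x x' y y'. (x, x') : D --> (y, y') : D --> (sc2 (1/2) (x + y), sc2 (1/2) (x' + y')) : D)}"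
  have D_base: "(tn v v, tn (V w v) (V w v)) : D" if "v : Q" for v using that by (auto simp: D_def)
  have D_mid: "(sc2 (1/2) (x + y), sc2 (1/2) (x' + y')) : D" if "(x, x') : D" "(y, y') : D" for x x' y y'
   using that by (auto simp: D_def)
  have D_induct: "P x x'" if "(x, x') : D" and "!!v. v : Q ==> P (tn v v) (tn (V w v) (V w v))"
   "!!x x' y y'. P x x' ==> P y y' ==> P (sc2 (1/2) (x + y)) (sc2 (1/2) (x' + y'))" for P x x'
  proof -
   have "D \<subseteq> {(x, x'). P x x'}" unfolding D_def by (rule Inter_lower) (use that in auto)
   thus "P x x'" using that(1) by auto
  qed
  have DC: "x : C \<and> x' : C" if "(x, x') : D" for x x' using that by (rule D_induct) (auto intro: C_base C_mid VQ[OF w])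
  have ex: "\<exists>x'. (x, x') : D" if "x : C" for x using that by (induction rule: C_induct) (auto intro: D_base D_mid)
  have Dip: "ip2 x y = ip2 x' y'" if "(x, x') : D" "(y, y') : D" for x x' y y'
  proof -
   have "(\<forall>z z'. (z, z') : D --> ip2 x z = ip2 x' z') \<and> x : HH \<and> x' : HH" using that(1)
   proof (rule D_induct)
    fix v assume v: "v : Q"
    have vE: "v : E" "V w v : E" using QE v V_E[OF w] by auto
    have "ip2 (tn v v) z = ip2 (tn (V w v) (V w v)) z' \<and> z : HH \<and> z' : HH" if "(z, z') : D" for z z' using that
    proof (rule D_induct)
     fix v' assume v': "v' : Q"
     have v'E: "v' : E" "V w v' : E" using QE v' V_E[OF w] by auto
     show "ip2 (tn v v) (tn v' v') = ip2 (tn (V w v) (V w v)) (tn (V w v') (V w v')) \<and> tn v' v' : HH \<and> tn (V w v') (V w v') : HH"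
      using vE v'E V_ip[OF w] by (simp add: tn_ip)
    next
     fix x x' y y'
     assume "ip2 (tn v v) x = ip2 (tn (V w v) (V w v)) x' \<and> x : HH \<and> x' : HH"
      "ip2 (tn v v) y = ip2 (tn (V w v) (V w v)) y' \<and> y : HH \<and> y' : HH"
     thus "ip2 (tn v v) (sc2 (1/2) (x + y)) = ip2 (tn (V w v) (V w v)) (sc2 (1/2) (x' + y')) \<and>
       sc2 (1/2) (x + y) : HH \<and> sc2 (1/2) (x' + y') : HH" using vE by (simp add: HS.ip_sc_right HS.ip_add_right)
    qed
    thus "(\<forall>z z'. (z, z') : D --> ip2 (tn v v) z = ip2 (tn (V w v) (V w v)) z') \<and> tn v v : HH \<and> tn (V w v) (V w v) : HH"
     using vE by simp
   next
    fix x x' y y'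
    assume 1: "(\<forall>z z'. (z, z') : D --> ip2 x z = ip2 x' z') \<and> x : HH \<and> x' : HH"
     and 2: "(\<forall>z z'. (z, z') : D --> ip2 y z = ip2 y' z') \<and> y : HH \<and> y' : HH"
    show "(\<forall>z z'. (z, z') : D --> ip2 (sc2 (1/2) (x + y)) z = ip2 (sc2 (1/2) (x' + y')) z') \<and>
      sc2 (1/2) (x + y) : HH \<and> sc2 (1/2) (x' + y') : HH" using 1 2 DC CH by (auto simp: HS.ip_sc_left HS.ip_add_left)
   qed
   thus ?thesis using that(2) by blast
  qed
  have Dtn: "ip2 x' (tn (V w r) (V w p)) = ip2 x (tn r p)" if "(x, x') : D" for x x'
  proof -
   have "ip2 x' (tn (V w r) (V w p)) = ip2 x (tn r p) \<and> x : HH \<and> x' : HH" using that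
   proof (rule D_induct)
    fix v assume v: "v : Q"
    have vE: "v : E" "V w v : E" using QE v V_E[OF w] by auto
    show "ip2 (tn (V w v) (V w v)) (tn (V w r) (V w p)) = ip2 (tn v v) (tn r p) \<and> tn v v : HH \<and> tn (V w v) (V w v) : HH"
     using vE rp V_E[OF w] V_ip[OF w] by (simp add: tn_ip)
   next
    fix x x' y y'
    assume 1: "ip2 x' (tn (V w r) (V w p)) = ip2 x (tn r p) \<and> x : HH \<and> x' : HH"
     and 2: "ip2 y' (tn (V w r) (V w p)) = ip2 y (tn r p) \<and> y : HH \<and> y' : HH"
    show "ip2 (sc2 (1/2) (x' + y')) (tn (V w r) (V w p)) = ip2 (sc2 (1/2) (x + y)) (tn r p) \<and>
      sc2 (1/2) (x + y) : HH \<and> sc2 (1/2) (x' + y') : HH" using 1 2 rp V_E[OF w] by (simp add: HS.ip_sc_left HS.ip_add_left)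
   qed
   thus ?thesis by simp
  qed
  have "\<forall>n. \<exists>x'. (h n, x') : D" using ex[OF \<kappa>(2)] by blast
  then obtain h' where h': "!!n. (h n, h' n) : D" by metis
  have h'C: "h' n : C" for n using DC[OF h'] by simp
  have "HS.nrm (h' n) = HS.nrm (h n)" for n using Dip[OF h' h'] by (simp add: HS.nrm_def)
  hence "HS.tends h' \<kappa>" using uniq[of h'] h'C HS.tends_nrm[OF hH \<kappa>(1,3)] by simp
  hence "(%n. ip2 (h' n) (tn (V w r) (V w p))) ----> ip2 \<kappa> (tn (V w r) (V w p))"
   using CH[OF h'C] \<kappa>(1) rp V_E[OF w] by (intro HS.tends_ip_left) auto
  moreover have "(%n. ip2 (h' n) (tn (V w r) (V w p))) ----> ip2 \<kappa> (tn r p)"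
   unfolding Dtn[OF h'] using hH \<kappa> rp by (intro HS.tends_ip_left) auto
  ultimately show ?thesis using LIMSEQ_unique by blast
 qed
 have TV: "nrm (T (V w x) - V w (T x)) = 0" if w: "w : K" and x: "x : E" for w x
 proof (rule nrm_eq0_orthoI[OF E])
  have m: "T x : E" "V w (T x) : E" "V w x : E" "T (V w x) : E" using TE x V_E[OF w] by auto
  thus "T (V w x) - V w (T x) : E" by (intro csub_diff[OF E])
  fix r assume r: "r : E"
  obtain z where z: "z : K" "nrm (V w (V z r) - r) = 0" using V_inverse[OF w] r by blast
  have "ip (T (V w x) - V w (T x)) (V w (V z r)) = 0"
   using m V_E[OF z(1) r] V_E[OF w V_E[OF z(1) r]] x inv[OF w V_E[OF z(1) r] x] V_ip[OF w m(1) V_E[OF z(1) r]]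
   by (simp add: ip_diff_left T_ip)
  thus "ip (T (V w x) - V w (T x)) r = 0"
   using ip_cong_right[of "V w (V z r)" r "T (V w x) - V w (T x)"] z(2) m r V_E[OF w V_E[OF z(1) r]] by simp
 qed
 have Tsc: "nrm (T (sc c x)) = cmod c * nrm (T x)" if "x : H" for c x
  using nrm_cong[OF _ _ op_sc[OF \<kappa>(1) that, of c]] that TH TH[OF that] unfolding T_def[symmetric] by (simp add: nrm_sc)
 have Tlin: "nrm (T (x + sc c y) - (T x + sc c (T y))) = 0" if "x : H" "y : H" for c x y
  unfolding T_def by (rule op_lin[OF \<kappa>(1) that])
 have Tsub: "nrm (T x - T y) <= HS.nrm \<kappa> * nrm (x - y)" if "x : H" "y : H" for x y
  unfolding T_def by (rule op_sub[OF \<kappa>(1) that])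
 have Ttends: "tends (%n. T (F n)) (T f)" if "!!n. F n : H" "f : H" "tends F f" for F f
 proof (rule tends_bound[where b = "%n. HS.nrm \<kappa> * nrm (F n - f)"])
  show "(%n. HS.nrm \<kappa> * nrm (F n - f)) ----> 0" using tendsto_mult_left[of _ 0 _ "HS.nrm \<kappa>"] that(3) by (simp add: tends_def)
 qed (use that Tsub TH in auto)
 have Tcpt: "compact_kernel \<kappa>"
 proof (rule compact_kernel_limit[OF hH _ \<kappa>(1,3)])
  have "compact_kernel x" if "x : C" for x using that
   by (induction rule: C_induct) (auto intro: compact_kernel_rank_one[OF E_H[OF QE]] compact_kernel_mid CH)
  thus "compact_kernel (h n)" for n using \<kappa>(2) by blast
 qed
 have cptT: "\<exists>s y. strict_mono s \<and> y : H \<and> tends (%n. T (P (s n))) y" if "!!n. P n : H \<and> nrm (P n) <= B" for P :: "nat => 'a" and B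
 proof -
  have PH: "P n : H" for n using that by blast
  have "\<exists>s :: nat => nat. strict_mono s \<and> cauchy (%n. T (P (s n)))" unfolding T_def
   by (rule Tcpt[unfolded compact_kernel_def, rule_format, of P B]) (rule that)
  then obtain s where s: "strict_mono s" "cauchy (%n. T (P (s n)))" by blast
  obtain y where "y : H" "tends (%n. T (P (s n))) y" by (rule cauchy_tends[OF TH[OF PH] cauchyD[OF s(2)]])
  thus ?thesis using s(1) by blast
 qed
 obtain m p where m: "m \<ge> 0" "!!x. x : E ==> nrm (T x) <= m * nrm x" and p: "!!n. p n : E" "!!n::nat. nrm (p n) = 1"
  "(%n. nrm (T (T (p n)) - sc (of_real (m^2)) (p n))) ----> 0"
 proof (rule approx_top_eigenvector[OF E, of T "HS.nrm \<kappa>"])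
  show "nrm (T x) <= HS.nrm \<kappa> * nrm x" if "x : E" for x unfolding T_def using that by (intro op_nrm[OF \<kappa>(1)]) simp
 qed (use TE Tsc Tsym q in auto)
 have m0: "m ~= 0"
 proof
  assume "m = 0"
  hence T0: "nrm (T x) = 0" if "x : E" for x using m(2)[OF that] nrm_nonneg[OF TH[of x]] that by simp
  have z: "ip2 \<kappa> (tn x x) = 0" if "x : E" for x using T_ip[of x x] nrm_eq_0_ip[OF TH _ T0[OF that], of x] that by simp
  obtain K0 where K0: "K0 \<subseteq> K" "finite K0" "!!u. u : K ==> \<exists>w\<in>K0. nrm (V u q - V w q) < nrm q / 2"
   using tot_bdd[OF q(1), of "nrm q / 2"] q nrm_nonneg[of q] by fastforce
  \<comment> \<open>A test kernel that detects the whole hull: each translate of \<open>q\<close> is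
    close to some \<open>V w q\<close> with \<open>w\<close> in the finite set \<open>K0\<close>, so
    its rank-one kernel pairs with \<open>\<Omega>\<close> to at least
    \<open>((nrm q)^2 / 2)^2\<close>. The bound passes to midpoints and to the limit
    \<open>\<kappa>\<close>, whereas \<open>m = 0\<close> makes the pairing with
    \<open>\<kappa>\<close> vanish.\<close>
  define \<Omega> where "\<Omega> = (\<Sum>w\<in>K0. tn (V w q) (V w q))"
  have \<Omega>: "\<Omega> : HH" unfolding \<Omega>_def using K0(1) V_E q by (intro HS.sum_mem) auto
  have "ip2 \<kappa> \<Omega> = 0" unfolding \<Omega>_def using K0(1) V_E q z \<kappa>(1) by (subst HS.ip_sum_right) (auto intro!: sum.neutral)
  moreover have lb: "Re (ip2 x \<Omega>) \<ge> ((nrm q)^2 / 2)^2" if "x : C" for x using that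
  proof (induction rule: C_induct)
   case (1 v)
   obtain u where u: "u : K" "nrm (v - V u q) = 0" using 1 by (auto simp: Q_def)
   have vE: "v : E" using QE[OF 1] .
   obtain w where w: "w : K0" "nrm (V u q - V w q) < nrm q / 2" using K0(3)[OF u(1)] by blast
   have wK: "w : K" using w(1) K0(1) by auto
   have Re: "Re (ip2 (tn v v) (tn (V z q) (V z q))) = (cmod (ip v (V z q)))^2" if "z : K0" for z
   proof -
    have zE: "V z q : E" using that K0(1) V_E q by auto
    have "ip2 (tn v v) (tn (V z q) (V z q)) = ip v (V z q) * cnj (ip v (V z q))"
     using vE zE ip_cnj[of v "V z q"] by (simp add: tn_ip)
    thus ?thesis by (simp add: complex_norm_square[symmetric] del: of_real_power)
   qed
   have "ip v (V w q) = ip (V u q) (V w q)" using u vE V_E[OF u(1) q(1)] V_E[OF wK q(1)] by (intro ip_cong) auto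
   moreover have "Re (ip (V u q) (V w q)) \<ge> (nrm q)^2 / 2"
   proof -
    have H: "V u q : H" "V w q : H" using V_E[OF u(1) q(1)] V_E[OF wK q(1)] by auto
    have "(nrm (V u q - V w q))^2 <= (nrm q / 2)^2" using w(2) H by (intro power_mono) auto
    thus ?thesis using nrm_diff_sq[OF H] V_nrm[OF u(1) q(1)] V_nrm[OF wK q(1)]
     by (simp add: power_divide) (smt (verit) zero_le_power2)
   qed
   ultimately have "cmod (ip v (V w q)) \<ge> (nrm q)^2 / 2" using complex_Re_le_cmod[of "ip v (V w q)"] by simp
   hence "((nrm q)^2 / 2)^2 <= (cmod (ip v (V w q)))^2" by (intro power_mono) auto
   also have "\<dots> <= (\<Sum>z\<in>K0. (cmod (ip v (V z q)))^2)" using w(1) K0(2) by (intro member_le_sum) auto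
   also have "\<dots> = Re (ip2 (tn v v) \<Omega>)"
    unfolding \<Omega>_def using K0(1) V_E q vE by (subst HS.ip_sum_right) (auto simp: Re subset_iff)
   finally show ?case .
  next
   case (2 x y) thus ?case using \<Omega> CH by (simp add: HS.ip_sc_left HS.ip_add_left)
  qed
  have "(%n. Re (ip2 (h n) \<Omega>)) ----> Re (ip2 \<kappa> \<Omega>)" by (intro tendsto_Re HS.tends_ip_left hH \<kappa> \<Omega>)
  hence "((nrm q)^2 / 2)^2 <= Re (ip2 \<kappa> \<Omega>)" by (rule LIMSEQ_le_const) (use lb \<kappa>(2) in auto)
  ultimately show False using q by simp
 qed
 define F where "F = {x : E. nrm (T (T x) - sc (of_real (m^2)) x) = 0}"
 have FE: "x : E" if "x : F" for x using that by (simp add: F_def)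
 have csF: "csub F"
 proof (rule csubI)
  have TT: "nrm (T (T (x + sc c y)) - (T (T x) + sc c (T (T y)))) = 0" if "x : H" "y : H" for x y c
  proof -
   have "nrm (T (T (x + sc c y)) - T (T x + sc c (T y))) = 0"
    by (rule antisym) (use Tsub[of "T (x + sc c y)" "T x + sc c (T y)"] Tlin[OF that, of c] TH that in auto)
   from nrm_diff_eq0_trans[OF _ _ _ this Tlin[of "T x" "T y" c]] show ?thesis using TH that by auto
  qed
  have comb: "x + sc c y : F" if "x : F" "y : F" for x y c
  proof -
   have xy: "x : H" "y : H" "x : E" "y : E" using that FE by auto
   have "nrm ((T (T x) + sc c (T (T y))) - (sc (of_real (m^2)) x + sc c (sc (of_real (m^2)) y))) = 0"
    using that xy TH by (intro nrm_diff_eq0_add nrm_diff_eq0_sc) (auto simp: F_def)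
   from nrm_diff_eq0_trans[OF _ _ _ TT[OF xy(1,2), of c] this]
   have "nrm (T (T (x + sc c y)) - (sc (of_real (m^2)) x + sc c (sc (of_real (m^2)) y))) = 0" using xy TH by auto
   thus ?thesis using xy csub_add[OF E] csub_sc[OF E] by (simp add: F_def sc_add_right mult.commute)
  qed
  have T0: "nrm (T 0) = 0" using Tsc[of 0 0] by simp
  hence "nrm (T (T 0)) = 0" using Tsub[of "T 0" 0] TH[of 0] nrm_cong[of "T (T 0)" "T 0"] by (metis diff_zero antisym mult_zero_right nrm_nonneg diff_mem TH zero_mem)
  thus "0 : F" using csub_zero[OF E] by (simp add: F_def)
  thus "sc c x : F" if "x : F" for c x using comb[of 0 x c] that by simp
  show "x + y : F" if "x : F" "y : F" for x y using comb[of x y 1] that by simp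
  show "f : F" if f: "f : H" "!!n. G n : F" "tends G f" for G f
  proof -
   have GH: "G n : H" "G n : E" for n using f(2) FE by auto
   have fE: "f : E" using csub_tends[OF E GH(2) f(1,3)] .
   have "tends (%n. T (T (G n)) - sc (of_real (m^2)) (G n)) (T (T f) - sc (of_real (m^2)) f)"
    using GH f TH by (intro tends_diff tends_sc Ttends) auto
   hence "(%n. nrm (T (T (G n)) - sc (of_real (m^2)) (G n))) ----> nrm (T (T f) - sc (of_real (m^2)) f)"
    using GH f TH by (intro tends_nrm) auto
   thus ?thesis using f(2) fE by (simp add: F_def LIMSEQ_const_iff)
  qed
 qed (use FE in auto)
 \<comment> \<open>On \<open>F\<close> the identity is \<open>T^2\<close> divided by
   \<open>m^2\<close>, which is compact. Admitting approximate eigenvectors \<open>x n\<close> lets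
   the same statement produce a non-zero element of \<open>F\<close> from the sequence
   \<open>p\<close>.\<close>
 have cptF: "\<exists>s p0. strict_mono s \<and> p0 : F \<and> tends (x \<circ> (s :: nat => nat)) p0"
  if x: "!!n. x n : E \<and> nrm (x n) <= 1" and xl: "(%n. nrm (T (T (x n)) - sc (of_real (m^2)) (x n))) ----> 0" for x
 proof -
  have xH: "x n : H" for n using x by simp
  have "nrm (T (x n)) <= m" for n using order_trans[OF m(2)[of "x n"] mult_left_mono[of "nrm (x n)" 1 m]] x m(1) by simp
  then obtain s y where s: "strict_mono s" "y : H" "tends (%n. T (T (x (s n)))) y"
   using cptT[of "%n. T (x n)" m] TH[OF xH] by auto
  define p0 where "p0 = sc (of_real (1 / m^2)) y"
  have p0H: "p0 : H" using s by (simp add: p0_def)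
  have "tends (%n. T (T (x (s n))) - sc (of_real (m^2)) (x (s n))) 0"
   using LIMSEQ_subseq_LIMSEQ[OF xl s(1)] by (simp add: tends_def comp_def)
  hence "tends (%n. T (T (x (s n))) - (T (T (x (s n))) - sc (of_real (m^2)) (x (s n)))) (y - 0)"
   using s xH TH by (intro tends_diff) auto
  hence "tends (%n. sc (of_real (1 / m^2)) (sc (of_real (m^2)) (x (s n)))) p0"
   unfolding p0_def using xH s by (intro tends_sc) auto
  hence t: "tends (%n. x (s n)) p0" using m0 by simp
  have p0E: "p0 : E" using csub_tends[OF E, of "%n. x (s n)"] x p0H t by blast
  have "tends (%n. T (T (x (s n))) - sc (of_real (m^2)) (x (s n))) (T (T p0) - sc (of_real (m^2)) p0)"
   using xH p0H t TH by (intro tends_diff tends_sc Ttends) auto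
  hence "(%n. nrm (T (T (x (s n))) - sc (of_real (m^2)) (x (s n)))) ----> nrm (T (T p0) - sc (of_real (m^2)) p0)"
   using xH p0H TH by (intro tends_nrm) auto
  hence "nrm (T (T p0) - sc (of_real (m^2)) p0) = 0" using LIMSEQ_unique LIMSEQ_subseq_LIMSEQ[OF xl s(1)] by (simp add: comp_def)
  thus ?thesis using s(1) t p0E by (intro exI[of _ s] exI[of _ p0]) (simp add: F_def comp_def)
 qed
 have "good F" unfolding good_def
 proof (intro conjI ballI csF)
  show "F \<subseteq> E" using FE by auto
  fix u x assume u: "u : K" and x: "x : F"
  have xE: "x : E" using FE[OF x] .
  have m1: "T x : E" "T (T x) : E" "V u x : E" "T (V u x) : E" "T (T (V u x)) : E" "V u (T x) : E" "V u (T (T x)) : E" "T (V u (T x)) : E"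
   using TE xE V_E[OF u] by auto
  have "nrm (T (T (V u x)) - T (V u (T x))) = 0" by (rule antisym) (use Tsub[of "T (V u x)" "V u (T x)"] TV[OF u xE] m1 in auto)
  moreover have "nrm (T (V u (T x)) - V u (T (T x))) = 0" using TV[OF u m1(1)] .
  moreover have "nrm (V u (T (T x)) - sc (of_real (m^2)) (V u x)) = 0"
  proof -
   have "V u (T (T x) - sc (of_real (m^2)) x) = V u (T (T x)) - sc (of_real (m^2)) (V u x)"
    using m1 xE csub_sc[OF E] by (simp add: V_diff[OF u] V_sc[OF u])
   thus ?thesis using V_nrm[OF u, of "T (T x) - sc (of_real (m^2)) x"] x m1 xE csub_diff[OF E] csub_sc[OF E] by (simp add: F_def)
  qed
  ultimately have "nrm (T (T (V u x)) - sc (of_real (m^2)) (V u x)) = 0" using m1 by (meson nrm_diff_eq0_trans E_H sc_mem)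
  thus "V u x : F" using m1 by (simp add: F_def)
 next
  obtain s p0 where s: "strict_mono s" "p0 : F" "tends (p \<circ> s) p0" using cptF[of p] p by auto
  have "nrm p0 = 1" using LIMSEQ_unique[OF tends_nrm[OF _ _ s(3)], of 1] p FE[OF s(2)] by (simp add: comp_def)
  thus "\<exists>x\<in>F. nrm x ~= 0" using s(2) by (intro bexI[of _ p0]) auto
 qed
 moreover have "\<exists>s p0. strict_mono s \<and> p0 : F \<and> tends (x \<circ> (s :: nat => nat)) p0"
  if x: "!!n. x n : F \<and> nrm (x n) <= 1" for x
 proof (rule cptF)
  show "x n : E \<and> nrm (x n) <= 1" for n using x[of n] FE by blast
  have "(%n. nrm (T (T (x n)) - sc (of_real (m^2)) (x n))) = (%n. 0)" using x by (simp add: F_def)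
  thus "(%n. nrm (T (T (x n)) - sc (of_real (m^2)) (x n))) ----> 0" by simp
 qed
 ultimately obtain y where "y : F" "nrm y ~= 0" "!!u. u : K ==> \<exists>\<gamma>. nrm (V u y - sc \<gamma> y) = 0"
  using joint_eigenvector_of_compact by blast
 thus ?thesis using that FE by blast
qed

end

section \<open>Topological groups and their quotients\<close>

lemma openin_connected_component_of:
 assumes "!!y. y : topspace T ==> \<exists>B. openin T B \<and> y : B \<and> connectedin T B"
 shows "openin T (connected_component_of_set T x)"
proof (subst openin_subopen, intro ballI)
 fix y assume y: "y : connected_component_of_set T x"
 hence "y : topspace T" using connected_component_of_subset_topspace by fastforce
 then obtain B where B: "openin T B" "y : B" "connectedin T B" using assms by blast
 have "B \<subseteq> connected_component_of_set T x"
 proof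
  fix z assume "z : B"
  hence "z : connected_component_of_set T y" using connected_component_of_maximal[OF B(3,2)] by blast
  thus "z : connected_component_of_set T x" using y connected_component_of_trans[of T x y z] by simp
 qed
 thus "\<exists>B. openin T B \<and> y : B \<and> B \<subseteq> connected_component_of_set T x" using B by blast
qed

text \<open>Charts pull back balls, which are connected. Through
  \<open>openin_connected_component_of\<close> this makes the identity component open.\<close>

lemma smooth_atlas_connected_nbhd:
 fixes A :: "('m, 'e::euclidean_space) chart set"
 assumes A: "smooth_atlas T A" and y: "y : topspace T"
 shows "\<exists>B. openin T B \<and> y : B \<and> connectedin T B"
proof -
 have "y : (\<Union>(U, \<phi>)\<in>A. U)" using A y by (simp add: smooth_atlas_def)
 then obtain U \<phi> where U: "(U, \<phi>) : A" "y : U" by auto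
 have "is_chart T (U, \<phi>)" using A U(1) by (simp add: smooth_atlas_def)
 hence ch: "openin T U" "open (\<phi> ` U)" "homeomorphic_map (subtopology T U) (top_of_set (\<phi> ` U)) \<phi>"
  by (auto simp: is_chart_def)
 obtain r where r: "r > 0" "ball (\<phi> y) r \<subseteq> \<phi> ` U" using ch(2) U(2) by (meson imageI open_contains_ball)
 have tsU: "topspace (subtopology T U) = U" using openin_subset[OF ch(1)] by auto
 define B where "B = {z : topspace (subtopology T U). \<phi> z : ball (\<phi> y) r}"
 have B_U: "B \<subseteq> topspace (subtopology T U)" by (auto simp: B_def)
 have "\<phi> ` B = ball (\<phi> y) r" using r(2) unfolding B_def tsU by blast
 moreover have "connectedin (top_of_set (\<phi> ` U)) (ball (\<phi> y) r)" using r(2) by (simp add: connectedin_subtopology)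
 ultimately have "connectedin (subtopology T U) B" using homeomorphic_map_connectedness[OF ch(3) B_U] by simp
 hence "connectedin T B" by (simp add: connectedin_subtopology)
 moreover have "openin (top_of_set (\<phi> ` U)) (ball (\<phi> y) r)" using r(2) by (simp add: open_subset)
 hence "openin (subtopology T U) B" unfolding B_def
  by (rule openin_continuous_map_preimage[OF homeomorphic_imp_continuous_map[OF ch(3)]])
 hence "openin T B" using ch(1) by (rule openin_trans_full)
 moreover have "y : B" using U(2) r(1) tsU by (simp add: B_def)
 ultimately show ?thesis by blast
qed

locale topological_group = group G for G :: "('g, 'z) monoid_scheme" (structure) +
 fixes T :: "'g topology"
 assumes T: "topspace T = carrier G"
  and mult_cont: "continuous_map (prod_topology T T) T (%(x, y). x \<otimes> y)"
  and inv_cont: "continuous_map T T (m_inv G)"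
begin

lemma mult_continuous:
 assumes "continuous_map Y T f" "continuous_map Y T g" shows "continuous_map Y T (%y. f y \<otimes> g y)"
 using continuous_map_compose[OF continuous_map_pairedI[OF assms] mult_cont] by (simp add: comp_def)

lemma inv_continuous:
 assumes "continuous_map Y T f" shows "continuous_map Y T (%y. inv (f y))"
 using continuous_map_compose[OF assms inv_cont] by (simp add: comp_def)

lemma open_carrier: "openin T W ==> x : W ==> x : carrier G" using openin_subset T by blast

lemma right_translate_open:
 assumes W: "openin T W" and g: "g : carrier G"
 shows "openin T ((%x. x \<otimes> g) ` W)"
proof -
 have "continuous_map T T (%x. x \<otimes> inv g)" using g T by (intro mult_continuous) auto
 hence "openin T {y : topspace T. y \<otimes> inv g : W}" using W by (rule openin_continuous_map_preimage)
 moreover have "{y : topspace T. y \<otimes> inv g : W} = (%x. x \<otimes> g) ` W"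
 proof (intro equalityI subsetI)
  fix y assume "y : {y : topspace T. y \<otimes> inv g : W}"
  thus "y : (%x. x \<otimes> g) ` W" using g T by (intro image_eqI[of _ _ "y \<otimes> inv g"]) (auto simp: m_assoc)
 next
  fix y assume "y : (%x. x \<otimes> g) ` W"
  then obtain x where "x : W" "y = x \<otimes> g" by blast
  thus "y : {y : topspace T. y \<otimes> inv g : W}" using g T open_carrier[OF W] by (simp add: m_assoc)
 qed
 ultimately show ?thesis by simp
qed

section \<open>The identity component and the subgroup generated by it and \<open>a\<close>\<close>

abbreviation idc :: "'g set" where "idc \<equiv> connected_component_of_set T \<one>"

lemma idc_connected: "connectedin T idc" by (rule connectedin_connected_component_of)

lemma idc_one: "\<one> : idc" using connected_component_of_refl[of T \<one>] T by simp

lemma idc_carrier: "x : idc ==> x : carrier G" using connectedin_subset_topspace[OF idc_connected] T by blast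

lemma idc_maximal: "connectedin T C ==> \<one> : C ==> C \<subseteq> idc" by (rule connected_component_of_maximal)

lemma idc_mult: "x : idc ==> y : idc ==> x \<otimes> y : idc"
proof -
 assume x: "x : idc" and y: "y : idc"
 let ?C = "(%(x, y). x \<otimes> y) ` (idc \<times> idc)"
 have "connectedin T ?C" by (rule connectedin_continuous_map_image[OF mult_cont]) (simp add: connectedin_Times idc_connected)
 moreover have "\<one> : ?C" using idc_one by (intro image_eqI[of _ _ "(\<one>, \<one>)"]) auto
 ultimately have "?C \<subseteq> idc" by (rule idc_maximal)
 moreover have "x \<otimes> y : ?C" using x y by (intro image_eqI[of _ _ "(x, y)"]) auto
 ultimately show ?thesis by (rule subsetD)
qed

lemma idc_image:
 assumes "continuous_map T T f" "f \<one> = \<one>" "x : idc" shows "f x : idc"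
proof -
 have "connectedin T (f ` idc)" by (rule connectedin_continuous_map_image[OF assms(1) idc_connected])
 moreover have "\<one> : f ` idc" using idc_one assms(2) by (metis imageI)
 ultimately have "f ` idc \<subseteq> idc" by (rule idc_maximal)
 thus ?thesis using imageI[OF assms(3)] by (rule subsetD)
qed

lemma idc_inv: "x : idc ==> inv x : idc" by (rule idc_image[OF inv_cont]) simp_all

lemma idc_conj: "x : idc ==> g : carrier G ==> g \<otimes> x \<otimes> inv g : idc"
 by (rule idc_image[where f = "%x. g \<otimes> x \<otimes> inv g"]) (auto intro!: mult_continuous simp: T)

definition idc_gen :: "'g => 'g set" where
 "idc_gen a = {c \<otimes> a [^] n | c (n::int). c : idc}"

text \<open>The identity component is normal, so powers of \<open>a\<close> can be moved past
  it.\<close>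

lemma subgroup_idc_gen:
 assumes a: "a : carrier G" shows "subgroup (idc_gen a) G"
proof (rule subgroupI)
 show "idc_gen a \<subseteq> carrier G" unfolding idc_gen_def using a idc_carrier by auto
 show "idc_gen a ~= {}" unfolding idc_gen_def using idc_one by blast
 show "inv x : idc_gen a" if x: "x : idc_gen a" for x
 proof -
  obtain c n where c: "c : idc" "x = c \<otimes> a [^] (n::int)" using x unfolding idc_gen_def by blast
  have cG: "c : carrier G" using idc_carrier[OF c(1)] .
  let ?b = "a [^] (- n)"
  have "inv x = (?b \<otimes> inv c \<otimes> inv ?b) \<otimes> ?b" using a cG c(2) by (simp add: inv_mult_group int_pow_neg m_assoc)
  moreover have "?b \<otimes> inv c \<otimes> inv ?b : idc" using a by (intro idc_conj idc_inv c) simp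
  ultimately show ?thesis unfolding idc_gen_def by blast
 qed
 show "x \<otimes> y : idc_gen a" if x: "x : idc_gen a" and y: "y : idc_gen a" for x y
 proof -
  obtain c n where c: "c : idc" "x = c \<otimes> a [^] (n::int)" using x unfolding idc_gen_def by blast
  obtain d m where d: "d : idc" "y = d \<otimes> a [^] (m::int)" using y unfolding idc_gen_def by blast
  have cG: "c : carrier G" "d : carrier G" using idc_carrier c d by auto
  let ?b = "a [^] n"
  have "x \<otimes> y = c \<otimes> (?b \<otimes> d \<otimes> inv ?b) \<otimes> (?b \<otimes> a [^] m)"
  proof -
   have "inv ?b \<otimes> (?b \<otimes> a [^] m) = a [^] m" using a by (simp add: m_assoc[symmetric])
   thus ?thesis using a cG c(2) d(2) by (simp add: m_assoc)
  qed
  hence "x \<otimes> y = c \<otimes> (?b \<otimes> d \<otimes> inv ?b) \<otimes> a [^] (n + m)" using a by (simp add: int_pow_mult)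
  moreover have "c \<otimes> (?b \<otimes> d \<otimes> inv ?b) : idc" using a by (intro idc_mult idc_conj c d) simp
  ultimately show ?thesis unfolding idc_gen_def by blast
 qed
qed

lemma idc_idc_gen: "a : carrier G ==> idc \<subseteq> idc_gen a"
proof
 fix x assume "a : carrier G" "x : idc"
 thus "x : idc_gen a" unfolding idc_gen_def using idc_carrier by (intro CollectI exI[of _ x] exI[of _ "0::int"]) simp
qed

lemma gen_idc_gen: "a : carrier G ==> a : idc_gen a"
 unfolding idc_gen_def using idc_one by (intro CollectI exI[of _ \<one>] exI[of _ "1::int"]) simp

lemma openin_idc_gen:
 assumes a: "a : carrier G" and o: "openin T idc" shows "openin T (idc_gen a)"
proof -
 have "idc_gen a = (\<Union>n::int. (%x. x \<otimes> a [^] n) ` idc)" unfolding idc_gen_def by blast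
 thus ?thesis using right_translate_open[OF o] a by auto
qed

section \<open>The coset space and its invariant measure\<close>

lemma coset_eq_iff:
 assumes \<Gamma>: "subgroup \<Gamma> G" and x: "x : carrier G" and y: "y : carrier G"
 shows "x <# \<Gamma> = y <# \<Gamma> \<longleftrightarrow> inv x \<otimes> y : \<Gamma>"
proof
 assume e: "x <# \<Gamma> = y <# \<Gamma>"
 have "y : y <# \<Gamma>" unfolding l_coset_def using subgroup.one_closed[OF \<Gamma>] y by (intro UN_I[of \<one>]) auto
 hence "y : x <# \<Gamma>" by (simp only: e)
 then obtain \<gamma> where g: "\<gamma> : \<Gamma>" "y = x \<otimes> \<gamma>" unfolding l_coset_def by blast
 have "\<gamma> : carrier G" using subgroup.mem_carrier[OF \<Gamma> g(1)] .
 thus "inv x \<otimes> y : \<Gamma>" using g x by (simp add: m_assoc[symmetric])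
next
 assume g: "inv x \<otimes> y : \<Gamma>"
 have "(inv x \<otimes> y) <# \<Gamma> = \<Gamma>" using coset_join3[OF _ \<Gamma> g] x y by simp
 hence "x <# \<Gamma> = x <# ((inv x \<otimes> y) <# \<Gamma>)" by simp
 also have "\<dots> = (x \<otimes> (inv x \<otimes> y)) <# \<Gamma>" using lcos_m_assoc[OF subgroup.subset[OF \<Gamma>]] x y by simp
 also have "x \<otimes> (inv x \<otimes> y) = y" using x y by (simp add: m_assoc[symmetric])
 finally show "x <# \<Gamma> = y <# \<Gamma>" .
qed

lemma topspace_cosets: "topspace (coset_topology G T \<Gamma>) = (%g. g <# \<Gamma>) ` carrier G"
 unfolding topspace_coset_topology[OF T] LCOSETS_def by blast

text \<open>The preimage of the image of \<open>W\<close> is the union of the right translates of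
  \<open>W\<close> by \<open>\<Gamma>\<close>.\<close>

lemma coset_map_open:
 assumes \<Gamma>: "subgroup \<Gamma> G" and W: "openin T W"
 shows "openin (coset_topology G T \<Gamma>) ((%g. g <# \<Gamma>) ` W)" unfolding openin_coset_topology
proof
 show "(%g. g <# \<Gamma>) ` W \<subseteq> lcosets \<Gamma>" using open_carrier[OF W] unfolding LCOSETS_def by blast
 have "{g : topspace T. g <# \<Gamma> : (%g. g <# \<Gamma>) ` W} = (\<Union>\<gamma>\<in>\<Gamma>. (%x. x \<otimes> \<gamma>) ` W)"
 proof (intro equalityI subsetI)
  fix g assume "g : {g : topspace T. g <# \<Gamma> : (%g. g <# \<Gamma>) ` W}"
  then obtain w where w: "g : carrier G" "w : W" "w <# \<Gamma> = g <# \<Gamma>" using T by auto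
  have wG: "w : carrier G" using open_carrier[OF W w(2)] .
  have "inv w \<otimes> g : \<Gamma>" using coset_eq_iff[OF \<Gamma> wG w(1)] w(3) by simp
  moreover have "g = w \<otimes> (inv w \<otimes> g)" using wG w(1) by (simp add: m_assoc[symmetric])
  ultimately show "g : (\<Union>\<gamma>\<in>\<Gamma>. (%x. x \<otimes> \<gamma>) ` W)" using w(2) by blast
 next
  fix g assume "g : (\<Union>\<gamma>\<in>\<Gamma>. (%x. x \<otimes> \<gamma>) ` W)"
  then obtain w \<gamma> where w: "\<gamma> : \<Gamma>" "w : W" "g = w \<otimes> \<gamma>" by blast
  have G: "w : carrier G" "\<gamma> : carrier G" using open_carrier[OF W w(2)] subgroup.mem_carrier[OF \<Gamma> w(1)] by auto
  have "w <# \<Gamma> = g <# \<Gamma>" using coset_eq_iff[OF \<Gamma> G(1), of g] G w by (simp add: m_assoc[symmetric])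
  thus "g : {g : topspace T. g <# \<Gamma> : (%g. g <# \<Gamma>) ` W}" using w G T by auto
 qed
 moreover have "openin T (\<Union>\<gamma>\<in>\<Gamma>. (%x. x \<otimes> \<gamma>) ` W)"
  using right_translate_open[OF W] subgroup.mem_carrier[OF \<Gamma>] by (intro openin_Union) auto
 ultimately show "openin T {g : topspace T. g <# \<Gamma> : (%g. g <# \<Gamma>) ` W}" by simp
qed

lemma coset_act_mult:
 assumes \<Gamma>: "subgroup \<Gamma> G" and g: "g : carrier G" "h : carrier G" shows "g <# (h <# \<Gamma>) = (g \<otimes> h) <# \<Gamma>"
 using lcos_m_assoc[OF subgroup.subset[OF \<Gamma>] g] .

lemma nbhds_of_mult:
 assumes W: "openin T W" and g: "g : carrier G" and h: "h : carrier G" and gh: "g \<otimes> h : W"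
 shows "\<exists>M N. openin T M \<and> openin T N \<and> g : M \<and> h : N \<and> (\<forall>x\<in>M. \<forall>y\<in>N. x \<otimes> y : W)"
proof -
 define P where "P = {p : topspace (prod_topology T T). (%(x, y). x \<otimes> y) p : W}"
 have "openin (prod_topology T T) P" unfolding P_def by (rule openin_continuous_map_preimage[OF mult_cont W])
 moreover have "(g, h) : P" unfolding P_def using g h gh T by simp
 ultimately obtain M N where MN: "openin T M" "openin T N" "g : M" "h : N" "M \<times> N \<subseteq> P"
  unfolding openin_prod_topology_alt by metis
 have "x \<otimes> y : W" if "x : M" "y : N" for x y
 proof -
  have "(x, y) : P" using that MN(5) by blast
  thus ?thesis by (simp add: P_def)
 qed
 thus ?thesis using MN(1-4) by (intro exI[of _ M] exI[of _ N]) blast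
qed

text \<open>A product of a quotient map with an identity map need not be a quotient map; openness of
  the coset map provides the required neighbourhoods.\<close>

lemma coset_act_continuous:
 assumes \<Gamma>: "subgroup \<Gamma> G"
 shows "continuous_map (prod_topology T (coset_topology G T \<Gamma>)) (coset_topology G T \<Gamma>) (%(g, C). g <# C)"
  (is "continuous_map (prod_topology T ?X) ?X _") unfolding continuous_map_def
proof (intro conjI allI impI)
 show "(%(g, C). g <# C) : topspace (prod_topology T ?X) \<rightarrow> topspace ?X"
  using coset_act_mult[OF \<Gamma>] unfolding topspace_prod_topology topspace_cosets T by (auto simp: Pi_iff)
 fix W assume W: "openin ?X W"
 have qW: "openin T {g : topspace T. g <# \<Gamma> : W}" using W by (simp add: openin_coset_topology)
 show "openin (prod_topology T ?X) {p : topspace (prod_topology T ?X). (case p of (g, C) => g <# C) : W}"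
  unfolding openin_prod_topology_alt
 proof (intro allI impI)
  fix g C assume "(g, C) : {p : topspace (prod_topology T ?X). (case p of (g, C) => g <# C) : W}"
  hence g: "g : carrier G" and C: "C : topspace ?X" and gC: "g <# C : W" using T by auto
  obtain h where h: "h : carrier G" "C = h <# \<Gamma>" using C unfolding topspace_cosets by blast
  have "g \<otimes> h : {g : topspace T. g <# \<Gamma> : W}" using gC g h coset_act_mult[OF \<Gamma> g h(1)] T by simp
  then obtain M N where MN: "openin T M" "openin T N" "g : M" "h : N"
   "\<forall>x\<in>M. \<forall>y\<in>N. x \<otimes> y : {g : topspace T. g <# \<Gamma> : W}"
   using nbhds_of_mult[OF qW g h(1)] by blast
  show "\<exists>M O'. openin T M \<and> openin ?X O' \<and> g : M \<and> C : O' \<and>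
   M \<times> O' \<subseteq> {p : topspace (prod_topology T ?X). (case p of (g, C) => g <# C) : W}"
  proof (intro exI conjI)
   show "openin T M" "g : M" by fact+
   show "openin ?X ((%g. g <# \<Gamma>) ` N)" by (rule coset_map_open[OF \<Gamma> MN(2)])
   show "C : (%g. g <# \<Gamma>) ` N" using h MN(4) by blast
   show "M \<times> (%g. g <# \<Gamma>) ` N \<subseteq> {p : topspace (prod_topology T ?X). (case p of (g, C) => g <# C) : W}"
   proof clarify
    fix x y assume x: "x : M" and y: "y : N"
    have G: "x : carrier G" "y : carrier G" using open_carrier MN x y by auto
    show "(x, y <# \<Gamma>) : topspace (prod_topology T ?X) \<and> x <# (y <# \<Gamma>) : W"
     using MN(5)[rule_format, OF x y] G coset_act_mult[OF \<Gamma> G] T topspace_cosets by simp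
   qed
  qed
 qed
qed

text \<open>Let \<open>N\<close> be a neighbourhood of the identity that meets
  \<open>\<Gamma>\<close> only there. Around \<open>z\<close> there is \<open>M\<close> with
  \<open>inv x \<otimes> y\<close> in \<open>N\<close> for all \<open>x\<close>, \<open>y\<close> in
  \<open>M\<close>, so \<open>M\<close> meets \<open>\<Gamma>\<close> in at most one point, which
  can be removed as points are closed.\<close>

lemma discrete_subgroup_closed:
 assumes \<Gamma>: "subgroup \<Gamma> G" and d: "subtopology T \<Gamma> = discrete_topology \<Gamma>" and H: "Hausdorff_space T"
 shows "openin T (carrier G - \<Gamma>)"
proof (subst openin_subopen, intro ballI)
 fix z assume z: "z : carrier G - \<Gamma>"
 have one: "\<one> : \<Gamma>" using subgroup.one_closed[OF \<Gamma>] .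
 have "openin (subtopology T \<Gamma>) {\<one>}" unfolding d using one by simp
 then obtain N where N: "openin T N" "{\<one>} = N \<inter> \<Gamma>" unfolding openin_subtopology by (metis inf_commute)
 have "inv z \<otimes> z : N" using z N by auto
 then obtain P Q where PQ: "openin T P" "openin T Q" "inv z : P" "z : Q" "\<forall>x\<in>P. \<forall>y\<in>Q. x \<otimes> y : N"
  using nbhds_of_mult[OF N(1), of "inv z" z] z by auto
 define M where "M = Q \<inter> {x : topspace T. inv x : P}"
 have M: "openin T M" unfolding M_def by (intro openin_Int PQ openin_continuous_map_preimage[OF inv_cont])
 have zM: "z : M" unfolding M_def using z PQ T by simp
 have unique: "\<gamma> = \<delta>" if "\<gamma> : M \<inter> \<Gamma>" "\<delta> : M \<inter> \<Gamma>" for \<gamma> \<delta>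
 proof -
  have G: "\<gamma> : carrier G" "\<delta> : carrier G" using that subgroup.mem_carrier[OF \<Gamma>] by auto
  have "inv \<gamma> \<otimes> \<delta> : N" using that PQ(5) by (simp add: M_def)
  moreover have "inv \<gamma> \<otimes> \<delta> : \<Gamma>" using that subgroup.m_closed[OF \<Gamma>] subgroup.m_inv_closed[OF \<Gamma>] by simp
  ultimately have "inv \<gamma> \<otimes> \<delta> = \<one>" using N(2) by blast
  thus ?thesis using G by (metis inv_equality inv_inv inv_closed)
 qed
 have "finite (M \<inter> \<Gamma>)"
 proof (cases "M \<inter> \<Gamma> = {}")
  case False
  then obtain \<gamma> where "\<gamma> : M \<inter> \<Gamma>" by blast
  hence "M \<inter> \<Gamma> \<subseteq> {\<gamma>}" using unique by blast
  thus ?thesis by (rule finite_subset) simp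
 qed simp
 moreover have "M \<inter> \<Gamma> \<subseteq> topspace T" using subgroup.subset[OF \<Gamma>] T by blast
 ultimately have "closedin T (M \<inter> \<Gamma>)" using H by (metis Hausdorff_imp_t1_space t1_space_closedin_finite)
 hence "openin T (M - M \<inter> \<Gamma>)" using M by (rule openin_diff[rotated])
 moreover have "z : M - M \<inter> \<Gamma>" using zM z by blast
 moreover have "M - M \<inter> \<Gamma> \<subseteq> carrier G - \<Gamma>" using open_carrier[OF M] by blast
 ultimately show "\<exists>B. openin T B \<and> z : B \<and> B \<subseteq> carrier G - \<Gamma>" by blast
qed

lemma coset_Hausdorff:
 assumes \<Gamma>: "subgroup \<Gamma> G" and c: "openin T (carrier G - \<Gamma>)"
 shows "Hausdorff_space (coset_topology G T \<Gamma>)" unfolding Hausdorff_space_def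
proof (intro allI impI)
 fix C D assume "C : topspace (coset_topology G T \<Gamma>) \<and> D : topspace (coset_topology G T \<Gamma>) \<and> C ~= D"
 then obtain x y where xy: "x : carrier G" "y : carrier G" "C = x <# \<Gamma>" "D = y <# \<Gamma>" "C ~= D"
  unfolding topspace_cosets by blast
 have "inv x \<otimes> y : carrier G - \<Gamma>" using coset_eq_iff[OF \<Gamma> xy(1,2)] xy by simp
 then obtain P Q where PQ: "openin T P" "openin T Q" "inv x : P" "y : Q" "\<forall>u\<in>P. \<forall>v\<in>Q. u \<otimes> v : carrier G - \<Gamma>"
  using nbhds_of_mult[OF c, of "inv x" y] xy by auto
 define M where "M = {x : topspace T. inv x : P}"
 have M: "openin T M" unfolding M_def by (intro PQ openin_continuous_map_preimage[OF inv_cont])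
 have "disjnt ((%g. g <# \<Gamma>) ` M) ((%g. g <# \<Gamma>) ` Q)"
 proof (rule ccontr)
  assume "\<not> disjnt ((%g. g <# \<Gamma>) ` M) ((%g. g <# \<Gamma>) ` Q)"
  then obtain u v where uv: "u : M" "v : Q" "u <# \<Gamma> = v <# \<Gamma>" unfolding disjnt_def by blast
  have G: "u : carrier G" "v : carrier G" using open_carrier M PQ(2) uv by auto
  have "inv u \<otimes> v : \<Gamma>" using coset_eq_iff[OF \<Gamma> G] uv(3) by simp
  moreover have "inv u \<otimes> v \<notin> \<Gamma>" using PQ(5) uv by (simp add: M_def)
  ultimately show False by blast
 qed
 moreover have "x : M" unfolding M_def using xy(1) T PQ(3) by simp
 ultimately show "\<exists>A B. openin (coset_topology G T \<Gamma>) A \<and> openin (coset_topology G T \<Gamma>) B \<and> C : A \<and> D : B \<and> disjnt A B"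
  using coset_map_open[OF \<Gamma> M] coset_map_open[OF \<Gamma> PQ(2)] xy PQ(4) by blast
qed

lemma coset_translate_vimage:
 assumes \<Gamma>: "subgroup \<Gamma> G" and g: "g : carrier G" and B: "B \<subseteq> lcosets \<Gamma>"
 shows "{C : lcosets \<Gamma>. g <# C : B} = (%C. inv g <# C) ` B"
proof (intro equalityI subsetI)
 fix C assume C: "C : {C : lcosets \<Gamma>. g <# C : B}"
 then obtain h where h: "h : carrier G" "C = h <# \<Gamma>" unfolding LCOSETS_def by blast
 have "inv g <# (g <# C) = C" using h g coset_act_mult[OF \<Gamma>] by (simp add: m_assoc[symmetric])
 thus "C : (%C. inv g <# C) ` B" using C by (metis (no_types, lifting) imageI mem_Collect_eq)
next
 fix C assume "C : (%C. inv g <# C) ` B"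
 then obtain D where D: "D : B" "C = inv g <# D" by blast
 then obtain h where h: "h : carrier G" "D = h <# \<Gamma>" using B unfolding LCOSETS_def by blast
 have "C = (inv g \<otimes> h) <# \<Gamma>" using D h g coset_act_mult[OF \<Gamma>] by simp
 moreover have "g <# C = D" using D h g coset_act_mult[OF \<Gamma>] by (simp add: m_assoc[symmetric])
 ultimately show "C : {C : lcosets \<Gamma>. g <# C : B}" using D(1) g h unfolding LCOSETS_def by auto
qed

text \<open>By transitivity and compactness finitely many translates of \<open>W\<close> cover the
  space, so they cannot all be null.\<close>

lemma haar_full_support:
 assumes \<Gamma>: "subgroup \<Gamma> G" and X: "compact_space (coset_topology G T \<Gamma>)"
  and \<mu>: "haar_measure_on_quotient G T \<Gamma> \<mu>" and W: "openin (coset_topology G T \<Gamma>) W" "W ~= {}"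
 shows "emeasure \<mu> W > 0"
proof (rule ccontr)
 let ?X = "coset_topology G T \<Gamma>"
 assume "\<not> emeasure \<mu> W > 0"
 hence z: "emeasure \<mu> W = 0" by simp
 interpret prob_space \<mu> using \<mu> by (simp add: haar_measure_on_quotient_def)
 have sp: "space \<mu> = lcosets \<Gamma>" and st: "sets \<mu> = sigma_sets (lcosets \<Gamma>) {W. openin ?X W}"
  and iv: "!!g B. g : carrier G ==> B : sets \<mu> ==> emeasure \<mu> ((%C. g <# C) ` B) = emeasure \<mu> B"
  using \<mu> by (auto simp: haar_measure_on_quotient_def)
 have os: "O' : sets \<mu>" if "openin ?X O'" for O' unfolding st using that by (simp add: sigma_sets.Basic)
 have Wsub: "W \<subseteq> lcosets \<Gamma>" using W(1) by (simp add: openin_coset_topology)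
 obtain C0 where C0: "C0 : W" using W(2) by blast
 obtain w where w: "w : carrier G" "C0 = w <# \<Gamma>" using C0 Wsub unfolding LCOSETS_def by blast
 define tr where "tr g = {C : lcosets \<Gamma>. g <# C : W}" for g
 have tr_open: "openin ?X (tr g)" if g: "g : carrier G" for g
 proof -
  have "continuous_map ?X (prod_topology T ?X) (%C. (g, C))" using g T by (intro continuous_map_pairedI) auto
  from continuous_map_compose[OF this coset_act_continuous[OF \<Gamma>]]
  have "continuous_map ?X ?X (%C. g <# C)" by (simp add: comp_def)
  hence "openin ?X {C : topspace ?X. g <# C : W}" using W(1) by (rule openin_continuous_map_preimage)
  thus ?thesis by (simp add: tr_def topspace_coset_topology[OF T])
 qed
 have tr_null: "tr g : null_sets \<mu>" if g: "g : carrier G" for g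
 proof -
  have "emeasure \<mu> (tr g) = 0" unfolding tr_def coset_translate_vimage[OF \<Gamma> g Wsub] using iv[of "inv g" W] os[OF W(1)] g z by simp
  thus ?thesis using os[OF tr_open[OF g]] by (simp add: null_sets_def)
 qed
 have "topspace ?X \<subseteq> \<Union>(tr ` carrier G)"
 proof
  fix C assume "C : topspace ?X"
  then obtain h where h: "h : carrier G" "C = h <# \<Gamma>" unfolding topspace_cosets by blast
  have "(w \<otimes> inv h) <# C = C0" using h w coset_act_mult[OF \<Gamma>] by (simp add: m_assoc)
  hence 1: "C : tr (w \<otimes> inv h)" unfolding tr_def LCOSETS_def using h C0 by auto
  have "w \<otimes> inv h : carrier G" using w(1) h(1) by simp
  thus "C : \<Union>(tr ` carrier G)" using 1 by (rule UN_I)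
 qed
 moreover have "\<forall>O'\<in>tr ` carrier G. openin ?X O'" using tr_open by blast
 ultimately obtain F where F: "finite F" "F \<subseteq> tr ` carrier G" "topspace ?X \<subseteq> \<Union>F"
  using X unfolding compact_space_alt by meson
 have "\<Union>F : null_sets \<mu>"
 proof -
  have "\<Union>(id ` F) : null_sets \<mu>" using F(2) tr_null by (intro null_sets_UN' countable_finite[OF F(1)]) auto
  thus ?thesis by simp
 qed
 moreover have "space \<mu> \<subseteq> \<Union>F" using F(3) sp by (simp add: topspace_coset_topology[OF T])
 ultimately have "space \<mu> : null_sets \<mu>" using null_sets_subset[OF _ sets.top] by blast
 thus False using emeasure_space_1 by (simp add: null_sets_def)
qed

text \<open>The orbits of an open subgroup \<open>S\<close> are open, so by ergodicity there is only one.\<close>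

lemma ergodic_transitive:
 assumes \<Gamma>: "subgroup \<Gamma> G" and X: "compact_space (coset_topology G T \<Gamma>)"
  and \<mu>: "haar_measure_on_quotient G T \<Gamma> \<mu>" and erg: "ergodic_translation G \<mu> a"
  and S: "subgroup S G" "openin T S" "a : S" and x: "C : lcosets \<Gamma>"
 shows "\<exists>s\<in>S. C = s <# \<Gamma>"
proof (rule ccontr)
 let ?X = "coset_topology G T \<Gamma>" and ?q = "%g. g <# \<Gamma>"
 assume no: "\<not> (\<exists>s\<in>S. C = s <# \<Gamma>)"
 obtain h where h: "h : carrier G" "C = h <# \<Gamma>" using x unfolding LCOSETS_def by blast
 interpret prob_space \<mu> using \<mu> by (simp add: haar_measure_on_quotient_def)
 interpret l2_space \<mu> by unfold_locales
 have sp: "space \<mu> = lcosets \<Gamma>" and st: "sets \<mu> = sigma_sets (lcosets \<Gamma>) {W. openin ?X W}"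
  using \<mu> by (auto simp: haar_measure_on_quotient_def)
 have os: "O' : sets \<mu>" if "openin ?X O'" for O' unfolding st using that by (simp add: sigma_sets.Basic)
 note SG = subgroup.mem_carrier[OF S(1)]
 define R where "R = ?q ` S"
 define R' where "R' = ?q ` ((%s. s \<otimes> h) ` S)"
 have Ro: "openin ?X R" "openin ?X R'" unfolding R_def R'_def
  using coset_map_open[OF \<Gamma>] S(2) right_translate_open[OF S(2) h(1)] by auto
 have disj: "R \<inter> R' = {}"
 proof (rule ccontr)
  assume "R \<inter> R' ~= {}"
  then obtain s t where st: "s : S" "t : S" "s <# \<Gamma> = (t \<otimes> h) <# \<Gamma>" unfolding R_def R'_def by blast
  have "(inv t \<otimes> s) <# \<Gamma> = inv t <# (s <# \<Gamma>)"
   using coset_act_mult[OF \<Gamma>, of "inv t" s] SG[OF st(1)] SG[OF st(2)] by simp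
  also have "\<dots> = (inv t \<otimes> (t \<otimes> h)) <# \<Gamma>"
   unfolding st(3) using coset_act_mult[OF \<Gamma>, of "inv t" "t \<otimes> h"] SG[OF st(2)] h(1) by simp
  also have "inv t \<otimes> (t \<otimes> h) = h" using SG[OF st(2)] h(1) by (simp add: m_assoc[symmetric])
  finally have "(inv t \<otimes> s) <# \<Gamma> = C" using h(2) by simp
  moreover have "inv t \<otimes> s : S" using st(1,2) subgroup.m_closed[OF S(1)] subgroup.m_inv_closed[OF S(1)] by simp
  ultimately show False using no by blast
 qed
 have aG: "a : carrier G" using SG[OF S(3)] .
 have inv: "a <# D : R \<longleftrightarrow> D : R" if D: "D : lcosets \<Gamma>" for D
 proof
  assume "D : R"
  then obtain s where "s : S" "D = s <# \<Gamma>" unfolding R_def by blast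
  thus "a <# D : R" unfolding R_def using coset_act_mult[OF \<Gamma> aG SG] subgroup.m_closed[OF S(1,3)] by blast
 next
  assume "a <# D : R"
  then obtain s where s: "s : S" "a <# D = s <# \<Gamma>" unfolding R_def by blast
  obtain d where d: "d : carrier G" "D = d <# \<Gamma>" using D unfolding LCOSETS_def by blast
  have "D = inv a <# (a <# D)" using d aG coset_act_mult[OF \<Gamma>] by (simp add: m_assoc[symmetric])
  also have "\<dots> = (inv a \<otimes> s) <# \<Gamma>" using s aG SG coset_act_mult[OF \<Gamma>] by simp
  finally show "D : R" unfolding R_def using s(1) subgroup.m_closed[OF S(1)] subgroup.m_inv_closed[OF S(1,3)] by blast
 qed
 let ?f = "%x. indicator R x :: complex"
 have "?f : L2 \<mu>" by (rule indicator_L2) (rule os[OF Ro(1)])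
 moreover have "AE x in \<mu>. koopman G a ?f x = ?f x" by (rule AE_I2) (simp add: koopman_def inv sp indicator_def)
 ultimately obtain c where c: "AE x in \<mu>. ?f x = c" using erg unfolding ergodic_translation_def by blast
 have dense: "\<exists>x\<in>W. ?f x = c" if W: "openin ?X W" "W ~= {}" for W
 proof (rule ccontr)
  assume n: "\<not> (\<exists>x\<in>W. ?f x = c)"
  have "AE x in \<mu>. x \<notin> W" using c by eventually_elim (use n in blast)
  hence "emeasure \<mu> W = 0" using os[OF W(1)] sets.sets_into_space[OF os[OF W(1)]]
   by (subst (asm) AE_iff_measurable[OF os[OF W(1)]]) auto
  thus False using haar_full_support[OF \<Gamma> X \<mu> W] by simp
 qed
 have ne: "R ~= {}" "R' ~= {}" using S(3) unfolding R_def R'_def by blast+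
 have "c = 1" using dense[OF Ro(1) ne(1)] by auto
 moreover have "c = 0" using dense[OF Ro(2) ne(2)] disj by (auto simp: indicator_def)
 ultimately show False by simp
qed

end

text \<open>For use with the open subgroup generated by the identity component and \<open>a\<close>,
  which inherits the nilpotency of \<open>G\<close> in this way.\<close>

lemma lower_central_subgroup:
 fixes G (structure)
 assumes G: "group G" and S: "subgroup S G"
 shows "lower_central (G\<lparr>carrier := S\<rparr>) i \<subseteq> lower_central G i \<and> subgroup (lower_central (G\<lparr>carrier := S\<rparr>) i) G \<and>
  lower_central (G\<lparr>carrier := S\<rparr>) i \<subseteq> S"
proof (induction i)
 interpret group G by (rule G)
 note SG = subgroup.mem_carrier[OF S]
 {
  case 0 thus ?case using S subgroup.subset[OF S] by auto
 next
  case (Suc i)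
  let ?L = "lower_central (G\<lparr>carrier := S\<rparr>) i"
  let ?K = "\<Union>x\<in>?L. \<Union>y\<in>S. {x \<otimes> y \<otimes> inv x \<otimes> inv y}"
  have LS: "?L \<subseteq> S" using Suc by blast
  have K: "(\<Union>x\<in>?L. \<Union>y\<in>S. {x \<otimes> y \<otimes> inv\<^bsub>G\<lparr>carrier := S\<rparr>\<^esub> x \<otimes> inv\<^bsub>G\<lparr>carrier := S\<rparr>\<^esub> y}) = ?K"
   using LS m_inv_consistent[OF S] by (intro SUP_cong refl) auto
  have KS: "?K \<subseteq> S" using LS subgroup.m_closed[OF S] subgroup.m_inv_closed[OF S] by (auto intro!: subgroup.m_closed[OF S])
  have e: "lower_central (G\<lparr>carrier := S\<rparr>) (Suc i) = generate G ?K" using generate_consistent[OF KS S] K by simp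
  have "?K \<subseteq> (\<Union>x\<in>lower_central G i. \<Union>y\<in>carrier G. {x \<otimes> y \<otimes> inv x \<otimes> inv y})" using Suc SG by blast
  hence "generate G ?K \<subseteq> lower_central G (Suc i)" using mono_generate by simp
  moreover have "subgroup (generate G ?K) G" using KS SG by (intro generate_is_subgroup) blast
  moreover have "generate G ?K \<subseteq> S" by (rule generate_subgroup_incl[OF KS S])
  ultimately show ?case unfolding e by blast
 }
qed

lemma lie_group_topological:
 fixes A :: "('g, 'e::euclidean_space) chart set"
 assumes "lie_group G T A"
 shows "topological_group G T" "!!x. openin T (connected_component_of_set T x)"
proof -
 have g: "group G" and T: "topspace T = carrier G" using assms by (auto simp: lie_group_def)
 interpret group G by (rule g)
 have alt: "smooth_atlas T A \<and> continuous_map (prod_topology T T) T (%(x, y). x \<otimes>\<^bsub>G\<^esub> y) \<and> continuous_map T T (m_inv G) \<or>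
  T = discrete_topology (carrier G)" using assms unfolding lie_group_def smooth_map_def by blast
 have nb: "\<exists>B. openin T B \<and> y : B \<and> connectedin T B" if y: "y : topspace T" for y using alt
 proof
  assume "smooth_atlas T A \<and> continuous_map (prod_topology T T) T (%(x, y). x \<otimes>\<^bsub>G\<^esub> y) \<and> continuous_map T T (m_inv G)"
  hence "smooth_atlas T A" by (rule conjunct1)
  thus ?thesis using y by (rule smooth_atlas_connected_nbhd)
 next
  assume "T = discrete_topology (carrier G)"
  thus ?thesis using y by (intro exI[of _ "{y}"]) auto
 qed
 show "openin T (connected_component_of_set T x)" for x by (rule openin_connected_component_of[OF nb])
 have "continuous_map (prod_topology T T) T (%(x, y). x \<otimes>\<^bsub>G\<^esub> y) \<and> continuous_map T T (m_inv G)"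
  using alt
 proof
  assume d: "T = discrete_topology (carrier G)"
  have "prod_topology T T = discrete_topology (carrier G \<times> carrier G)"
   unfolding d by (rule prod_topology_discrete_topology[symmetric])
  thus ?thesis unfolding d by (auto simp: d Pi_iff)
 qed blast
 thus "topological_group G T" using g T by (simp add: topological_group_def topological_group_axioms_def)
qed

section \<open>Nilpotent actions\<close>

text \<open>The group that acts will be the open subgroup generated by the identity component and
  \<open>a\<close>, whereas the points remain cosets in the original group. Therefore
  \<open>X\<close> is an abstract space with base point \<open>x0\<close>, a transitive action and
  an open orbit map; \<open>C0\<close> stands for the identity component, and \<open>gen\<close>
  writes group elements as \<open>c \<otimes> a [^] n\<close>.\<close>

locale nil_action = topological_group G T + l2_space \<mu>
 for G :: "('g, 'z) monoid_scheme" (structure) and T :: "'g topology" and \<mu> :: "'x measure" +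
 fixes X :: "'x topology" and act :: "'g => 'x => 'x" and x0 :: 'x
  and C0 :: "'g set" and a :: 'g and k :: nat
 assumes T_sc: "second_countable T"
  and act_cont: "continuous_map (prod_topology T X) X (%(g, x). act g x)"
  and act_one: "x : topspace X ==> act \<one> x = x"
  and act_mult: "g : carrier G ==> h : carrier G ==> x : topspace X ==> act (g \<otimes> h) x = act g (act h x)"
  and x0: "x0 : topspace X"
  and trans: "x : topspace X ==> \<exists>g\<in>carrier G. x = act g x0"
  and orbit_open: "openin T W ==> openin X ((%g. act g x0) ` W)"
  and X_compact: "compact_space X" and X_Hausdorff: "Hausdorff_space X"
  and prob: "prob_space \<mu>" and space_\<mu>: "space \<mu> = topspace X"
  and sets_\<mu>: "sets \<mu> = sigma_sets (topspace X) {W. openin X W}"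
  and invariant: "g : carrier G ==> B : sets \<mu> ==> emeasure \<mu> {x : topspace X. act g x : B} = emeasure \<mu> B"
  and full_support: "openin X Z ==> Z ~= {} ==> emeasure \<mu> Z > 0"
  and a [simp]: "a : carrier G"
  and ergodic: "f : L2 \<mu> ==> AE x in \<mu>. f (act a x) = f x ==> \<exists>c. AE x in \<mu>. f x = c"
  and C0: "connectedin T C0" "\<one> : C0"
  and gen: "g : carrier G ==> \<exists>c\<in>C0. \<exists>n::int. g = c \<otimes> a [^] n"
  and nil: "lower_central G k = {\<one>}"
begin

sublocale prob_space \<mu> by (rule prob)

lemma act_closed [simp]: "g : carrier G ==> x : topspace X ==> act g x : topspace X"
 using continuous_map_image_subset_topspace[OF act_cont] T by auto

lemma act_continuous: "g : carrier G ==> continuous_map X X (act g)"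
proof -
 assume g: "g : carrier G"
 have "continuous_map X (prod_topology T X) (%x. (g, x))" using g T by (simp add: continuous_map_paired)
 from continuous_map_compose[OF this act_cont] show ?thesis by (simp add: comp_def)
qed

lemma orbit_continuous: "continuous_map T X (%g. act g x0)"
proof -
 have "continuous_map T (prod_topology T X) (%g. (g, x0))" using x0 T by (simp add: continuous_map_paired)
 from continuous_map_compose[OF this act_cont] show ?thesis by (simp add: comp_def)
qed

lemma act_inv [simp]: "g : carrier G ==> x : topspace X ==> act (inv g) (act g x) = x"
 "g : carrier G ==> x : topspace X ==> act g (act (inv g) x) = x" by (simp_all add: act_mult[symmetric] act_one)

lemma open_sets: "openin X W ==> W : sets \<mu>" by (simp add: sets_\<mu> sigma_sets.Basic)

lemma act_open_vimage: "g : carrier G ==> openin X W ==> openin X {x : topspace X. act g x : W}"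
 by (rule openin_continuous_map_preimage[OF act_continuous])

lemma act_measurable [measurable]: "g : carrier G ==> act g : measurable \<mu> \<mu>"
proof (rule measurable_sigma_sets[OF sets_\<mu>])
 assume g: "g : carrier G"
 show "act g : space \<mu> \<rightarrow> topspace X" using g space_\<mu> by auto
 fix W assume "W : {W. openin X W}"
 hence "openin X {x : topspace X. act g x : W}" using act_open_vimage[OF g] by simp
 hence "{x : topspace X. act g x : W} : sets \<mu>" by (rule open_sets)
 moreover have "act g -` W \<inter> space \<mu> = {x : topspace X. act g x : W}" using space_\<mu> by auto
 ultimately show "act g -` W \<inter> space \<mu> : sets \<mu>" by simp
qed (auto dest: openin_subset)

lemma distr_act: "g : carrier G ==> distr \<mu> \<mu> (act g) = \<mu>"
proof (rule measure_eqI)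
 fix A assume g: "g : carrier G" and "A : sets (distr \<mu> \<mu> (act g))"
 hence A: "A : sets \<mu>" by simp
 have "act g -` A \<inter> space \<mu> = {x : topspace X. act g x : A}" using space_\<mu> by auto
 thus "emeasure (distr \<mu> \<mu> (act g)) A = emeasure \<mu> A"
  using A g invariant[OF g A] by (simp add: emeasure_distr act_measurable)
qed simp

section \<open>Continuous functions and their density\<close>

definition CX :: "('x => complex) set" where
 "CX = {c. continuous_map X euclidean c}"

lemma CX_bounded:
 assumes c: "c : CX" obtains B where "!!x. x : topspace X ==> cmod (c x) <= B"
proof -
 have "compactin euclidean (c ` topspace X)" using c X_compact unfolding CX_def compact_space_def by (intro image_compactin) auto
 hence "bounded (c ` topspace X)" by (simp add: compact_imp_bounded)
 thus ?thesis using that unfolding bounded_iff by auto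
qed

lemma CX_measurable: "c : CX ==> c : borel_measurable \<mu>"
proof (rule borel_measurableI)
 fix S :: "complex set" assume c: "c : CX" and S: "open S"
 have "openin X {x : topspace X. c x : S}" using c S unfolding CX_def by (intro openin_continuous_map_preimage) auto
 moreover have "c -` S \<inter> space \<mu> = {x : topspace X. c x : S}" using space_\<mu> by auto
 ultimately show "c -` S \<inter> space \<mu> : sets \<mu>" using open_sets by simp
qed

lemma CX_L2: "c : CX ==> c : L2 \<mu>" using CX_bounded[of c] CX_measurable[of c] L2_bounded[OF fin, of c] space_\<mu> by metis

lemma AE_open_eq:
 assumes c: "continuous_map X (euclidean :: 'y::t2_space topology) c" "continuous_map X euclidean d"
  and e: "AE x in \<mu>. c x = d x" and x: "x : topspace X"
 shows "c x = d x"
proof (rule ccontr)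
 assume ne: "c x ~= d x"
 obtain A B where AB: "open A" "open B" "c x : A" "d x : B" "A \<inter> B = {}" using hausdorff[OF ne] by blast
 define W where "W = {x : topspace X. c x : A} \<inter> {x : topspace X. d x : B}"
 have W: "openin X W" unfolding W_def using c AB by (intro openin_Int openin_continuous_map_preimage) auto
 have "emeasure \<mu> W > 0" using full_support[OF W] x AB by (auto simp: W_def)
 moreover have "AE x in \<mu>. x \<notin> W" using e by eventually_elim (use AB in "auto simp: W_def")
 hence "emeasure \<mu> W = 0" using open_sets[OF W] sets.sets_into_space[OF open_sets[OF W]]
  by (subst (asm) AE_iff_measurable[OF open_sets[OF W]]) auto
 ultimately show False by simp
qed

lemma X_sc: "second_countable X"
proof (rule second_countable_open_map_image[OF orbit_continuous _ _ T_sc])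
 show "open_map T X (%g. act g x0)" unfolding open_map_def using orbit_open by blast
 show "(%g. act g x0) ` topspace T = topspace X" using T x0 trans by auto
qed

text \<open>Second countability and regularity exhaust \<open>W\<close> by countably many basic
  sets, each within a closed subset of \<open>W\<close>. Urysohn functions that are 1 on the first
  \<open>n\<close> of these closed sets and 0 off \<open>W\<close> converge to the
  indicator.\<close>

lemma CX_indicator:
 assumes V: "csub V" "CX \<subseteq> V" and W: "openin X W" shows "(%x. indicator W x) : V"
proof -
 have norm: "normal_space X" using X_compact X_Hausdorff compact_Hausdorff_or_regular_imp_normal_space by blast
 have reg: "regular_space X" using X_compact X_Hausdorff compact_Hausdorff_imp_regular_space by blast
 obtain \<B> where \<B>: "countable \<B>" "!!B. B : \<B> ==> openin X B" "!!U x. openin X U ==> x : U ==> \<exists>B\<in>\<B>. x : B \<and> B \<subseteq> U"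
  using X_sc unfolding second_countable_def by metis
 define \<D> where "\<D> = {B : \<B>. \<exists>K. closedin X K \<and> B \<subseteq> K \<and> K \<subseteq> W}"
 have cover: "\<exists>B\<in>\<D>. x : B" if x: "x : W" for x
 proof -
  obtain U K where UK: "openin X U" "closedin X K" "x : U" "U \<subseteq> K" "K \<subseteq> W"
   using reg W x unfolding neighbourhood_base_of_closedin[symmetric] neighbourhood_base_of by metis
  obtain B where "B : \<B>" "x : B" "B \<subseteq> U" using \<B>(3)[OF UK(1,3)] by blast
  thus ?thesis using UK by (intro bexI[of _ B]) (auto simp: \<D>_def)
 qed
 have WX: "W \<subseteq> topspace X" using W openin_subset by blast
 show ?thesis
 proof (cases "\<D> = {}")
  case True
  hence "W = {}" using cover by auto
  thus ?thesis using csub_zero[OF V(1), unfolded zero_fun] by simp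
 next
  case False
  define D where "D = from_nat_into \<D>"
  have cD: "countable \<D>" using \<B>(1) by (simp add: \<D>_def)
  have D: "D i : \<D>" for i unfolding D_def using False by (rule from_nat_into)
  hence "\<exists>K. closedin X K \<and> D i \<subseteq> K \<and> K \<subseteq> W" for i by (auto simp: \<D>_def)
  then obtain K where K: "!!i. closedin X (K i)" "!!i. D i \<subseteq> K i" "!!i. K i \<subseteq> W" by metis
  have "\<exists>f. continuous_map X (top_of_set {0..1::real}) f \<and> f ` (topspace X - W) \<subseteq> {0} \<and> f ` (\<Union>i<n. K i) \<subseteq> {1}" for n :: nat
  proof (rule Urysohn_lemma[OF norm, of "topspace X - W" "\<Union>i<n. K i" 0 1])
   show "closedin X (\<Union>i<n. K i)" using K(1) by (intro closedin_Union) auto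
   show "disjnt (topspace X - W) (\<Union>i<n. K i)" using K(3) by (auto simp: disjnt_def)
  qed (use W in auto)
  then obtain f where f: "!!n. continuous_map X (top_of_set {0..1::real}) (f n)"
   "!!n. f n ` (topspace X - W) \<subseteq> {0}" "!!n. f n ` (\<Union>i<n. K i) \<subseteq> {1}" by metis
  have f01: "f n x : {0..1}" if "x : topspace X" for n x using continuous_map_image_subset_topspace[OF f(1)[of n]] that by auto
  have fc: "(%x. complex_of_real (f n x)) : CX" for n
  proof -
   have "continuous_map X euclideanreal (f n)" using f(1)[of n] by (simp add: continuous_map_in_subtopology)
   moreover have "continuous_map euclideanreal euclidean complex_of_real" by (simp add: continuous_on_of_real)
   ultimately have "continuous_map X euclidean (complex_of_real \<circ> f n)" by (rule continuous_map_compose)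
   thus ?thesis by (simp add: CX_def comp_def)
  qed
  show ?thesis
  proof (rule csub_tends[OF V(1)])
   show "(%x. complex_of_real (f n x)) : V" for n using fc V(2) by blast
   show "(%x. indicator W x :: complex) : L2 \<mu>" by (rule indicator_L2[OF open_sets[OF W]])
   show "tends (%n x. complex_of_real (f n x)) (%x. indicator W x)"
   proof (rule tends_dominated[where B = 1])
    show "AE x in \<mu>. (%n. complex_of_real (f n x)) ----> indicator W x"
    proof (rule AE_I2)
     fix x assume x: "x : space \<mu>"
     show "(%n. complex_of_real (f n x)) ----> indicator W x"
     proof (cases "x : W")
      case True
      then obtain B where "B : \<D>" "x : B" using cover by blast
      then obtain i where "x : D i" unfolding D_def using from_nat_into_surj[OF cD] by metis
      hence "f n x = 1" if "n \<ge> Suc i" for n using f(3)[of n] K(2)[of i] that by force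
      hence "\<forall>\<^sub>F n in sequentially. complex_of_real (f n x) = 1"
       by (intro eventually_sequentiallyI[of "Suc i"]) simp
      thus ?thesis using True by (simp add: tendsto_eventually)
     next
      case False
      hence "f n x = 0" for n using f(2)[of n] x space_\<mu> by auto
      thus ?thesis using False by simp
     qed
    qed
    show "cmod (complex_of_real (f n x)) <= 1" if "x : space \<mu>" for n x using f01[of x n] that space_\<mu> by auto
   qed (use CX_measurable[OF fc] open_sets[OF W] in auto)
  qed
 qed
qed

lemma Int_stable_open: "Int_stable {W. openin X W}" by (auto simp: Int_stable_def)

lemma CX_dense: "csub V ==> CX \<subseteq> V ==> V = L2 \<mu>"
proof (rule L2_eqI_dense[OF _ Int_stable_open])
 assume V: "csub V" "CX \<subseteq> V"
 show "(%x. 1) : V" using V(2) by (auto simp: CX_def)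
 show "(%x. indicator A x) : V" if "A : {W. openin X W}" for A using CX_indicator[OF V] that by simp
qed (auto simp: space_\<mu> sets_\<mu> dest: openin_subset)

lemma CX_linsub: "linsub CX" unfolding linsub_def
proof (intro conjI ballI allI)
 show "CX \<subseteq> L2 \<mu>" using CX_L2 by auto
 show "0 : CX" by (simp add: CX_def zero_fun)
 show "c + d : CX" if "c : CX" "d : CX" for c d using that continuous_map_add[of X c d] by (simp add: plus_fun CX_def)
 show "(%x. z * c x) : CX" if "c : CX" for z c
 proof -
  have "continuous_map euclidean euclidean ((*) z)" by (simp add: continuous_intros)
  thus ?thesis using that continuous_map_compose[of X euclidean c euclidean "(*) z"] by (simp add: comp_def CX_def)
 qed
qed

lemma CX_approx:
 assumes f: "f : L2 \<mu>" "e > 0" obtains c where "c : CX" "nrm (f - c) < e"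
proof -
 have "cls CX = L2 \<mu>" using csub_cls[OF CX_linsub] cls_superset[of CX] CX_L2 by (intro CX_dense) auto
 hence "f : cls CX" using f by simp
 thus ?thesis using that f(2) by (auto simp: cls_def)
qed

text \<open>Finite intersections from a countable base form a countable generating system that is
  stable under intersection, so their indicators are total.\<close>

lemma L2_separable: "\<exists>D. countable D \<and> D \<subseteq> L2 \<mu> \<and> (\<forall>f\<in>ortho D. nrm f = 0)"
proof -
 obtain \<B> where \<B>: "countable \<B>" "!!B. B : \<B> ==> openin X B" "!!U x. openin X U ==> x : U ==> \<exists>B\<in>\<B>. x : B \<and> B \<subseteq> U"
  using X_sc unfolding second_countable_def by metis
 define P where "P = (%F. topspace X \<inter> \<Inter>F) ` {F. finite F \<and> F \<subseteq> \<B>}"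
 have Popen: "openin X A" if AP: "A : P" for A
 proof -
  obtain F where F: "finite F" "F \<subseteq> \<B>" "A = topspace X \<inter> \<Inter>F" using AP unfolding P_def by blast
  have "A = \<Inter>(insert (topspace X) F)" using F by auto
  moreover have "openin X (\<Inter>(insert (topspace X) F))" using F \<B>(2) by (intro openin_Inter) auto
  ultimately show ?thesis by simp
 qed
 have cP: "countable P" unfolding P_def using \<B>(1) by (intro countable_image countable_Collect_finite_subset)
 have istab: "Int_stable P"
 proof (rule Int_stableI)
  fix A B assume "A : P" "B : P"
  then obtain F F' where F: "finite F" "F \<subseteq> \<B>" "A = topspace X \<inter> \<Inter>F" "finite F'" "F' \<subseteq> \<B>" "B = topspace X \<inter> \<Inter>F'"
   unfolding P_def by blast
  have "A \<inter> B = topspace X \<inter> \<Inter>(F \<union> F')" unfolding F(3,6) by blast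
  thus "A \<inter> B : P" unfolding P_def using F(1,2,4,5) by (intro image_eqI[of _ _ "F \<union> F'"]) simp_all
 qed
 have BP: "B : P" if "B : \<B>" for B
  unfolding P_def using that openin_subset[OF \<B>(2)[OF that]] by (intro image_eqI[of _ _ "{B}"]) auto
 have gen: "sets \<mu> = sigma_sets (space \<mu>) P"
 proof
  show "sigma_sets (space \<mu>) P \<subseteq> sets \<mu>" using Popen open_sets by (intro sets.sigma_sets_subset) auto
  show "sets \<mu> \<subseteq> sigma_sets (space \<mu>) P" unfolding sets_\<mu> space_\<mu>
  proof (rule sigma_sets_mono, clarify)
   fix W assume W: "openin X W"
   have "W = \<Union>{B : \<B>. B \<subseteq> W}" using \<B>(3)[OF W] by blast
   moreover have "\<Union>{B : \<B>. B \<subseteq> W} : sigma_sets (topspace X) P"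
    using \<B>(1) BP by (intro sigma_sets_UNION countable_Collect sigma_sets.Basic) auto
   ultimately show "W : sigma_sets (topspace X) P" by simp
  qed
 qed
 define D where "D = insert (%x. 1) ((%A x. indicator A x :: complex) ` P)"
 have D: "D \<subseteq> L2 \<mu>" using indicator_L2 Popen open_sets CX_L2[of "%x. 1"] by (auto simp: D_def CX_def)
 have "cspan D = L2 \<mu>"
 proof (rule L2_eqI_dense[OF csub_cspan istab _ gen])
  show "P \<subseteq> Pow (space \<mu>)" using Popen openin_subset space_\<mu> by blast
  show "(%x. indicator A x) : cspan D" if "A : P" for A using cspan_superset[OF D] that by (auto simp: D_def)
  show "(%x. 1) : cspan D" using cspan_superset[OF D] by (auto simp: D_def)
 qed
 hence "nrm f = 0" if "f : ortho D" for f using ortho_cspan_ip[OF that, of f] ortho_mem[OF that] by (intro ip_self_eq_0) auto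
 moreover have "countable D" unfolding D_def using cP by simp
 ultimately show ?thesis using D by blast
qed

section \<open>The representation of the group by translations\<close>

definition V :: "'g => ('x => complex) => 'x => complex" where
 "V g f = (%x. f (act g x))"

lemma V_add: "V g (f + h) = V g f + V g h" by (simp add: V_def plus_fun)

lemma V_sc: "V g (%x. c * f x) = (%x. c * V g f x)" by (simp add: V_def)

lemma V_diff: "V g (f - h) = V g f - V g h" by (simp add: V_def minus_fun)

lemma V_integral:
 fixes f :: "'x => 'y::{banach, second_countable_topology}"
 assumes g: "g : carrier G" and f: "f : borel_measurable \<mu>"
 shows "(\<integral>x. f (act g x) \<partial>\<mu>) = (\<integral>x. f x \<partial>\<mu>)"
  "integrable \<mu> (%x. f (act g x)) \<longleftrightarrow> integrable \<mu> f"
 using integral_distr[OF act_measurable[OF g] f] integrable_distr_eq[OF act_measurable[OF g] f] distr_act[OF g] by auto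

lemma V_mem [simp]: "g : carrier G ==> f : L2 \<mu> ==> V g f : L2 \<mu>" unfolding V_def
proof (rule L2I)
 assume g: "g : carrier G" and f: "f : L2 \<mu>"
 show "(%x. f (act g x)) : borel_measurable \<mu>" by (rule measurable_compose[OF act_measurable[OF g] L2_measurable[OF f]])
 have "(%x. (cmod (f x))^2) : borel_measurable \<mu>" using L2_measurable[OF f] by measurable
 thus "integrable \<mu> (%x. (cmod (f (act g x)))^2)"
  using V_integral(2)[OF g, of "%x. (cmod (f x))^2"] L2_integrable_sq[OF f] by simp
qed

lemma V_ip: "g : carrier G ==> f : L2 \<mu> ==> h : L2 \<mu> ==> l2_inner \<mu> (V g f) (V g h) = l2_inner \<mu> f h"
 unfolding l2_inner_def V_def
proof (rule V_integral(1))
 assume f: "f : L2 \<mu>" and h: "h : L2 \<mu>"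
 note [measurable] = L2_measurable[OF f] L2_measurable[OF h]
 show "(%x. f x * cnj (h x)) : borel_measurable \<mu>" by measurable
qed

lemma V_nrm: "g : carrier G ==> f : L2 \<mu> ==> nrm (V g f) = nrm f" by (simp add: nrm_def V_ip)

lemma eq_on_space_nrm: "(!!x. x : topspace X ==> f x = h x) ==> nrm (f - h) = 0"
proof -
 assume e: "!!x. x : topspace X ==> f x = h x"
 have "(\<integral>x. (cmod ((f - h) x))^2 \<partial>\<mu>) = (\<integral>x. 0 \<partial>\<mu>)"
  by (rule Bochner_Integration.integral_cong) (use e space_\<mu> in "auto simp: minus_fun")
 thus ?thesis by (simp add: nrm_eq l2_norm_def)
qed

text \<open>The order of the factors is reversed, since \<open>V\<close> composes on the inside; the
  law holds only up to norm zero because \<open>act\<close> is unconstrained outside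
  \<open>topspace X\<close>.\<close>

lemma V_comp: "g : carrier G ==> h : carrier G ==> nrm (V h (V g f) - V (g \<otimes> h) f) = 0"
 by (rule eq_on_space_nrm) (simp add: V_def act_mult)

lemma V_one: "nrm (V \<one> f - f) = 0" by (rule eq_on_space_nrm) (simp add: V_def act_one)

lemma V_CX: "g : carrier G ==> c : CX ==> V g c : CX"
 unfolding V_def CX_def using continuous_map_compose[OF act_continuous] by (simp add: comp_def)

text \<open>Compactness of \<open>X\<close>, through the tube lemma, makes the neighbourhood of
  \<open>g\<close> independent of the point.\<close>

lemma uniform_nbhd:
 assumes c: "c : CX" and g: "g : carrier G" and e: "e > 0"
 obtains N where "openin T N" "g : N" "!!h x. h : N ==> x : topspace X ==> cmod (c (act h x) - c (act g x)) < e"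
proof -
 define W where "W = {p : topspace (prod_topology T X). c (act (fst p) (snd p)) - c (act g (snd p)) : ball 0 e}"
 have c1: "continuous_map (prod_topology T X) euclidean (%p. c (act (fst p) (snd p)))"
  using continuous_map_compose[OF act_cont, of euclidean c] c by (simp add: CX_def comp_def case_prod_beta)
 have c2: "continuous_map (prod_topology T X) euclidean (%p. c (act g (snd p)))"
  using continuous_map_compose[OF continuous_map_snd, of X euclidean "V g c" T] V_CX[OF g c] by (simp add: CX_def comp_def V_def)
 have "openin (prod_topology T X) W" unfolding W_def
  by (rule openin_continuous_map_preimage[OF continuous_map_diff[OF c1 c2]]) simp
 moreover have "compactin X (topspace X)" using X_compact by (simp add: compact_space_def)
 moreover have "{g} \<times> topspace X \<subseteq> W" using g T e by (auto simp: W_def)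
 ultimately obtain U N where "openin T U" "openin X N" "g : U" "topspace X \<subseteq> N" "U \<times> N \<subseteq> W"
  using tube_lemma_right[of T X W "topspace X" g] g T by auto
 hence UW: "openin T U" "g : U" "!!h x. h : U ==> x : topspace X ==> (h, x) : W" by auto
 show ?thesis
 proof (rule that[OF UW(1,2)])
  show "cmod (c (act h x) - c (act g x)) < e" if "h : U" "x : topspace X" for h x
   using UW(3)[OF that] by (simp add: W_def dist_norm norm_minus_commute)
 qed
qed

lemma L2_bound_nrm:
 assumes f: "f : L2 \<mu>" and b: "!!x. x : topspace X ==> cmod (f x) <= e" and e: "e \<ge> 0"
 shows "nrm f <= e"
proof -
 have "(\<integral>x. (cmod (f x))^2 \<partial>\<mu>) <= (\<integral>x. e^2 \<partial>\<mu>)"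
  by (rule integral_mono) (use L2_integrable_sq[OF f] b space_\<mu> in "auto intro!: power_mono")
 also have "\<dots> = e^2" by (simp add: prob_space)
 finally show ?thesis using e by (simp add: nrm_eq l2_norm_def real_le_lsqrt)
qed

lemma strong_continuity:
 assumes f: "f : L2 \<mu>" and g: "g : carrier G" and e: "e > 0"
 obtains N where "openin T N" "g : N" "!!h. h : N ==> nrm (V h f - V g f) < e"
proof -
 have e4: "e / 4 > 0" using e by simp
 obtain c where c: "c : CX" "nrm (f - c) < e / 4" using CX_approx[OF f e4] .
 obtain N where N: "openin T N" "g : N" "!!h x. h : N ==> x : topspace X ==> cmod (c (act h x) - c (act g x)) < e / 4"
  using uniform_nbhd[OF c(1) g e4] by blast
 have "nrm (V h f - V g f) < e" if h: "h : N" for h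
 proof -
  have hG: "h : carrier G" using h N(1) T openin_subset by auto
  have cL: "c : L2 \<mu>" by (rule CX_L2[OF c(1)])
  have "nrm (V h c - V g c) <= e / 4"
  proof (rule L2_bound_nrm)
   show "V h c - V g c : L2 \<mu>" using hG g cL by simp
   show "cmod ((V h c - V g c) x) <= e / 4" if "x : topspace X" for x using N(3)[OF h that] by (simp add: V_def minus_fun)
  qed (use e in simp)
  moreover have "nrm (V h f - V h c) < e / 4" using V_nrm[OF hG, of "f - c"] f cL c(2) by (simp add: V_diff)
  moreover have "nrm (V g c - V g f) < e / 4"
   using V_nrm[OF g, of "c - f"] f cL c(2) nrm_diff_commute[of f c] by (simp add: V_diff)
  ultimately show ?thesis
   using nrm_triangle3[of "V h f" "V h c" "V g f"] nrm_triangle3[of "V h c" "V g c" "V g f"] f cL hG g e by simp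
 qed
 thus ?thesis using that N by blast
qed

end

context semi_hilbert
begin

text \<open>Closure under midpoints is all that \<open>midpoint_min\<close> asks for, and it keeps
  inductions over the hull to one binary step.\<close>

definition midhull :: "'v set => 'v set" where
 "midhull S = \<Inter>{D. S \<subseteq> D \<and> (\<forall>x\<in>D. \<forall>y\<in>D. sc (1/2) (x + y) : D)}"

lemma midhull_base: "x : S ==> x : midhull S" by (auto simp: midhull_def)

lemma midhull_mid: "x : midhull S ==> y : midhull S ==> sc (1/2) (x + y) : midhull S" by (auto simp: midhull_def)

lemma midhull_induct [consumes 1, case_names base mid]:
 assumes "x : midhull S" "!!x. x : S ==> P x"
  "!!x y. x : midhull S ==> y : midhull S ==> P x ==> P y ==> P (sc (1/2) (x + y))"
 shows "P x"
proof -
 have "midhull S \<subseteq> {x : midhull S. P x}"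
  by (subst midhull_def, rule Inter_lower) (use assms(2,3) midhull_base midhull_mid in auto)
 thus ?thesis using assms(1) by auto
qed

lemma tends_unique:
 assumes F: "!!n. F n : H" "f : H" "g : H" and t: "tends F f" "tends F g" shows "nrm (f - g) = 0"
proof -
 have "tends (%n. F n - F n) (f - g)" by (intro tends_diff F t)
 hence "(%n. nrm (f - g)) ----> 0" using F nrm_minus[of "f - g"] by (simp add: tends_def)
 thus ?thesis by (simp add: LIMSEQ_const_iff)
qed

lemma csub_INT: "(!!i. i : I ==> csub (W i)) ==> csub {f : H. \<forall>i\<in>I. f : W i}"
proof (rule csubI)
 assume c: "!!i. i : I ==> csub (W i)"
 show "f : {f : H. \<forall>i\<in>I. f : W i}" if "f : H" "!!n. F n : {f : H. \<forall>i\<in>I. f : W i}" "tends F f" for F f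
  using that csub_tends[OF c, of _ F f] by auto
qed (auto intro: csub_zero csub_add csub_sc)

end

lemma half_sum_le: "x <= z ==> y <= z ==> 1/2 * (x + y) <= (z::real)" by simp

lemma tensor_L2:
 assumes M: "finite_measure M" and f: "f : L2 M" and g: "g : L2 M"
 shows "(%p. f (fst p) * cnj (g (snd p))) : L2 (M \<Otimes>\<^sub>M M)"
proof (rule L2I)
 interpret finite_measure M by (rule M)
 interpret P: pair_sigma_finite M M ..
 note [measurable] = L2_measurable[OF f] L2_measurable[OF g]
 show "(%p. f (fst p) * cnj (g (snd p))) : borel_measurable (M \<Otimes>\<^sub>M M)" by measurable
 have "integrable (M \<Otimes>\<^sub>M M) (%p. (cmod (f (fst p)))^2 * (cmod (g (snd p)))^2)"
 proof (rule P.Fubini_integrable)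
  show "(%p. (cmod (f (fst p)))^2 * (cmod (g (snd p)))^2) : borel_measurable (M \<Otimes>\<^sub>M M)" by measurable
  show "integrable M (%x. \<integral>y. norm ((cmod (f (fst (x, y))))^2 * (cmod (g (snd (x, y))))^2) \<partial>M)"
   using L2_integrable_sq[OF f] by (simp add: abs_mult)
  show "AE x in M. integrable M (%y. (cmod (f (fst (x, y))))^2 * (cmod (g (snd (x, y))))^2)" using L2_integrable_sq[OF g] by simp
 qed
 thus "integrable (M \<Otimes>\<^sub>M M) (%p. (cmod (f (fst p) * cnj (g (snd p))))^2)"
  by (simp add: norm_mult power_mult_distrib)
qed

lemma tensor_ip:
 assumes M: "finite_measure M" and f: "f : L2 M" and g: "g : L2 M" and f': "f' : L2 M" and g': "g' : L2 M"
 shows "l2_inner (M \<Otimes>\<^sub>M M) (%p. f (fst p) * cnj (g (snd p))) (%p. f' (fst p) * cnj (g' (snd p)))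
  = l2_inner M f f' * l2_inner M g' g"
proof -
 interpret finite_measure M by (rule M)
 interpret P: pair_sigma_finite M M ..
 have int: "integrable (M \<Otimes>\<^sub>M M) (%(x, y). (f x * cnj (f' x)) * (g' y * cnj (g y)))"
  using L2_integrable_mult[OF tensor_L2[OF M f g] tensor_L2[OF M f' g']] by (simp add: case_prod_unfold mult_ac)
 have "l2_inner (M \<Otimes>\<^sub>M M) (%p. f (fst p) * cnj (g (snd p))) (%p. f' (fst p) * cnj (g' (snd p)))
  = (\<integral>p. (case p of (x, y) => (f x * cnj (f' x)) * (g' y * cnj (g y))) \<partial>(M \<Otimes>\<^sub>M M))"
  unfolding l2_inner_def by (intro Bochner_Integration.integral_cong refl) (auto simp: mult_ac)
 also have "\<dots> = (\<integral>x. (\<integral>y. (f x * cnj (f' x)) * (g' y * cnj (g y)) \<partial>M) \<partial>M)"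
  using P.integral_fst'[OF int] by (simp add: case_prod_unfold)
 also have "\<dots> = l2_inner M f f' * l2_inner M g' g" by (simp add: l2_inner_def)
 finally show ?thesis .
qed

context nil_action
begin

declare lower_central.simps(2) [simp del]

abbreviation L :: "nat => 'g set" where "L \<equiv> lower_central G"

section \<open>The lower central series\<close>

definition comm :: "'g => 'g => 'g" where
 "comm x y = x \<otimes> y \<otimes> inv x \<otimes> inv y"

lemma comm_closed [simp]: "x : carrier G ==> y : carrier G ==> comm x y : carrier G" by (simp add: comm_def)

lemma inv_cancel [simp]: "x : carrier G ==> y : carrier G ==> inv x \<otimes> (x \<otimes> y) = y"
 "x : carrier G ==> y : carrier G ==> x \<otimes> (inv x \<otimes> y) = y" by (simp_all add: m_assoc[symmetric])

lemma comm_swap: "x : carrier G ==> y : carrier G ==> comm x y \<otimes> (y \<otimes> x) = x \<otimes> y"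
 by (simp add: comm_def m_assoc)

lemma comm_inv: "x : carrier G ==> y : carrier G ==> inv (comm x y) = comm y x" by (simp add: comm_def m_assoc inv_mult_group)

lemma comm_conj: "x : carrier G ==> y : carrier G ==> g : carrier G ==>
  g \<otimes> comm x y \<otimes> inv g = comm (g \<otimes> x \<otimes> inv g) (g \<otimes> y \<otimes> inv g)"
 by (simp add: comm_def m_assoc inv_mult_group)

lemma L_Suc: "L (Suc i) = generate G (\<Union>x\<in>L i. \<Union>y\<in>carrier G. {comm x y})"
 by (simp add: comm_def lower_central.simps(2))

lemma L_carrier: "L i \<subseteq> carrier G"
proof (induction i)
 case (Suc i)
 hence "(\<Union>x\<in>L i. \<Union>y\<in>carrier G. {comm x y}) \<subseteq> carrier G" by auto
 thus ?case unfolding L_Suc by (rule generate_incl)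
qed simp

lemma L_mem [simp]: "x : L i ==> x : carrier G" using L_carrier by blast

lemma L_gen_carrier: "(\<Union>x\<in>L i. \<Union>y\<in>carrier G. {comm x y}) \<subseteq> carrier G" by auto

lemma L_subgroup: "subgroup (L i) G"
proof (cases i)
 case 0 thus ?thesis by (simp add: subgroup_self)
next
 case (Suc j) thus ?thesis using generate_is_subgroup[OF L_gen_carrier[of j]] by (simp only: L_Suc)
qed

lemma comm_L: "x : L i ==> y : carrier G ==> comm x y : L (Suc i)" unfolding L_Suc by (rule generate.incl) auto

lemma L_one: "\<one> : L i" and L_mult: "x : L i ==> y : L i ==> x \<otimes> y : L i" and L_inv: "x : L i ==> inv x : L i"
 using L_subgroup[of i] by (auto simp: subgroup.one_closed subgroup.m_closed subgroup.m_inv_closed)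

lemma comm_L2: "x : L i ==> y : carrier G ==> comm y x : L (Suc i)" using L_inv[OF comm_L[of x i y]] comm_inv[of x y] by simp

lemma L_conj: "x : L i ==> g : carrier G ==> g \<otimes> x \<otimes> inv g : L i"
proof (induction i arbitrary: x)
 case 0 thus ?case by simp
next
 case (Suc i)
 have "x : generate G (\<Union>x\<in>L i. \<Union>y\<in>carrier G. {comm x y})" using Suc.prems(1) by (simp only: L_Suc)
 thus ?case
 proof (induction rule: generate.induct)
  case one thus ?case using Suc.prems(2) L_one by simp
 next
  case (incl h)
  then obtain x y where xy: "x : L i" "y : carrier G" "h = comm x y" by auto
  hence "g \<otimes> h \<otimes> inv g = comm (g \<otimes> x \<otimes> inv g) (g \<otimes> y \<otimes> inv g)" using comm_conj Suc.prems(2) by simp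
  thus ?case using comm_L[OF Suc.IH[OF xy(1) Suc.prems(2)]] xy Suc.prems(2) by simp
 next
  case (inv h)
  then obtain x y where xy: "x : L i" "y : carrier G" "h = comm x y" by auto
  hence "g \<otimes> inv h \<otimes> inv g = comm (g \<otimes> y \<otimes> inv g) (g \<otimes> x \<otimes> inv g)"
   using comm_conj comm_inv Suc.prems(2) by simp
  thus ?case using comm_L2[OF Suc.IH[OF xy(1) Suc.prems(2)]] xy Suc.prems(2) by simp
 next
  case (eng h1 h2)
  have h: "h1 : carrier G" "h2 : carrier G" using eng(1,2) by (auto intro: generate_in_carrier[OF L_gen_carrier])
  have "g \<otimes> (h1 \<otimes> h2) \<otimes> inv g = (g \<otimes> h1 \<otimes> inv g) \<otimes> (g \<otimes> h2 \<otimes> inv g)"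
   using h Suc.prems(2) by (simp add: m_assoc)
  thus ?case using L_mult[OF eng.IH] by simp
 qed
qed

lemma L_Suc_sub: "L (Suc i) \<subseteq> L i" unfolding L_Suc
proof (rule generate_subgroup_incl[OF _ L_subgroup])
 show "(\<Union>x\<in>L i. \<Union>y\<in>carrier G. {comm x y}) \<subseteq> L i"
 proof clarsimp
  fix x y assume x: "x : L i" and y: "y : carrier G"
  have "comm x y = x \<otimes> (y \<otimes> inv x \<otimes> inv y)" using x y by (simp add: comm_def m_assoc)
  thus "comm x y : L i" using L_mult[OF x L_conj[OF L_inv[OF x] y]] by simp
 qed
qed

lemma L_antimono: "i <= j ==> L j \<subseteq> L i" using lift_Suc_antimono_le[of L i j] L_Suc_sub by blast

definition eigenspace :: "'g => complex => ('x => complex) set" where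
 "eigenspace u \<theta> = {f : L2 \<mu>. nrm (V u f - (%x. \<theta> * f x)) = 0}"

lemma V_tends: "u : carrier G ==> (!!n. F n : L2 \<mu>) ==> f : L2 \<mu> ==> tends F f ==> tends (%n. V u (F n)) (V u f)"
 by (simp add: tends_def V_diff[symmetric] V_nrm)

lemma csub_eigenspace: "u : carrier G ==> csub (eigenspace u \<theta>)"
proof (rule csubI)
 assume u: "u : carrier G"
 show "x + y : eigenspace u \<theta>" if "x : eigenspace u \<theta>" "y : eigenspace u \<theta>" for x y
 proof -
  have xy: "x : L2 \<mu>" "y : L2 \<mu>" using that by (auto simp: eigenspace_def)
  have "V u (x + y) - (%t. \<theta> * (x + y) t) = (V u x + V u y) - ((%t. \<theta> * x t) + (%t. \<theta> * y t))"
   by (simp only: V_add sc_add_right)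
  moreover have "nrm ((V u x + V u y) - ((%t. \<theta> * x t) + (%t. \<theta> * y t))) = 0"
   using that u xy by (intro nrm_diff_eq0_add V_mem sc_mem) (auto simp: eigenspace_def)
  ultimately show ?thesis using xy by (simp only: eigenspace_def mem_Collect_eq add_mem)
 qed
 show "(%t. c * x t) : eigenspace u \<theta>" if "x : eigenspace u \<theta>" for c x
 proof -
  have x: "x : L2 \<mu>" using that by (auto simp: eigenspace_def)
  have "nrm ((%t. c * V u x t) - (%t. c * (\<theta> * x t))) = 0"
   using that u x by (intro nrm_diff_eq0_sc V_mem sc_mem) (auto simp: eigenspace_def)
  thus ?thesis using x sc_mem[OF x] by (simp add: eigenspace_def V_sc mult.left_commute)
 qed
 show "0 : eigenspace u \<theta>" using L2_zero by (simp add: eigenspace_def V_def zero_fun minus_fun nrm_zero[unfolded zero_fun])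
 show "f : eigenspace u \<theta>" if f: "f : L2 \<mu>" "!!n. F n : eigenspace u \<theta>" "tends F f" for F f
 proof -
  have FL: "F n : L2 \<mu>" for n using f(2) by (simp add: eigenspace_def)
  have "tends (%n. V u (F n) - (%x. \<theta> * F n x)) (V u f - (%x. \<theta> * f x))"
   using FL f u by (intro tends_diff V_tends tends_sc) auto
  hence "(%n. nrm (V u (F n) - (%x. \<theta> * F n x))) ----> nrm (V u f - (%x. \<theta> * f x))"
   using FL f u sc_mem by (intro tends_nrm) auto
  thus ?thesis using f by (simp add: eigenspace_def LIMSEQ_const_iff)
 qed
qed (auto simp: eigenspace_def)

section \<open>Functions invariant under \<open>L i\<close> and equicontinuity\<close>

definition E :: "nat => ('x => complex) set" where
 "E i = {f : L2 \<mu>. \<forall>u\<in>L i. nrm (V u f - f) = 0}"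

lemma E_mem: "f : E i ==> f : L2 \<mu>" by (simp add: E_def)

lemma csub_E: "csub (E i)"
proof -
 have "E i = {f : L2 \<mu>. \<forall>u\<in>L i. f : eigenspace u 1}" by (auto simp: E_def eigenspace_def)
 thus ?thesis using csub_INT[of "L i" "%u. eigenspace u 1"] csub_eigenspace by simp
qed

lemma E_mono: "i <= j ==> E i \<subseteq> E j" using L_antimono[of i j] by (auto simp: E_def)

lemma E_top: "E k = L2 \<mu>" by (auto simp: E_def nil V_one)

lemma V_cong: "u : carrier G ==> f : L2 \<mu> ==> h : L2 \<mu> ==> nrm (f - h) = 0 ==> nrm (V u f - V u h) = 0"
 using V_nrm[of u "f - h"] by (simp add: V_diff)

lemma V_mult_E:
 assumes f: "f : E i" and w: "w : L i" and g: "g : carrier G"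
 shows "nrm (V (w \<otimes> g) f - V g f) = 0"
proof -
 have fL: "f : L2 \<mu>" and e: "nrm (V w f - f) = 0" using f w by (auto simp: E_def)
 have "nrm (V g (V w f) - V g f) = 0" using V_cong[OF g _ fL e] fL w by simp
 thus ?thesis using nrm_diff_eq0_trans[of "V (w \<otimes> g) f" "V g (V w f)" "V g f"] V_comp[of w g f] w g fL
  nrm_diff_commute[of "V (w \<otimes> g) f" "V g (V w f)"] by simp
qed

text \<open>\<open>w \<otimes> u\<close> and \<open>u \<otimes> w\<close> differ by a commutator in
  \<open>L (Suc i)\<close>, which \<open>f\<close> does not see. In particular \<open>L i\<close>
  acts on \<open>E (Suc i)\<close> as an abelian group, and it commutes with all of \<open>G\<close>
  there.\<close>

lemma V_swap:
 assumes f: "f : E (Suc i)" and w: "w : L i" and u: "u : carrier G"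
 shows "nrm (V u (V w f) - V w (V u f)) = 0"
proof -
 have fL: "f : L2 \<mu>" using f by (rule E_mem)
 have wG: "w : carrier G" using w by simp
 have "nrm (V (comm w u \<otimes> (u \<otimes> w)) f - V (u \<otimes> w) f) = 0"
  by (rule V_mult_E[OF f comm_L[OF w u]]) (use u wG in simp)
 hence 1: "nrm (V (w \<otimes> u) f - V (u \<otimes> w) f) = 0" using comm_swap[OF wG u] by simp
 have 2: "nrm (V u (V w f) - V (w \<otimes> u) f) = 0" by (rule V_comp[OF wG u])
 have 3: "nrm (V w (V u f) - V (u \<otimes> w) f) = 0" by (rule V_comp[OF u wG])
 have "nrm (V u (V w f) - V (u \<otimes> w) f) = 0" by (rule nrm_diff_eq0_trans[OF _ _ _ 2 1]) (use fL u wG in auto)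
 thus ?thesis by (intro nrm_diff_eq0_trans2[OF _ _ _ _ 3]) (use fL u wG in auto)
qed

lemma V_E:
 assumes f: "f : E i" and g: "g : carrier G" shows "V g f : E i"
proof -
 have fL: "f : L2 \<mu>" using f by (rule E_mem)
 have "nrm (V u (V g f) - V g f) = 0" if u: "u : L i" for u
 proof -
  have uG: "u : carrier G" using u by simp
  have "nrm (V ((g \<otimes> u \<otimes> inv g) \<otimes> g) f - V g f) = 0" by (rule V_mult_E[OF f L_conj[OF u g] g])
  moreover have "(g \<otimes> u \<otimes> inv g) \<otimes> g = g \<otimes> u" using g uG by (simp add: m_assoc)
  ultimately have 1: "nrm (V (g \<otimes> u) f - V g f) = 0" by simp
  show ?thesis by (rule nrm_diff_eq0_trans[OF _ _ _ V_comp[OF g uG] 1]) (use fL g uG in auto)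
 qed
 thus ?thesis using fL g by (simp add: E_def)
qed

lemma CX_E_eq:
 assumes c: "c : CX" "c : E i" and u: "u : L i" and x: "x : topspace X"
 shows "c (act u x) = c x"
proof -
 have "AE x in \<mu>. V u c x = c x" using c u CX_L2 by (subst nrm_diff_eq_0_iff[symmetric]) (auto simp: E_def)
 moreover have "continuous_map X euclidean (V u c)" "continuous_map X euclidean c" using V_CX[of u c] c u by (auto simp: CX_def)
 ultimately have "V u c x = c x" using AE_open_eq x by blast
 thus ?thesis by (simp add: V_def)
qed

text \<open>The pointwise form of \<open>V_swap\<close>: it moves \<open>z\<close> from the outside
  to the base point, so that \<open>h\<close> becomes the outer factor.\<close>

lemma CX_E_swap:
 assumes c: "c : CX" "c : E (Suc i)" and z: "z : L i" and h: "h : carrier G"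
 shows "c (act z (act h x0)) = c (act h (act z x0))"
proof -
 have zG: "z : carrier G" using z by simp
 have "act z (act h x0) = act (comm z h) (act h (act z x0))" using comm_swap[OF zG h] zG h x0 by (simp add: act_mult[symmetric])
 thus ?thesis using CX_E_eq[OF c comm_L[OF z h]] zG h x0 by simp
qed

text \<open>After \<open>CX_E_swap\<close>, replacing \<open>g\<close> by a nearby \<open>h\<close>
  changes the outer factor at the point \<open>act z x0\<close>, and \<open>uniform_nbhd\<close>
  bounds the effect for all points simultaneously, hence for all \<open>z\<close> in
  \<open>L i\<close>.\<close>

lemma equicontinuous:
 assumes c: "c : CX" "c : E (Suc i)" and x: "x : topspace X" and e: "e > 0"
 obtains B where "openin X B" "x : B" "!!z y. z : L i ==> y : B ==> cmod (c (act z y) - c (act z x)) < e"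
proof -
 obtain g where g: "g : carrier G" "x = act g x0" using trans[OF x] by blast
 obtain N where N: "openin T N" "g : N" "!!h y. h : N ==> y : topspace X ==> cmod (c (act h y) - c (act g y)) < e"
  using uniform_nbhd[OF c(1) g(1) e] by blast
 show ?thesis
 proof (rule that[of "(%g. act g x0) ` N"])
  show "openin X ((%g. act g x0) ` N)" by (rule orbit_open[OF N(1)])
  show "x : (%g. act g x0) ` N" using g N by auto
  fix z y assume z: "z : L i" and "y : (%g. act g x0) ` N"
  then obtain h where h: "h : N" "y = act h x0" by auto
  have hG: "h : carrier G" using h(1) N(1) T openin_subset by auto
  show "cmod (c (act z y) - c (act z x)) < e"
   using N(3)[OF h(1), of "act z x0"] CX_E_swap[OF c z hG] CX_E_swap[OF c z g(1)] z x0 h g by simp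
 qed
qed

lemma AE_dense:
 assumes P: "AE x in \<mu>. P x" and W: "openin X W" "W ~= {}"
 shows "\<exists>x\<in>W. P x"
proof (rule ccontr)
 assume n: "\<not> (\<exists>x\<in>W. P x)"
 have "AE x in \<mu>. x \<notin> W" using P by eventually_elim (use n in auto)
 hence "emeasure \<mu> W = 0" using open_sets[OF W(1)] sets.sets_into_space[OF open_sets[OF W(1)]]
  by (subst (asm) AE_iff_measurable[OF open_sets[OF W(1)]]) auto
 thus False using full_support[OF W] by simp
qed

lemma continuousI_dist:
 fixes c :: "'x => complex"
 assumes "!!x e. x : topspace X ==> e > 0 ==> \<exists>B. openin X B \<and> x : B \<and> (\<forall>y\<in>B. cmod (c y - c x) < e)"
 shows "c : CX" unfolding CX_def continuous_map
proof (intro CollectI conjI allI impI)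
 show "c ` topspace X \<subseteq> topspace euclidean" by simp
 fix S :: "complex set" assume "openin euclidean S"
 hence S: "open S" by simp
 show "openin X {x : topspace X. c x : S}"
 proof (subst openin_subopen, intro ballI)
  fix x assume x: "x : {x : topspace X. c x : S}"
  then obtain e where e: "e > 0" "ball (c x) e \<subseteq> S" using S open_contains_ball by blast
  obtain B where B: "openin X B" "x : B" "\<forall>y\<in>B. cmod (c y - c x) < e" using assms[of x e] x e by blast
  have "B \<subseteq> {x : topspace X. c x : S}"
   using B e(2) openin_subset[OF B(1)] by (auto simp: dist_norm norm_minus_commute subset_iff)
  thus "\<exists>T. openin X T \<and> x : T \<and> T \<subseteq> {x : topspace X. c x : S}" using B by blast
 qed
qed

text \<open>An \<open>L^2\<close> limit of an equicontinuous sequence is continuous, because almost everywhere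
 convergence holds on a dense set.\<close>

lemma equicontinuous_limit:
 assumes h: "!!n. h n : L2 \<mu>" and m: "m : L2 \<mu>" "tends h m"
  and eq: "!!x e. x : topspace X ==> e > 0 ==> \<exists>B. openin X B \<and> x : B \<and> (\<forall>n. \<forall>y\<in>B. cmod (h n y - h n x) <= e)"
 obtains c where "c : CX" "nrm (m - c) = 0"
proof -
 have dL: "h n - m : L2 \<mu>" for n using h m by simp
 have "(%n. \<integral>x. cmod ((h n - m) x) \<partial>\<mu>) ----> 0"
 proof (rule tendsto_0_le[where K = 1, OF m(2)[unfolded tends_def]], rule always_eventually, rule allI)
  fix n
  have absL: "(%x. complex_of_real (cmod ((h n - m) x))) : L2 \<mu>"
  proof (rule L2I)
   show "(%x. complex_of_real (cmod ((h n - m) x))) : borel_measurable \<mu>"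
    using measurable_compose[OF L2_measurable[OF dL, of n], of "%z. complex_of_real (cmod z)" borel] by simp
   show "integrable \<mu> (%x. (cmod (complex_of_real (cmod ((h n - m) x))))^2)"
    unfolding norm_of_real abs_norm_cancel by (rule L2_integrable_sq[OF dL])
  qed
  have one: "(%x. 1) : L2 \<mu>" by (rule L2_bounded[OF fin, where B = 1]) auto
  have "cmod (l2_inner \<mu> (%x. complex_of_real (cmod ((h n - m) x))) (%x. 1)) \<le>
   nrm (%x. complex_of_real (cmod ((h n - m) x))) * nrm (%x. 1)" by (rule cauchy_schwarz[OF absL one])
  moreover have "nrm (%x. 1) = 1" by (simp add: nrm_eq l2_norm_def prob_space)
  moreover have "nrm (%x. complex_of_real (cmod ((h n - m) x))) = nrm (h n - m)" by (simp add: nrm_eq l2_norm_def)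
  moreover have "l2_inner \<mu> (%x. complex_of_real (cmod ((h n - m) x))) (%x. 1) = complex_of_real (\<integral>x. cmod ((h n - m) x) \<partial>\<mu>)"
   by (simp add: l2_inner_def)
  ultimately show "norm (\<integral>x. cmod ((h n - m) x) \<partial>\<mu>) <= norm (nrm (h n - m)) * 1" using nrm_nonneg[OF dL] by simp
 qed
 then obtain r where r: "strict_mono r" "AE x in \<mu>. (%n. (h (r n) - m) x) ----> 0"
  using tendsto_L1_AE_subseq[of \<mu> "%n. h n - m"] L2_integrable[OF fin dL] by auto
 have conv: "AE x in \<mu>. (%n. h (r n) x) ----> m x" using r(2) by eventually_elim (simp add: minus_fun LIM_zero_iff)
 have cv: "convergent (%n. h (r n) x)" if x: "x : topspace X" for x
 proof -
  have "Cauchy (%n. h (r n) x)" unfolding Cauchy_def dist_norm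
  proof (intro allI impI)
   fix e :: real assume e: "e > 0"
   obtain B where B: "openin X B" "x : B" "!!n y. y : B ==> cmod (h n y - h n x) <= e / 4" using eq[OF x, of "e / 4"] e by auto
   obtain y where y: "y : B" "(%n. h (r n) y) ----> m y" using AE_dense[OF conv B(1)] B(2) by blast
   have "Cauchy (%n. h (r n) y)" using y(2) LIMSEQ_imp_Cauchy by blast
   then obtain N where N: "\<forall>m\<ge>N. \<forall>n\<ge>N. cmod (h (r m) y - h (r n) y) < e / 4"
    unfolding Cauchy_def dist_norm using e by (metis zero_less_divide_iff zero_less_numeral)
   have "cmod (h (r m) x - h (r n) x) < e" if "m \<ge> N" "n \<ge> N" for m n
   proof -
    have "h (r m) x - h (r n) x = (h (r m) x - h (r m) y) + ((h (r m) y - h (r n) y) + (h (r n) y - h (r n) x))" by simp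
    also have "cmod \<dots> <= cmod (h (r m) x - h (r m) y) + (cmod (h (r m) y - h (r n) y) + cmod (h (r n) y - h (r n) x))"
     by (intro order_trans[OF norm_triangle_ineq] add_left_mono norm_triangle_ineq)
    also have "\<dots> < e" using B(3)[OF y(1), of "r m"] B(3)[OF y(1), of "r n"] N[rule_format, OF that] e
     by (simp add: norm_minus_commute)
    finally show ?thesis .
   qed
   thus "\<exists>N. \<forall>m\<ge>N. \<forall>n\<ge>N. cmod (h (r m) x - h (r n) x) < e" by blast
  qed
  thus ?thesis by (simp add: Cauchy_convergent_iff)
 qed
 define c where "c x = lim (%n. h (r n) x)" for x
 have clim: "(%n. h (r n) x) ----> c x" if "x : topspace X" for x using cv[OF that] by (simp add: c_def convergent_LIMSEQ_iff)
 have cCX: "c : CX"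
 proof (rule continuousI_dist)
  fix x and e :: real assume x: "x : topspace X" and e: "e > 0"
  obtain B where B: "openin X B" "x : B" "!!n y. y : B ==> cmod (h n y - h n x) <= e / 2" using eq[OF x, of "e / 2"] e by auto
  have "cmod (c y - c x) < e" if y: "y : B" for y
  proof -
   have yX: "y : topspace X" using y openin_subset[OF B(1)] by auto
   have "(%n. cmod (h (r n) y - h (r n) x)) ----> cmod (c y - c x)" by (intro tendsto_norm tendsto_diff clim yX x)
   hence "cmod (c y - c x) <= e / 2" by (rule LIMSEQ_le_const2) (use B(3)[OF y] in auto)
   thus ?thesis using e by simp
  qed
  thus "\<exists>B. openin X B \<and> x : B \<and> (\<forall>y\<in>B. cmod (c y - c x) < e)" using B by blast
 qed
 have "AE x in \<mu>. m x = c x" using conv AE_space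
 proof eventually_elim
  case (elim x)
  thus ?case using LIMSEQ_unique clim[of x] space_\<mu> by blast
 qed
 hence "nrm (m - c) = 0" using nrm_diff_eq_0_iff m CX_L2[OF cCX] by blast
 thus ?thesis using that cCX by blast
qed

text \<open>Passing from a continuous \<open>c\<close> in \<open>E (Suc i)\<close> to
  \<open>E i\<close> must not destroy continuity. The least-norm point for the midpoint hull of the
  \<open>L i\<close>-translates of \<open>c\<close> is fixed by \<open>L i\<close>; the hull is
  equicontinuous, so \<open>equicontinuous_limit\<close> makes this point continuous; and no point
  of the hull is farther from the invariant \<open>f\<close> than \<open>c\<close> is.\<close>

lemma CX_E_dense_step:
 assumes dense: "!!f e. f : E (Suc i) ==> e > 0 ==> \<exists>c\<in>CX \<inter> E (Suc i). nrm (f - c) < e"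
  and f: "f : E i" and e: "e > 0"
 shows "\<exists>c\<in>CX \<inter> E i. nrm (f - c) < e"
proof -
 obtain c where c: "c : CX" "c : E (Suc i)" "nrm (f - c) < e / 2" using dense[of f "e / 2"] f E_mono[of i "Suc i"] e by auto
 have fL: "f : L2 \<mu>" and cL: "c : L2 \<mu>" using f c E_mem by auto
 define C where "C = midhull ((%u. V u c) ` L i)"
 have CL: "h : L2 \<mu>" if "h : C" for h using that unfolding C_def
 proof (induction rule: midhull_induct)
  case (base h) thus ?case using cL by auto
 next
  case (mid x y) thus ?case by (intro sc_mem[OF add_mem])
 qed
 have Cne: "C ~= {}" using midhull_base[of "V \<one> c" "(%u. V u c) ` L i"] L_one by (auto simp: C_def)
 obtain m h where m: "m : L2 \<mu>" "!!n. h n : C" "tends h m"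
  and uniq: "!!F. (!!n. F n : C) ==> (%n. nrm (F n)) ----> nrm m ==> tends F m"
 proof (rule midpoint_min[of C])
  show "(%t. 1 / 2 * (x + y) t) : C" if "x : C" "y : C" for x y using midhull_mid that by (simp add: C_def)
 qed (use CL Cne in blast)+
 have hL: "h n : L2 \<mu>" for n using CL m(2) by blast
 have shift: "\<exists>h'\<in>C. nrm (V u x - h') = 0" if u: "u : L i" and x: "x : C" for u x using x unfolding C_def
 proof (induction rule: midhull_induct)
  case (base x)
  then obtain w where w: "w : L i" "x = V w c" by auto
  hence "V (w \<otimes> u) c : midhull ((%u. V u c) ` L i)" using u by (intro midhull_base imageI L_mult)
  moreover have "nrm (V u x - V (w \<otimes> u) c) = 0" unfolding w(2) by (rule V_comp) (use w u in auto)
  ultimately show ?case by blast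
 next
  case (mid x y)
  then obtain x' y' where xy: "x' : C" "y' : C" "nrm (V u x - x') = 0" "nrm (V u y - y') = 0" unfolding C_def by blast
  have xyL: "x : L2 \<mu>" "y : L2 \<mu>" using CL mid(1,2) by (auto simp: C_def)
  have "nrm ((V u x + V u y) - (x' + y')) = 0" using xy CL xyL u by (intro nrm_diff_eq0_add) auto
  hence e1: "nrm ((%t. 1/2 * (V u x + V u y) t) - (%t. 1/2 * (x' + y') t)) = 0"
   by (intro nrm_diff_eq0_sc[of "V u x + V u y" "x' + y'" "1/2"] add_mem) (use xy CL xyL u in auto)
  have e2: "V u (%t. 1/2 * (x + y) t) = (%t. 1/2 * (V u x + V u y) t)" by (simp only: V_sc V_add)
  have e3: "(%t. 1/2 * (x' + y') t) : midhull ((%u. V u c) ` L i)" using xy(1,2) midhull_mid by (simp add: C_def)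
  show ?case by (rule bexI[OF _ e3]) (simp only: e2 e1)
 qed
 have mE: "m : E i" unfolding E_def
 proof (intro CollectI conjI ballI m(1))
  fix u assume u: "u : L i"
  have uG: "u : carrier G" using u by simp
  have "\<forall>n. \<exists>h'. h' : C \<and> nrm (V u (h n) - h') = 0" using shift[OF u m(2)] by blast
  then obtain h' where h': "!!n. h' n : C" "!!n. nrm (V u (h n) - h' n) = 0" by metis
  have h'L: "h' n : L2 \<mu>" for n using CL h'(1) by blast
  have "nrm (h' n) = nrm (h n)" for n using nrm_cong[OF _ h'L h'(2)] hL uG V_nrm by simp
  hence "tends h' m" using uniq[of h'] h'(1) tends_nrm[OF hL m(1,3)] by simp
  moreover have "tends h' (V u m)"
  proof -
   have "nrm (h' n - V u m) = nrm (V u (h n) - V u m)" for n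
    using nrm_cong[of "V u (h n) - V u m" "h' n - V u m"] h'(2) h'L hL m(1) uG by simp
   thus ?thesis using V_tends[OF uG hL m(1,3)] by (simp add: tends_def)
  qed
  ultimately show "nrm (V u m - m) = 0" using tends_unique[OF h'L _ m(1)] m(1) uG by simp
 qed
 have Cf: "nrm (f - x) <= nrm (f - c)" if "x : C" for x using that unfolding C_def
 proof (induction rule: midhull_induct)
  case (base x)
  then obtain w where w: "w : L i" "x = V w c" by auto
  have wG: "w : carrier G" using w by simp
  have "nrm (V w f - f) = 0" using f w by (auto simp: E_def)
  hence "nrm (f - V w c) = nrm (V w f - V w c)" using nrm_cong[of "V w f - V w c" "f - V w c"] fL cL wG by simp
  moreover have "nrm (V w f - V w c) = nrm (f - c)" using V_nrm[OF wG, of "f - c"] fL cL by (simp add: V_diff)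
  ultimately show ?case unfolding w(2) by linarith
 next
  case (mid x y)
  have xyL: "x : L2 \<mu>" "y : L2 \<mu>" using CL mid(1,2) by (auto simp: C_def)
  have m: "(f - x) + (f - y) : L2 \<mu>" by (intro add_mem diff_mem fL xyL)
  have c2: "cmod (1/2) = 1/2" by simp
  have eq: "f - (%t. 1/2 * (x + y) t) = (%t. 1/2 * ((f - x) + (f - y)) t)" by (auto simp: plus_fun minus_fun fun_eq_iff field_simps)
  have "nrm (f - (%t. 1/2 * (x + y) t)) = 1/2 * nrm ((f - x) + (f - y))" unfolding eq nrm_sc[OF m] c2 ..
  also have "\<dots> <= 1/2 * (nrm (f - x) + nrm (f - y))" by (intro mult_left_mono nrm_triangle diff_mem fL xyL) simp
  also have "\<dots> <= nrm (f - c)" using mid(3,4) by (rule half_sum_le)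
  finally show ?case .
 qed
 have fm: "nrm (f - m) <= nrm (f - c)"
 proof (rule LIMSEQ_le_const2)
  show "(%n. nrm (f - h n)) ----> nrm (f - m)" using hL fL m by (intro tends_nrm tends_diff) auto
 qed (use Cf m(2) in auto)
 obtain c' where c': "c' : CX" "nrm (m - c') = 0"
 proof (rule equicontinuous_limit[OF hL m(1,3)])
  fix x and d :: real assume x: "x : topspace X" and d: "d > 0"
  obtain B where B: "openin X B" "x : B" "!!z y. z : L i ==> y : B ==> cmod (c (act z y) - c (act z x)) < d"
   using equicontinuous[OF c(1,2) x d] by blast
  have "\<forall>y\<in>B. cmod (g y - g x) <= d" if "g : C" for g using that unfolding C_def
  proof (induction rule: midhull_induct)
   case (base g)
   then obtain w where "w : L i" "g = V w c" by auto
   thus ?case using B(3)[of w] by (auto simp: V_def intro: less_imp_le)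
  next
   case (mid g h)
   show ?case
   proof
    fix y assume y: "y : B"
    have "(%t. 1/2 * (g + h) t) y - (%t. 1/2 * (g + h) t) x = 1/2 * ((g y - g x) + (h y - h x))"
     by (simp add: plus_fun field_simps)
    hence "cmod ((%t. 1/2 * (g + h) t) y - (%t. 1/2 * (g + h) t) x) = 1/2 * cmod ((g y - g x) + (h y - h x))"
     by (simp only: norm_mult) simp
    also have "\<dots> <= 1/2 * (d + d)"
     using mid(3,4) y by (intro mult_left_mono order_trans[OF norm_triangle_ineq] add_mono) auto
    finally show "cmod ((%t. 1/2 * (g + h) t) y - (%t. 1/2 * (g + h) t) x) <= d" by simp
   qed
  qed
  thus "\<exists>B. openin X B \<and> x : B \<and> (\<forall>n. \<forall>y\<in>B. cmod (h n y - h n x) <= d)" using B m(2) by blast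
 qed
 have c'L: "c' : L2 \<mu>" by (rule CX_L2[OF c'(1)])
 have "c' : E i" by (rule csub_cong[OF csub_E mE c'L c'(2)])
 moreover have "nrm (f - c') = nrm (f - m)" using nrm_cong[of "f - c'" "f - m"] c'(2) fL m(1) c'L by simp
 ultimately show ?thesis using c' fm c(3) e by (intro bexI[of _ c']) auto
qed

text \<open>Downward induction from \<open>E k\<close>, which is all of \<open>L2 \<mu>\<close> by
  nilpotency.\<close>

lemma CX_E_dense: "i <= k ==> f : E i ==> e > 0 ==> \<exists>c\<in>CX \<inter> E i. nrm (f - c) < e"
proof (induction i arbitrary: f e rule: inc_induct)
 case base
 thus ?case using CX_approx[of f e] CX_L2 unfolding E_top by blast
next
 case (step i)
 show ?case by (rule CX_E_dense_step[OF step.IH step.prems])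
qed

end

section \<open>Characters of the lower central series\<close>

text \<open>While a power \<open>w\<close> stays within distance 1 of 1, its real part exceeds 1/2,
  so squaring multiplies the distance to 1 by \<open>cmod (w + 1)\<close>, which is at least 3/2.
  Repeated squaring would push the distance beyond 1.\<close>

lemma no_small_subgroup:
 fixes z :: complex
 assumes z: "cmod z = 1" and small: "!!n::nat. cmod (z ^ n - 1) < 1"
 shows "z = 1"
proof (rule ccontr)
 assume n: "z ~= 1"
 define d where "d = cmod (z - 1)"
 have d0: "d > 0" using n by (simp add: d_def)
 have step: "cmod (w^2 - 1) \<ge> 3/2 * cmod (w - 1)" if "cmod w = 1" "cmod (w - 1) < 1" "cmod (w^2 - 1) < 1" for w
 proof -
  have sq: "(cmod (w - 1))^2 = 2 - 2 * Re w"
   using that(1) by (simp add: cmod_power2 power2_diff) (smt (verit) cmod_power2 one_power2)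
  have "(cmod (w - 1))^2 < 1^2" using that(2) by (intro power_strict_mono) auto
  hence Re: "Re w > 1/2" using sq by simp
  have "w^2 - 1 = (w - 1) * (w + 1)" by (simp add: power2_eq_square algebra_simps)
  hence "cmod (w^2 - 1) = cmod (w - 1) * cmod (w + 1)" by (simp add: norm_mult)
  moreover have "cmod (w + 1) \<ge> 3/2" using complex_Re_le_cmod[of "w + 1"] Re by simp
  ultimately show ?thesis using mult_left_mono[of "3/2" "cmod (w + 1)" "cmod (w - 1)"] by (simp add: mult.commute)
 qed
 have "cmod (z ^ (2 ^ n) - 1) \<ge> (3/2) ^ n * d" for n
 proof (induction n)
  case (Suc n)
  have "cmod ((z ^ (2 ^ n))^2 - 1) \<ge> 3/2 * cmod (z ^ (2 ^ n) - 1)"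
   by (rule step) (use z small[of "2 ^ n"] small[of "2 ^ Suc n"] in "simp_all add: norm_power power_mult[symmetric] mult.commute")
  thus ?case using Suc by (simp add: power_mult[symmetric] mult.commute)
 qed (simp add: d_def)
 moreover obtain n where "(3/2) ^ n > 1 / d" using real_arch_pow[of "3/2" "1 / d"] by auto
 ultimately have "cmod (z ^ (2 ^ n) - 1) > 1" using d0 by (smt (verit, ccfv_SIG) divide_less_eq mult.commute)
 thus False using small[of "2 ^ n"] by simp
qed

text \<open>By connectedness the real parts of \<open>P\<close> fill the interval from
  \<open>Re p\<close> to 1, so \<open>Q\<close>, being closed under conjugation, contains the arc of
  all points with at least this real part. Every point of the circle is a power of a point of the
  arc.\<close>

lemma connected_subset_generates_circle:
 fixes P Q :: "complex set"
 assumes P: "connected P" "1 : P" "p : P" "p ~= 1" "P \<subseteq> Q"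
  and Q: "Q \<subseteq> S1" "!!x y. x : Q ==> y : Q ==> x * y : Q" "!!x. x : Q ==> cnj x : Q"
 shows "Q = S1"
proof (intro equalityI Q(1) subsetI)
 fix w :: complex assume w: "w : S1"
 have p1: "cmod p = 1" using P Q by auto
 have "(Re p)^2 + (Im p)^2 = 1" using p1 by (simp add: cmod_def)
 have Rep: "Re p < 1"
 proof (rule ccontr)
  assume "\<not> Re p < 1"
  hence "Re p = 1" using complex_Re_le_cmod[of p] p1 by simp
  hence "Im p = 0" using \<open>(Re p)^2 + (Im p)^2 = 1\<close> by simp
  thus False using \<open>Re p = 1\<close> P(4) by (simp add: complex_eq_iff)
 qed
 have arc: "z : Q" if z: "cmod z = 1" "Re z \<ge> Re p" for z
 proof -
  have "connected (Re ` P)" by (intro connected_continuous_image P continuous_intros)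
  moreover have "Re p : Re ` P" "1 : Re ` P" using P by force+
  moreover have "Re z <= 1" using complex_Re_le_cmod[of z] z by simp
  ultimately have "Re z : Re ` P" using z(2) connectedD_interval[of "Re ` P" "Re p" 1 "Re z"] by blast
  then obtain y where y: "y : P" "Re y = Re z" by auto
  have yQ: "y : Q" using y P by auto
  have "(Im y)^2 = (Im z)^2" using yQ Q(1) y(2) z(1) by (auto simp: cmod_def)
  hence "Im y = Im z \<or> Im y = - Im z" by (simp add: power2_eq_iff)
  hence "z = y \<or> z = cnj y" using y(2) by (auto simp: complex_eq_iff)
  thus ?thesis using yQ Q(3) by auto
 qed
 have pow: "z ^ n : Q" if "z : Q" for z and n :: nat using that P by (induction n) (auto intro: Q(2))
 obtain t where t: "w = cis t" using w by (metis complex_norm_eq_1_exp_eq cis_conv_exp mem_sphere_0)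
 have "(%n. cos (t / real (Suc n))) ----> cos 0"
 proof (intro tendsto_cos)
  show "(%n. t / real (Suc n)) ----> 0" using tendsto_mult_left[OF LIMSEQ_inverse_real_of_nat, of t] by (simp add: divide_inverse)
 qed
 hence "\<forall>\<^sub>F n in sequentially. Re p < cos (t / real (Suc n))" using Rep by (intro order_tendstoD) auto
 then obtain n where n: "Re p < cos (t / real (Suc n))" by (auto simp: eventually_sequentially)
 have "cis (t / real (Suc n)) : Q" using n by (intro arc) auto
 hence "cis (t / real (Suc n)) ^ Suc n : Q" by (rule pow)
 moreover have "cis (t / real (Suc n)) ^ Suc n = w"
 proof -
  have "cis (t / real (Suc n)) ^ Suc n = cis (real (Suc n) * (t / real (Suc n)))" by (rule Complex.DeMoivre)
  also have "real (Suc n) * (t / real (Suc n)) = t" by (simp del: of_nat_Suc)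
  finally show ?thesis using t by simp
 qed
 ultimately show "w : Q" by simp
qed

context nil_action
begin

text \<open>Arzela-Ascoli: open sets on which all \<open>L i\<close>-translates of \<open>c\<close>
  are within \<open>d\<close> of their value at a sample point have a finite subcover
  \<open>F\<close>, and \<open>\<phi> z\<close> records the values of the translate at the sample
  points \<open>p W\<close>, rounded to multiples of \<open>d\<close>. There are finitely many
  records, and equal records mean close translates.\<close>

lemma tot_bdd_CX:
 assumes c: "c : CX" "c : E (Suc i)" and e: "e > 0"
 shows "\<exists>K0\<subseteq>L i. finite K0 \<and> (\<forall>u\<in>L i. \<exists>w\<in>K0. nrm (V u c - V w c) < e)"
proof -
 \<comment> \<open>Two equicontinuity errors \<open>d\<close> and a rounding error
   \<open>2 * d\<close> from real and imaginary part add up to \<open>4 * d = e / 2\<close>.\<close>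
 define d where "d = e / 8"
 have d: "d > 0" using e by (simp add: d_def)
 obtain M where M: "!!x. x : topspace X ==> cmod (c x) <= M" using CX_bounded[OF c(1)] by blast
 define \<U> where "\<U> = {W. openin X W \<and> (\<exists>x\<in>W. \<forall>z\<in>L i. \<forall>y\<in>W. cmod (c (act z y) - c (act z x)) < d)}"
 have "topspace X \<subseteq> \<Union>\<U>"
 proof
  fix x assume x: "x : topspace X"
  obtain B where "openin X B" "x : B" "!!z y. z : L i ==> y : B ==> cmod (c (act z y) - c (act z x)) < d"
   using equicontinuous[OF c x d] by blast
  hence "B : \<U>" "x : B" unfolding \<U>_def by blast+
  thus "x : \<Union>\<U>" by blast
 qed
 moreover have "\<forall>W\<in>\<U>. openin X W" by (simp add: \<U>_def)
 ultimately obtain F where F: "finite F" "F \<subseteq> \<U>" "topspace X \<subseteq> \<Union>F"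
  using X_compact unfolding compact_space_alt by meson
 have "\<forall>W\<in>F. \<exists>x. x : W \<and> (\<forall>z\<in>L i. \<forall>y\<in>W. cmod (c (act z y) - c (act z x)) < d)"
  using F(2) by (auto simp: \<U>_def)
 then obtain p where p: "!!W. W : F ==> p W : W"
  "!!W z y. W : F ==> z : L i ==> y : W ==> cmod (c (act z y) - c (act z (p W))) < d" by metis
 have pX: "p W : topspace X" if "W : F" for W using p(1)[OF that] F(2) that openin_subset by (auto simp: \<U>_def)
 define fl where "fl r = \<lfloor>r / d\<rfloor>" for r
 define N where "N = \<lceil>M / d\<rceil> + 1"
 define \<phi> where "\<phi> z = (\<lambda>W\<in>F. (fl (Re (c (act z (p W)))), fl (Im (c (act z (p W))))))" for z
 have flN: "fl r : {-N..N}" if "\<bar>r\<bar> <= M" for r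
 proof -
  have "\<bar>r / d\<bar> = \<bar>r\<bar> / d" using d by (metis abs_div_pos)
  moreover have "\<bar>r\<bar> / d <= M / d" by (rule divide_right_mono[OF that]) (use d in linarith)
  ultimately have "\<bar>r / d\<bar> <= M / d" by (simp only:)
  hence "- (M / d) <= r / d" "r / d <= M / d" by linarith+
  moreover have "M / d <= of_int \<lceil>M / d\<rceil>" by (rule le_of_int_ceiling)
  ultimately have "of_int (- \<lceil>M / d\<rceil> - 1) <= r / d" "r / d <= of_int (\<lceil>M / d\<rceil> + 1)" unfolding of_int_add of_int_diff of_int_minus of_int_1 by linarith+
  hence "- \<lceil>M / d\<rceil> - 1 <= \<lfloor>r / d\<rfloor>" "\<lfloor>r / d\<rfloor> <= \<lceil>M / d\<rceil> + 1"
   by (simp_all only: le_floor_iff floor_le_iff of_int_add of_int_diff of_int_minus of_int_1)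
  thus ?thesis unfolding fl_def N_def by simp
 qed
 have "\<phi> ` L i \<subseteq> (\<Pi>\<^sub>E W\<in>F. {-N..N} \<times> {-N..N})"
 proof clarify
  fix z assume z: "z : L i"
  have "\<bar>Re (c (act z (p W)))\<bar> <= M \<and> \<bar>Im (c (act z (p W)))\<bar> <= M" if "W : F" for W
   using M[of "act z (p W)"] z pX[OF that] abs_Re_le_cmod[of "c (act z (p W))"] abs_Im_le_cmod[of "c (act z (p W))"] by auto
  thus "\<phi> z : (\<Pi>\<^sub>E W\<in>F. {-N..N} \<times> {-N..N})" unfolding \<phi>_def using flN by (intro restrict_PiE_iff[THEN iffD2]) blast
 qed
 hence fin: "finite (\<phi> ` L i)" by (rule finite_subset) (use F(1) in "auto intro!: finite_PiE")
 define K0 where "K0 = (%v. SOME z. z : L i \<and> \<phi> z = v) ` (\<phi> ` L i)"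
 have K0: "(SOME z. z : L i \<and> \<phi> z = \<phi> u) : L i \<and> \<phi> (SOME z. z : L i \<and> \<phi> z = \<phi> u) = \<phi> u" if "u : L i" for u
  by (rule someI[of "%z. z : L i \<and> \<phi> z = \<phi> u" u]) (use that in simp)
 have fleq: "\<bar>r - s\<bar> <= d" if "fl r = fl s" for r s
 proof -
  have "\<bar>r / d - s / d\<bar> <= 1" using that unfolding fl_def by linarith
  hence "\<bar>(r - s) / d\<bar> <= 1" by (simp only: diff_divide_distrib)
  moreover have "\<bar>(r - s) / d\<bar> = \<bar>r - s\<bar> / d" using d by (metis abs_div_pos)
  ultimately have "\<bar>r - s\<bar> / d <= 1" by (simp only:)
  thus ?thesis using d by (simp only: pos_divide_le_eq mult_1)
 qed
 show ?thesis
 proof (intro exI[of _ K0] conjI ballI)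
  show "K0 \<subseteq> L i" using K0 by (auto simp: K0_def)
  show "finite K0" unfolding K0_def using fin by simp
  fix u assume u: "u : L i"
  define w where "w = (SOME z. z : L i \<and> \<phi> z = \<phi> u)"
  have w: "w : L i" "\<phi> w = \<phi> u" using K0[OF u] by (auto simp: w_def)
  have "nrm (V u c - V w c) <= 4 * d"
  proof (rule L2_bound_nrm)
   show "V u c - V w c : L2 \<mu>" using u w(1) CX_L2[OF c(1)] by simp
   fix x assume x: "x : topspace X"
   obtain W where W: "W : F" "x : W" using F(3) x by auto
   have "\<phi> w W = \<phi> u W" using w by simp
   hence "fl (Re (c (act u (p W)))) = fl (Re (c (act w (p W))))" "fl (Im (c (act u (p W)))) = fl (Im (c (act w (p W))))"
    using W(1) by (auto simp: \<phi>_def)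
   hence "\<bar>Re (c (act u (p W)) - c (act w (p W)))\<bar> <= d" "\<bar>Im (c (act u (p W)) - c (act w (p W)))\<bar> <= d"
    using fleq by auto
   hence mid: "cmod (c (act u (p W)) - c (act w (p W))) <= 2 * d"
    using cmod_le[of "c (act u (p W)) - c (act w (p W))"] by linarith
   have "c (act u x) - c (act w x) = (c (act u x) - c (act u (p W))) + ((c (act u (p W)) - c (act w (p W))) + (c (act w (p W)) - c (act w x)))" by simp
   also have "cmod \<dots> <= cmod (c (act u x) - c (act u (p W))) + (cmod (c (act u (p W)) - c (act w (p W))) + cmod (c (act w (p W)) - c (act w x)))"
    by (intro order_trans[OF norm_triangle_ineq] add_left_mono norm_triangle_ineq)
   also have "\<dots> <= 4 * d" using p(2)[OF W(1) u W(2)] p(2)[OF W(1) w(1) W(2)] mid by (simp add: norm_minus_commute)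
   finally show "cmod ((V u c - V w c) x) <= 4 * d" by (simp add: V_def minus_fun)
  qed (use d in simp)
  hence "nrm (V u c - V w c) < e" using e by (simp add: d_def)
  moreover have "w : K0" unfolding K0_def w_def using u by (intro imageI)
  ultimately show "\<exists>w\<in>K0. nrm (V u c - V w c) < e" by blast
 qed
qed

lemma tot_bdd_E:
 assumes i: "i < k" and f: "f : E (Suc i)" and e: "e > 0"
 shows "\<exists>K0\<subseteq>L i. finite K0 \<and> (\<forall>u\<in>L i. \<exists>w\<in>K0. nrm (V u f - V w f) < e)"
proof -
 have e3: "e / 3 > 0" using e by simp
 obtain c where c: "c : CX" "c : E (Suc i)" "nrm (f - c) < e / 3" using CX_E_dense[of "Suc i" f, OF _ f e3] i by auto
 obtain K0 where K0: "K0 \<subseteq> L i" "finite K0" "!!u. u : L i ==> \<exists>w\<in>K0. nrm (V u c - V w c) < e / 3"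
  using tot_bdd_CX[OF c(1,2) e3] by blast
 have fL: "f : L2 \<mu>" and cL: "c : L2 \<mu>" using f c E_mem by auto
 have "\<exists>w\<in>K0. nrm (V u f - V w f) < e" if u: "u : L i" for u
 proof -
  obtain w where w: "w : K0" "nrm (V u c - V w c) < e / 3" using K0(3)[OF u] by blast
  have G: "u : carrier G" "w : carrier G" using u w(1) K0(1) by auto
  have 1: "nrm (V u f - V u c) < e / 3" using V_nrm[OF G(1), of "f - c"] fL cL c(3) by (simp add: V_diff)
  have 2: "nrm (V w c - V w f) < e / 3"
   using V_nrm[OF G(2), of "c - f"] fL cL c(3) nrm_diff_commute[OF fL cL] by (simp add: V_diff)
  have "nrm (V u f - V w f) <= nrm (V u f - V u c) + nrm (V u c - V w f)" using fL cL G by (intro nrm_triangle3) auto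
  moreover have "nrm (V u c - V w f) <= nrm (V u c - V w c) + nrm (V w c - V w f)" using fL cL G by (intro nrm_triangle3) auto
  ultimately have "nrm (V u f - V w f) < e" using 1 2 w(2) by linarith
  thus ?thesis using w(1) by blast
 qed
 thus ?thesis using K0 by blast
qed

lemma V_inv:
 assumes g: "g : carrier G" and f: "f : L2 \<mu>"
 shows "nrm (V g (V (inv g) f) - f) = 0" "nrm (V (inv g) (V g f) - f) = 0"
 using V_comp[of "inv g" g f] V_comp[of g "inv g" f] V_one[of f] g f
  nrm_diff_eq0_trans[of "V g (V (inv g) f)" "V \<one> f" f] nrm_diff_eq0_trans[of "V (inv g) (V g f)" "V \<one> f" f] by simp_all

text \<open>Instance of \<open>joint_eigenvector\<close> with kernels in \<open>L2\<close> of the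
  product measure. The invariant subspace \<open>W\<close> is kept general so that eigenvectors can
  be found inside orthogonal complements.\<close>

lemma joint_eigen:
 assumes i: "i < k" and W: "csub W" "W \<subseteq> E (Suc i)" "!!u f. u : L i ==> f : W ==> V u f : W"
  and q: "q : W" "nrm q ~= 0"
 shows "\<exists>p\<in>W. nrm p ~= 0 \<and> (\<forall>u\<in>L i. \<exists>\<theta>. nrm (V u p - (%x. \<theta> * p x)) = 0)"
proof -
 have WL: "f : L2 \<mu>" if "f : W" for f using that W(2) E_mem by blast
 interpret P: pair_prob_space \<mu> \<mu> ..
 have finP: "finite_measure (\<mu> \<Otimes>\<^sub>M \<mu>)" using P.finite_measure_axioms .
 interpret A: abelian_rep_tensor "L2 \<mu>" "%c f x. c * f x" "l2_inner \<mu>" W "L i" V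
  "L2 (\<mu> \<Otimes>\<^sub>M \<mu>)" "%c f x. c * f x" "l2_inner (\<mu> \<Otimes>\<^sub>M \<mu>)" "%f g p. f (fst p) * cnj (g (snd p))"
 proof (intro abelian_rep_tensor.intro abelian_rep.intro abelian_rep_axioms.intro abelian_rep_tensor_axioms.intro)
  show "semi_hilbert (L2 \<mu>) (%c f x. c * f x) (l2_inner \<mu>)" by (rule semi_hilbert_L2[OF fin])
  show "semi_hilbert (L2 (\<mu> \<Otimes>\<^sub>M \<mu>)) (%c f x. c * f x) (l2_inner (\<mu> \<Otimes>\<^sub>M \<mu>))" by (rule semi_hilbert_L2[OF finP])
  show "csub W" by (rule W(1))
  show "L i ~= {}" using L_one by blast
  show "V u f : W" if "u : L i" "f : W" for u f using W(3) that .
  show "\<exists>z\<in>L i. \<forall>x\<in>W. nrm (V u (V w x) - V z x) = 0" if "u : L i" "w : L i" for u w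
   using that L_mult[of w i u] V_comp[of w u] by (intro bexI[of _ "w \<otimes> u"]) auto
  show "\<exists>z\<in>L i. \<forall>x\<in>W. nrm (V u (V z x) - x) = 0 \<and> nrm (V z (V u x) - x) = 0" if "u : L i" for u
   using that L_inv[of u i] V_inv WL by (intro bexI[of _ "inv u"]) auto
  show "nrm (V u (V w x) - V w (V u x)) = 0" if "u : L i" "w : L i" "x : W" for u w x using V_swap[of x i w u] that W(2) by auto
  show "\<exists>K0\<subseteq>L i. finite K0 \<and> (\<forall>u\<in>L i. \<exists>w\<in>K0. nrm (V u x - V w x) < e)" if "x : W" "e > 0" for x e
   using tot_bdd_E[OF i _ that(2)] that(1) W(2) by blast
  show "l2_inner \<mu> (V u x) (V u y) = l2_inner \<mu> x y" if "u : L i" "x : W" "y : W" for u x y using V_ip that WL by simp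
  show "(%p. x (fst p) * cnj (y (snd p))) : L2 (\<mu> \<Otimes>\<^sub>M \<mu>)" if "x : L2 \<mu>" "y : L2 \<mu>" for x y
   by (rule tensor_L2[OF fin that])
  show "l2_inner (\<mu> \<Otimes>\<^sub>M \<mu>) (%p. x (fst p) * cnj (y (snd p))) (%p. x' (fst p) * cnj (y' (snd p))) = l2_inner \<mu> x x' * l2_inner \<mu> y' y"
   if "x : L2 \<mu>" "y : L2 \<mu>" "x' : L2 \<mu>" "y' : L2 \<mu>" for x y x' y' by (rule tensor_ip[OF fin that])
 qed (auto simp: V_def plus_fun distrib_left distrib_right)
 show ?thesis using A.joint_eigenvector[OF q] by metis
qed

section \<open>Characters and commutators\<close>

definition chr :: "nat => ('g => complex) => bool" where
 "chr i \<phi> \<longleftrightarrow> (\<forall>x\<in>L i. \<forall>y\<in>L i. \<phi> (x \<otimes> y) = \<phi> x * \<phi> y) \<and> (\<forall>x\<in>L i. cmod (\<phi> x) = 1)"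

lemma chr_mult: "chr i \<phi> ==> x : L i ==> y : L i ==> \<phi> (x \<otimes> y) = \<phi> x * \<phi> y"
 and chr_norm: "chr i \<phi> ==> x : L i ==> cmod (\<phi> x) = 1" by (auto simp: chr_def)

lemma chr_one: "chr i \<phi> ==> \<phi> \<one> = 1"
 using chr_mult[of i \<phi> \<one> \<one>] chr_norm[of i \<phi> \<one>] L_one[of i] by auto

lemma chr_inv: "chr i \<phi> ==> x : L i ==> \<phi> (inv x) = cnj (\<phi> x)"
proof -
 assume c: "chr i \<phi>" and x: "x : L i"
 have "\<phi> x * \<phi> (inv x) = 1" using chr_mult[OF c x L_inv[OF x]] chr_one[OF c] x by simp
 moreover have "\<phi> x * cnj (\<phi> x) = 1" using chr_norm[OF c x] by (simp add: complex_norm_square[symmetric])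
 moreover have "\<phi> x ~= 0" using chr_norm[OF c x] by auto
 ultimately show ?thesis by (metis mult_left_cancel)
qed

lemma chr_generate:
 assumes c: "chr (Suc i) \<phi>" and g: "!!x y. x : L i ==> y : carrier G ==> \<phi> (comm x y) = 1" and u: "u : L (Suc i)"
 shows "\<phi> u = 1"
proof -
 have "u : generate G (\<Union>x\<in>L i. \<Union>y\<in>carrier G. {comm x y})" using u by (simp only: L_Suc)
 hence "u : L (Suc i) \<and> \<phi> u = 1"
 proof (induction rule: generate.induct)
  case one thus ?case using chr_one[OF c] L_one by simp
 next
  case (incl h) thus ?case using g comm_L by auto
 next
  case (inv h)
  hence h: "h : L (Suc i)" "\<phi> h = 1" using g comm_L by auto
  thus ?case using chr_inv[OF c h(1)] L_inv[OF h(1)] by simp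
 next
  case (eng h1 h2) thus ?case using chr_mult[OF c] L_mult by simp
 qed
 thus ?thesis by simp
qed

lemma comm_mult_left: "x : carrier G ==> x' : carrier G ==> y : carrier G ==>
 comm (x \<otimes> x') y = comm x (comm x' y) \<otimes> comm x' y \<otimes> comm x y"
 by (simp add: comm_def m_assoc inv_mult_group)

lemma comm_mult_right: "x : carrier G ==> y : carrier G ==> y' : carrier G ==>
 comm x (y \<otimes> y') = comm x y \<otimes> (comm y (comm x y') \<otimes> comm x y')"
 by (simp add: comm_def m_assoc inv_mult_group)

text \<open>Commutators are multiplicative in each argument up to order of factors and elements of
  \<open>L (Suc (Suc i))\<close>, which \<open>\<phi>\<close> kills.\<close>

lemma chr_comm_left:
 assumes c: "chr (Suc i) \<phi>" and kill: "!!w. w : L (Suc (Suc i)) ==> \<phi> w = 1"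
  and x: "x : L i" "x' : L i" and y: "y : carrier G"
 shows "\<phi> (comm (x \<otimes> x') y) = \<phi> (comm x y) * \<phi> (comm x' y)"
proof -
 have d: "comm x' y : L (Suc i)" "comm x y : L (Suc i)" using comm_L x y by auto
 have e: "comm x (comm x' y) : L (Suc (Suc i))" using comm_L2[OF d(1)] x by simp
 have e': "comm x (comm x' y) : L (Suc i)" using e L_Suc_sub by blast
 show ?thesis using comm_mult_left[of x x' y] x y kill[OF e]
   chr_mult[OF c e' d(1)] chr_mult[OF c L_mult[OF e' d(1)] d(2)] by simp
qed

lemma chr_comm_right:
 assumes c: "chr (Suc i) \<phi>" and kill: "!!w. w : L (Suc (Suc i)) ==> \<phi> w = 1"
  and x: "x : L i" and y: "y : carrier G" "y' : carrier G"
 shows "\<phi> (comm x (y \<otimes> y')) = \<phi> (comm x y) * \<phi> (comm x y')"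
proof -
 have d: "comm x y' : L (Suc i)" "comm x y : L (Suc i)" using comm_L x y by auto
 have e: "comm y (comm x y') : L (Suc (Suc i))" using comm_L2[OF d(1)] y by simp
 have e': "comm y (comm x y') : L (Suc i)" using e L_Suc_sub by blast
 show ?thesis using comm_mult_right[of x y y'] x y kill[OF e]
   chr_mult[OF c e' d(1)] chr_mult[OF c d(2) L_mult[OF e' d(1)]] by simp
qed

lemma stab_comm:
 assumes "x : carrier G" "y : carrier G" "act x x0 = x0" "act y x0 = x0" shows "act (comm x y) x0 = x0"
proof -
 have "act (inv x) x0 = x0" "act (inv y) x0 = x0" using act_inv(1)[of x x0] act_inv(1)[of y x0] assms x0 by auto
 thus ?thesis using assms x0 by (simp add: comm_def act_mult)
qed

lemma comm_continuous:
 assumes "continuous_map Y T f" "continuous_map Y T g" shows "continuous_map Y T (%y. comm (f y) (g y))"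
 unfolding comm_def by (intro mult_continuous inv_continuous assms)

text \<open>The characters of the compact space \<open>X = G / stab x0\<close> form a discrete set.\<close>

lemma chr_family_base:
 assumes chr: "!!t. t : C0 ==> chr 0 (\<psi> t)"
  and stab: "!!t y. t : C0 ==> y : carrier G ==> act y x0 = x0 ==> \<psi> t y = 1"
  and cont: "continuous_map (prod_topology (subtopology T C0) T) euclidean (%(t, y). \<psi> t y)"
  and one: "!!y. y : carrier G ==> \<psi> \<one> y = 1"
  and t: "t : C0" and y: "y : carrier G"
 shows "\<psi> t y = 1"
proof -
 have C0T: "C0 \<subseteq> topspace T" using C0(1) connectedin_subset_topspace by blast
 have tsC: "topspace (subtopology T C0) = C0" using C0T by auto
 have local_const: "\<exists>M. openin (subtopology T C0) M \<and> t0 : M \<and> (\<forall>t\<in>M. \<forall>y\<in>carrier G. \<psi> t y = \<psi> t0 y)" if t0: "t0 : C0" for t0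
 proof -
  \<comment> \<open>Near each point of \<open>X\<close>, joint continuity keeps
    \<open>\<psi> t\<close> close to \<open>\<psi> t0\<close> for \<open>t\<close> near
    \<open>t0\<close>; by compactness finitely many neighbourhoods of \<open>t0\<close> suffice, and
    their intersection \<open>M0\<close> serves all of \<open>X\<close>. The passage to
    \<open>X\<close> is possible because the characters kill the stabiliser.\<close>
  define \<U> where "\<U> = {W. \<exists>M N. openin (subtopology T C0) M \<and> t0 : M \<and> openin T N \<and>
    W = (%g. act g x0) ` N \<and> (\<forall>t\<in>M. \<forall>y\<in>N. cmod (\<psi> t y - \<psi> t0 y) < 1)}"
  have cont2: "continuous_map (prod_topology (subtopology T C0) T) euclidean (%p. \<psi> (fst p) (snd p) - \<psi> t0 (snd p))"
  proof (intro continuous_map_diff)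
   show "continuous_map (prod_topology (subtopology T C0) T) euclidean (%p. \<psi> (fst p) (snd p))"
    using cont by (simp add: case_prod_unfold)
   have "continuous_map (prod_topology (subtopology T C0) T) (prod_topology (subtopology T C0) T) (%p. (t0, snd p))"
    using t0 tsC by (intro continuous_map_pairedI continuous_map_snd) auto
   from continuous_map_compose[OF this cont]
   show "continuous_map (prod_topology (subtopology T C0) T) euclidean (%p. \<psi> t0 (snd p))" by (simp add: comp_def)
  qed
  have "topspace X \<subseteq> \<Union>\<U>"
  proof
   fix x assume "x : topspace X"
   then obtain y where y: "y : carrier G" "x = act y x0" using trans by blast
   define W where "W = {p : topspace (prod_topology (subtopology T C0) T). \<psi> (fst p) (snd p) - \<psi> t0 (snd p) : ball 0 1}"
   have "openin (prod_topology (subtopology T C0) T) W" unfolding W_def by (rule openin_continuous_map_preimage[OF cont2]) simp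
   moreover have "(t0, y) : W" using t0 y tsC T by (auto simp: W_def)
   ultimately obtain M N where MN: "openin (subtopology T C0) M" "openin T N" "t0 : M" "y : N" "M \<times> N \<subseteq> W"
    unfolding openin_prod_topology_alt by metis
   have "cmod (\<psi> t y' - \<psi> t0 y') < 1" if "t : M" "y' : N" for t y'
   proof -
    have "(t, y') : W" using that MN(5) by auto
    thus ?thesis by (simp add: W_def dist_norm norm_minus_commute)
   qed
   hence "(%g. act g x0) ` N : \<U>" unfolding \<U>_def using MN by blast
   moreover have "x : (%g. act g x0) ` N" using y MN by auto
   ultimately show "x : \<Union>\<U>" by blast
  qed
  moreover have "\<forall>W\<in>\<U>. openin X W" unfolding \<U>_def using orbit_open by blast
  ultimately obtain F where F: "finite F" "F \<subseteq> \<U>" "topspace X \<subseteq> \<Union>F"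
   using X_compact unfolding compact_space_alt by meson
  have "\<forall>W\<in>F. \<exists>M. openin (subtopology T C0) M \<and> t0 : M \<and> (\<exists>N. openin T N \<and>
    W = (%g. act g x0) ` N \<and> (\<forall>t\<in>M. \<forall>y\<in>N. cmod (\<psi> t y - \<psi> t0 y) < 1))"

  proof
   fix W assume "W : F"
   hence "W : \<U>" using F(2) by (rule rev_subsetD)
   then obtain M N where "openin (subtopology T C0) M" "t0 : M" "openin T N"
    "W = (%g. act g x0) ` N" "\<forall>t\<in>M. \<forall>y\<in>N. cmod (\<psi> t y - \<psi> t0 y) < 1" unfolding \<U>_def mem_Collect_eq by metis
   thus "\<exists>M. openin (subtopology T C0) M \<and> t0 : M \<and> (\<exists>N. openin T N \<and>
    W = (%g. act g x0) ` N \<and> (\<forall>t\<in>M. \<forall>y\<in>N. cmod (\<psi> t y - \<psi> t0 y) < 1))" by metis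
  qed
  then obtain M where M: "!!W. W : F ==> openin (subtopology T C0) (M W)" "!!W. W : F ==> t0 : M W"
   "!!W. W : F ==> \<exists>N. openin T N \<and> W = (%g. act g x0) ` N \<and> (\<forall>t\<in>M W. \<forall>y\<in>N. cmod (\<psi> t y - \<psi> t0 y) < 1)" by metis
  define M0 where "M0 = \<Inter>(insert C0 (M ` F))"
  have M0: "openin (subtopology T C0) M0" unfolding M0_def
   using F(1) M(1) openin_topspace[of "subtopology T C0"] tsC by (intro openin_Inter) auto
  have near: "cmod (\<psi> t y - \<psi> t0 y) < 1" if t: "t : M0" and y: "y : carrier G" for t y
  proof -
   have tC: "t : C0" using t by (auto simp: M0_def)
   have "act y x0 : topspace X" using y x0 by simp
   then obtain W where W: "W : F" "act y x0 : W" using F(3) by auto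
   obtain N where N: "openin T N" "W = (%g. act g x0) ` N" "!!t y. t : M W ==> y : N ==> cmod (\<psi> t y - \<psi> t0 y) < 1"
    using M(3)[OF W(1)] by blast
   obtain y' where y': "y' : N" "act y x0 = act y' x0" using W(2) N(2) by auto
   have y'G: "y' : carrier G" using y'(1) N(1) T openin_subset by auto
   have st: "act (inv y' \<otimes> y) x0 = x0" using y y'G y'(2) x0 by (simp add: act_mult)
   have eq: "\<psi> s y = \<psi> s y'" if "s : C0" for s
   proof -
    have "\<psi> s (y' \<otimes> (inv y' \<otimes> y)) = \<psi> s y' * \<psi> s (inv y' \<otimes> y)"
     by (rule chr_mult[OF chr[OF that]]) (use y y'G in auto)
    moreover have "y' \<otimes> (inv y' \<otimes> y) = y" using y y'G by (simp add: m_assoc[symmetric])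
    ultimately show ?thesis using stab[OF that _ st] y y'G by (metis inv_closed m_closed mult.right_neutral)
   qed
   have "t : M W" using t W(1) by (auto simp: M0_def)
   thus ?thesis using N(3)[OF _ y'(1)] eq[OF tC] eq[OF t0] by simp
  qed
  have "\<psi> t y = \<psi> t0 y" if t: "t : M0" and y: "y : carrier G" for t y
  proof -
   have tC: "t : C0" using t by (auto simp: M0_def)
   have yL: "y : L 0" using y by simp
   note ct = chr[OF tC] and c0 = chr[OF t0]
   have pw: "\<psi> s (y [^] n) = \<psi> s y ^ n" if "s : C0" for s and n :: nat
    using chr_mult[OF chr[OF that]] chr_one[OF chr[OF that]] y by (induction n) (auto simp: mult.commute)
   \<comment> \<open>Closeness within 1 holds at every power of \<open>y\<close>, so all powers of
     this quotient lie within 1 of 1 and \<open>no_small_subgroup\<close> applies.\<close>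
   define z where "z = \<psi> t y * cnj (\<psi> t0 y)"
   have n0: "\<psi> t0 y * cnj (\<psi> t0 y) = 1" using chr_norm[OF c0 yL] by (simp add: complex_norm_square[symmetric])
   have "z = 1"
   proof (rule no_small_subgroup)
    show "cmod z = 1" using chr_norm[OF ct yL] chr_norm[OF c0 yL] by (simp add: z_def norm_mult)
    fix n :: nat
    have nn: "\<psi> t0 y ^ n * cnj (\<psi> t0 y) ^ n = 1" using n0 by (simp add: power_mult_distrib[symmetric])
    have "z ^ n - 1 = (\<psi> t y ^ n - \<psi> t0 y ^ n) * cnj (\<psi> t0 y) ^ n"
     using nn by (simp add: z_def power_mult_distrib left_diff_distrib)
    hence "cmod (z ^ n - 1) = cmod (\<psi> t y ^ n - \<psi> t0 y ^ n)"
     using chr_norm[OF c0 yL] by (simp add: norm_mult norm_power)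
    also have "\<dots> < 1" using near[OF t, of "y [^] n"] y pw[OF tC] pw[OF t0] by simp
    finally show "cmod (z ^ n - 1) < 1" .
   qed
   hence "\<psi> t y * (\<psi> t0 y * cnj (\<psi> t0 y)) = \<psi> t0 y" by (simp add: z_def mult_ac)
   thus ?thesis using n0 by simp
  qed
  moreover have "t0 : M0" using t0 M(2) by (auto simp: M0_def)
  ultimately show ?thesis using M0 by blast
 qed
 \<comment> \<open>\<open>local_const\<close> makes both \<open>A\<close> and its complement open in
   the connected set \<open>C0\<close>, and \<open>A\<close> contains the identity by
   \<open>one\<close>.\<close>
 define A where "A = {t : C0. \<forall>y\<in>carrier G. \<psi> t y = 1}"
 have "openin (subtopology T C0) A"
 proof (subst openin_subopen, intro ballI)
  fix t assume t: "t : A"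
  obtain M where M: "openin (subtopology T C0) M" "t : M" "\<forall>s\<in>M. \<forall>y\<in>carrier G. \<psi> s y = \<psi> t y"
   using local_const[of t] t by (auto simp: A_def)
  have "M \<subseteq> C0" using openin_subset[OF M(1)] tsC by simp
  thus "\<exists>M. openin (subtopology T C0) M \<and> t : M \<and> M \<subseteq> A"
  proof (intro exI[of _ M] conjI M(1,2) subsetI)
   fix s assume s: "s : M"
   show "s : A" using t M(3)[rule_format, OF s] \<open>M \<subseteq> C0\<close> s unfolding A_def by force
  qed
 qed
 moreover have "openin (subtopology T C0) (C0 - A)"
 proof (subst openin_subopen, intro ballI)
  fix t assume t: "t : C0 - A"
  obtain M where M: "openin (subtopology T C0) M" "t : M" "\<forall>s\<in>M. \<forall>y\<in>carrier G. \<psi> s y = \<psi> t y"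
   using local_const[of t] t by auto
  have "M \<subseteq> C0" using openin_subset[OF M(1)] tsC by simp
  thus "\<exists>M. openin (subtopology T C0) M \<and> t : M \<and> M \<subseteq> C0 - A"
  proof (intro exI[of _ M] conjI M(1,2) subsetI)
   fix s assume s: "s : M"
   show "s : C0 - A" using t M(3)[rule_format, OF s] \<open>M \<subseteq> C0\<close> s unfolding A_def by force
  qed
 qed
 moreover have "connected_space (subtopology T C0)" using C0(1) by (simp add: connectedin_def)
 moreover have "C0 \<subseteq> A \<union> (C0 - A)" "A \<inter> (C0 - A) = {}" by blast+
 ultimately have "A = {} \<or> C0 - A = {}" unfolding connected_space_def tsC by metis
 hence "t : A" using C0(2) one t by (auto simp: A_def)
 thus ?thesis using y by (simp add: A_def)
qed

lemma chr_family_trivial: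
 assumes "!!t. t : C0 ==> chr i (\<psi> t)"
  and "!!t y. t : C0 ==> y : L (Suc i) ==> \<psi> t y = 1"
  and "!!t y. t : C0 ==> y : L i ==> act y x0 = x0 ==> \<psi> t y = 1"
  and "continuous_map (prod_topology (subtopology T C0) (subtopology T (L i))) euclidean (%(t, y). \<psi> t y)"
  and "!!y. y : L i ==> \<psi> \<one> y = 1"
  and "t : C0" and "y : L i"
 shows "\<psi> t y = 1" using assms
proof (induction i arbitrary: \<psi> t y)
 case 0
 have "subtopology T (carrier G) = T" using T subtopology_topspace by metis
 hence cont: "continuous_map (prod_topology (subtopology T C0) T) euclidean (%(t, y). \<psi> t y)" using "0.prems"(4) by simp
 show ?case
 proof (rule chr_family_base[of \<psi>, OF _ _ cont])
  show "chr 0 (\<psi> t)" if "t : C0" for t using "0.prems"(1) that .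
  show "\<psi> t y = 1" if "t : C0" "y : carrier G" "act y x0 = x0" for t y using "0.prems"(3)[of t y] that by simp
  show "\<psi> \<one> y = 1" if "y : carrier G" for y using "0.prems"(5)[of y] that by simp
  show "t : C0" by (rule "0.prems")
  show "y : carrier G" using "0.prems"(7) by simp
 qed
next
 case (Suc i)
 note chr = Suc.prems(1) and kill = Suc.prems(2) and stab = Suc.prems(3) and cont = Suc.prems(4) and one = Suc.prems(5)
 have C0T: "C0 \<subseteq> topspace T" using C0(1) connectedin_subset_topspace by blast
 have c1: "\<psi> s (comm x \<gamma>) = 1" if s: "s : C0" and \<gamma>: "\<gamma> : carrier G" "act \<gamma> x0 = x0" and x: "x : L i" for s \<gamma> x
 proof (rule Suc.IH[of "%t x. \<psi> t (comm x \<gamma>)"])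
  show "chr i (%x. \<psi> t (comm x \<gamma>))" if t: "t : C0" for t
   unfolding chr_def using chr_comm_left[OF chr[OF t] kill[OF t] _ _ \<gamma>(1)] chr_norm[OF chr[OF t] comm_L[OF _ \<gamma>(1)]] by blast
  show "\<psi> t (comm y \<gamma>) = 1" if "t : C0" "y : L (Suc i)" for t y
   using kill[OF that(1) comm_L[OF that(2) \<gamma>(1)]] .
  show "\<psi> t (comm y \<gamma>) = 1" if "t : C0" "y : L i" "act y x0 = x0" for t y
   using stab[OF that(1) comm_L[OF that(2) \<gamma>(1)]] stab_comm[of y \<gamma>] that \<gamma> by simp
  show "continuous_map (prod_topology (subtopology T C0) (subtopology T (L i))) euclidean (%(t, y). \<psi> t (comm y \<gamma>))"
  proof -
   have "continuous_map (prod_topology (subtopology T C0) (subtopology T (L i))) T (%p. comm (snd p) \<gamma>)"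
    using \<gamma> T by (intro comm_continuous) (auto intro: continuous_map_into_fulltopology[OF continuous_map_snd])
   hence "continuous_map (prod_topology (subtopology T C0) (subtopology T (L i))) (subtopology T (L (Suc i))) (%p. comm (snd p) \<gamma>)"
    using comm_L \<gamma>(1) by (intro continuous_map_into_subtopology) auto
   from continuous_map_compose[OF continuous_map_pairedI[OF continuous_map_fst this] cont]
   show ?thesis by (simp add: comp_def case_prod_unfold)
  qed
  show "\<psi> \<one> (comm y \<gamma>) = 1" if "y : L i" for y using one[OF comm_L[OF that \<gamma>(1)]] .
 qed (use s x in auto)
 have c2: "\<psi> s (comm x y) = 1" if s: "s : C0" and x: "x : L i" and y: "y : carrier G" for s x y
 proof (rule chr_family_base[of "%t y. \<psi> t (comm x y)"])
  show "chr 0 (%y. \<psi> t (comm x y))" if t: "t : C0" for t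
   unfolding chr_def using chr_comm_right[OF chr[OF t] kill[OF t] x] chr_norm[OF chr[OF t] comm_L[OF x]] by simp
  show "\<psi> t (comm x y) = 1" if "t : C0" "y : carrier G" "act y x0 = x0" for t y using c1 that x by blast
  show "continuous_map (prod_topology (subtopology T C0) T) euclidean (%(t, y). \<psi> t (comm x y))"
  proof -
   have "continuous_map (prod_topology (subtopology T C0) T) T (%p. comm x (snd p))"
    using x T by (intro comm_continuous continuous_map_snd) auto
   hence "continuous_map (prod_topology (subtopology T C0) T) (subtopology T (L (Suc i))) (%p. comm x (snd p))"
    using comm_L x T by (intro continuous_map_into_subtopology) auto
   from continuous_map_compose[OF continuous_map_pairedI[OF continuous_map_fst this] cont]
   show ?thesis by (simp add: comp_def case_prod_unfold)
  qed
  show "\<psi> \<one> (comm x y) = 1" if "y : carrier G" for y using one[OF comm_L[OF x that]] .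
 qed (use s y in auto)
 show ?case using chr_generate[OF chr[OF Suc.prems(6)] c2[OF Suc.prems(6)] Suc.prems(7)] by simp
qed

end

context nil_action
begin

section \<open>Joint eigenspaces of \<open>L i\<close>\<close>

definition charsp :: "nat => ('g => complex) => ('x => complex) set" where
 "charsp i \<xi> = {f : E (Suc i). \<forall>u\<in>L i. nrm (V u f - (%x. \<xi> u * f x)) = 0}"

lemma charsp_E: "f : charsp i \<xi> ==> f : E (Suc i)"
 and charsp_L2: "f : charsp i \<xi> ==> f : L2 \<mu>"
 and charsp_eq: "f : charsp i \<xi> ==> u : L i ==> nrm (V u f - (%x. \<xi> u * f x)) = 0" using E_mem by (auto simp: charsp_def)

lemma csub_charsp: "csub (charsp i \<xi>)"
proof -
 have "charsp i \<xi> = E (Suc i) \<inter> {f : L2 \<mu>. \<forall>u\<in>L i. f : eigenspace u (\<xi> u)}"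
  using E_mem by (auto simp: charsp_def eigenspace_def)
 moreover have "csub {f : L2 \<mu>. \<forall>u\<in>L i. f : eigenspace u (\<xi> u)}"
  by (rule csub_INT) (simp add: csub_eigenspace)
 ultimately show ?thesis using csub_Int csub_E by simp
qed

lemma scalar_unique:
 assumes f: "f : L2 \<mu>" "nrm f ~= 0" and h: "h : L2 \<mu>"
  and c: "nrm (h - (%x. c * f x)) = 0" and d: "nrm (h - (%x. d * f x)) = 0"
 shows "c = d"
proof -
 have cf: "(%x. c * f x) : L2 \<mu>" and df: "(%x. d * f x) : L2 \<mu>" using sc_mem[OF f(1)] by auto
 have "l2_inner \<mu> h f = c * l2_inner \<mu> f f" "l2_inner \<mu> h f = d * l2_inner \<mu> f f"
  using ip_cong[OF h cf f(1) c] ip_cong[OF h df f(1) d] ip_sc_left[OF f(1) f(1)] by simp_all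
 hence "c * l2_inner \<mu> f f = d * l2_inner \<mu> f f" by (simp only:)
 moreover have "l2_inner \<mu> f f ~= 0" using ip_self_eq_0[OF f(1)] f(2) by blast
 ultimately show ?thesis by simp
qed

lemma charsp_ip:
 assumes f: "f : charsp i \<xi>" and u: "u : L i"
 shows "l2_inner \<mu> (V u f) f = \<xi> u * l2_inner \<mu> f f"
proof -
 have fL: "f : L2 \<mu>" using charsp_L2[OF f] .
 have Vf: "V u f : L2 \<mu>" using u fL by simp
 show ?thesis using ip_cong[OF Vf sc_mem[OF fL] fL charsp_eq[OF f u]] ip_sc_left[OF fL fL] by simp
qed

lemma charsp_chr:
 assumes f: "f : charsp i \<xi>" and n: "nrm f ~= 0"
 shows "chr i \<xi>" unfolding chr_def
proof (intro conjI ballI)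
 have fL: "f : L2 \<mu>" using charsp_L2[OF f] .
 fix x assume x: "x : L i"
 have "nrm f = cmod (\<xi> x) * nrm f"
  using nrm_cong[OF V_mem[OF L_mem[OF x] fL] sc_mem[OF fL] charsp_eq[OF f x]] V_nrm[OF L_mem[OF x] fL] nrm_sc[OF fL] by simp
 thus "cmod (\<xi> x) = 1" using n by simp
 fix y assume y: "y : L i"
 have 1: "nrm (V y (V x f) - V (x \<otimes> y) f) = 0" using V_comp x y by simp
 have 2: "nrm (V y (V x f) - V y (%t. \<xi> x * f t)) = 0" using x y fL sc_mem[OF fL] charsp_eq[OF f x] by (intro V_cong) auto
 have 3: "nrm ((%t. \<xi> x * V y f t) - (%t. \<xi> x * (\<xi> y * f t))) = 0"
  using y fL charsp_eq[OF f y] sc_mem[OF fL] by (intro nrm_diff_eq0_sc) auto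
 have mem: "V y (V x f) : L2 \<mu>" "V (x \<otimes> y) f : L2 \<mu>" "(%t. \<xi> x * V y f t) : L2 \<mu>" "(%t. \<xi> x * (\<xi> y * f t)) : L2 \<mu>"
  using x y fL sc_mem by auto
 have 4: "nrm (V y (V x f) - (%t. \<xi> x * (\<xi> y * f t))) = 0" by (rule nrm_diff_eq0_trans[OF mem(1,3,4) 2[unfolded V_sc] 3])
 have 5: "nrm (V (x \<otimes> y) f - V y (V x f)) = 0" using 1 nrm_diff_commute[OF mem(1,2)] by simp
 have "nrm (V (x \<otimes> y) f - (%t. \<xi> x * (\<xi> y * f t))) = 0" by (rule nrm_diff_eq0_trans[OF mem(2,1,4) 5 4])
 hence "nrm (V (x \<otimes> y) f - (%t. (\<xi> x * \<xi> y) * f t)) = 0" by (simp only: mult.assoc)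
 moreover have "nrm (V (x \<otimes> y) f - (%t. \<xi> (x \<otimes> y) * f t)) = 0" using charsp_eq[OF f L_mult[OF x y]] .
 ultimately show "\<xi> (x \<otimes> y) = \<xi> x * \<xi> y" using scalar_unique[OF fL n mem(2)] by blast
qed

lemma charsp_kill:
 assumes f: "f : charsp i \<xi>" and n: "nrm f ~= 0" and u: "u : L (Suc i)"
 shows "\<xi> u = 1"
proof -
 have uL: "u : L i" using u L_Suc_sub by blast
 have fL: "f : L2 \<mu>" using charsp_L2[OF f] .
 have "nrm (V u f - f) = 0" using charsp_E[OF f] u by (simp add: E_def)
 hence "nrm (V u f - (%x. 1 * f x)) = 0" by simp
 thus ?thesis using scalar_unique[OF fL n _ charsp_eq[OF f uL]] u fL by simp
qed

text \<open>If \<open>u\<close> fixes \<open>x0\<close>, then \<open>CX_E_swap\<close> gives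
  \<open>c (act u (act h x0)) = c (act h x0)\<close> for continuous \<open>c\<close> in
  \<open>E (Suc i)\<close>; density of these \<open>c\<close> carries invariance under
  \<open>u\<close> over to all of \<open>E (Suc i)\<close>.\<close>

lemma charsp_stab:
 assumes i: "i < k" and f: "f : charsp i \<xi>" and n: "nrm f ~= 0" and u: "u : L i" "act u x0 = x0"
 shows "\<xi> u = 1"
proof -
 have fL: "f : L2 \<mu>" using charsp_L2[OF f] .
 have uG: "u : carrier G" using u by simp
 have "nrm (V u f - f) <= e" if e: "e > 0" for e
 proof -
  have e2: "e / 2 > 0" using e by simp
  obtain c where c: "c : CX" "c : E (Suc i)" "nrm (f - c) < e / 2"
   using CX_E_dense[of "Suc i" f, OF _ charsp_E[OF f] e2] i by auto
  have cL: "c : L2 \<mu>" using CX_L2[OF c(1)] .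
  have z: "nrm (V u c - c) = 0"
  proof (rule eq_on_space_nrm)
   fix x assume "x : topspace X"
   then obtain h where "h : carrier G" "x = act h x0" using trans by blast
   thus "V u c x = c x" using CX_E_swap[OF c(1,2) u(1)] u(2) by (simp add: V_def)
  qed
  have "nrm (V u f - f) <= nrm (V u f - V u c) + nrm (V u c - f)" using uG fL cL by (intro nrm_triangle3) auto
  moreover have "nrm (V u c - f) <= nrm (V u c - c) + nrm (c - f)" using uG fL cL by (intro nrm_triangle3) auto
  moreover have "nrm (V u f - V u c) = nrm (f - c)" using uG fL cL by (simp add: V_diff[symmetric] V_nrm)
  moreover have "nrm (c - f) = nrm (f - c)" by (rule nrm_diff_commute[OF cL fL])
  ultimately show ?thesis using c(3) z by linarith
 qed
 hence "nrm (V u f - f) <= 0" by (rule field_le_epsilon[of _ 0, simplified])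
 hence "nrm (V u f - (%x. 1 * f x)) = 0" using nrm_nonneg[of "V u f - f"] uG fL by (simp add: antisym)
 thus ?thesis using scalar_unique[OF fL n _ charsp_eq[OF f u(1)]] uG fL by simp
qed

lemma ip_V_continuous:
 assumes f: "f : L2 \<mu>" and h: "h : L2 \<mu>"
 shows "continuous_map T euclidean (%g. l2_inner \<mu> (V g f) h)" unfolding continuous_map_atin limitin_canonical_iff
proof
 fix g assume "g : topspace T"
 hence g: "g : carrier G" using T by simp
 have "\<forall>\<^sub>F u in atin T g. dist (l2_inner \<mu> (V u f) h) (l2_inner \<mu> (V g f) h) < e" if e: "e > 0" for e
 proof -
  have d0: "e / (nrm h + 1) > 0" using e nrm_nonneg[OF h] by (simp add: add_nonneg_pos)
  obtain N where N: "openin T N" "g : N" "!!u. u : N ==> nrm (V u f - V g f) < e / (nrm h + 1)"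
   using strong_continuity[OF f g d0] by blast
  show ?thesis
  proof (subst eventually_atin, intro disjI2 exI[of _ N] conjI N(1,2) ballI)
   fix u assume "u : N - {g}"
   hence u: "u : N" by simp
   have uG: "u : carrier G" using u N(1) openin_subset T by blast
   have "l2_inner \<mu> (V u f) h - l2_inner \<mu> (V g f) h = l2_inner \<mu> (V u f - V g f) h"
    using uG g f h by (simp add: ip_diff_left)
   also have "cmod \<dots> <= nrm (V u f - V g f) * nrm h" using uG g f h by (intro cauchy_schwarz) auto
   also have "\<dots> <= nrm (V u f - V g f) * (nrm h + 1)" using uG g f by (intro mult_left_mono nrm_nonneg) auto
   also have "\<dots> < e" using N(3)[OF u] nrm_nonneg[OF h] by (simp add: pos_less_divide_eq add_nonneg_pos)
   finally show "dist (l2_inner \<mu> (V u f) h) (l2_inner \<mu> (V g f) h) < e" by (simp add: dist_norm)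
  qed
 qed
 thus "((%g. l2_inner \<mu> (V g f) h) \<longlongrightarrow> l2_inner \<mu> (V g f) h) (atin T g)" by (rule tendstoI)
qed

text \<open>\<open>\<xi> u\<close> is the matrix coefficient \<open>l2_inner \<mu> (V u f) f\<close>
  divided by \<open>l2_inner \<mu> f f\<close>.\<close>

lemma charsp_continuous:
 assumes f: "f : charsp i \<xi>" and n: "nrm f ~= 0"
 shows "continuous_map (subtopology T (L i)) euclidean \<xi>"
proof -
 have fL: "f : L2 \<mu>" using charsp_L2[OF f] .
 have nz: "l2_inner \<mu> f f ~= 0" using ip_self_eq_0[OF fL] n by auto
 have "continuous_map (subtopology T (L i)) euclidean (%g. l2_inner \<mu> (V g f) f * (1 / l2_inner \<mu> f f))"
 proof -
  have "continuous_map euclidean euclidean (%z. z * (1 / l2_inner \<mu> f f))"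
   unfolding continuous_map_iff_continuous2 by (intro continuous_intros)
  from continuous_map_compose[OF continuous_map_from_subtopology[OF ip_V_continuous[OF fL fL]] this]
  show ?thesis by (simp add: comp_def)
 qed
 thus ?thesis by (rule continuous_map_eq) (use charsp_ip[OF f] nz in auto)
qed

lemma charsp_V:
 assumes f: "f : charsp i \<xi>" and g: "g : carrier G" shows "V g f : charsp i \<xi>" unfolding charsp_def
proof (intro CollectI conjI ballI)
 show "V g f : E (Suc i)" using V_E[OF charsp_E[OF f] g] .
 fix u assume u: "u : L i"
 have fL: "f : L2 \<mu>" using charsp_L2[OF f] .
 have uG: "u : carrier G" using u by simp
 have mem: "V u (V g f) : L2 \<mu>" "V g (V u f) : L2 \<mu>" "(%x. \<xi> u * V g f x) : L2 \<mu>" using uG g fL sc_mem by auto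
 have 1: "nrm (V u (V g f) - V g (V u f)) = 0" using V_swap[OF charsp_E[OF f] u g] nrm_diff_commute[OF mem(1,2)] by simp
 have 2: "nrm (V g (V u f) - (%x. \<xi> u * V g f x)) = 0"
  using V_cong[OF g V_mem[OF uG fL] sc_mem[OF fL] charsp_eq[OF f u]] by (simp only: V_sc)
 show "nrm (V u (V g f) - (%x. \<xi> u * V g f x)) = 0" by (rule nrm_diff_eq0_trans[OF mem 1 2])
qed

text \<open>A character of \<open>G\<close> that kills the stabiliser of \<open>x0\<close> descends to \<open>X\<close>, where it is a
 continuous eigenfunction of \<open>a\<close>.\<close>

lemma invariant_character_trivial:
 assumes c: "chr 0 \<beta>" and stab: "!!y. y : carrier G ==> act y x0 = x0 ==> \<beta> y = 1"
  and cont: "continuous_map T euclidean \<beta>" and ba: "\<beta> a = 1" and y: "y : carrier G"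
 shows "\<beta> y = 1"
proof -
 define b where "b x = \<beta> (SOME y. y : carrier G \<and> x = act y x0)" for x
 have b: "b (act y x0) = \<beta> y" if y: "y : carrier G" for y
 proof -
  define z where "z = (SOME z. z : carrier G \<and> act y x0 = act z x0)"
  have z: "z : carrier G" "act y x0 = act z x0"
   using someI[of "%z. z : carrier G \<and> act y x0 = act z x0" y] y unfolding z_def by auto
  have st: "act (inv z \<otimes> y) x0 = x0" using y z x0 by (simp add: act_mult)
  have "\<beta> (z \<otimes> (inv z \<otimes> y)) = \<beta> z * \<beta> (inv z \<otimes> y)" by (rule chr_mult[OF c]) (use y z in auto)
  moreover have "z \<otimes> (inv z \<otimes> y) = y" using y z by (simp add: m_assoc[symmetric])
  ultimately have "\<beta> y = \<beta> z" using stab[OF _ st] y z(1) by simp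
  thus ?thesis by (simp add: b_def z_def)
 qed
 have bC: "continuous_map X euclidean b" unfolding continuous_map_def
 proof (intro conjI allI impI)
  fix W :: "complex set" assume "openin euclidean W"
  hence "openin T {y : topspace T. \<beta> y : W}" by (intro openin_continuous_map_preimage[OF cont])
  moreover have "{x : topspace X. b x : W} = (%g. act g x0) ` {y : topspace T. \<beta> y : W}"
  proof (intro equalityI subsetI)
   fix x assume x: "x : {x : topspace X. b x : W}"
   then obtain y where "y : carrier G" "x = act y x0" using trans by blast
   thus "x : (%g. act g x0) ` {y : topspace T. \<beta> y : W}" using b T x by auto
  next
   fix x assume "x : (%g. act g x0) ` {y : topspace T. \<beta> y : W}"
   thus "x : {x : topspace X. b x : W}" using b x0 T by auto
  qed
  ultimately show "openin X {x : topspace X. b x : W}" using orbit_open by simp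
 qed simp
 have inv: "b (act a x) = b x" if x: "x : topspace X" for x
 proof -
  obtain y where y: "y : carrier G" "x = act y x0" using trans[OF x] by blast
  have "b (act (a \<otimes> y) x0) = \<beta> (a \<otimes> y)" using y by (intro b) simp
  also have "\<dots> = \<beta> y" using chr_mult[OF c, of a y] ba y by simp
  finally show ?thesis using y b x0 by (simp add: act_mult)
 qed
 have "b : L2 \<mu>" using bC by (intro CX_L2) (simp add: CX_def)
 moreover have "AE x in \<mu>. b (act a x) = b x" by (rule AE_I2) (simp add: space_\<mu> inv)
 ultimately obtain d where d: "AE x in \<mu>. b x = d" using ergodic by blast
 have const: "b x = d" if "x : topspace X" for x using AE_open_eq[OF bC _ d that] by simp
 have "b (act \<one> x0) = 1" using b[of \<one>] chr_one[OF c] by simp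
 hence "d = 1" using const[of "act \<one> x0"] x0 by simp
 thus ?thesis using const[of "act y x0"] b[OF y] x0 y by simp
qed

text \<open>Triviality on commutators with \<open>a\<close> is spread to commutators with
  everything. For \<open>\<gamma>\<close> in \<open>L i\<close> fixing \<open>x0\<close>, the map
  \<open>y\<close> to \<open>\<xi> (comm \<gamma> y)\<close> is a character of \<open>G\<close> that
  kills the stabiliser and \<open>a\<close>, so ergodicity makes it trivial. This supplies the
  stabiliser hypothesis for the family \<open>\<xi> (comm x t)\<close> with \<open>t\<close> in the
  connected set \<open>C0\<close>, and every group element is some
  \<open>c \<otimes> a [^] n\<close>.\<close>

lemma chr_comm_trivial:
 assumes i: "Suc i < k" and f: "f : charsp (Suc i) \<xi>" and n: "nrm f ~= 0"
  and ta: "!!g. g : L i ==> \<xi> (comm g a) = 1" and u: "u : L (Suc i)"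
 shows "\<xi> u = 1"
proof -
 note c = charsp_chr[OF f n] and kill = charsp_kill[OF f n] and stab = charsp_stab[OF i f n] and cont = charsp_continuous[OF f n]
 have hom: "chr 0 (%y. \<xi> (comm x y))" if x: "x : L i" for x
  unfolding chr_def using chr_comm_right[OF c kill x] chr_norm[OF c comm_L[OF x]] by simp
 have contr: "continuous_map T euclidean (%y. \<xi> (comm x y))" if x: "x : L i" for x
 proof -
  have "continuous_map T T (comm x)" using comm_continuous[of T "%_. x" "%y. y"] x T by simp
  hence "continuous_map T (subtopology T (L (Suc i))) (comm x)"
   using comm_L[OF x] T by (intro continuous_map_into_subtopology) auto
  from continuous_map_compose[OF this cont] show ?thesis by (simp add: comp_def)
 qed
 have step1: "\<xi> (comm \<gamma> y) = 1" if \<gamma>: "\<gamma> : L i" "act \<gamma> x0 = x0" and y: "y : carrier G" for \<gamma> y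
  by (rule invariant_character_trivial[OF hom[OF \<gamma>(1)] _ contr[OF \<gamma>(1)] ta[OF \<gamma>(1)] y])
   (use stab[OF comm_L[OF \<gamma>(1)]] stab_comm[of \<gamma>] \<gamma> in auto)
 have C0G: "t : carrier G" if "t : C0" for t using C0(1) T connectedin_subset_topspace that by blast
 have step2: "\<xi> (comm x t) = 1" if t: "t : C0" and x: "x : L i" for t x
 proof (rule chr_family_trivial[of i "%t x. \<xi> (comm x t)"])
  show "chr i (%x. \<xi> (comm x t))" if "t : C0" for t
   unfolding chr_def using chr_comm_left[OF c kill _ _ C0G[OF that]] chr_norm[OF c comm_L[OF _ C0G[OF that]]] by blast
  show "\<xi> (comm y t) = 1" if "t : C0" "y : L (Suc i)" for t y using kill[OF comm_L[OF that(2) C0G[OF that(1)]]] .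
  show "\<xi> (comm y t) = 1" if "t : C0" "y : L i" "act y x0 = x0" for t y using step1 that C0G by blast
  show "continuous_map (prod_topology (subtopology T C0) (subtopology T (L i))) euclidean (%(t, y). \<xi> (comm y t))"
  proof -
   have "continuous_map (prod_topology (subtopology T C0) (subtopology T (L i))) T (%p. comm (snd p) (fst p))"
    by (intro comm_continuous continuous_map_into_fulltopology[OF continuous_map_snd] continuous_map_into_fulltopology[OF continuous_map_fst])
   hence "continuous_map (prod_topology (subtopology T C0) (subtopology T (L i))) (subtopology T (L (Suc i))) (%p. comm (snd p) (fst p))"
    using comm_L C0G by (intro continuous_map_into_subtopology) auto
   from continuous_map_compose[OF this cont]
   show ?thesis by (simp add: comp_def case_prod_unfold)
  qed
  show "\<xi> (comm y \<one>) = 1" if "y : L i" for y using chr_one[OF hom[OF that]] .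
 qed (use t x in auto)
 have step3: "\<xi> (comm x g) = 1" if x: "x : L i" and g: "g : carrier G" for x g
 proof -
  note h = hom[OF x]
  have np: "\<xi> (comm x (a [^] (m::nat))) = 1" for m
  proof (induction m)
   case 0 thus ?case using chr_one[OF h] by simp
  next
   case (Suc m) thus ?case using chr_mult[OF h, of "a [^] m" a] ta[OF x] by simp
  qed
  have ip: "\<xi> (comm x (a [^] (m::int))) = 1" for m
  proof (cases m rule: int_cases2)
   case (nonneg j) thus ?thesis using np[of j] by (simp add: int_pow_int)
  next
   case (nonpos j)
   hence "a [^] m = inv (a [^] j)" by (simp add: int_pow_neg int_pow_int)
   thus ?thesis using np[of j] chr_inv[OF h, of "a [^] j"] by simp
  qed
  obtain c n where cn: "c : C0" "g = c \<otimes> a [^] (n::int)" using gen[OF g] by blast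
  thus ?thesis using chr_mult[OF h, of c "a [^] n"] C0G[OF cn(1)] step2[OF cn(1) x] ip[of n] by simp
 qed
 show ?thesis by (rule chr_generate[OF c step3 u])
qed

text \<open>Each element of the generated group lies in a connected subset containing the identity;
  for a product, \<open>C1\<close> is joined with the translate of \<open>C2\<close> by
  \<open>h1\<close>, which meets it in \<open>h1\<close>.\<close>

lemma connectedin_generate:
 assumes \<C>: "!!C. C : \<C> ==> connectedin T C" "!!C. C : \<C> ==> \<one> : C"
 shows "connectedin T (generate G (\<Union>\<C>))"
proof -
 have CG: "\<Union>\<C> \<subseteq> carrier G" using \<C>(1) connectedin_subset_topspace T by blast
 have gG: "h : carrier G" if "h : generate G (\<Union>\<C>)" for h using generate_in_carrier[OF CG that] .
 have ex: "\<exists>C. connectedin T C \<and> \<one> : C \<and> h : C \<and> C \<subseteq> generate G (\<Union>\<C>)" if "h : generate G (\<Union>\<C>)" for h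
  using that
 proof (induction rule: generate.induct)
  case one
  thus ?case using T generate.one by (intro exI[of _ "{\<one>}"]) auto
 next
  case (incl h)
  then obtain C where "C : \<C>" "h : C" by blast
  thus ?case using \<C> generate.incl[of _ "\<Union>\<C>" G] by (intro exI[of _ C]) auto
 next
  case (inv h)
  then obtain C where C: "C : \<C>" "h : C" by blast
  have "connectedin T (m_inv G ` C)" using connectedin_continuous_map_image[OF inv_cont \<C>(1)[OF C(1)]] .
  moreover have "\<one> : m_inv G ` C" using \<C>(2)[OF C(1)] inv_one by (metis imageI)
  moreover have "m_inv G ` C \<subseteq> generate G (\<Union>\<C>)" using C generate.inv[of _ "\<Union>\<C>" G] by auto
  ultimately show ?case using C(2) by (intro exI[of _ "m_inv G ` C"]) auto
 next
  case (eng h1 h2)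
  obtain C1 where C1: "connectedin T C1" "\<one> : C1" "h1 : C1" "C1 \<subseteq> generate G (\<Union>\<C>)" using eng by blast
  obtain C2 where C2: "connectedin T C2" "\<one> : C2" "h2 : C2" "C2 \<subseteq> generate G (\<Union>\<C>)" using eng by blast
  have h1: "h1 : carrier G" using gG eng by blast
  have "continuous_map T T (%y. h1 \<otimes> y)" using mult_continuous[of T "%_. h1" "%y. y"] h1 T by simp
  hence "connectedin T ((%y. h1 \<otimes> y) ` C2)" using C2(1) by (rule connectedin_continuous_map_image)
  moreover have "h1 : (%y. h1 \<otimes> y) ` C2" using C2(2) h1 by (intro image_eqI[of _ _ \<one>]) auto
  ultimately have "connectedin T (C1 \<union> (%y. h1 \<otimes> y) ` C2)" using C1(3) by (intro connectedin_Un[OF C1(1)]) blast+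
  moreover have "(%y. h1 \<otimes> y) ` C2 \<subseteq> generate G (\<Union>\<C>)"
  proof (rule image_subsetI)
   fix y assume "y : C2"
   thus "h1 \<otimes> y : generate G (\<Union>\<C>)" using C2(4) by (intro generate.eng[OF eng.hyps(1)]) (rule subsetD)
  qed
  moreover have "C1 \<union> (%y. h1 \<otimes> y) ` C2 \<subseteq> generate G (\<Union>\<C>)" using C1(4) calculation(2) by (rule Un_least)
  ultimately show ?case using C1(2) C2(3) by (intro exI[of _ "C1 \<union> (%y. h1 \<otimes> y) ` C2"] conjI UnI1[of \<one>] UnI2[of "h1 \<otimes> h2"] imageI)
 qed
 define \<D> where "\<D> = {C. connectedin T C \<and> \<one> : C \<and> C \<subseteq> generate G (\<Union>\<C>)}"
 have "generate G (\<Union>\<C>) = \<Union>\<D>"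
 proof (intro equalityI subsetI)
  fix h assume "h : generate G (\<Union>\<C>)"
  then obtain C where "C : \<D>" "h : C" unfolding \<D>_def using ex by (metis (no_types, lifting) mem_Collect_eq)
  thus "h : \<Union>\<D>" by (rule UnionI)
 next
  fix h assume "h : \<Union>\<D>"
  then obtain C where "C : \<D>" "h : C" by (rule UnionE)
  thus "h : generate G (\<Union>\<C>)" unfolding \<D>_def mem_Collect_eq by (metis subsetD)
 qed
 moreover have "connectedin T (\<Union>\<D>)"
 proof (rule connectedin_Union)
  show "\<Inter>\<D> ~= {}" unfolding \<D>_def by blast
 qed (simp add: \<D>_def)
 ultimately show ?thesis by simp
qed

text \<open>\<open>G\<close> itself may be disconnected. But the commutator of
  \<open>c \<otimes> a [^] n\<close> and \<open>d \<otimes> a [^] m\<close> depends continuously on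
  \<open>(c, d)\<close> in the connected set \<open>C0 \<times> C0\<close> and is the identity at
  \<open>(\<one>, \<one>)\<close>, because powers of \<open>a\<close> commute.\<close>

lemma L_connected: "connectedin T (L (Suc j))"
proof (induction j)
 case 0
 have C0G: "C0 \<subseteq> carrier G" using C0(1) T connectedin_subset_topspace by blast
 define B where "B n m = (%p. comm (fst p \<otimes> a [^] n) (snd p \<otimes> a [^] m)) ` (C0 \<times> C0)" for n m :: int
 have cB: "connectedin T (B n m)" for n m unfolding B_def
 proof (rule connectedin_continuous_map_image)
  show "continuous_map (prod_topology T T) T (%p. comm (fst p \<otimes> a [^] n) (snd p \<otimes> a [^] m))"
   by (intro comm_continuous mult_continuous continuous_map_fst continuous_map_snd) (auto simp: T)
  show "connectedin (prod_topology T T) (C0 \<times> C0)" using C0(1) by (simp add: connectedin_Times)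
 qed
 have oneB: "\<one> : B n m" for n m
 proof -
  have "a [^] n \<otimes> a [^] m = a [^] m \<otimes> a [^] n" using int_pow_mult[of a n m] int_pow_mult[of a m n] by (simp add: add.commute)
  hence "comm (a [^] n) (a [^] m) = \<one>" by (simp add: comm_def m_assoc inv_mult_group[symmetric])
  thus ?thesis unfolding B_def using C0(2) by (intro image_eqI[of _ _ "(\<one>, \<one>)"]) auto
 qed
 have "(\<Union>x\<in>L 0. \<Union>y\<in>carrier G. {comm x y}) = \<Union>(\<Union>n. range (B n))"
 proof (intro equalityI subsetI)
  fix z assume "z : (\<Union>x\<in>L 0. \<Union>y\<in>carrier G. {comm x y})"
  then obtain x y where xy: "x : carrier G" "y : carrier G" "z = comm x y" by auto
  obtain c n d m where "c : C0" "x = c \<otimes> a [^] (n::int)" "d : C0" "y = d \<otimes> a [^] (m::int)"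
   using gen[OF xy(1)] gen[OF xy(2)] by metis
  hence "z : B n m" unfolding B_def xy(3) by force
  thus "z : \<Union>(\<Union>n. range (B n))" by blast
 next
  fix z assume "z : \<Union>(\<Union>n. range (B n))"
  then obtain n m where "z : B n m" by blast
  thus "z : (\<Union>x\<in>L 0. \<Union>y\<in>carrier G. {comm x y})" unfolding B_def using C0G by force
 qed
 thus ?case unfolding L_Suc using cB oneB by (simp only:) (rule connectedin_generate, auto)
next
 case (Suc j)
 define B where "B y = (%x. comm x y) ` L (Suc j)" for y
 have cB: "connectedin T (B y)" if "y : carrier G" for y unfolding B_def
 proof (rule connectedin_continuous_map_image[OF _ Suc])
  show "continuous_map T T (%x. comm x y)" using comm_continuous[of T "%x. x" "%_. y"] that T by simp
 qed
 have oneB: "\<one> : B y" if "y : carrier G" for y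
  unfolding B_def using that L_one[of "Suc j"] by (intro image_eqI[of _ _ \<one>]) (auto simp: comm_def)
 have "(\<Union>x\<in>L (Suc j). \<Union>y\<in>carrier G. {comm x y}) = \<Union>(B ` carrier G)" unfolding B_def by blast
 thus ?case unfolding L_Suc[of "Suc j"] using cB oneB by (simp only:) (rule connectedin_generate, auto)
qed

text \<open>\<open>V g\<close> rotates the spectrum of a vector in \<open>charsp (Suc i) \<xi>\<close> by \<open>\<xi> (comm g a)\<close>.\<close>

lemma theta_onto:
 assumes i: "Suc i < k" and f: "f : charsp (Suc i) \<xi>" and n: "nrm f ~= 0"
  and ne: "\<exists>u\<in>L (Suc i). \<xi> u ~= 1"
 shows "(%g. \<xi> (comm g a)) ` L i = S1"
proof -
 note c = charsp_chr[OF f n] and kill = charsp_kill[OF f n] and cont = charsp_continuous[OF f n]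
 define \<theta> where "\<theta> g = \<xi> (comm g a)" for g
 have ct: "chr i \<theta>" unfolding chr_def \<theta>_def
  using chr_comm_left[OF c kill _ _ a] chr_norm[OF c comm_L[OF _ a]] by blast
 have contt: "continuous_map (subtopology T (L i)) euclidean \<theta>"
 proof -
  have "continuous_map T T (%x. comm x a)" using comm_continuous[of T "%x. x" "%_. a"] T by simp
  hence "continuous_map (subtopology T (L i)) (subtopology T (L (Suc i))) (%x. comm x a)"
   using comm_L by (intro continuous_map_into_subtopology continuous_map_from_subtopology) auto
  from continuous_map_compose[OF this cont] show ?thesis by (simp add: comp_def \<theta>_def[abs_def])
 qed
 obtain g where g: "g : L i" "\<theta> g ~= 1" unfolding \<theta>_def using chr_comm_trivial[OF i f n] ne by blast
 have "\<exists>P. P \<subseteq> L i \<and> connectedin T P \<and> \<one> : P \<and> (\<exists>p\<in>P. \<theta> p ~= 1)"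
 proof (cases i)
  case (Suc j)
  thus ?thesis using L_connected[of j] L_one[of i] g by (intro exI[of _ "L i"]) auto
 next
  \<comment> \<open>\<open>L 0\<close> is the whole group and may be disconnected, but
    \<open>\<theta>\<close> is trivial on powers of \<open>a\<close>, so a non-trivial value is
    already attained on \<open>C0\<close>.\<close>
  case 0
  have C0G: "C0 \<subseteq> carrier G" using C0(1) T connectedin_subset_topspace by blast
  obtain d m where dm: "d : C0" "g = d \<otimes> a [^] (m::int)" using gen[of g] g by auto
  have "a [^] m \<otimes> a = a \<otimes> a [^] m" using int_pow_mult[of a m 1] int_pow_mult[of a 1 m] by (simp add: add.commute)
  hence "comm (a [^] m) a = \<one>" by (simp add: comm_def m_assoc inv_mult_group[symmetric])
  hence "\<theta> (a [^] m) = 1" using chr_one[OF c] by (simp add: \<theta>_def)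
  hence "\<theta> g = \<theta> d" using chr_mult[OF ct, of d "a [^] m"] dm C0G 0 by auto
  thus ?thesis using C0 C0G dm(1) g(2) 0 by (intro exI[of _ C0]) auto
 qed
 then obtain P p where P: "P \<subseteq> L i" "connectedin T P" "\<one> : P" "p : P" "\<theta> p ~= 1" by blast
 have "connectedin euclidean (\<theta> ` P)"
  by (rule connectedin_continuous_map_image[OF contt]) (use P in "simp add: connectedin_subtopology")
 hence conP: "connected (\<theta> ` P)" by simp
 have "\<theta> ` L i = S1"
 proof (rule connected_subset_generates_circle[OF conP])
  show "1 : \<theta> ` P" using P(3) chr_one[OF ct] by (metis imageI)
  show "\<theta> p : \<theta> ` P" using P(4) by (rule imageI)
  show "\<theta> p ~= 1" by (rule P(5))
  show "\<theta> ` P \<subseteq> \<theta> ` L i" using P(1) by (rule image_mono)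
  show "\<theta> ` L i \<subseteq> S1" using chr_norm[OF ct] by auto
  show "x * y : \<theta> ` L i" if x: "x : \<theta> ` L i" and y: "y : \<theta> ` L i" for x y
  proof -
   obtain x' where "x' : L i" "x = \<theta> x'" using x by (rule imageE)
   moreover obtain y' where "y' : L i" "y = \<theta> y'" using y by (rule imageE)
   ultimately show ?thesis using chr_mult[OF ct] L_mult by (intro image_eqI[of _ _ "x' \<otimes> y'"]) auto
  qed
  show "cnj x : \<theta> ` L i" if x: "x : \<theta> ` L i" for x
  proof -
   obtain x' where "x' : L i" "x = \<theta> x'" using x by (rule imageE)
   thus ?thesis using chr_inv[OF ct] L_inv by (intro image_eqI[of _ _ "inv x'"]) auto
  qed
 qed
 thus ?thesis by (simp add: \<theta>_def)
qed

end

section \<open>Lebesgue spectrum\<close>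

lemma inverse_unit_cnj: "cmod z = 1 ==> inverse z = cnj z" by (rule inverse_unique) (simp add: complex_norm_square[symmetric])

lemma exists_irrational_rotation:
 obtains w :: complex where "w : S1" "!!n::int. n ~= 0 ==> w powi n ~= 1"
proof -
 obtain r :: real where r: "r \<notin> \<rat>" using countable_rat uncountable_UNIV_real by (metis UNIV_eq_I)
 have "cis (2 * pi * r) powi n ~= 1" if n: "n ~= 0" for n :: int
 proof
  assume "cis (2 * pi * r) powi n = 1"
  hence "cis (of_int n * (2 * pi * r)) = 1" by (simp add: cis_power_int)
  hence "cos (of_int n * (2 * pi * r)) = 1" by (metis cis.sel(1) one_complex.sel(1))
  then obtain j :: int where "of_int n * (2 * pi * r) = of_int j * 2 * pi" using cos_one_2pi_int by auto
  hence "of_int n * r = of_int j" by simp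
  hence "r = of_int j / of_int n" using n by (simp add: field_simps)
  thus False using r by simp
 qed
 thus ?thesis using that[of "cis (2 * pi * r)"] by simp
qed

context nil_action
begin

abbreviation U :: "int => ('x => complex) => 'x => complex" where
 "U n \<equiv> V (a [^] n)"

lemma V_comp_ip: "g : carrier G ==> h : carrier G ==> f : L2 \<mu> ==> f' : L2 \<mu> ==>
 l2_inner \<mu> (V h (V g f)) f' = l2_inner \<mu> (V (g \<otimes> h) f) f'" by (rule ip_cong) (auto simp: V_comp)

sublocale unitary_powers "L2 \<mu>" "%c f x. c * f x" "l2_inner \<mu>" U
proof unfold_locales
 show "l2_inner \<mu> (U m (U n x)) y = l2_inner \<mu> (U (m + n) x) y" if "x : L2 \<mu>" "y : L2 \<mu>" for x y m n
  using V_comp_ip[of "a [^] n" "a [^] m" x y] that int_pow_mult[of a n m] by (simp add: add.commute)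
qed (auto simp: V_def plus_fun V_ip[unfolded V_def] V_mem[unfolded V_def])

lemma chr_int_pow:
 assumes h: "chr 0 \<beta>" shows "\<beta> (a [^] (m::int)) = \<beta> a powi m"
proof -
 have np: "\<beta> (a [^] (j::nat)) = \<beta> a ^ j" for j
 proof (induction j)
  case 0 thus ?case using chr_one[OF h] by simp
 next
  case (Suc j) thus ?case using chr_mult[OF h, of "a [^] j" a] by (simp add: mult.commute)
 qed
 show ?thesis
 proof (cases m rule: int_cases2)
  case (nonneg j) thus ?thesis using np[of j] by (simp add: int_pow_int)
 next
  case (nonpos j)
  hence "a [^] m = inv (a [^] j)" by (simp add: int_pow_neg int_pow_int)
  moreover have "inverse (\<beta> a ^ j) = cnj (\<beta> a ^ j)"
   using chr_norm[OF h, of "a [^] j"] np[of j] by (simp add: inverse_unit_cnj)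
  ultimately show ?thesis using nonpos np[of j] chr_inv[OF h, of "a [^] j"] by (simp add: power_int_minus)
 qed
qed

text \<open>Write \<open>g \<otimes> a [^] m\<close> as the commutator of the two factors times
  \<open>a [^] m \<otimes> g\<close>. The commutator acts on \<open>f\<close> by a scalar, which is
  \<open>\<xi> (comm g a) powi m\<close> since \<open>\<xi> (comm g y)\<close> is multiplicative in
  \<open>y\<close>.\<close>

lemma V_rotates:
 assumes f: "f : charsp (Suc i) \<xi>" and n: "nrm f ~= 0" and g: "g : L i"
 shows "l2_inner \<mu> (U m (V g f)) (V g f) = \<xi> (comm g a) powi m * l2_inner \<mu> (U m f) f"
proof -
 note c = charsp_chr[OF f n] and kill = charsp_kill[OF f n]
 have fL: "f : L2 \<mu>" using charsp_L2[OF f] .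
 have gG: "g : carrier G" using g by simp
 let ?b = "a [^] m" and ?c = "comm g (a [^] m)"
 have c_in: "?c : L (Suc i)" using comm_L[OF g] by simp
 have h: "chr 0 (%y. \<xi> (comm g y))" unfolding chr_def using chr_comm_right[OF c kill g] chr_norm[OF c comm_L[OF g]] by simp
 have "l2_inner \<mu> (V ?b (V g f)) (V g f) = l2_inner \<mu> (V (?c \<otimes> (?b \<otimes> g)) f) (V g f)"
  using V_comp_ip[of g ?b f "V g f"] comm_swap[of g ?b] gG fL by simp
 also have "\<dots> = l2_inner \<mu> (V (?b \<otimes> g) (V ?c f)) (V g f)"
  using V_comp_ip[of ?c "?b \<otimes> g" f "V g f"] gG fL by simp
 also have "\<dots> = l2_inner \<mu> (V (?b \<otimes> g) (%x. \<xi> ?c * f x)) (V g f)"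
  using V_cong[OF _ _ sc_mem[OF fL] charsp_eq[OF f c_in], of "?b \<otimes> g"] gG fL sc_mem[OF fL] by (intro ip_cong) auto
 also have "\<dots> = \<xi> ?c * l2_inner \<mu> (V (?b \<otimes> g) f) (V g f)"
  unfolding V_sc using gG fL by (intro ip_sc_left) auto
 also have "l2_inner \<mu> (V (?b \<otimes> g) f) (V g f) = l2_inner \<mu> (V g (V ?b f)) (V g f)"
  using V_comp_ip[of ?b g f "V g f"] gG fL by simp
 also have "\<dots> = l2_inner \<mu> (V ?b f) f" using gG fL by (intro V_ip) auto
 finally show ?thesis using chr_int_pow[OF h] by simp
qed

lemma sm_V:
 assumes f: "f : charsp (Suc i) \<xi>" and n: "nrm f ~= 0" and g: "g : L i"
 shows "sm (V g f) = distr (sm f) circle_borel (%t. \<xi> (comm g a) * t)"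
proof (rule sm_eq)
 have fL: "f : L2 \<mu>" using charsp_L2[OF f] .
 have w: "\<xi> (comm g a) : S1" using chr_norm[OF charsp_chr[OF f n] comm_L[OF g a]] by simp
 show "spec (V g f) (distr (sm f) circle_borel (%t. \<xi> (comm g a) * t))"
  unfolding spec_def rotation_powi[OF sm_circle_measure[OF fL] w] V_rotates[OF f n g] sm_powi[OF fL]
  using rotation_circle_measure[OF sm_circle_measure[OF fL] w] by simp
qed

lemma null_vectors_V:
 assumes f: "f : charsp (Suc i) \<xi>" and n: "nrm f ~= 0" and g: "g : L i" and N: "N : sets circle_borel"
 shows "V g f : null_vectors N \<longleftrightarrow> emeasure (sm f) {t : S1. \<xi> (comm g a) * t : N} = 0"
proof -
 have fL: "f : L2 \<mu>" using charsp_L2[OF f] .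
 have w: "\<xi> (comm g a) : S1" using chr_norm[OF charsp_chr[OF f n] comm_L[OF g a]] by simp
 show ?thesis using null_vectors_iff[of "V g f" N] emeasure_rotation[OF sm_circle_measure[OF fL] w N] sm_V[OF f n g] g fL by simp
qed

definition nontrivial :: "nat => ('g => complex) => bool" where
 "nontrivial i \<xi> \<longleftrightarrow> (\<exists>u\<in>L i. \<xi> u ~= 1)"

text \<open>For almost every \<open>w\<close> the rotation of \<open>sm f\<close> by \<open>w\<close> does not charge the Lebesgue null set \<open>N\<close>,
 and countably many rotates of the set of rotations that come from a neighbourhood of the identity
 cover the circle. So \<open>f\<close> is a limit of vectors in the closed subspace \<open>null_vectors N\<close>.\<close>

lemma charsp_null:
 assumes i: "Suc i < k" and f: "f : charsp (Suc i) \<xi>" and ne: "nontrivial (Suc i) \<xi>"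
  and N: "N : sets circle_borel" "emeasure circle_lebesgue N = 0"
 shows "f : null_vectors N"
proof (cases "nrm f = 0")
 case True
 have fL: "f : L2 \<mu>" using charsp_L2[OF f] .
 have "nrm (0 - f) = 0" using nrm_minus[OF fL] True by simp
 thus ?thesis by (rule csub_cong[OF csub_null_vectors[OF N(1)] csub_zero[OF csub_null_vectors[OF N(1)]] fL])
next
 case n: False
 have fL: "f : L2 \<mu>" using charsp_L2[OF f] .
 define \<theta> where "\<theta> g = \<xi> (comm g a)" for g
 note c = charsp_chr[OF f n] and kill = charsp_kill[OF f n]
 have onto: "\<theta> ` L i = S1" using theta_onto[OF i f n] ne unfolding \<theta>_def nontrivial_def by blast
 have ct: "chr i \<theta>" unfolding chr_def \<theta>_def
  using chr_comm_left[OF c kill _ _ a] chr_norm[OF c comm_L[OF _ a]] by blast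
 have \<theta>s: "\<theta> g : S1" if "g : L i" for g using onto that by blast
 obtain N0 where N0: "{w : space circle_lebesgue. emeasure (sm f) {t : S1. w * t : N} ~= 0} \<subseteq> N0"
  "emeasure circle_lebesgue N0 = 0" "N0 : sets circle_lebesgue"
  using AE_E[OF AE_rotation_null[OF sm_circle_measure[OF fL] N]] by blast
 have sp: "space circle_lebesgue = S1" using circle_measure_space[OF circle_lebesgue_circle_measure] .
 have N0s: "N0 : sets circle_borel" using N0(3) circle_measure_sets[OF circle_lebesgue_circle_measure] by simp
 have near: "\<exists>g\<in>L i. nrm (V g f - f) < e \<and> V g f : null_vectors N" if e: "e > 0" for e
 proof (rule ccontr)
  assume no: "\<not> (\<exists>g\<in>L i. nrm (V g f - f) < e \<and> V g f : null_vectors N)"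
  have bad: "\<theta> g : N0" if "g : L i" "nrm (V g f - f) < e" for g
  proof -
   have "V g f \<notin> null_vectors N" using no that by blast
   hence "emeasure (sm f) {t : S1. \<theta> g * t : N} ~= 0"
    using null_vectors_V[OF f n that(1) N(1)] by (simp add: \<theta>_def)
   thus ?thesis using N0(1) \<theta>s[OF that(1)] sp by blast
  qed
  have "\<forall>g\<in>L i. \<exists>M. openin T M \<and> g : M \<and> (\<forall>h\<in>M. nrm (V h f - V g f) < e)"
   using strong_continuity[OF fL L_mem e] by metis
  then obtain M where M: "!!g. g : L i ==> openin T (M g)" "!!g. g : L i ==> g : M g"
   "!!g h. g : L i ==> h : M g ==> nrm (V h f - V g f) < e" by metis
  have LT: "L i \<subseteq> topspace T" using L_carrier T by simp
  have "Lindelof_space (subtopology T (L i))" by (intro second_countable_imp_Lindelof_space second_countable_subtopology T_sc)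
  note Lindelof = this[unfolded Lindelof_space_subtopology_subset[OF LT], rule_format]
  have "\<exists>\<V>. countable \<V> \<and> \<V> \<subseteq> M ` L i \<and> L i \<subseteq> \<Union>\<V>"
  proof (rule Lindelof, intro conjI ballI subsetI)
   show "openin T W" if "W : M ` L i" for W using that M(1) by (rule_tac imageE[OF that]) simp
   show "g : \<Union>(M ` L i)" if "g : L i" for g using M(2)[OF that] that by (intro UN_I)
  qed
  then obtain \<V> where "countable \<V>" "\<V> \<subseteq> M ` L i" "L i \<subseteq> \<Union>\<V>" by (elim exE conjE)
  then obtain J where J: "countable J" "J \<subseteq> L i" "L i \<subseteq> \<Union>(M ` J)" by (metis countable_subset_image)
  \<comment> \<open>If \<open>h\<close> lies in the neighbourhood of \<open>g\<close>, then
    \<open>p = h \<otimes> inv g\<close> moves \<open>f\<close> by less than \<open>e\<close>, so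
    \<open>\<theta> p\<close> lies in \<open>N0\<close> and \<open>\<theta> h\<close> in its
    rotation \<open>R g\<close>. Countably many of these null sets would cover the circle.\<close>
  define R where "R g = {t : S1. cnj (\<theta> g) * t : N0}" for g
  have R0: "R g : null_sets circle_lebesgue" if "g : J" for g
  proof -
   have w: "cnj (\<theta> g) : S1" using \<theta>s[of g] J(2) that by auto
   show ?thesis unfolding R_def null_sets_def using circle_lebesgue_null_rotation[OF w N0s] N0(2) rotation_sets[OF w N0s]
     circle_measure_sets[OF circle_lebesgue_circle_measure] by simp
  qed
  have "S1 \<subseteq> \<Union>(R ` J)"
  proof
   fix t :: complex assume "t : S1"
   then obtain h where h: "h : L i" "t = \<theta> h" using onto by blast
   then obtain g where g: "g : J" "h : M g" using J(3) by blast
   have gL: "g : L i" using g J by blast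
   define p where "p = h \<otimes> inv g"
   have pL: "p : L i" unfolding p_def using h gL L_mult L_inv by blast
   have G: "p : carrier G" "g : carrier G" "h : carrier G" using pL gL h by auto
   have hp: "h = p \<otimes> g" using G unfolding p_def by (simp add: m_assoc)
   have mem: "V h f : L2 \<mu>" "V g (V p f) : L2 \<mu>" "V g f : L2 \<mu>" using G fL by auto
   have "nrm (V p f - f) = nrm (V g (V p f) - V g f)" using G fL by (simp add: V_diff[symmetric] V_nrm)
   also have "\<dots> <= nrm (V g (V p f) - V h f) + nrm (V h f - V g f)" by (rule nrm_triangle3[OF mem(2,1,3)])
   also have "\<dots> < e" using M(3)[OF gL g(2)] V_comp[OF G(1,2), of f] hp by simp
   finally have "\<theta> p : N0" using bad[OF pL] by simp
   moreover have "cnj (\<theta> g) * t = \<theta> p"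
   proof -
    have "\<theta> h = \<theta> p * \<theta> g" using chr_mult[OF ct pL gL] hp by simp
    moreover have "\<theta> g * cnj (\<theta> g) = 1" using \<theta>s[OF gL] by (simp add: complex_norm_square[symmetric])
    ultimately show ?thesis using h(2) by (simp add: mult.commute mult.left_commute)
   qed
   ultimately have "t : R g" unfolding R_def using \<open>t \<in> S1\<close> by simp
   thus "t : \<Union>(R ` J)" using g(1) by blast
  qed
  moreover have "\<Union>(R ` J) : null_sets circle_lebesgue" using J(1) R0 by (rule null_sets_UN')
  moreover have "S1 : sets circle_lebesgue" using sp sets.top[of circle_lebesgue] by simp
  ultimately have "S1 : null_sets circle_lebesgue" using null_sets_subset by blast
  thus False using circle_lebesgue_total by (simp add: null_sets_def)
 qed
 have "\<forall>m. \<exists>g\<in>L i. nrm (V g f - f) < inverse (real (Suc m)) \<and> V g f : null_vectors N" using near by simp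
 then obtain g where g: "!!m. g m : L i" "!!m. nrm (V (g m) f - f) < inverse (real (Suc m))" "!!m. V (g m) f : null_vectors N" by metis
 have "tends (%m. V (g m) f) f" by (rule tends_bound[where b = "%m. inverse (real (Suc m))"])
   (use g(2) V_mem[OF L_mem[OF g(1)] fL] fL LIMSEQ_inverse_real_of_nat in "simp_all add: less_imp_le")
 thus ?thesis by (rule csub_tends[OF csub_null_vectors[OF N(1)] g(3) fL])
qed

text \<open>Let \<open>v\<close> dominate the translates of \<open>f\<close> by the powers of
  \<open>g\<close>, and let \<open>N\<close> be null for \<open>sm v\<close>. The union
  \<open>N'\<close> of the rotates of \<open>N\<close> by powers of \<open>w\<close> is null for
  \<open>sm f\<close> and invariant under \<open>w\<close>, so by the zero-one law it is Lebesgue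
  null or co-null; in the second case \<open>charsp_null\<close> would make its complement null for
  \<open>sm f\<close> as well. Thus Lebesgue measure is absolutely continuous with respect to
  \<open>sm v\<close> and is realised in the cyclic subspace of \<open>v\<close>.\<close>

lemma wandering_vector:
 assumes i: "Suc i < k" and f: "f : charsp (Suc i) \<xi>" and n: "nrm f ~= 0" and ne: "nontrivial (Suc i) \<xi>"
 obtains e where "e : charsp (Suc i) \<xi>" "spec e circle_lebesgue"
proof -
 have fL: "f : L2 \<mu>" using charsp_L2[OF f] .
 define \<theta> where "\<theta> g = \<xi> (comm g a)" for g
 note c = charsp_chr[OF f n] and kill = charsp_kill[OF f n]
 have onto: "\<theta> ` L i = S1" using theta_onto[OF i f n] ne unfolding \<theta>_def nontrivial_def by blast
 have ct: "chr i \<theta>" unfolding chr_def \<theta>_def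
  using chr_comm_left[OF c kill _ _ a] chr_norm[OF c comm_L[OF _ a]] by blast
 obtain w :: complex where w: "w : S1" "!!n::int. n ~= 0 ==> w powi n ~= 1" using exists_irrational_rotation by blast
 obtain g where g: "g : L i" "\<theta> g = w" using onto w(1) by (metis imageE)
 have gp: "g [^] j : L i \<and> \<theta> (g [^] j) = w ^ j" for j :: nat
 proof (induction j)
  case 0 thus ?case using L_one chr_one[OF ct] by simp
 next
  case (Suc j) thus ?case using chr_mult[OF ct _ g(1)] L_mult[OF _ g(1)] g(2) by (simp add: mult.commute)
 qed
 have gi: "\<exists>h\<in>L i. \<theta> h = w powi j" for j :: int
 proof (cases j rule: int_cases2)
  case (nonneg m) thus ?thesis using gp[of m] by (intro bexI[of _ "g [^] m"]) auto
 next
  case (nonpos m)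
  have "inverse (w ^ m) = cnj (w ^ m)" using w(1) by (simp add: inverse_unit_cnj norm_power)
  thus ?thesis using nonpos gp[of m] chr_inv[OF ct, of "g [^] m"] L_inv[of "g [^] m" i]
   by (intro bexI[of _ "inv (g [^] m)"]) (auto simp: power_int_minus)
 qed
 then obtain h where h: "!!j::int. h j : L i" "!!j. \<theta> (h j) = w powi j" by metis
 define F where "F m = V (h (int_decode m)) f" for m
 have "csub (charsp (Suc i) \<xi>)" by (rule csub_charsp)
 moreover have "U_inv (charsp (Suc i) \<xi>)" unfolding U_inv_def using charsp_V by simp
 moreover have "F m : charsp (Suc i) \<xi>" for m unfolding F_def by (rule charsp_V[OF f L_mem[OF h(1)]])
 ultimately obtain v where v: "v : charsp (Suc i) \<xi>"
  "!!m N. N : sets circle_borel ==> v : null_vectors N ==> F m : null_vectors N" using dominating_vector by metis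
 have vL: "v : L2 \<mu>" using charsp_L2[OF v(1)] .
 have "absolutely_continuous (sm v) circle_lebesgue" unfolding absolutely_continuous_def
 proof
  fix N assume "N : null_sets (sm v)"
  hence N: "N : sets circle_borel" "v : null_vectors N"
   using circle_measure_sets[OF sm_circle_measure[OF vL]] null_vectors_iff[OF vL] by (auto simp: null_sets_def)
  define R where "R j = {t : S1. w powi j * t : N}" for j :: int
  have wj: "w powi j : S1" for j :: int using w(1) by (simp add: norm_power_int)
  have R0: "R j : null_sets (sm f)" for j
  proof -
   have "V (h j) f : null_vectors N" using v(2)[OF N, of "int_encode j"] by (simp add: F_def)
   hence "emeasure (sm f) (R j) = 0" using null_vectors_V[OF f n h(1) N(1)] h(2) by (simp add: R_def \<theta>_def)
   thus ?thesis unfolding null_sets_def R_def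
    using rotation_sets[OF wj N(1)] circle_measure_sets[OF sm_circle_measure[OF fL]] by simp
  qed
  define N' where "N' = (\<Union>j. R j)"
  have N'0: "N' : null_sets (sm f)" unfolding N'_def using R0 by (intro null_sets_UN)
  have N's: "N' : sets circle_borel" unfolding N'_def R_def using rotation_sets[OF wj N(1)] by (intro sets.countable_UN) auto
  have w0: "w ~= 0" using w(1) by auto
  have inv: "w * t : N' \<longleftrightarrow> t : N'" if t: "t : S1" for t
  proof
   assume "w * t : N'"
   then obtain j where "w powi j * (w * t) : N" unfolding N'_def R_def by blast
   moreover have "w powi j * (w * t) = w powi (j + 1) * t" using w0 by (simp add: power_int_add_1)
   ultimately show "t : N'" unfolding N'_def R_def using t by auto
  next
   assume "t : N'"
   then obtain j where j: "w powi j * t : N" unfolding N'_def R_def by blast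
   have "w powi j = w powi (j - 1) * w" using power_int_add_1[of w "j - 1"] w0 by simp
   hence "w powi (j - 1) * (w * t) : N" using j by (simp add: mult.assoc)
   thus "w * t : N'" unfolding N'_def R_def using t w(1) by (auto simp: norm_mult)
  qed
  have "emeasure circle_lebesgue N' = 0"
  proof (rule ccontr)
   assume "emeasure circle_lebesgue N' ~= 0"
   hence z: "emeasure circle_lebesgue (S1 - N') = 0" using circle_lebesgue_zero_one[OF w N's inv] by blast
   have cs: "S1 - N' : sets circle_borel" using sets.compl_sets[OF N's] by simp
   have "f : null_vectors (S1 - N')" by (rule charsp_null[OF i f ne cs z])
   hence "S1 - N' : null_sets (sm f)"
    using null_vectors_iff[OF fL] cs circle_measure_sets[OF sm_circle_measure[OF fL]] by (simp add: null_sets_def)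
   hence "N' \<union> (S1 - N') : null_sets (sm f)" using N'0 by (rule null_sets.Un[rotated])
   moreover have "N' \<union> (S1 - N') = S1" using sets.sets_into_space[OF N's] by auto
   ultimately have "measure (sm f) S1 = 0" by (simp add: measure_eq_0_null_sets)
   thus False using sm_total[OF fL] n by simp
  qed
  hence "N' : null_sets circle_lebesgue" using N's circle_measure_sets[OF circle_lebesgue_circle_measure] by (simp add: null_sets_def)
  moreover have "N \<subseteq> N'"
  proof
   fix t assume t: "t : N"
   hence "t : S1" using sets.sets_into_space[OF N(1)] by auto
   hence "t : R 0" unfolding R_def using t by simp
   thus "t : N'" unfolding N'_def by blast
  qed
  ultimately show "N : null_sets circle_lebesgue"
   using null_sets_subset N(1) circle_measure_sets[OF circle_lebesgue_circle_measure] by metis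
 qed
 then obtain e where e: "e : cyc {v}" "spec e circle_lebesgue"
  using absolutely_continuous_spec[OF vL circle_lebesgue_circle_measure] by blast
 have "cyc {v} \<subseteq> charsp (Suc i) \<xi>" using v(1) charsp_V by (intro cyc_least csub_charsp) (auto simp: U_inv_def)
 thus ?thesis using that e by blast
qed

lemma charsp_orth:
 assumes f: "f : charsp i \<xi>" and h: "h : charsp i \<eta>" and u: "u : L i" "\<xi> u * cnj (\<eta> u) ~= 1"
 shows "l2_inner \<mu> f h = 0"
proof -
 have fL: "f : L2 \<mu>" and hL: "h : L2 \<mu>" using charsp_L2 f h by auto
 have uG: "u : carrier G" using u by simp
 have "l2_inner \<mu> f h = l2_inner \<mu> (V u f) (V u h)" using V_ip[OF uG fL hL] by simp
 also have "\<dots> = l2_inner \<mu> (%x. \<xi> u * f x) (V u h)"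
  by (rule ip_cong[OF V_mem[OF uG fL] sc_mem[OF fL] V_mem[OF uG hL] charsp_eq[OF f u(1)]])
 also have "\<dots> = l2_inner \<mu> (%x. \<xi> u * f x) (%x. \<eta> u * h x)"
  by (rule ip_cong_right[OF V_mem[OF uG hL] sc_mem[OF hL] sc_mem[OF fL] charsp_eq[OF h u(1)]])
 also have "\<dots> = \<xi> u * cnj (\<eta> u) * l2_inner \<mu> f h"
  using ip_sc_left[OF fL sc_mem[OF hL]] ip_sc_right[OF fL hL] by simp
 finally show ?thesis using u(2) by simp
qed

lemma E_charsp: "f : E i ==> f : charsp i (%u. 1)"
 using subsetD[OF E_mono[of i "Suc i"], of f] unfolding charsp_def by (simp add: E_def)

lemma charsp_trivial_E: "f : charsp i \<xi> ==> \<not> nontrivial i \<xi> ==> f : E i"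
proof -
 assume f: "f : charsp i \<xi>" and t: "\<not> nontrivial i \<xi>"
 have "nrm (V u f - f) = 0" if "u : L i" for u
  using charsp_eq[OF f that] t that unfolding nontrivial_def by (metis (no_types, lifting) ext mult_1)
 thus ?thesis using charsp_L2[OF f] unfolding E_def by blast
qed

lemma charsp_ortho_E:
 assumes f: "f : charsp i \<xi>" and ne: "nontrivial i \<xi>" and j: "j <= i"
 shows "f : ortho (E j)"
proof -
 obtain u where u: "u : L i" "\<xi> u ~= 1" using ne by (auto simp: nontrivial_def)
 have "l2_inner \<mu> f h = 0" if "h : E j" for h using charsp_orth[OF f E_charsp[of h i] u(1)] E_mono[OF j] that u(2) by auto
 thus ?thesis using charsp_L2[OF f] by (simp add: ortho_def)
qed

end

context semi_hilbert
begin

section \<open>Spanning sets and orthogonal series\<close>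

lemma csub_sub_cspan:
 assumes V: "csub V" and S: "S \<subseteq> V" and z: "!!x. x : V ==> x : ortho S ==> nrm x = 0"
 shows "V \<subseteq> cspan S"
proof
 fix x assume x: "x : V"
 have xH: "x : H" using csub_mem[OF V x] .
 obtain p where p: "p : cspan S" "x - p : ortho (cspan S)" using projection[OF csub_cspan xH] .
 have SH: "S \<subseteq> H" using S csub_mem[OF V] by blast
 have pV: "p : V" using p(1) cspan_least[OF V S] by blast
 have "nrm (x - p) = 0" using p(2) ortho_cspan[OF SH] csub_diff[OF V x pV] z by simp
 hence "nrm (p - x) = 0" using nrm_diff_commute[OF xH csub_mem[OF V pV]] by simp
 thus "x : cspan S" by (rule csub_cong[OF csub_cspan p(1) xH])
qed

text \<open>The projections of \<open>f\<close> on the \<open>W i\<close> form a convergent series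
  by Bessel's inequality; its sum differs from \<open>f\<close> by a vector orthogonal to every
  \<open>W i\<close>, which has norm zero by \<open>z\<close>.\<close>

lemma orthogonal_series:
 assumes V: "csub V" and W: "!!i::nat. csub (W i)" "!!i. W i \<subseteq> V"
  and orth: "!!i j x y. i ~= j ==> x : W i ==> y : W j ==> ip x y = 0"
  and z: "!!x. x : V ==> (!!i. x : ortho (W i)) ==> nrm x = 0"
  and f: "f : V"
 obtains w where "!!i. w i : W i" "(%n. nrm (f - (\<Sum>i<n. w i))) ----> 0"
proof -
 have fH: "f : H" using csub_mem[OF V f] .
 have "\<forall>i. \<exists>p. p : W i \<and> f - p : ortho (W i)" using projection[OF W(1) fH] by metis
 then obtain w where w: "!!i. w i : W i" "!!i. f - w i : ortho (W i)" by metis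
 have wH: "w i : H" for i using csub_mem[OF W(1) w(1)] .
 have wo: "ip (w i) (w j) = 0" if "i ~= j" for i j using orth[OF that w(1) w(1)] .
 have bes: "(\<Sum>i<n. (nrm (w i))^2) <= (nrm f)^2" for n by (rule bessel) (use wH wo fH ortho_ip[OF w(2) w(1)] in auto)
 obtain s where s: "s : H" "tends (%n. \<Sum>i<n. w i) s" using orth_series_tends[OF wH wo bes] by blast
 have sumH: "(\<Sum>i<n. w i) : H" for n using wH by (intro sum_mem)
 have sumV: "(\<Sum>i<n. w i) : V" for n using w(1) W(2) by (intro csub_sum[OF V]) blast
 have sV: "s : V" by (rule csub_tends[OF V sumV s])
 have "ip s y = ip (w j) y" if y: "y : W j" for j y
 proof -
  have yH: "y : H" using csub_mem[OF W(1) y] .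
  have "(%n. ip (\<Sum>i<n. w i) y) ----> ip s y" by (rule tends_ip_left[OF sumH s(1) yH s(2)])
  moreover have "\<forall>\<^sub>F n in sequentially. ip (\<Sum>i<n. w i) y = ip (w j) y"
  proof (rule eventually_sequentiallyI[of "Suc j"])
   fix n assume n: "Suc j <= n"
   have "ip (\<Sum>i<n. w i) y = (\<Sum>i<n. ip (w i) y)" using wH yH by (intro ip_sum_left)
   also have "\<dots> = (\<Sum>i<n. if i = j then ip (w j) y else 0)" using orth[OF _ w(1) y] by (intro sum.cong) auto
   also have "\<dots> = ip (w j) y" using n by simp
   finally show "ip (\<Sum>i<n. w i) y = ip (w j) y" .
  qed
  ultimately have "(%n. ip (w j) y) ----> ip s y" by (rule Lim_transform_eventually)
  thus ?thesis by (simp add: LIMSEQ_const_iff)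
 qed
 hence "f - s : ortho (W j)" for j using ortho_ip[OF w(2)] csub_mem[OF W(1)] wH fH s(1) by (simp add: ortho_def ip_diff_left)
 hence fs: "nrm (f - s) = 0" using z csub_diff[OF V f sV] by blast
 have "nrm (f - (\<Sum>i<n. w i)) <= nrm ((\<Sum>i<n. w i) - s)" for n
  using nrm_triangle3[OF fH s(1) sumH[of n]] fs nrm_diff_commute[OF s(1) sumH[of n]] by simp
 hence "(%n. nrm (f - (\<Sum>i<n. w i))) ----> 0" using s(2) unfolding tends_def
  by (intro tendsto_sandwich[OF _ _ tendsto_const s(2)[unfolded tends_def]]) (use fH sumH in "auto intro!: always_eventually")
 thus ?thesis using that w(1) by blast
qed

end

context l2_space
begin

lemma orthogonal_sumI:
 assumes V: "csub V" and W: "!!i::nat. csub (W i)" "!!i. W i \<subseteq> V"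
  and orth: "!!i j x y. i ~= j ==> x : W i ==> y : W j ==> l2_inner M x y = 0"
  and z: "!!x. x : V ==> (!!i. x : ortho (W i)) ==> nrm x = 0"
 shows "orthogonal_sum M W V" unfolding orthogonal_sum_def
proof (intro conjI allI impI)
 show "closed_subspace M (W i)" for i using W(1) by (simp add: csub_eq[symmetric])
 show "l2_orthogonal M (W i) (W j)" if "i ~= j" for i j using orth[OF that] by (simp add: l2_orthogonal_def)
 have eq: "l2_norm M (%x. f x - (\<Sum>i<n. w i x)) = nrm (f - (\<Sum>i<n. w i))" for f w and n :: nat
  by (simp add: nrm_eq minus_fun sum_fun)
 show "V = {f : L2 M. \<exists>w. (\<forall>i. w i : W i) \<and> (%n. l2_norm M (%x. f x - (\<Sum>i<n. w i x))) ----> 0}"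
  unfolding eq
 proof (intro equalityI subsetI CollectI conjI)
  fix f assume f: "f : V"
  show "f : L2 M" using csub_mem[OF V f] .
  show "\<exists>w. (\<forall>i. w i : W i) \<and> (%n. nrm (f - (\<Sum>i<n. w i))) ----> 0"
   by (rule orthogonal_series[OF V W orth z f]) (assumption | blast)+
 next
  fix f assume "f : {f : L2 M. \<exists>w. (\<forall>i. w i : W i) \<and> (%n. nrm (f - (\<Sum>i<n. w i))) ----> 0}"
  then obtain w where f: "f : L2 M" and w: "!!i. w i : W i" "(%n. nrm (f - (\<Sum>i<n. w i))) ----> 0" by blast
  have sV: "(\<Sum>i<n. w i) : V" for n using w(1) W(2) by (intro csub_sum[OF V]) blast
  have "tends (%n. \<Sum>i<n. w i) f" unfolding tends_def using w(2) nrm_diff_commute[OF f csub_mem[OF V sV]] by simp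
  thus "f : V" by (rule csub_tends[OF V sV f])
 qed
qed

end

context nil_action
begin

text \<open>Taking powers of the phase only keeps the modulus, so the function stays in
  \<open>L2 \<mu>\<close> with the same norm; where \<open>f\<close> vanishes, the factor
  \<open>cmod (f x)\<close> makes the value 0.\<close>

definition pow_fun :: "nat => ('x => complex) => 'x => complex" where
 "pow_fun n f = (%x. of_real (cmod (f x)) * (f x / of_real (cmod (f x))) ^ n)"

lemma cmod_pow_fun: "cmod (pow_fun n f x) = cmod (f x)"
 by (cases "f x = 0") (simp_all add: pow_fun_def norm_mult norm_power norm_divide)

lemma pow_fun_mult: "cmod w = 1 ==> g x = w * f x ==> pow_fun n g x = w ^ n * pow_fun n f x"
 by (simp add: pow_fun_def norm_mult power_mult_distrib power_divide)

lemma pow_fun_L2: "f : L2 \<mu> ==> pow_fun n f : L2 \<mu>"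
proof (rule L2I)
 assume f: "f : L2 \<mu>"
 note [measurable] = L2_measurable[OF f]
 show "pow_fun n f : borel_measurable \<mu>" unfolding pow_fun_def by measurable
 show "integrable \<mu> (%x. (cmod (pow_fun n f x))^2)" using L2_integrable_sq[OF f] by (simp add: cmod_pow_fun)
qed

lemma nrm_pow_fun: "nrm (pow_fun n f) = nrm f" by (simp add: nrm_eq l2_norm_def cmod_pow_fun)

lemma pow_fun_eigen:
 assumes f: "f : L2 \<mu>" and u: "u : carrier G" and c: "cmod w = 1" and e: "nrm (V u f - (%x. w * f x)) = 0"
 shows "nrm (V u (pow_fun n f) - (%x. w ^ n * pow_fun n f x)) = 0"
proof -
 have "AE x in \<mu>. V u f x = w * f x" using e nrm_diff_eq_0_iff[OF V_mem[OF u f] sc_mem[OF f]] by simp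
 hence "AE x in \<mu>. pow_fun n (V u f) x = w ^ n * pow_fun n f x" by eventually_elim (rule pow_fun_mult[OF c])
 moreover have "pow_fun n (V u f) = V u (pow_fun n f)" by (simp add: pow_fun_def V_def)
 ultimately show ?thesis using nrm_diff_eq_0_iff[OF V_mem[OF u pow_fun_L2[OF f]] sc_mem[OF pow_fun_L2[OF f]]] by simp
qed

lemma pow_fun_charsp:
 assumes f: "f : charsp i \<xi>" and n: "nrm f ~= 0"
 shows "pow_fun n f : charsp i (%u. \<xi> u ^ n)"
proof -
 have fL: "f : L2 \<mu>" using charsp_L2[OF f] .
 have "nrm (V u (pow_fun n f) - pow_fun n f) = 0" if u: "u : L (Suc i)" for u
  using pow_fun_eigen[OF fL L_mem[OF u], of 1 n] charsp_E[OF f] u by (simp add: E_def)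
 hence "pow_fun n f : E (Suc i)" using pow_fun_L2[OF fL] by (simp add: E_def)
 moreover have "nrm (V u (pow_fun n f) - (%x. \<xi> u ^ n * pow_fun n f x)) = 0" if u: "u : L i" for u
  using pow_fun_eigen[OF fL L_mem[OF u] chr_norm[OF charsp_chr[OF f n] u] charsp_eq[OF f u]] .
 ultimately show ?thesis by (simp add: charsp_def)
qed

lemma wandering_sequence:
 assumes i: "Suc i < k" and f: "f : charsp (Suc i) \<xi>" and n: "nrm f ~= 0" and ne: "nontrivial (Suc i) \<xi>"
 obtains e where "!!m. e m : ortho (E 1)" "!!m::nat. spec (e m) circle_lebesgue"
  "!!l m x y. l ~= m ==> x : cyc {e l} ==> y : cyc {e m} ==> l2_inner \<mu> x y = 0"
proof -
 have onto: "(%g. \<xi> (comm g a)) ` L i = S1" using theta_onto[OF i f n] ne unfolding nontrivial_def by blast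
 obtain w :: complex where w: "w : S1" "!!n::int. n ~= 0 ==> w powi n ~= 1" using exists_irrational_rotation by blast
 have "w : (%g. \<xi> (comm g a)) ` L i" unfolding onto by (rule w(1))
 then obtain g where g: "g : L i" "\<xi> (comm g a) = w" by blast
 define u where "u = comm g a"
 have u: "u : L (Suc i)" "\<xi> u = w" unfolding u_def using comm_L[OF g(1)] g(2) by auto
 \<comment> \<open>Exponents start at 1, since the zeroth power is the trivial character. As no
   non-zero power of \<open>\<xi> u = w\<close> is 1, the single element \<open>u\<close> shows all
   these characters to be non-trivial and distinct.\<close>
 define \<xi>' where "\<xi>' m = (%u. \<xi> u ^ Suc m)" for m
 have w0: "w ~= 0" using w(1) by auto
 have ne': "nontrivial (Suc i) (\<xi>' m)" for m
  using w(2)[of "int (Suc m)"] u unfolding nontrivial_def \<xi>'_def by (intro bexI[of _ u]) (simp_all del: power_Suc of_nat_Suc)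
 have "\<forall>m. \<exists>e. e : charsp (Suc i) (\<xi>' m) \<and> spec e circle_lebesgue"
  using wandering_vector[OF i pow_fun_charsp[OF f n, of "Suc _"] _ ne'[unfolded \<xi>'_def]] n nrm_pow_fun unfolding \<xi>'_def by metis
 then obtain e where e: "!!m. e m : charsp (Suc i) (\<xi>' m)" "!!m. spec (e m) circle_lebesgue" by metis
 have cy: "cyc {e m} \<subseteq> charsp (Suc i) (\<xi>' m)" for m
  using e(1) charsp_V by (intro cyc_least csub_charsp) (auto simp: U_inv_def)
 have orth: "l2_inner \<mu> x y = 0" if lm: "l ~= m" and x: "x : cyc {e l}" and y: "y : cyc {e m}" for l m x y
 proof (rule charsp_orth[OF subsetD[OF cy x] subsetD[OF cy y] u(1)])
  have "\<xi>' l u * cnj (\<xi>' m u) = w powi (int l - int m)"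
  proof -
   have "cnj w = inverse w" using inverse_unit_cnj[of w] w(1) by simp
   hence "\<xi>' l u * cnj (\<xi>' m u) = w ^ Suc l / w ^ Suc m" unfolding \<xi>'_def u(2) by (simp add: divide_inverse power_inverse del: power_Suc)
   also have "\<dots> = w powi (int (Suc l) - int (Suc m))" using w0 by (simp add: power_int_diff del: power_Suc of_nat_Suc)
   finally show ?thesis by simp
  qed
  thus "\<xi>' l u * cnj (\<xi>' m u) ~= 1" using w(2)[of "int l - int m"] lm by simp
 qed
 show ?thesis
 proof (rule that[OF _ e(2) orth])
  show "e m : ortho (E 1)" for m by (rule charsp_ortho_E[OF e(1) ne']) simp
 qed
qed

lemma ortho_V:
 assumes S: "!!f g. f : S ==> g : carrier G ==> V g f : S" "S \<subseteq> L2 \<mu>" and f: "f : ortho S" and g: "g : carrier G"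
 shows "V g f : ortho S"
proof -
 have fL: "f : L2 \<mu>" using ortho_mem[OF f] .
 have "l2_inner \<mu> (V g f) h = 0" if h: "h : S" for h
 proof -
  have hL: "h : L2 \<mu>" using h S(2) by blast
  have "l2_inner \<mu> (V g f) h = l2_inner \<mu> (V (inv g) (V g f)) (V (inv g) h)" using g fL hL by (simp add: V_ip)
  also have "\<dots> = l2_inner \<mu> f (V (inv g) h)" using g fL hL V_inv(2)[OF g fL] by (intro ip_cong) auto
  also have "\<dots> = 0" using ortho_ip[OF f S(1)[OF h]] g by simp
  finally show ?thesis .
 qed
 thus ?thesis using g fL by (simp add: ortho_def)
qed

definition level_vectors :: "nat => ('x => complex) set" where
 "level_vectors i = {f. \<exists>\<xi>. f : charsp i \<xi> \<and> nontrivial i \<xi>}"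

lemma level_vectors_V: "f : level_vectors i ==> g : carrier G ==> V g f : level_vectors i"
 using charsp_V unfolding level_vectors_def by blast

lemma level_vectors_L2: "level_vectors i \<subseteq> L2 \<mu>" using charsp_L2 by (auto simp: level_vectors_def)

text \<open>The part \<open>W\<close> of \<open>E (Suc i)\<close> orthogonal to \<open>E i\<close>
  and to the level vectors contains no joint eigenvector: with trivial character it would lie in
  \<open>E i\<close>, otherwise it would be a level vector. By \<open>joint_eigen\<close> all of
  \<open>W\<close> then has norm zero.\<close>

lemma ortho_level_vectors:
 assumes i: "i < k" and q: "q : E (Suc i)" "q : ortho (level_vectors i)"
 shows "q : E i"
proof -
 define W where "W = E (Suc i) \<inter> (ortho (E i) \<inter> ortho (level_vectors i))"
 have EL: "E i \<subseteq> L2 \<mu>" using E_mem by blast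
 have W: "csub W" unfolding W_def by (intro csub_Int csub_E csub_ortho EL level_vectors_L2)
 have WV: "V u f : W" if "u : L i" "f : W" for u f
  using that V_E ortho_V[OF V_E EL] ortho_V[OF level_vectors_V level_vectors_L2] unfolding W_def by auto
 have Wnull: "nrm x = 0" if x: "x : W" for x
 proof (rule ccontr)
  assume "nrm x ~= 0"
  then obtain p where p: "p : W" "nrm p ~= 0" "\<forall>u\<in>L i. \<exists>\<theta>. nrm (V u p - (%x. \<theta> * p x)) = 0"
   using joint_eigen[OF i W _ WV x] unfolding W_def by blast
  then obtain \<xi> where "!!u. u : L i ==> nrm (V u p - (%x. \<xi> u * p x)) = 0" by metis
  hence pc: "p : charsp i \<xi>" using p(1) by (simp add: charsp_def W_def)
  have pL: "p : L2 \<mu>" using charsp_L2[OF pc] .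
  have "l2_inner \<mu> p p = 0"
  proof (cases "nontrivial i \<xi>")
   case True
   hence "p : level_vectors i" using pc by (auto simp: level_vectors_def)
   moreover have "p : ortho (level_vectors i)" using p(1) by (simp add: W_def)
   ultimately show ?thesis using ortho_ip by blast
  next
   case False
   hence "p : E i" using charsp_trivial_E[OF pc] by blast
   moreover have "p : ortho (E i)" using p(1) by (simp add: W_def)
   ultimately show ?thesis using ortho_ip by blast
  qed
  thus False using ip_self_eq_0[OF pL] p(2) by simp
 qed
 have qL: "q : L2 \<mu>" using E_mem[OF q(1)] .
 obtain p where p: "p : E i" "q - p : ortho (E i)" using projection[OF csub_E qL] .
 have pL: "p : L2 \<mu>" using E_mem[OF p(1)] .
 have "p : ortho (level_vectors i)"
 proof -
  have "l2_inner \<mu> p s = 0" if s: "s : level_vectors i" for s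
  proof -
   obtain \<xi> where s': "s : charsp i \<xi>" "nontrivial i \<xi>" using s unfolding level_vectors_def by blast
   show ?thesis using ortho_sym[OF charsp_ortho_E[OF s' order_refl] p(1) pL] .
  qed
  thus ?thesis using pL by (simp add: ortho_def)
 qed
 hence "q - p : W" unfolding W_def
  using p q E_mono[of i "Suc i"] by (auto intro: csub_diff[OF csub_E] csub_diff[OF csub_ortho[OF level_vectors_L2]])
 hence "nrm (q - p) = 0" by (rule Wnull)
 hence "nrm (p - q) = 0" using nrm_diff_commute[OF qL pL] by simp
 thus ?thesis by (rule csub_cong[OF csub_E p(1) qL])
qed

lemma ortho_all_levels:
 assumes j: "j <= k" and q: "q : L2 \<mu>" "!!i. j <= i ==> i < k ==> q : ortho (level_vectors i)"
 shows "q : E j" using j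
proof (induction rule: inc_induct)
 case base thus ?case using q(1) E_top by simp
next
 case (step i) thus ?case using ortho_level_vectors q(2) by simp
qed

lemma ortho_E_cspan:
 assumes j: "j <= k"
 shows "ortho (E j) \<subseteq> cspan (\<Union>i\<in>{j..<k}. level_vectors i)"
proof -
 let ?S = "\<Union>i\<in>{j..<k}. level_vectors i"
 have EL: "E j \<subseteq> L2 \<mu>" using E_mem by blast
 show ?thesis
 proof (rule csub_sub_cspan[OF csub_ortho[OF EL]])
  show "?S \<subseteq> ortho (E j)" using charsp_ortho_E by (auto simp: level_vectors_def)
  fix x assume x: "x : ortho (E j)" "x : ortho ?S"
  have xL: "x : L2 \<mu>" using ortho_mem[OF x(1)] .
  have "x : E j" by (rule ortho_all_levels[OF j xL]) (use x(2) in "auto simp: ortho_def")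
  hence "l2_inner \<mu> x x = 0" using ortho_ip[OF x(1)] by blast
  thus "nrm x = 0" by (rule ip_self_eq_0[OF xL])
 qed
qed

text \<open>Here the closedness of \<open>null_vectors N\<close> pays off: it suffices to treat the
  level vectors, which span the complement of \<open>E 1\<close>.\<close>

lemma ortho_E1_null:
 assumes k: "0 < k" and f: "f : ortho (E 1)" and N: "N : sets circle_borel" "emeasure circle_lebesgue N = 0"
 shows "f : null_vectors N"
proof -
 have "cspan (\<Union>i\<in>{1..<k}. level_vectors i) \<subseteq> null_vectors N"
 proof (rule cspan_least[OF csub_null_vectors[OF N(1)]], rule UN_least)
  fix i assume "i : {1..<k}"
  then obtain j where "i = Suc j" "Suc j < k" by (cases i) auto
  thus "level_vectors i \<subseteq> null_vectors N" using charsp_null[OF _ _ _ N] by (auto simp: level_vectors_def)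
 qed
 thus ?thesis using ortho_E_cspan[of 1] k f by auto
qed

lemma E1_cspan:
 assumes k: "0 < k" shows "E 1 \<subseteq> cspan {p. \<exists>\<xi>. p : charsp 0 \<xi>}"
proof (rule csub_sub_cspan[OF csub_E])
 let ?S = "{p. \<exists>\<xi>. p : charsp 0 \<xi>}"
 have SL: "?S \<subseteq> L2 \<mu>" using charsp_L2 by blast
 show "?S \<subseteq> E 1" using charsp_E by auto
 fix x assume x: "x : E 1" "x : ortho ?S"
 show "nrm x = 0"
 proof (rule ccontr)
  assume n: "nrm x ~= 0"
  have W: "csub (E 1 \<inter> ortho ?S)" by (intro csub_Int csub_E csub_ortho SL)
  have SV: "V g f : ?S" if "f : ?S" "g : carrier G" for f g using that charsp_V by blast
  have WV: "V u f : E 1 \<inter> ortho ?S" if "u : L 0" "f : E 1 \<inter> ortho ?S" for u f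
   using that V_E ortho_V[OF SV SL] by auto
  obtain p where p: "p : E 1 \<inter> ortho ?S" "nrm p ~= 0" "\<forall>u\<in>L 0. \<exists>\<theta>. nrm (V u p - (%x. \<theta> * p x)) = 0"
   using joint_eigen[OF k W _ WV _ n] x by auto
  then obtain \<xi> where "!!u. u : L 0 ==> nrm (V u p - (%x. \<xi> u * p x)) = 0" by metis
  hence pc: "p : charsp 0 \<xi>" using p(1) by (simp add: charsp_def)
  hence "l2_inner \<mu> p p = 0" using p(1) ortho_ip[of p ?S p] by blast
  thus False using ip_self_eq_0[OF charsp_L2[OF pc]] p(2) by simp
 qed
qed

text \<open>The projections to \<open>W\<close> of a countable total set span \<open>W\<close>, so a
  vector that dominates these projections dominates all of \<open>W\<close>.\<close>

lemma dominating_vector_of_subspace: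
 assumes W: "csub W" "U_inv W"
 obtains h where "h : W" "!!f N. f : W ==> N : sets circle_borel ==> h : null_vectors N ==> f : null_vectors N"
proof -
 obtain D where D: "countable D" "D \<subseteq> L2 \<mu>" "!!f. f : ortho D ==> nrm f = 0" using L2_separable by blast
 have "\<forall>d\<in>D. \<exists>p. p : W \<and> d - p : ortho W"
 proof
  fix d assume "d : D"
  hence "d : L2 \<mu>" using D(2) by (rule rev_subsetD)
  then obtain p where "p : W" "d - p : ortho W" using projection[OF W(1)] by blast
  thus "\<exists>p. p : W \<and> d - p : ortho W" by blast
 qed
 then obtain P where P: "!!d. d : D ==> P d : W" "!!d. d : D ==> d - P d : ortho W" by metis
 define S where "S = insert 0 (P ` D)"
 have S: "S \<subseteq> W" "S ~= {}" "countable S" using P(1) csub_zero[OF W(1)] D(1) by (auto simp: S_def)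
 have WS: "W \<subseteq> cspan S"
 proof (rule csub_sub_cspan[OF W(1) S(1)])
  fix x assume x: "x : W" "x : ortho S"
  have xL: "x : L2 \<mu>" using csub_mem[OF W(1) x(1)] .
  have "l2_inner \<mu> x d = 0" if d: "d : D" for d
  proof -
   have dL: "d : L2 \<mu>" "P d : L2 \<mu>" using d D(2) csub_mem[OF W(1) P(1)[OF d]] by auto
   have "l2_inner \<mu> x (P d) = 0" using ortho_ip[OF x(2)] d by (simp add: S_def)
   moreover have "l2_inner \<mu> x (d - P d) = 0" by (rule ortho_sym[OF P(2)[OF d] x(1) xL])
   ultimately show ?thesis using ip_diff_right[OF dL xL] by simp
  qed
  thus "nrm x = 0" using D(3)[of x] xL by (simp add: ortho_def)
 qed
 have fn: "from_nat_into S m : W" for m using from_nat_into[OF S(2)] S(1) by blast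
 show ?thesis
 proof (rule dominating_vector[OF W, of "from_nat_into S", OF fn])
  fix h assume h: "h : W" "!!m N. N : sets circle_borel ==> h : null_vectors N ==> from_nat_into S m : null_vectors N"
  show thesis
 proof (rule that[OF h(1)])
  fix f N assume f: "f : W" and N: "N : sets circle_borel" "h : null_vectors N"
  have "S \<subseteq> null_vectors N"
  proof
   fix s assume "s : S"
   then obtain m where "from_nat_into S m = s" using from_nat_into_surj[OF S(3)] by blast
   thus "s : null_vectors N" using h(2)[OF N, of m] by simp
  qed
  hence "cspan S \<subseteq> null_vectors N" by (rule cspan_least[OF csub_null_vectors[OF N(1)]])
  thus "f : null_vectors N" using f WS by blast
 qed
 qed
qed

section \<open>Maximal spectral types of the two summands\<close>

lemma spectral_measure_eq: "spectral_measure \<mu> U h \<sigma> \<longleftrightarrow> spec h \<sigma>"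
 by (simp add: spectral_measure_def spec_def)

lemma maximal_spectral_typeI:
 assumes W: "csub W" "U_inv W" and e: "e : W"
  and dom: "!!f N. f : W ==> N : sets circle_borel ==> emeasure (sm e) N = 0 ==> f : null_vectors N"
 shows "maximal_spectral_type \<mu> U W (sm e)" unfolding maximal_spectral_type_def spectral_measure_eq
proof (intro conjI ballI allI impI)
 have eL: "e : L2 \<mu>" using csub_mem[OF W(1) e] .
 show "circle_measure (sm e)" by (rule sm_circle_measure[OF eL])
 show "\<exists>\<tau>. spec h \<tau> \<and> absolutely_continuous (sm e) \<tau>" if h: "h : W" for h
  using spec_sm[OF csub_mem[OF W(1) h]]
   absolutely_continuous_smI[OF sm_circle_measure[OF eL] csub_mem[OF W(1) h] dom[OF h]] by blast
 show "\<exists>h\<in>W. spec h \<tau>" if \<tau>: "circle_measure \<tau> \<and> absolutely_continuous (sm e) \<tau>" for \<tau>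
 proof -
  obtain h where "h : cyc {e}" "spec h \<tau>" using absolutely_continuous_spec[OF eL] \<tau> by blast
  moreover have "cyc {e} \<subseteq> W" using e by (intro cyc_least W) simp
  ultimately show ?thesis by blast
 qed
qed

text \<open>The maximal type is concentrated on its countably many atoms: if the eigenvalue
  \<open>\<zeta>\<close> of a joint eigenvector \<open>p\<close> were no atom of
  \<open>sm h\<close>, domination would make \<open>p\<close> null on \<open>{\<zeta>}\<close>,
  besides being null on the complement, hence of norm zero. Joint eigenvectors span
  \<open>E 1\<close>.\<close>

lemma discrete_spectrum_E1:
 assumes k: "0 < k" shows "discrete_spectrum \<mu> U (E 1)"
proof -
 have Ui: "U_inv (E 1)" using V_E by (simp add: U_inv_def)
 obtain h where h: "h : E 1" "!!f N. f : E 1 ==> N : sets circle_borel ==> h : null_vectors N ==> f : null_vectors N"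
  using dominating_vector_of_subspace[OF csub_E Ui] by blast
 have hL: "h : L2 \<mu>" using E_mem[OF h(1)] .
 have max: "maximal_spectral_type \<mu> U (E 1) (sm h)"
  using h null_vectors_iff[OF hL] by (intro maximal_spectral_typeI[OF csub_E Ui h(1)]) auto
 have cm: "circle_measure (sm h)" by (rule sm_circle_measure[OF hL])
 interpret finite_measure "sm h" by (rule circle_measure_finite[OF cm])
 define C where "C = {x : S1. measure (sm h) {x} ~= 0}"
 have "C \<subseteq> {x. measure (sm h) {x} ~= 0}" by (auto simp: C_def)
 hence C: "countable C" using countable_support by (rule countable_subset)
 have sing: "{z} : sets circle_borel" if "z : S1" for z using that by (simp add: circle_borel_def sets_restrict_space_iff)
 have Cs: "C : sets circle_borel" using sets.countable[OF sing _ ] C by (auto simp: C_def)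
 have N: "S1 - C : sets circle_borel" using sets.compl_sets[OF Cs] by simp
 have "E 1 \<subseteq> null_vectors (S1 - C)"
 proof (rule order_trans[OF E1_cspan[OF k]], rule cspan_least[OF csub_null_vectors[OF N]], clarify)
  fix p \<xi> assume p: "p : charsp 0 \<xi>"
  have pL: "p : L2 \<mu>" and pE: "p : E 1" using charsp_L2[OF p] charsp_E[OF p] by auto
  show "p : null_vectors (S1 - C)"
  proof (cases "nrm p = 0")
   case True
   have "nrm (0 - p) = 0" using nrm_minus[OF pL] True by simp
   thus ?thesis by (rule csub_cong[OF csub_null_vectors[OF N] csub_zero[OF csub_null_vectors[OF N]] pL])
  next
   case n: False
   note c = charsp_chr[OF p n]
   define \<zeta> where "\<zeta> = \<xi> a"
   have l1: "cmod \<zeta> = 1" using chr_norm[OF c, of a] by (simp add: \<zeta>_def)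
   have ev: "nrm (U m p - (%x. \<zeta> powi m * p x)) = 0" for m
    using charsp_eq[OF p, of "a [^] m"] chr_int_pow[OF c, of m] by (simp add: \<zeta>_def)
   have ev_null: "p : null_vectors M" if "M : sets circle_borel" "\<zeta> \<notin> M" for M
    by (rule eigenvector_null[OF pL ev l1 that])
   have "\<zeta> : C"
   proof (rule ccontr)
    assume "\<zeta> \<notin> C"
    hence z: "measure (sm h) {\<zeta>} = 0" using l1 by (simp add: C_def)
    have s: "{\<zeta>} : sets circle_borel" using sing[of \<zeta>] l1 by simp
    have "h : null_vectors {\<zeta>}" using z hL by (simp add: null_vectors_def)
    hence 1: "p : null_vectors {\<zeta>}" using h(2)[OF pE s] by blast
    have s': "S1 - {\<zeta>} : sets circle_borel" using sets.compl_sets[OF s] by simp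
    have 2: "p : null_vectors (S1 - {\<zeta>})" by (rule ev_null[OF s']) simp
    have "{\<zeta>} : null_sets (sm p)" "S1 - {\<zeta>} : null_sets (sm p)"
     using 1 2 s s' null_vectors_iff[OF pL] circle_measure_sets[OF sm_circle_measure[OF pL]] by (simp_all add: null_sets_def)
    hence "{\<zeta>} \<union> (S1 - {\<zeta>}) : null_sets (sm p)" by (rule null_sets.Un)
    moreover have "{\<zeta>} \<union> (S1 - {\<zeta>}) = S1" using l1 by auto
    ultimately have "measure (sm p) S1 = 0" by (simp add: measure_eq_0_null_sets)
    thus False using sm_total[OF pL] n by simp
   qed
   thus ?thesis by (intro ev_null[OF N]) simp
  qed
 qed
 hence "emeasure (sm h) (S1 - C) = 0" using h(1) null_vectors_iff[OF hL] by blast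
 moreover have "C \<subseteq> S1" by (auto simp: C_def)
 ultimately have "discrete_measure (sm h)"
  unfolding discrete_measure_def circle_measure_space[OF cm] using C by (intro exI[of _ C]) simp
 thus ?thesis using max unfolding discrete_spectrum_def by blast
qed

lemma infinite_lebesgue_spectrum_ortho_E1:
 assumes i: "Suc i < k" and f: "f : charsp (Suc i) \<xi>" and n: "nrm f ~= 0" and ne: "nontrivial (Suc i) \<xi>"
 shows "infinite_lebesgue_spectrum \<mu> U (ortho (E 1))"
proof -
 have EL: "E 1 \<subseteq> L2 \<mu>" using E_mem by blast
 obtain e where e: "!!m. e m : ortho (E 1)" "!!m::nat. spec (e m) circle_lebesgue"
  "!!l m x y. l ~= m ==> x : cyc {e l} ==> y : cyc {e m} ==> l2_inner \<mu> x y = 0"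
  using wandering_sequence[OF i f n ne] by blast
 have eL: "e m : L2 \<mu>" for m using ortho_mem[OF e(1)] .
 have Hl: "csub (ortho (E 1))" "U_inv (ortho (E 1))" using csub_ortho[OF EL] ortho_V[OF V_E EL] by (auto simp: U_inv_def)
 have cycH: "cyc {e m} \<subseteq> ortho (E 1)" for m using e(1) by (intro cyc_least Hl) simp
 define R where "R = (\<Union>m\<in>{1..}. cyc {e m})"
 have RL: "R \<subseteq> L2 \<mu>" unfolding R_def using cycH ortho_mem by blast
 have RU: "U_inv R" using U_inv_cyc[of "{e _}"] eL unfolding R_def U_inv_def by blast
 \<comment> \<open>The cyclic subspaces need not exhaust the orthogonal complement of
   \<open>E 1\<close>. The zeroth summand takes up everything orthogonal to the others; as it
   contains \<open>e 0\<close>, its type is Lebesgue too.\<close>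
 define W where "W m = (if m = 0 then ortho (E 1) \<inter> ortho R else cyc {e m})" for m :: nat
 have Wc: "csub (W m)" for m unfolding W_def using csub_Int[OF Hl(1) csub_ortho[OF RL]] csub_cyc by (simp del: One_nat_def)
 have Wsub: "W m \<subseteq> ortho (E 1)" for m unfolding W_def using cycH by auto
 have WU: "U_inv (W m)" for m using U_inv_ortho[OF RL RU] Hl(2) U_inv_cyc[of "{e m}"] eL unfolding W_def by (auto simp: U_inv_def)
 have eW: "e m : W m" for m
 proof (cases m)
  case 0
  have e0: "e 0 : cyc {e 0}" using cyc_superset[of "{e 0}"] eL by simp
  have "l2_inner \<mu> (e 0) s = 0" if s: "s : R" for s
  proof -
   obtain j where j: "j : {1..}" "s : cyc {e j}" using s unfolding R_def by (rule UN_E)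
   thus ?thesis using e(3)[OF _ e0 j(2)] by simp
  qed
  thus ?thesis using e(1) eL by (simp add: W_def 0 ortho_def)
 next
  case (Suc j) thus ?thesis using cyc_superset[of "{e m}"] eL by (simp add: W_def)
 qed
 have orth: "l2_inner \<mu> x y = 0" if lm: "l ~= m" and x: "x : W l" and y: "y : W m" for l m x y
 proof -
  have 0: "l2_inner \<mu> x y = 0 \<and> l2_inner \<mu> y x = 0" if "x : W 0" "y : W m" "m ~= 0" for x y m
  proof -
   have "x : ortho R" using that by (simp add: W_def)
   moreover have "y : R" unfolding R_def using that by (intro UN_I[of m]) (auto simp: W_def)
   ultimately have "x : ortho R" "y : R" .
   thus ?thesis using ortho_ip[of x R y] ortho_sym[of x R y] RL by blast
  qed
  show ?thesis
  proof (cases "l = 0 \<or> m = 0")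
   case True thus ?thesis using 0[of x y m] 0[of y x l] lm x y by metis
  next
   case False thus ?thesis using e(3)[OF lm] x y by (simp add: W_def)
  qed
 qed
 have sum: "orthogonal_sum \<mu> W (ortho (E 1))"
 proof (rule orthogonal_sumI[OF Hl(1) Wc Wsub orth])
  fix x assume x: "x : ortho (E 1)" "!!i. x : ortho (W i)"
  have xL: "x : L2 \<mu>" using ortho_mem[OF x(1)] .
  have "l2_inner \<mu> x s = 0" if s: "s : R" for s
  proof -
   obtain m where "m \<ge> 1" "s : cyc {e m}" using s unfolding R_def by blast
   hence "s : W m" by (simp add: W_def)
   thus ?thesis using ortho_ip[OF x(2)] by blast
  qed
  hence "x : W 0" using x(1) xL by (simp add: W_def ortho_def)
  hence "l2_inner \<mu> x x = 0" using ortho_ip[OF x(2)] by blast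
  thus "nrm x = 0" by (rule ip_self_eq_0[OF xL])
 qed
 have sme: "sm (e m) = circle_lebesgue" for m using sm_eq[OF e(2)] .
 have type: "maximal_spectral_type \<mu> U (W m) circle_lebesgue" for m
  using maximal_spectral_typeI[OF Wc WU eW] ortho_E1_null[OF _ subsetD[OF Wsub]] i unfolding sme by auto
 have inv: "invariant_subspace \<mu> U (W m)" for m
  using Wc[of m] WU[of m] by (simp add: invariant_subspace_def csub_eq U_inv_def)
 show ?thesis unfolding infinite_lebesgue_spectrum_def
  using sum inv type by (intro exI[of _ W] conjI allI exI[of _ circle_lebesgue]) (auto simp: equivalent_measures_def absolutely_continuous_def)
qed

text \<open>If \<open>u\<close> moved \<open>x\<close> into an open set \<open>A\<close> disjoint
  from a neighbourhood of \<open>x\<close>, the indicator of \<open>A\<close> would be an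
  \<open>L2\<close> function that \<open>u\<close> changes on a non-empty open set, which has
  positive measure.\<close>

lemma act_trivial:
 assumes top: "E i = L2 \<mu>" and u: "u : L i" and x: "x : topspace X"
 shows "act u x = x"
proof (rule ccontr)
 assume ne: "act u x ~= x"
 have uG: "u : carrier G" using u by simp
 obtain A B where AB: "openin X A" "openin X B" "act u x : A" "x : B" "disjnt A B"
  using X_Hausdorff ne uG x unfolding Hausdorff_space_def by (metis act_closed)
 define B' where "B' = B \<inter> {y : topspace X. act u y : A}"
 have B': "openin X B'" "B' ~= {}" unfolding B'_def using AB act_open_vimage[OF uG AB(1)] x by auto
 let ?f = "%x. indicator A x :: complex"
 have f: "?f : L2 \<mu>" by (rule indicator_L2) (rule open_sets[OF AB(1)])
 have "?f : E i" using f unfolding top .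
 hence "nrm (V u ?f - ?f) = 0" using u unfolding E_def by blast
 hence "AE y in \<mu>. V u ?f y = ?f y" using nrm_diff_eq_0_iff[OF V_mem[OF uG f] f] by simp
 then obtain y where y: "y : B'" "V u ?f y = ?f y" using AE_dense[OF _ B'] by blast
 thus False using AB(5) by (auto simp: B'_def V_def disjnt_def indicator_def split: if_splits)
qed

theorem spectral_decomposition:
 assumes k: "0 < k"
 shows "orthogonal_decomposition \<mu> (E 1) (ortho (E 1)) \<and>
  invariant_subspace \<mu> U (E 1) \<and> invariant_subspace \<mu> U (ortho (E 1)) \<and>
  discrete_spectrum \<mu> U (E 1) \<and>
  (infinite_lebesgue_spectrum \<mu> U (ortho (E 1)) \<or>
   ((\<forall>u\<in>L 1. act u x0 = x0) \<and> (\<forall>h\<in>ortho (E 1). AE x in \<mu>. h x = 0)))"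
proof (intro conjI)
 have EL: "E 1 \<subseteq> L2 \<mu>" using E_mem by blast
 note cs = csub_E[of 1] csub_ortho[OF EL]
 show "invariant_subspace \<mu> U (E 1)" using cs V_E by (simp add: invariant_subspace_def csub_eq)
 show "invariant_subspace \<mu> U (ortho (E 1))" using cs ortho_V[OF V_E EL] by (simp add: invariant_subspace_def csub_eq)
 show "discrete_spectrum \<mu> U (E 1)" by (rule discrete_spectrum_E1[OF k])
 have "\<exists>g\<in>E 1. \<exists>h\<in>ortho (E 1). AE x in \<mu>. f x = g x + h x" if f: "f : L2 \<mu>" for f
 proof -
  obtain p where p: "p : E 1" "f - p : ortho (E 1)" using projection[OF cs(1) f] .
  have "AE x in \<mu>. f x = p x + (f - p) x" by (simp add: minus_fun)
  thus ?thesis using p by blast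
 qed
 moreover have "l2_orthogonal \<mu> (E 1) (ortho (E 1))" unfolding l2_orthogonal_def using ortho_sym EL by blast
 ultimately show "orthogonal_decomposition \<mu> (E 1) (ortho (E 1))" using cs by (simp add: orthogonal_decomposition_def csub_eq)
 show "infinite_lebesgue_spectrum \<mu> U (ortho (E 1)) \<or>
   ((\<forall>u\<in>L 1. act u x0 = x0) \<and> (\<forall>h\<in>ortho (E 1). AE x in \<mu>. h x = 0))"
 proof (cases "\<exists>i f \<xi>. Suc i < k \<and> f : charsp (Suc i) \<xi> \<and> nrm f ~= 0 \<and> nontrivial (Suc i) \<xi>")
  case True thus ?thesis using infinite_lebesgue_spectrum_ortho_E1 by blast
 next
  case False
  \<comment> \<open>All level vectors above level 0 have norm zero in this case, so \<open>h\<close>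
    is orthogonal to them and descends through the levels to \<open>E 1\<close>.\<close>
  have null: "nrm h = 0" if h: "h : ortho (E 1)" for h
  proof -
   have hL: "h : L2 \<mu>" using ortho_mem[OF h] .
   have "h : E 1"
   proof (rule ortho_all_levels)
    fix i assume i: "1 <= i" "i < k"
    have "l2_inner \<mu> h s = 0" if s: "s : level_vectors i" for s
    proof -
     have sL: "s : L2 \<mu>" using s level_vectors_L2 by blast
     have "nrm s = 0" using s False i unfolding level_vectors_def by (cases i) auto
     thus ?thesis by (rule nrm_eq_0_ip_right[OF sL hL])
    qed
    thus "h : ortho (level_vectors i)" using hL by (simp add: ortho_def)
   qed (use k hL in auto)
   hence "l2_inner \<mu> h h = 0" using ortho_ip[OF h] by blast
   thus ?thesis by (rule ip_self_eq_0[OF hL])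
  qed
  have "E 1 = L2 \<mu>" by (rule csub_eq_H[OF cs(1) null])
  hence "\<forall>u\<in>L 1. act u x0 = x0" using act_trivial x0 by blast
  moreover have "\<forall>h\<in>ortho (E 1). AE x in \<mu>. h x = 0" using null nrm_eq_0_iff ortho_mem by blast
  ultimately show ?thesis by blast
 qed
qed

end

context topological_group
begin

text \<open>The group generated by the identity component and \<open>a\<close> is open and acts transitively, so the
 whole system is an action of this group.\<close>

lemma nilsystem_spectrum:
 assumes k: "0 < k" and nilp: "lower_central G k = {\<one>}" and idc: "openin T idc"
  and sc: "second_countable T" and Ha: "Hausdorff_space T" and \<Gamma>: "subgroup \<Gamma> G"
  and \<Gamma>d: "subtopology T \<Gamma> = discrete_topology \<Gamma>" and Xc: "compact_space (coset_topology G T \<Gamma>)"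
  and \<mu>: "haar_measure_on_quotient G T \<Gamma> \<mu>" and a: "a : carrier G" and erg: "ergodic_translation G \<mu> a"
 shows "\<exists>Hd Hl. orthogonal_decomposition \<mu> Hd Hl \<and>
  invariant_subspace \<mu> (koopman_powers G a) Hd \<and> invariant_subspace \<mu> (koopman_powers G a) Hl \<and>
  discrete_spectrum \<mu> (koopman_powers G a) Hd \<and>
  (infinite_lebesgue_spectrum \<mu> (koopman_powers G a) Hl \<or>
   (abelian_type G T a \<and> (\<forall>h\<in>Hl. AE x in \<mu>. h x = 0)))"
proof -
 let ?X = "coset_topology G T \<Gamma>"
 define S where "S = idc_gen a"
 define G' where "G' = G\<lparr>carrier := S\<rparr>"
 define T' where "T' = subtopology T S"
 have S: "subgroup S G" unfolding S_def by (rule subgroup_idc_gen[OF a])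
 have So: "openin T S" unfolding S_def by (rule openin_idc_gen[OF a idc])
 have aS: "a : S" unfolding S_def by (rule gen_idc_gen[OF a])
 have idcS: "idc \<subseteq> S" unfolding S_def by (rule idc_idc_gen[OF a])
 note SG = subgroup.mem_carrier[OF S]
 have tsT': "topspace T' = S" unfolding T'_def using SG T by auto
 have tsX: "topspace ?X = lcosets \<Gamma>" by (rule topspace_coset_topology[OF T])
 have pw: "a [^]\<^bsub>G'\<^esub> n = a [^] n" for n :: int unfolding G'_def using int_pow_consistent[OF S aS] by simp
 have coset: "g <# \<Gamma> : topspace ?X" if "g : carrier G" for g using that unfolding topspace_cosets by blast
 have \<Gamma>1: "\<one> <# \<Gamma> = \<Gamma>" by (rule lcos_mult_one[OF subgroup.subset[OF \<Gamma>]])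
 have sp: "space \<mu> = lcosets \<Gamma>" and st: "sets \<mu> = sigma_sets (lcosets \<Gamma>) {W. openin ?X W}"
  and iv: "!!g B. g : carrier G ==> B : sets \<mu> ==> emeasure \<mu> ((%C. g <# C) ` B) = emeasure \<mu> B"
  using \<mu> by (auto simp: haar_measure_on_quotient_def)
 interpret prob_space \<mu> using \<mu> by (simp add: haar_measure_on_quotient_def)
 interpret N: nil_action G' T' \<mu> ?X "l_coset G" \<Gamma> idc a k
 proof (intro nil_action.intro nil_action_axioms.intro topological_group.intro topological_group_axioms.intro)
  show "group G'" unfolding G'_def by (rule subgroup.subgroup_is_group[OF S group_axioms])
  show "l2_space \<mu>" by unfold_locales
  show "topspace T' = carrier G'" by (simp add: tsT' G'_def)
  show "continuous_map (prod_topology T' T') T' (%(x, y). x \<otimes>\<^bsub>G'\<^esub> y)"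
  proof -
   have "continuous_map (prod_topology T' T') T (%(x, y). x \<otimes> y)"
    unfolding T'_def subtopology_Times[symmetric] by (rule continuous_map_from_subtopology[OF mult_cont])
   thus ?thesis unfolding G'_def using tsT' subgroup.m_closed[OF S]
    by (subst (2) T'_def, intro continuous_map_into_subtopology) auto
  qed
  show "continuous_map T' T' (m_inv G')"
  proof -
   have "continuous_map T' T (m_inv G)" unfolding T'_def by (rule continuous_map_from_subtopology[OF inv_cont])
   hence "continuous_map T' T (m_inv G')" by (rule continuous_map_eq) (use tsT' m_inv_consistent[OF S] in "simp add: G'_def")
   thus ?thesis using tsT' subgroup.m_inv_closed[OF S] m_inv_consistent[OF S]
    by (subst (2) T'_def, intro continuous_map_into_subtopology) (auto simp: G'_def)
  qed
  show "second_countable T'" unfolding T'_def by (rule second_countable_subtopology[OF sc])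
  show "continuous_map (prod_topology T' ?X) ?X (%(g, x). g <# x)"
   unfolding T'_def prod_topology_subtopology by (rule continuous_map_from_subtopology[OF coset_act_continuous[OF \<Gamma>]])
  show "\<one>\<^bsub>G'\<^esub> <# x = x" if x: "x : topspace ?X" for x
  proof -
   obtain h where "h : carrier G" "x = h <# \<Gamma>" using x unfolding topspace_cosets by blast
   thus ?thesis using coset_act_mult[OF \<Gamma>, of "\<one>" h] by (simp add: G'_def)
  qed
  show "(g \<otimes>\<^bsub>G'\<^esub> h) <# x = g <# (h <# x)" if g: "g : carrier G'" and h: "h : carrier G'" and x: "x : topspace ?X" for g h x
  proof -
   obtain y where y: "y : carrier G" "x = y <# \<Gamma>" using x unfolding topspace_cosets by blast
   have "g : carrier G" "h : carrier G" using g h SG by (auto simp: G'_def)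
   thus ?thesis using y coset_act_mult[OF \<Gamma>] by (simp add: G'_def m_assoc)
  qed
  show "\<Gamma> : topspace ?X" using coset[of "\<one>"] \<Gamma>1 by simp
  show "\<exists>g\<in>carrier G'. x = g <# \<Gamma>" if "x : topspace ?X" for x
   using ergodic_transitive[OF \<Gamma> Xc \<mu> erg S So aS, of x] that tsX by (simp add: G'_def)
  show "openin ?X ((%g. g <# \<Gamma>) ` W)" if "openin T' W" for W
   using that So unfolding T'_def by (intro coset_map_open[OF \<Gamma>]) (rule openin_trans_full)
  show "compact_space ?X" by (rule Xc)
  show "Hausdorff_space ?X" by (rule coset_Hausdorff[OF \<Gamma> discrete_subgroup_closed[OF \<Gamma> \<Gamma>d Ha]])
  show "prob_space \<mu>" by unfold_locales
  show "space \<mu> = topspace ?X" by (simp add: sp tsX)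
  show "sets \<mu> = sigma_sets (topspace ?X) {W. openin ?X W}" by (simp only: st tsX)
  show "emeasure \<mu> {x : topspace ?X. g <# x : B} = emeasure \<mu> B" if g: "g : carrier G'" and B: "B : sets \<mu>" for g B
  proof -
   have gG: "g : carrier G" using g SG by (simp add: G'_def)
   have "B \<subseteq> lcosets \<Gamma>" using sets.sets_into_space[OF B] sp by simp
   thus ?thesis unfolding tsX coset_translate_vimage[OF \<Gamma> gG] using iv[OF inv_closed[OF gG] B] by (simp add: coset_translate_vimage[OF \<Gamma> gG])
  qed
  show "emeasure \<mu> W > 0" if "openin ?X W" "W ~= {}" for W using haar_full_support[OF \<Gamma> Xc \<mu> that] .
  show "a : carrier G'" using aS by (simp add: G'_def)
  show "\<exists>c. AE x in \<mu>. f x = c" if "f : L2 \<mu>" "AE x in \<mu>. f (a <# x) = f x" for f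
   using erg that unfolding ergodic_translation_def koopman_def by blast
  show "connectedin T' idc" unfolding T'_def using idc_connected idcS by (simp add: connectedin_subtopology)
  show "\<one>\<^bsub>G'\<^esub> : idc" using idc_one by (simp add: G'_def)
  show "\<exists>c\<in>idc. \<exists>n::int. g = c \<otimes>\<^bsub>G'\<^esub> a [^]\<^bsub>G'\<^esub> n" if "g : carrier G'" for g
   using that unfolding pw unfolding G'_def S_def idc_gen_def by auto
  show "lower_central G' k = {\<one>\<^bsub>G'\<^esub>}"
  proof -
   have "lower_central G' k \<subseteq> {\<one>}" "subgroup (lower_central G' k) G"
    using lower_central_subgroup[OF group_axioms S, of k] nilp unfolding G'_def by auto
   thus ?thesis using subgroup.one_closed[of "lower_central G' k" G] by (auto simp: G'_def)
  qed
 qed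
 have kp: "koopman_powers G a = (%n. N.V (a [^]\<^bsub>G'\<^esub> n))"
  by (intro ext) (simp add: koopman_powers_def koopman_def N.V_def pw)
 have "abelian_type G T a" if L1: "\<forall>u\<in>lower_central G' 1. u <# \<Gamma> = \<Gamma>"
 proof -
  have sub: "lower_central G' 1 \<subseteq> \<Gamma>"
  proof
   fix u assume u: "u : lower_central G' 1"
   have uG: "u : carrier G" using N.L_mem[OF u] SG by (simp add: G'_def)
   have "\<one> <# \<Gamma> = u <# \<Gamma>" using L1 u \<Gamma>1 by simp
   thus "u : \<Gamma>" using coset_eq_iff[OF \<Gamma> one_closed uG] uG by simp
  qed
  have "connectedin T' (lower_central G' 1)" using N.L_connected[of 0] by simp
  hence "connectedin T (lower_central G' 1)" by (simp add: T'_def connectedin_subtopology)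
  hence "connectedin (subtopology T \<Gamma>) (lower_central G' 1)" using sub by (simp add: connectedin_subtopology)
  then obtain b where b: "lower_central G' 1 \<subseteq> {b}" unfolding \<Gamma>d connectedin_discrete_topology by blast
  have one: "\<one>\<^bsub>G'\<^esub> : lower_central G' 1" by (rule N.L_one)
  have triv: "u = \<one>\<^bsub>G'\<^esub>" if "u : lower_central G' 1" for u using that one b by blast
  have comm: "x \<otimes> y = y \<otimes> x" if x: "x : S" and y: "y : S" for x y
  proof -
   have G': "x : carrier G'" "y : carrier G'" using x y by (auto simp: G'_def)
   have "N.comm x y = \<one>\<^bsub>G'\<^esub>" using triv N.comm_L[of x 0 y] G' by simp
   hence "x \<otimes>\<^bsub>G'\<^esub> y = y \<otimes>\<^bsub>G'\<^esub> x" using N.comm_swap[OF G'] G' by simp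
   thus ?thesis by (simp add: G'_def)
  qed
  show ?thesis unfolding abelian_type_def Let_def using comm idcS aS by blast
 qed
 thus ?thesis using N.spectral_decomposition[OF k] unfolding kp by (intro exI[of _ "N.E 1"] exI[of _ "N.ortho (N.E 1)"]) auto
qed

end

theorem theorem1p4:
  fixes G :: "'g monoid" and T :: "'g topology"
    and A :: "('g, 'e::euclidean_space) chart set"
    and \<Gamma> :: "'g set" and \<mu> :: "'g set measure" and a :: 'g and k :: nat
  assumes "k \<ge> 2"
    and "nilmanifold k G T A \<Gamma>"
    and "haar_measure_on_quotient G T \<Gamma> \<mu>"
    and "a \<in> carrier G"
    and "ergodic_translation G \<mu> a"
  shows "\<exists>Hd Hl. orthogonal_decomposition \<mu> Hd Hl \<and>
    invariant_subspace \<mu> (koopman_powers G a) Hd \<and> invariant_subspace \<mu> (koopman_powers G a) Hl \<and>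
    discrete_spectrum \<mu> (koopman_powers G a) Hd \<and>
    (infinite_lebesgue_spectrum \<mu> (koopman_powers G a) Hl \<or>
     (abelian_type G T a \<and> (\<forall>h\<in>Hl. AE x in \<mu>. h x = 0)))"
proof -
 have lie: "lie_group G T A" using assms(2) by (simp add: nilmanifold_def)
 interpret topological_group G T by (rule lie_group_topological(1)[OF lie])
 show ?thesis using assms lie lie_group_topological(2)[OF lie] by (intro nilsystem_spectrum[of k \<Gamma>])
   (auto simp: nilmanifold_def discrete_cocompact_def step_nilpotent_def lie_group_def)
qed

end
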